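(* Fix a normalized reduced root system $R$ in $\mathbb R^N$ and a multiplicity function $k\ge 0$. Let $\Phi\in\mathcal S(\mathbb R^N)$ and $\Phi_t(\mathbf x)=t^{-\mathbf N}\Phi(t^{-1}\mathbf x)$ for $t>0$. Then the maximal function $$\mathcal M_\Phi f(\mathbf x)=\sup_{t>0}|\Phi_t*f(\mathbf x)|=\sup_{t>0}\left|\int_{\mathbb R^N}\Phi_t(\mathbf x,\mathbf y)f(\mathbf y)\,dw(\mathbf y)\right|$$ is of weak type $(1,1)$ with respect to $dw$ and is bounded on $L^p(dw)$ for every $1<p\le\infty$.
   Context: Root system and measure. $R\subset\mathbb R^N\setminus\{0\}$ is a finite set with $\sigma_\alpha(R)=R$ for all $\alpha\in R$, where $\sigma_\alpha\mathbf x=\mathbf x-2\frac{\langle\mathbf x,\alpha\rangle}{\|\alpha\|^2}\alpha$; it is reduced ($R\cap\mathbb R\alpha=\{\pm\alpha\}$) and normalized ($\|\alpha\|^2=2$ for all $\alpha\in R$). $G$ is the finite group generated by the $\sigma_\alpha$, and $k:R\to[0,\infty)$ is $G$-invariant. $\mathbf N=N+\sum_{\alpha\in R}k(\alpha)$, $dw(\mathbf x)=\prod_{\alpha\in R}|\langle\mathbf x,\alpha\rangle|^{k(\alpha)}d\mathbf x$. Dunkl kernel and transform. For $\xi\in\mathbb R^N$ the Dunkl operator is $T_\xi f(\mathbf x)=\partial_\xi f(\mathbf x)+\sum_{\alpha\in R}\frac{k(\alpha)}2\langle\alpha,\xi\rangle\frac{f(\mathbf x)-f(\sigma_\alpha\mathbf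 x)}{\langle\alpha,\mathbf x\rangle}$. For fixed $\mathbf y\in\mathbb R^N$, $E(\cdot,\mathbf y)$ is the unique solution of $T_\xi f=\langle\xi,\mathbf y\rangle f$ (all $\xi\in\mathbb R^N$), $f(0)=1$; $E$ extends uniquely to a holomorphic function on $\mathbb C^N\times\mathbb C^N$. With $c_k=\int_{\mathbb R^N}e^{-\|\mathbf x\|^2/2}dw(\mathbf x)$, $\mathcal Ff(\xi)=c_k^{-1}\int E(-i\xi,\mathbf x)f(\mathbf x)\,dw(\mathbf x)$. Dunkl translation. For $g\in\mathcal S(\mathbb R^N)$ (the Schwartz class), $\tau_{\mathbf x}g(\mathbf y)=c_k^{-1}\int E(i\xi,\mathbf x)E(i\xi,\mathbf y)\mathcal Fg(\xi)\,dw(\xi)$, and $g(\mathbf x,\mathbf y):=\tau_{\mathbf x}g(-\mathbf y)$. In particular $\Phi_t(\mathbf x,\mathbf y)=\tau_{\mathbf x}\Phi_t(-\mathbf y)$, and $\Phi_t*f(\mathbf x)=\int\Phi_t(\mathbf x,\mathbf y)f(\mathbf y)\,dw(\mathbf y)$ is the Dunkl convolution. *)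

theory Defs
  imports "HOL-Probability.Essential_Supremum"
begin

section \<open>Root systems and the associated measure\<close>

definition root_reflection :: "real^'n \<Rightarrow> real^'n \<Rightarrow> real^'n" where
  "root_reflection \<alpha> x = x - (2 * (x \<bullet> \<alpha>) / (norm \<alpha>)\<^sup>2) *\<^sub>R \<alpha>"

definition normalized_root_system :: "(real^'n) set \<Rightarrow> bool" where
  "normalized_root_system R \<longleftrightarrow>
     finite R \<and> 0 \<notin> R \<and>
     (\<forall>\<alpha>\<in>R. root_reflection \<alpha> ` R = R) \<and>
     (\<forall>\<alpha>\<in>R. R \<inter> range (\<lambda>c::real. c *\<^sub>R \<alpha>) = {\<alpha>, - \<alpha>}) \<and>
     (\<forall>\<alpha>\<in>R. (norm \<alpha>)\<^sup>2 = 2)"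

text \<open>Reflections are involutions, so closing them under composition already gives a group.\<close>

inductive_set reflection_group :: "(real^'n) set \<Rightarrow> (real^'n \<Rightarrow> real^'n) set"
  for R :: "(real^'n) set" where
  unit: "id \<in> reflection_group R"
| step: "\<alpha> \<in> R \<Longrightarrow> g \<in> reflection_group R \<Longrightarrow> root_reflection \<alpha> \<circ> g \<in> reflection_group R"

text \<open>Multiplicities are total functions, but only their values on \<open>R\<close> are constrained and used.\<close>

definition multiplicity_function :: "(real^'n) set \<Rightarrow> (real^'n \<Rightarrow> real) \<Rightarrow> bool" where
  "multiplicity_function R k \<longleftrightarrow>
     (\<forall>\<alpha>\<in>R. 0 \<le> k \<alpha>) \<and> (\<forall>g\<in>reflection_group R. \<forall>\<alpha>\<in>R. k (g \<alpha>) = k \<alpha>)"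

definition homogeneous_dim :: "(real^'n) set \<Rightarrow> (real^'n \<Rightarrow> real) \<Rightarrow> real" where
  "homogeneous_dim R k = real CARD('n) + (\<Sum>\<alpha>\<in>R. k \<alpha>)"

text \<open>Since \<open>0 powr 0 = 0\<close>, the density differs from the usual one (where an exponent \<open>0\<close>
  contributes the factor \<open>1\<close>) on the hyperplanes orthogonal to the roots. These are null sets,
  so the measure is the same.\<close>

definition dunkl_measure :: "(real^'n) set \<Rightarrow> (real^'n \<Rightarrow> real) \<Rightarrow> (real^'n) measure" where
  "dunkl_measure R k = density lborel (\<lambda>x. ennreal (\<Prod>\<alpha>\<in>R. \<bar>x \<bullet> \<alpha>\<bar> powr k \<alpha>))"

section \<open>Dunkl operators and the Dunkl kernel\<close>

text \<open>On the hyperplane orthogonal to \<open>\<alpha>\<close> the difference quotient is extended by its limit, which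
  for a continuously differentiable \<open>f\<close> is \<open>2 / (norm \<alpha>)\<^sup>2\<close> times the derivative of \<open>f\<close> in
  direction \<open>\<alpha>\<close>.\<close>

definition dunkl_quotient :: "real^'n \<Rightarrow> (real^'n \<Rightarrow> complex) \<Rightarrow> real^'n \<Rightarrow> complex" where
  "dunkl_quotient \<alpha> f x =
     (if \<alpha> \<bullet> x = 0 then (2 / (norm \<alpha>)\<^sup>2) *\<^sub>R frechet_derivative f (at x) \<alpha>
      else (f x - f (root_reflection \<alpha> x)) /\<^sub>R (\<alpha> \<bullet> x))"

definition dunkl_operator ::
  "(real^'n) set \<Rightarrow> (real^'n \<Rightarrow> real) \<Rightarrow> real^'n \<Rightarrow> (real^'n \<Rightarrow> complex) \<Rightarrow> real^'n \<Rightarrow> complex" where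
  "dunkl_operator R k \<xi> f x =
     frechet_derivative f (at x) \<xi> + (\<Sum>\<alpha>\<in>R. (k \<alpha> / 2 * (\<alpha> \<bullet> \<xi>)) *\<^sub>R dunkl_quotient \<alpha> f x)"

definition C1_function :: "(real^'n \<Rightarrow> complex) \<Rightarrow> bool" where
  "C1_function f \<longleftrightarrow>
     (\<forall>x. f differentiable (at x)) \<and>
     (\<forall>v. continuous_on UNIV (\<lambda>x. frechet_derivative f (at x) v))"

definition dunkl_kernel_real ::
  "(real^'n) set \<Rightarrow> (real^'n \<Rightarrow> real) \<Rightarrow> real^'n \<Rightarrow> real^'n \<Rightarrow> complex" where
  "dunkl_kernel_real R k x y =
     (THE f. C1_function f \<and> f 0 = 1 \<and>
        (\<forall>\<xi> z. dunkl_operator R k \<xi> f z = (\<xi> \<bullet> y) *\<^sub>R f z)) x"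

definition cvec :: "real^'n \<Rightarrow> complex^'n" where
  "cvec x = (\<chi> j. complex_of_real (x $ j))"

text \<open>Holomorphy in several variables: real differentiability with complex-linear derivative.\<close>

definition entire2 :: "(complex^'n \<Rightarrow> complex^'n \<Rightarrow> complex) \<Rightarrow> bool" where
  "entire2 F \<longleftrightarrow>
     (\<forall>p. \<exists>D. ((\<lambda>(z, w). F z w) has_derivative D) (at p) \<and>
        (\<forall>c u v. D (c *s u, c *s v) = c * D (u, v)))"

definition dunkl_kernel ::
  "(real^'n) set \<Rightarrow> (real^'n \<Rightarrow> real) \<Rightarrow> complex^'n \<Rightarrow> complex^'n \<Rightarrow> complex" where
  "dunkl_kernel R k =
     (THE F. entire2 F \<and> (\<forall>x y. F (cvec x) (cvec y) = dunkl_kernel_real R k x y))"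

section \<open>Dunkl transform, translation and convolution\<close>

definition dunkl_const :: "(real^'n) set \<Rightarrow> (real^'n \<Rightarrow> real) \<Rightarrow> real" where
  "dunkl_const R k = (LINT x|dunkl_measure R k. exp (- (norm x)\<^sup>2 / 2))"

definition dunkl_transform ::
  "(real^'n) set \<Rightarrow> (real^'n \<Rightarrow> real) \<Rightarrow> (real^'n \<Rightarrow> complex) \<Rightarrow> real^'n \<Rightarrow> complex" where
  "dunkl_transform R k f \<xi> =
     (LINT x|dunkl_measure R k. dunkl_kernel R k ((- \<i>) *s cvec \<xi>) (cvec x) * f x)
       /\<^sub>R dunkl_const R k"

definition dunkl_translation ::
  "(real^'n) set \<Rightarrow> (real^'n \<Rightarrow> real) \<Rightarrow> real^'n \<Rightarrow> (real^'n \<Rightarrow> complex) \<Rightarrow> real^'n \<Rightarrow> complex" where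
  "dunkl_translation R k x g y =
     (LINT \<xi>|dunkl_measure R k. dunkl_kernel R k (\<i> *s cvec \<xi>) (cvec x) *
        dunkl_kernel R k (\<i> *s cvec \<xi>) (cvec y) * dunkl_transform R k g \<xi>)
       /\<^sub>R dunkl_const R k"

definition dunkl_convolution ::
  "(real^'n) set \<Rightarrow> (real^'n \<Rightarrow> real) \<Rightarrow> (real^'n \<Rightarrow> complex) \<Rightarrow> (real^'n \<Rightarrow> complex)
     \<Rightarrow> real^'n \<Rightarrow> complex" where
  "dunkl_convolution R k g f x =
     (LINT y|dunkl_measure R k. dunkl_translation R k x g (- y) * f y)"

definition dunkl_dilate ::
  "(real^'n) set \<Rightarrow> (real^'n \<Rightarrow> real) \<Rightarrow> real \<Rightarrow> (real^'n \<Rightarrow> complex) \<Rightarrow> real^'n \<Rightarrow> complex" where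
  "dunkl_dilate R k t \<Phi> x = (t powr (- homogeneous_dim R k)) *\<^sub>R \<Phi> (x /\<^sub>R t)"

definition dunkl_maximal ::
  "(real^'n) set \<Rightarrow> (real^'n \<Rightarrow> real) \<Rightarrow> (real^'n \<Rightarrow> complex) \<Rightarrow> (real^'n \<Rightarrow> complex)
     \<Rightarrow> real^'n \<Rightarrow> ennreal" where
  "dunkl_maximal R k \<Phi> f x =
     (SUP t\<in>{0<..}. ennreal (norm (dunkl_convolution R k (dunkl_dilate R k t \<Phi>) f x)))"

section \<open>Schwartz functions\<close>

primrec iterated_partial :: "'n list \<Rightarrow> (real^'n \<Rightarrow> complex) \<Rightarrow> real^'n \<Rightarrow> complex" where
  "iterated_partial [] f = f"
| "iterated_partial (j # js) f =
     (\<lambda>x. frechet_derivative (iterated_partial js f) (at x) (axis j 1))"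

definition schwartz :: "(real^'n \<Rightarrow> complex) set" where
  "schwartz = {f. \<forall>js. (\<forall>x. iterated_partial js f differentiable (at x)) \<and>
     (\<forall>m::nat. bounded (range (\<lambda>x. (1 + norm x) ^ m *\<^sub>R iterated_partial js f x)))}"

section \<open>Lebesgue norms and bounds for operators\<close>

definition ennreal_powr :: "ennreal \<Rightarrow> real \<Rightarrow> ennreal" where
  "ennreal_powr a r = (if a = \<infinity> then \<infinity> else ennreal (enn2real a powr r))"

definition Lp_norm :: "'a measure \<Rightarrow> ennreal \<Rightarrow> ('a \<Rightarrow> ennreal) \<Rightarrow> ennreal" where
  "Lp_norm M p u =
     (if p = \<infinity> then esssup M u
      else ennreal_powr (\<integral>\<^sup>+ x. ennreal_powr (u x) (enn2real p) \<partial>M) (1 / enn2real p))"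

definition Lp_space :: "'a measure \<Rightarrow> ennreal \<Rightarrow> ('a \<Rightarrow> complex) set" where
  "Lp_space M p = {f \<in> borel_measurable M. Lp_norm M p (\<lambda>x. ennreal (norm (f x))) < \<infinity>}"

text \<open>The operators below have values in \<open>[0, \<infinity>]\<close>. Measurability of \<open>T f\<close> is part of both notions,
  because \<open>emeasure\<close> is \<open>0\<close> on sets that are not measurable.\<close>

definition weak_type_1_1 :: "'a measure \<Rightarrow> (('a \<Rightarrow> complex) \<Rightarrow> 'a \<Rightarrow> ennreal) \<Rightarrow> bool" where
  "weak_type_1_1 M T \<longleftrightarrow>
     (\<exists>C::real. \<forall>f\<in>Lp_space M 1. T f \<in> borel_measurable M \<and>
        (\<forall>l::real>0. emeasure M {x \<in> space M. T f x > ennreal l}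
           \<le> ennreal (C / l) * Lp_norm M 1 (\<lambda>x. ennreal (norm (f x)))))"

definition bounded_on_Lp ::
  "'a measure \<Rightarrow> ennreal \<Rightarrow> (('a \<Rightarrow> complex) \<Rightarrow> 'a \<Rightarrow> ennreal) \<Rightarrow> bool" where
  "bounded_on_Lp M p T \<longleftrightarrow>
     (\<exists>C::real. \<forall>f\<in>Lp_space M p. T f \<in> borel_measurable M \<and>
        Lp_norm M p (T f) \<le> ennreal C * Lp_norm M p (\<lambda>x. ennreal (norm (f x))))"

end

theory Submission
  imports Defs "HOL-Complex_Analysis.Complex_Analysis" "HOL-Probability.Distributions"
begin

text \<open>
 Write \<open>\<Phi>(x,y) = \<tau>\<^sub>x \<Phi>(-y)\<close>, \<open>V(x)\<close> for the measure of the unit ball at \<open>x\<close> and \<open>d\<close> for the distance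
 between \<open>G\<close>-orbits. The theorem follows from \<open>|\<Phi>(x,y)| <= C V(x)\<^sup>-\<^sup>1 (1 + d(x,y))\<^sup>-\<^sup>M\<close> for all \<open>M\<close>: after
 rescaling, the maximal function is dominated by averages over balls centred on the orbit of \<open>x\<close>, and the
 Vitali covering lemma and Marcinkiewicz interpolation apply.

 With \<open>\<Psi> = (1 - \<Delta>\<^sub>k)\<^sup>L \<Phi>\<close> one has \<open>\<Phi>(x,y) = c \<integral>\<integral> t\<^sup>L\<^sup>-\<^sup>1 e\<^sup>-\<^sup>t \<Psi>(q) B(t;x,y,q) dw(q) dt\<close>, where \<open>B\<close> is the integral of
 \<open>E(i\<xi>,x) E(-i\<xi>,y) E(-i\<xi>,q) e\<close> to the \<open>-t|\<xi>|\<^sup>2\<close>. By the semigroup property \<open>B\<close> pairs the heat kernel at \<open>y\<close> with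
 \<open>u\<^sub>q\<close>, the translation by \<open>q\<close> of the heat kernel at \<open>x\<close>. Positivity of translations is not available, but
 they propagate with finite speed: the sum over \<open>g\<close> of the integrals of
 \<open>(\<rho>(z) + (1-r)|q|)\<close> to the \<open>2M\<close> times \<open>|u\<^sub>r\<^sub>g\<^sub>q(z)|\<^sup>2\<close>, with \<open>\<rho>\<close> comparable to \<open>1 + d(x,z)\<close> and 1-Lipschitz, decreases
 in \<open>r\<close>. Indeed \<open>T\<close> in direction \<open>p\<close> acts on \<open>u\<^sub>p(z)\<close> in the same way in \<open>p\<close> and in \<open>z\<close>, it is skew in \<open>z\<close>,
 and its difference part in \<open>p\<close> has a favourable sign after summation over \<open>g\<close>.
\<close>

text \<open>The kernel is given by a definite description, so its existence is part of the proof. In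
  the direction of its argument a Dunkl operator acts on functions of degree n as n + Z, where Z
  generates a random walk on G that jumps across roots. The inverse of n + Z has nonnegative weights
  of total mass 1/n. Solving degree by degree along an orbit yields the kernel as an exponential
  series with two properties: it is monotone in its exponents, and adding a constant to them
  multiplies it by an exponential. A shift by a large constant turns these into |E(th x, y)| <= exp
  (max over g of Re (th <g x, y>)), hence |E| <= 1 for imaginary th, and into comparisons of E at
  two real points, which feed the heat kernel bounds. The same walk returns in the energy argument:
  summed over the orbit of the pole, its Dirichlet form is the favourable sign. The power L is tied
  to the bound of B: t^(L-1) has to absorb the blow-up of B as t tends to 0, and the decay of \<Psi>
  its growth in q.\<close>

notation scaleR (infixr "*R" 75)
notation divideR (infixl "'/R" 70)
notation inner (infixl "\<cdot>" 70)

hide_fact (open) Henstock_Kurzweil_Integration.integrable_add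
 Henstock_Kurzweil_Integration.integrable_bound
 Henstock_Kurzweil_Integration.integrable_diff
 Henstock_Kurzweil_Integration.integrable_sum
 Henstock_Kurzweil_Integration.integral_add
 Henstock_Kurzweil_Integration.integral_cnj
 Henstock_Kurzweil_Integration.integral_cong
 Henstock_Kurzweil_Integration.integral_diff
 Henstock_Kurzweil_Integration.integral_norm_bound_integral
 Henstock_Kurzweil_Integration.integral_sum

abbreviation BM where "BM == borel_measurable borel"
abbreviation nnl :: "('a::euclidean_space => ennreal) => ennreal" (binder "NL " 10) where "nnl f == nn_integral lborel f"
lemmas cont_BM = borel_measurable_continuous_onI
abbreviation fd where "fd f x == frechet_derivative f (at x)"

section \<open>The reflection group\<close>

locale dunkl =
 fixes R :: "(real^'n) set" and k :: "real^'n => real"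
 assumes root_system: "normalized_root_system R"
  and mult_fun: "multiplicity_function R k"
begin

abbreviation rf :: "real^'n => real^'n => real^'n" where "rf \<equiv> root_reflection"
abbreviation MX where "MX \<equiv> dunkl_maximal R k"

abbreviation G :: "(real^'n => real^'n) set" where "G \<equiv> reflection_group R"

lemma finite_R [simp]: "finite R"
 using root_system by (simp add: normalized_root_system_def)

lemma inner_root [simp]: "al \<in> R ==> al \<cdot> al = 2"
 using root_system by (simp add: normalized_root_system_def power2_norm_eq_inner)

lemma norm_root: "al \<in> R ==> norm al = sqrt 2"
 by (simp add: norm_eq_sqrt_inner)

lemma root_nz: "al \<in> R ==> al ~= 0"
 using root_system by (auto simp: normalized_root_system_def)

lemma k_nonneg [simp]: "al \<in> R ==> 0 <= k al"
 using mult_fun by (simp add: multiplicity_function_def)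

lemma refl_eq: "al \<in> R ==> rf al x = x - (x \<cdot> al) *R al"
 by (simp add: root_reflection_def power2_norm_eq_inner)

lemma refl_inner: "al \<in> R ==> rf al x \<cdot> rf al y = x \<cdot> y"
 by (simp add: refl_eq inner_diff inner_commute algebra_simps)

lemma refl_root: "al \<in> R ==> rf al al = - al"
 by (simp add: refl_eq algebra_simps scaleR_2)

lemma refl_inner_root: "al \<in> R ==> al \<cdot> rf al x = - (al \<cdot> x)"
 by (simp add: refl_eq inner_diff inner_commute algebra_simps)

lemma refl_refl [simp]: "al \<in> R ==> rf al (rf al x) = x"
 by (simp add: refl_eq inner_diff algebra_simps)

lemma refl_comp_refl: "al \<in> R ==> rf al o rf al = id"
 by auto

lemma refl_in_G [simp]: "al \<in> R ==> rf al \<in> G"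
 using reflection_group.step[OF _ reflection_group.unit] by fastforce

lemma id_in_G [simp]: "id \<in> G"
 by (rule reflection_group.unit)

lemma G_comp [simp]: "g \<in> G ==> h \<in> G ==> g o h \<in> G"
 by (induction rule: reflection_group.induct) (auto simp: comp_assoc intro: reflection_group.step)

lemma G_linear: "g \<in> G ==> linear g"
proof (induction rule: reflection_group.induct)
 case unit
 then show ?case by (rule linear_id)
next
 case (step al g)
 have "linear (rf al)"
  by (rule linearI) (use step in \<open>auto simp: refl_eq algebra_simps inner_add_left\<close>)
 then show ?case using step linear_compose by blast
qed

lemma G_inner [simp]: "g \<in> G ==> g x \<cdot> g y = x \<cdot> y"
 by (induction rule: reflection_group.induct) (auto simp: refl_inner)

lemma G_norm [simp]: "g \<in> G ==> norm (g x) = norm x"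
 by (simp add: norm_eq_sqrt_inner)

lemma G_bij: "g \<in> G ==> bij g"
proof (induction rule: reflection_group.induct)
 case (step al g)
 have "bij (rf al)"
  by (rule involuntory_imp_bij) (use step in auto)
 then show ?case using step bij_comp by blast
qed (rule bij_id)

lemma G_root: "g \<in> G ==> al \<in> R ==> g al \<in> R"
proof (induction arbitrary: al rule: reflection_group.induct)
 case (step \<beta> g)
 then have "rf \<beta> ` R = R"
  using root_system by (simp add: normalized_root_system_def)
 then show ?case using step by auto
qed simp

lemma k_inv [simp]: "g \<in> G ==> al \<in> R ==> k (g al) = k al"
 using mult_fun by (simp add: multiplicity_function_def)

lemma G_image_R: "g \<in> G ==> g ` R = R"
 using endo_inj_surj[OF finite_R, of g] G_root G_bij
 by (metis bij_is_inj image_subsetI inj_on_subset subset_UNIV)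

lemma G_bij_betw_R: "g \<in> G ==> bij_betw g R R"
 using G_image_R G_bij by (metis bij_betw_def bij_is_inj inj_on_subset subset_UNIV)

lemma G_inv_in [simp]: "g \<in> G ==> inv g \<in> G"
proof (induction rule: reflection_group.induct)
 case (step al g)
 have "inv (rf al) = rf al"
  using step refl_comp_refl inv_unique_comp by blast
 moreover have "inv (rf al o g) = inv g o inv (rf al)"
  using step by (intro o_inv_distrib) (auto intro: G_bij)
 ultimately show ?case using step by (metis G_comp refl_in_G)
qed (simp only: inv_id id_in_G)

lemma G_inv_left [simp]: "g \<in> G ==> inv g (g x) = x"
 using G_bij by (simp add: bij_is_inj)

lemma G_inv_right [simp]: "g \<in> G ==> g (inv g x) = x"
 using G_bij by (simp add: bij_is_surj surj_f_inv_f)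

lemma G_refl: "g \<in> G ==> al \<in> R ==> g (rf al x) = rf (g al) (g x)"
 by (simp add: refl_eq G_root linear_diff[OF G_linear] linear_cmul[OF G_linear])

text \<open>An element is determined by its values on \<open>R\<close>: \<open>g x - x\<close> lies
  in the span of \<open>R\<close>, so if \<open>g\<close> and \<open>h\<close> agree on
  \<open>R\<close>, then \<open>g x - h x\<close> is in the span and, both maps being isometries,
  orthogonal to every root. Hence \<open>G\<close> embeds into the maps from \<open>R\<close> to
  \<open>R\<close>.\<close>

lemma finite_G [simp]: "finite G"
proof -
 define \<phi> :: "(real^'n => real^'n) => real^'n => real^'n" where "\<phi> = (%g. restrict g R)"
 have span: "g x - x \<in> span R" if "g \<in> G" for g x
  using that
 proof (induction rule: reflection_group.induct)
  case (step al g)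
  have "rf al (g x) - x = (g x - x) - (g x \<cdot> al) *R al"
   using step by (simp add: refl_eq)
  then show ?case using step by (simp only: comp_apply span_diff span_scale span_base)
 qed (simp add: span_zero)
 have "inj_on \<phi> G"
 proof (rule inj_onI)
  fix g h assume gh: "g \<in> G" "h \<in> G" and eq: "\<phi> g = \<phi> h"
  have e: "g al = h al" if "al \<in> R" for al
   using eq that unfolding \<phi>_def by (metis restrict_apply')
  show "g = h"
  proof
   fix x
   define d where "d = g x - h x"
   have "d \<in> span R"
    using span_diff[OF span[OF gh(1), of x] span[OF gh(2), of x]] by (simp add: d_def)
   moreover have "orthogonal d \<beta>" if b: "\<beta> \<in> R" for \<beta>
   proof -
    obtain al where a: "al \<in> R" "\<beta> = g al" using G_image_R[OF gh(1)] b by blast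
    then have "d \<cdot> \<beta> = g x \<cdot> g al - h x \<cdot> h al" by (simp add: d_def inner_diff e)
    also have "... = 0" using gh by simp
    finally show ?thesis by (simp add: orthogonal_def)
   qed
   ultimately have "orthogonal d d" using orthogonal_to_span by blast
   then show "g x = h x" by (simp add: d_def orthogonal_self)
  qed
 qed
 moreover have "\<phi> ` G \<subseteq> R \<rightarrow>\<^sub>E R"
  by (auto simp: \<phi>_def G_root)
 moreover have "finite (R \<rightarrow>\<^sub>E R)" by (intro finite_PiE) auto
 ultimately show ?thesis using finite_imageD finite_subset by blast
qed

lemma G_nonempty [simp]: "G ~= {}"
 using id_in_G by blast

lemma card_G_pos: "0 < card G"
 by (simp add: card_gt_0_iff)

lemma bij_right: "h \<in> G ==> bij_betw (%g. g o h) G G"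
 by (rule bij_betw_byWitness[where f' = "%g. g o inv h"])
  (auto simp: comp_assoc fun_eq_iff)

lemma bij_left: "h \<in> G ==> bij_betw (%g. h o g) G G"
 by (rule bij_betw_byWitness[where f' = "%g. inv h o g"])
  (auto simp: comp_assoc[symmetric] fun_eq_iff)

lemma sum_right: "h \<in> G ==> (SUM g:G. f (g o h)) = (SUM g:G. f g)"
 by (rule sum.reindex_bij_betw[OF bij_right])

lemma sum_left: "h \<in> G ==> (SUM g:G. f (h o g)) = (SUM g:G. f g)"
 by (rule sum.reindex_bij_betw[OF bij_left])

lemma sum_roots: "g \<in> G ==> (SUM al:R. f (g al)) = (SUM al:R. f al)"
 by (rule sum.reindex_bij_betw[OF G_bij_betw_R])

lemma G_cont: "g \<in> G ==> continuous_on S g"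
 using G_linear linear_continuous_on linear_conv_bounded_linear by blast

section \<open>Inverting the degree operator on the group\<close>

text \<open>On functions of degree \<open>n\<close>, the Dunkl operator in the direction of the
  argument is \<open>n + gam\<close> minus the reflections weighted by \<open>k al / 2\<close> (see
  \<open>T_euler\<close>); \<open>gam\<close> is the total weight.\<close>

definition gam :: real where "gam = (SUM al:R. k al / 2)"

lemma gam_nonneg [simp]: "0 <= gam"
 unfolding gam_def by (intro sum_nonneg) auto

text \<open>Weights of the random walk on \<open>G\<close> that jumps across \<open>al\<close> at rate \<open>k al / 2\<close>.\<close>

primrec walk :: "nat => (real^'n => real^'n) => real" where
 "walk 0 g = (if g = id then 1 else 0)"
| "walk (Suc m) g = (SUM al:R. k al / 2 * walk m (g o rf al))"

text \<open>Neumann series for the inverse of \<open>n + gam\<close> minus the jump part of the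
  walk. It converges for \<open>n > 0\<close> because the jump part has norm at most
  \<open>gam\<close>.\<close>

definition resolv :: "nat => (real^'n => real^'n) => real" where
 "resolv n g = (\<Sum>m. walk m g / (real n + gam) ^ Suc m)"

lemma walk_nonneg: "0 <= walk m g"
 by (induction m arbitrary: g) (auto intro!: sum_nonneg mult_nonneg_nonneg)

lemma walk_sum: "(SUM g:G. walk m g) = gam ^ m"
proof (induction m)
 case 0
 then show ?case by (simp add: sum.delta)
next
 case (Suc m)
 have "(SUM g:G. walk (Suc m) g) = (SUM al:R. k al / 2 * (SUM g:G. walk m (g o rf al)))"
  by (simp add: sum_distrib_left sum.swap[of _ R])
 also have "... = (SUM al:R. k al / 2 * gam ^ m)"
  by (intro sum.cong refl) (use Suc in \<open>simp add: sum_right[where f="walk m"]\<close>)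
 also have "... = gam ^ Suc m" by (simp add: gam_def sum_distrib_right)
 finally show ?case .
qed

lemma walk_le: "g \<in> G ==> walk m g <= gam ^ m"
 using member_le_sum[of g G "walk m"] walk_nonneg walk_sum by simp

lemma geom_sums: "0 < n ==> (%m. gam ^ m / (real n + gam) ^ Suc m) sums (1 / real n)"
proof -
 assume n: "0 < n"
 have p: "real n + gam > 0" using n gam_nonneg by (simp add: add_pos_nonneg)
 have "norm (gam / (real n + gam)) < 1" using n p gam_nonneg by (simp only: real_norm_def abs_of_nonneg divide_nonneg_pos pos_divide_less_eq) simp
 then have "(%m. (gam / (real n + gam)) ^ m) sums (1 / (1 - gam / (real n + gam)))"
  by (rule geometric_sums)
 from sums_mult[OF this, of "1 / (real n + gam)"]
 show ?thesis using n p by (simp add: field_simps)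
qed

lemma resolv_summable:
 assumes "0 < n" "g \<in> G" shows "summable (%m. walk m g / (real n + gam) ^ Suc m)"
proof (rule summable_comparison_test'[OF sums_summable[OF geom_sums[OF assms(1)]]])
 fix m :: nat
 have "0 < (real n + gam) ^ Suc m" using assms gam_nonneg by (simp add: add_pos_nonneg)
 then show "norm (walk m g / (real n + gam) ^ Suc m) <= gam ^ m / (real n + gam) ^ Suc m"
  using walk_nonneg walk_le[OF assms(2)] by (simp add: divide_right_mono)
qed

lemma resolv_nonneg: "0 < n ==> g \<in> G ==> 0 <= resolv n g"
 unfolding resolv_def using resolv_summable
 by (intro suminf_nonneg divide_nonneg_nonneg walk_nonneg zero_le_power add_nonneg_nonneg) auto

text \<open>The mass \<open>1 / n\<close> in degree \<open>n\<close> is the source of the factorial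
  in all bounds for \<open>en\<close>.\<close>

lemma resolv_sum: "0 < n ==> (SUM g:G. resolv n g) = 1 / real n"
proof -
 assume n: "0 < n"
 have "(SUM g:G. resolv n g) = (\<Sum>m. SUM g:G. walk m g / (real n + gam) ^ Suc m)"
  unfolding resolv_def using n by (intro suminf_sum[symmetric] resolv_summable) auto
 also have "... = (\<Sum>m. gam ^ m / (real n + gam) ^ Suc m)"
  by (simp only: sum_divide_distrib[symmetric] walk_sum)
 also have "... = 1 / real n" using geom_sums[OF n] sums_unique by metis
 finally show ?thesis .
qed

text \<open>First-step analysis: shifting the Neumann series by one term takes one jump out of
  it.\<close>

lemma resolv_rec:
 assumes n: "0 < n" and g: "g \<in> G"
 shows "(real n + gam) * resolv n g - (SUM al:R. k al / 2 * resolv n (g o rf al))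
  = (if g = id then 1 else 0)"
proof -
 define q where "q = real n + gam"
 have q: "q > 0" using n gam_nonneg by (simp add: q_def add_pos_nonneg)
 let ?t = "%m g. walk m g / q ^ Suc m"
 have sm: "summable (%m. ?t m g)" if "g \<in> G" for g
  using resolv_summable[OF n that] by (simp add: q_def)
 have "(SUM al:R. k al / 2 * resolv n (g o rf al))
   = (SUM al:R. \<Sum>m. k al / 2 * ?t m (g o rf al))"
  unfolding resolv_def q_def[symmetric] using g
  by (intro sum.cong refl suminf_mult[symmetric] sm) auto
 also have "... = (\<Sum>m. SUM al:R. k al / 2 * ?t m (g o rf al))"
  using g by (intro suminf_sum[symmetric] summable_mult sm) auto
 also have "... = (\<Sum>m. q * ?t (Suc m) g)"
  using q by (simp add: sum_divide_distrib sum_distrib_left)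
 also have "... = q * (\<Sum>m. ?t (Suc m) g)"
  by (intro suminf_mult) (use sm[OF g] in \<open>simp only: summable_Suc_iff[of "%n. ?t n g"]\<close>)
 also have "... = q * (resolv n g - ?t 0 g)"
  using suminf_split_head[OF sm[OF g]] by (simp add: resolv_def q_def[symmetric])
 also have "... = q * resolv n g - (if g = id then 1 else 0)"
  using q by (simp add: right_diff_distrib)
 finally show ?thesis unfolding q_def[symmetric] by linarith
qed

end

section \<open>The exponential series on the group\<close>

context dunkl begin

text \<open>The coefficients of the solution \<open>F\<close> of \<open>r F' + L F = r A F\<close>, \<open>F 0 = 1\<close>, where \<open>L\<close> is the
 generator of the random walk above.\<close>

primrec en :: "((real^'n => real^'n) => 'a) => nat => (real^'n => real^'n) => 'a::{real_normed_field,banach}" where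
 "en A 0 g = 1"
| "en A (Suc m) g = (SUM h:G. resolv (Suc m) h *R (A (h o g) * en A m (h o g)))"

definition ek :: "((real^'n => real^'n) => 'a) => (real^'n => real^'n) => 'a::{real_normed_field,banach}" where
 "ek A g = (\<Sum>n. en A n g)"

lemma en_cong: "(!!g. g \<in> G ==> A g = B g) ==> g \<in> G ==> en A n g = en B n g"
 by (induction n arbitrary: g) auto

lemma ek_cong: "(!!g. g \<in> G ==> A g = B g) ==> g \<in> G ==> ek A g = ek B g"
 unfolding ek_def using en_cong[of A B g] by simp

lemma en_comp: "en (%h. A (h o g)) n h = en A n (h o g)"
 by (induction n arbitrary: h) (simp_all add: comp_assoc)

lemma en_scale: "en (%h. c * A h) n g = c ^ n * en A n g"
 by (induction n arbitrary: g) (simp_all add: sum_distrib_left mult_ac)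

lemma en_of_real: "en (%h. of_real (a h)) n g = of_real (en a n g)"
 by (induction n arbitrary: g) (simp_all add: scaleR_conv_of_real)

text \<open>The weights \<open>resolv\<close> are nonnegative, so the recursion is monotone in the
  exponents. The size estimates of the kernel rest on this.\<close>

lemma en_mono:
 fixes a :: "_ => real"
 assumes "!!g. g \<in> G ==> norm (A g) <= a g" and "g \<in> G"
 shows "norm (en A n g) <= en a n g"
 using assms(2)
proof (induction n arbitrary: g)
 case (Suc m)
 have a: "0 <= a g" if "g \<in> G" for g using assms(1)[OF that] norm_ge_zero order_trans by blast
 have "norm (en A (Suc m) g) <= (SUM h:G. norm (resolv (Suc m) h *R (A (h o g) * en A m (h o g))))"
  unfolding en.simps by (rule norm_sum)
 also have "... <= en a (Suc m) g"
  unfolding en.simps norm_scaleR norm_mult using Suc.prems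
  by (intro sum_mono) (auto simp: abs_of_nonneg resolv_nonneg simp del: comp_apply
    intro!: mult_left_mono mult_mono assms a Suc.IH G_comp)
 finally show ?case .
qed simp

lemma en_const: "g \<in> G ==> en (%_. c) n g = c ^ n / fact n"
proof (induction n arbitrary: g)
 case (Suc m)
 have "en (%_. c) (Suc m) g = (SUM h:G. resolv (Suc m) h) *R (c * (c ^ m / fact m))"
  unfolding en.simps scaleR_sum_left by (intro sum.cong refl) (simp only: Suc.IH G_comp Suc.prems)
 also have "... = c ^ Suc m / fact (Suc m)"
  by (subst resolv_sum) (simp_all add: scaleR_conv_of_real field_simps)
 finally show ?case .
qed simp

lemma en_bound:
 fixes A :: "_ => 'a::{real_normed_field,banach}"
 shows "(!!g. g \<in> G ==> norm (A g) <= M) ==> g \<in> G ==> norm (en A n g) <= M ^ n / fact n"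
 using en_mono[of A "%_. M" g n] en_const[of g M n] by simp

lemma exp_summable: "summable (%n. (M::real) ^ n / fact n)"
 using summable_exp[of M] by (simp add: field_simps)

lemma exp_suminf: "(\<Sum>n. (M::real) ^ n / fact n) = exp M"
 by (simp add: exp_def field_simps)

lemma ex_bound: "EX M>=0. ALL g:G. norm (A g) <= M"
proof -
 have "finite ((%g. norm (A g)) ` G)" by simp
 then have "ALL g:G. norm (A g) <= Max ((%g. norm (A g)) ` G)" by (auto intro: Max_ge)
 moreover from this have "0 <= Max ((%g. norm (A g)) ` G)"
  using id_in_G norm_ge_zero order_trans by blast
 ultimately show ?thesis by blast
qed

lemma en_summable_norm: "g \<in> G ==> summable (%n. norm (en A n g))"
proof -
 assume g: "g \<in> G"
 obtain M where "ALL g:G. norm (A g) <= M" using ex_bound by blast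
 then show ?thesis using en_bound[of A M g] g
  by (intro summable_comparison_test'[OF exp_summable[of M]]) auto
qed

lemma en_summable: "g \<in> G ==> summable (%n. en A n g)"
 by (rule summable_norm_cancel[OF en_summable_norm])

lemma ek_mono:
 fixes a :: "_ => real"
 assumes "!!g. g \<in> G ==> norm (A g) <= a g" and "g \<in> G"
 shows "norm (ek A g) <= ek a g"
proof -
 have "norm (ek A g) <= (\<Sum>n. norm (en A n g))"
  unfolding ek_def by (rule summable_norm[OF en_summable_norm[OF assms(2)]])
 also have "... <= ek a g"
  unfolding ek_def using assms en_summable_norm en_summable
  by (intro suminf_le en_mono) auto
 finally show ?thesis .
qed

lemma ek_const: "g \<in> G ==> ek (%_. c::real) g = exp c"
 by (simp add: ek_def en_const exp_suminf)

text \<open>Reindexing the sum by a reflection moves the jump from the argument of \<phi> onto the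
  weights, where \<open>resolv_rec\<close> leaves a point mass at \<open>id\<close>.\<close>

lemma resolv_eq:
 fixes \<phi> :: "_ => 'a::real_vector"
 assumes n: "0 < n" and g: "g \<in> G"
 shows "(real n + gam) *R (SUM h:G. resolv n h *R \<phi> (h o g))
  - (SUM al:R. (k al / 2) *R (SUM h:G. resolv n h *R \<phi> (h o (rf al o g)))) = \<phi> g"
proof -
 have "(SUM h:G. resolv n h *R \<phi> (h o (rf al o g)))
   = (SUM h:G. resolv n (h o rf al) *R \<phi> (h o g))" if "al \<in> R" for al
  using sum_right[of "rf al" "%h. resolv n (h o rf al) *R \<phi> (h o g)"] that
  by (simp add: comp_assoc refl_comp_refl)
 then have "(SUM al:R. (k al / 2) *R (SUM h:G. resolv n h *R \<phi> (h o (rf al o g))))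
   = (SUM al:R. SUM h:G. (k al / 2 * resolv n (h o rf al)) *R \<phi> (h o g))"
  by (intro sum.cong refl) (simp add: scaleR_sum_right)
 also have "... = (SUM h:G. (SUM al:R. k al / 2 * resolv n (h o rf al)) *R \<phi> (h o g))"
  by (subst sum.swap) (simp add: scaleR_sum_left)
 finally have "(real n + gam) *R (SUM h:G. resolv n h *R \<phi> (h o g))
  - (SUM al:R. (k al / 2) *R (SUM h:G. resolv n h *R \<phi> (h o (rf al o g))))
  = (SUM h:G. ((real n + gam) * resolv n h - (SUM al:R. k al / 2 * resolv n (h o rf al))) *R \<phi> (h o g))"
  by (simp only: scaleR_sum_right scaleR_diff_left sum_subtractf scaleR_scaleR)
 also have "... = (SUM h:G. (if h = id then 1 else 0) *R \<phi> (h o g))"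
  by (intro sum.cong refl) (simp only: resolv_rec[OF n])
 also have "... = (SUM h:G. (if h = id then \<phi> (h o g) else 0))"
  by (intro sum.cong refl) auto
 also have "... = \<phi> g" by (simp add: sum.delta)
 finally show ?thesis .
qed

lemma en_rec:
 assumes "g \<in> G"
 shows "(real (Suc m) + gam) *R en A (Suc m) g - (SUM al:R. (k al / 2) *R en A (Suc m) (rf al o g))
  = A g * en A m g"
 unfolding en.simps using resolv_eq[OF _ assms, of "Suc m" "%g. A g * en A m g"] by simp

text \<open>Maximum principle: where the norm of \<phi> is maximal, the left side has norm
  \<open>n + gam\<close> times the maximum and the right side at most \<open>gam\<close> times
  it.\<close>

lemma walk_unique:
 fixes \<phi> :: "_ => 'a::real_normed_vector"
 assumes n: "0 < (n::real)"
  and eq: "!!g. g \<in> G ==> (n + gam) *R \<phi> g = (SUM al:R. (k al / 2) *R \<phi> (rf al o g))"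
  and g: "g \<in> G"
 shows "\<phi> g = 0"
proof -
 define M where "M = Max ((%g. norm (\<phi> g)) ` G)"
 have fin: "finite ((%g. norm (\<phi> g)) ` G)" by simp
 have le: "norm (\<phi> h) <= M" if "h \<in> G" for h unfolding M_def using that by (intro Max_ge[OF fin]) auto
 have "M \<in> (%g. norm (\<phi> g)) ` G" unfolding M_def by (intro Max_in) auto
 then obtain h where h: "h \<in> G" "M = norm (\<phi> h)" by blast
 have "(n + gam) * M = norm ((n + gam) *R \<phi> h)" using n gam_nonneg h by simp
 also have "... = norm (SUM al:R. (k al / 2) *R \<phi> (rf al o h))" using eq h by simp
 also have "... <= (SUM al:R. norm ((k al / 2) *R \<phi> (rf al o h)))" by (rule norm_sum)
 also have "... <= (SUM al:R. k al / 2 * M)"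
  by (intro sum_mono) (use le h in \<open>auto intro!: mult_left_mono\<close>)
 also have "... = gam * M" by (simp add: gam_def sum_distrib_right)
 finally have "n * M <= 0" by (simp add: algebra_simps)
 then have "M <= 0" using n by (simp add: mult_le_0_iff)
 then have "norm (\<phi> g) <= 0" using le[OF g] by linarith
 then show ?thesis by simp
qed

text \<open>The operator \<open>L\<close> commutes with multiplication by constants, so the Cauchy
  product with the exponential series of \<open>a\<close> solves the recursion with exponents
  \<open>A g + a\<close>; \<open>walk_unique\<close> identifies the two solutions.\<close>

lemma en_shift:
 fixes A :: "_ => 'a::{real_normed_field,banach}"
 assumes "g \<in> G"
 shows "en (%g. A g + a) n g = (SUM j<=n. en A j g * (a ^ (n - j) / fact (n - j)))"
 using assms
proof (induction n arbitrary: g)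
 case (Suc m)
 define b where "b i = a ^ i / fact i" for i
 define S where "S n g = (SUM j<=n. en A j g * b (n - j))" for n g
 define L where "L \<phi> g = gam *R \<phi> g - (SUM al:R. (k al / 2) *R \<phi> (rf al o g))" for \<phi> :: "(real^'n => real^'n) => 'a" and g
 have b: "of_nat (Suc i) * b (Suc i) = a * b i" for i
  unfolding b_def by (simp del: of_nat_Suc)
 have Len: "of_nat j * en A j g + L (en A j) g = (if j = 0 then 0 else A g * en A (j - 1) g)" if "g \<in> G" for j g
 proof (cases j)
  case 0
  have "(SUM x:R. (k x / 2) *R (1::'a)) = gam *R 1" by (simp only: gam_def scaleR_sum_left)
  then show ?thesis by (simp add: L_def 0)
 next
  case (Suc i)
  then show ?thesis using en_rec[OF that, of i A]
   by (simp add: L_def scaleR_add_left scaleR_conv_of_real add_diff_eq del: en.simps of_nat_Suc)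
    (simp add: scaleR_conv_of_real distrib_right del: en.simps)
 qed
 have LS: "of_nat (Suc m) * S (Suc m) g + L (S (Suc m)) g = (A g + a) * S m g" if g: "g \<in> G" for g
 proof -
  have "L (S (Suc m)) g = (SUM j<=Suc m. L (en A j) g * b (Suc m - j))"
   unfolding L_def S_def
   by (simp only: scaleR_sum_right sum_distrib_right left_diff_distrib sum_subtractf
     sum.swap[of _ R] mult_scaleR_left)
  then have "of_nat (Suc m) * S (Suc m) g + L (S (Suc m)) g
    = (SUM j<=Suc m. (of_nat (Suc m) * en A j g + L (en A j) g) * b (Suc m - j))"
   unfolding S_def by (simp only: sum_distrib_left distrib_right sum.distrib mult.assoc)
  \<comment> \<open>The product rule for the degree: \<open>Suc m\<close> is split into the degree
    \<open>j\<close> of the coefficient of \<open>A\<close> and the degree of the exponential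
    factor.\<close>
  also have "... = (SUM j<=Suc m. en A j g * (of_nat (Suc m - j) * b (Suc m - j))
    + (of_nat j * en A j g + L (en A j) g) * b (Suc m - j))"
  proof (intro sum.cong refl)
   fix j assume "j \<in> {..Suc m}"
   then have "(of_nat (Suc m) :: 'a) = of_nat (Suc m - j) + of_nat j"
    by (metis atMost_iff le_add_diff_inverse2 of_nat_add)
   then show "(of_nat (Suc m) * en A j g + L (en A j) g) * b (Suc m - j)
     = en A j g * (of_nat (Suc m - j) * b (Suc m - j))
    + (of_nat j * en A j g + L (en A j) g) * b (Suc m - j)"
    by (simp only: distrib_right) (simp add: algebra_simps)
  qed
  also have "... = (SUM j<=m. en A j g * (of_nat (Suc m - j) * b (Suc m - j)))
    + (SUM j<=Suc m. (of_nat j * en A j g + L (en A j) g) * b (Suc m - j))"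
   by (simp add: sum.distrib)
  also have "(SUM j<=m. en A j g * (of_nat (Suc m - j) * b (Suc m - j))) = a * S m g"
   unfolding S_def sum_distrib_left
   by (intro sum.cong refl) (use b in \<open>simp add: Suc_diff_le del: of_nat_Suc\<close>)
  also have "(SUM j<=Suc m. (of_nat j * en A j g + L (en A j) g) * b (Suc m - j)) = A g * S m g"
   unfolding sum.atMost_Suc_shift Len[OF g] by (simp add: S_def sum_distrib_left mult.assoc)
  finally show ?thesis by (simp add: algebra_simps)
 qed
 have LE: "of_nat (Suc m) * en (%g. A g + a) (Suc m) g + L (en (%g. A g + a) (Suc m)) g = (A g + a) * S m g"
  if g: "g \<in> G" for g
 proof -
  have "en (%g. A g + a) m g = S m g" using Suc.IH[OF g] by (simp add: S_def b_def)
  then show ?thesis using en_rec[OF g, of m "%g. A g + a"]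
   by (simp add: L_def scaleR_add_left scaleR_conv_of_real add_diff_eq del: en.simps of_nat_Suc)
    (simp add: scaleR_conv_of_real distrib_right del: en.simps)
 qed
 have "en (%g. A g + a) (Suc m) g - S (Suc m) g = 0"
 proof (rule walk_unique[where n = "real (Suc m)" and \<phi> = "%g. en (%g. A g + a) (Suc m) g - S (Suc m) g"])
  fix g assume g: "g \<in> G"
  have "of_nat (Suc m) * (en (%g. A g + a) (Suc m) g - S (Suc m) g)
   + (L (en (%g. A g + a) (Suc m)) g - L (S (Suc m)) g) = 0"
   using LE[OF g] LS[OF g] by (simp only: right_diff_distrib) (simp add: algebra_simps)
  then show "(real (Suc m) + gam) *R (en (%g. A g + a) (Suc m) g - S (Suc m) g) =
   (SUM al:R. (k al / 2) *R (en (%g. A g + a) (Suc m) (rf al o g) - S (Suc m) (rf al o g)))"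
   unfolding L_def scaleR_diff_right sum_subtractf scaleR_add_left
   by (simp only: scaleR_conv_of_real of_real_of_nat_eq) (simp add: algebra_simps del: en.simps of_nat_Suc)
 qed (use Suc in auto)
 then show ?case by (simp add: S_def b_def del: en.simps)
qed simp

lemma ek_shift:
 fixes A :: "_ => 'a::{real_normed_field,banach}"
 assumes "g \<in> G"
 shows "ek (%g. A g + a) g = exp a * ek A g"
proof -
 have e: "(\<Sum>n. a ^ n / fact n) = exp a"
  by (simp add: exp_def scaleR_conv_of_real divide_inverse mult.commute)
 have "summable (%n. norm (a ^ n / fact n))"
  using summable_norm_exp[of a] by (simp add: scaleR_conv_of_real divide_inverse mult.commute)
 from Cauchy_product_sums[OF en_summable_norm[OF assms, of A] this]
 have "(%n. en (%g. A g + a) n g) sums (ek A g * exp a)"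
  unfolding en_shift[OF assms] e ek_def .
 then show ?thesis unfolding ek_def by (simp add: sums_iff mult.commute)
qed

text \<open>\<open>en_mono\<close> alone would give the maximum of |A|. After adding a large real
  \<open>a\<close>, however, |A + a| is \<open>a + Re A\<close> up to an error of order
  \<open>1 / a\<close>, and \<open>ek_shift\<close> divides the factor \<open>exp a\<close> out
  again; then \<open>a\<close> tends to infinity.\<close>

lemma ek_le:
 fixes A :: "_ => complex"
 assumes M: "!!g. g \<in> G ==> Re (A g) <= M" and g: "g \<in> G"
 shows "norm (ek A g) <= exp M"
proof -
 obtain B where B: "0 <= B" "ALL g:G. norm (A g) <= B" using ex_bound by blast
 have *: "norm (ek A g) <= exp (M + B^2 / a)" if a: "a > 2 * B" for a :: real
 proof -
  have a0: "a > 0" using a B by linarith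
  have "norm (A h + of_real a) <= a + M + B^2 / a" if h: "h \<in> G" for h
  proof -
   define r i where "r = Re (A h)" and "i = Im (A h)"
   have r: "\<bar>r\<bar> <= B" "\<bar>i\<bar> <= B" using B h abs_Re_le_cmod abs_Im_le_cmod order_trans unfolding r_def i_def by blast+
   have i2: "i^2 <= B^2" using r(2) by (metis abs_le_square_iff abs_of_nonneg B(1))
   have sum_sq: "p^2 + 2 * (p * t) <= (p + t)^2" for p t :: real
    by (simp add: power2_sum)
   have ar: "a + r >= a / 2" using r a by linarith
   have "(norm (A h + of_real a))^2 = (a + r)^2 + i^2"
    by (simp add: cmod_power2 r_def i_def add.commute)
   \<comment> \<open>Since \<open>a + r >= a / 2\<close>, the added term is at least
     \<open>B^2\<close> and so dominates \<open>i^2\<close>. It has the form of the cross term of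
     the square of \<open>a + r + B^2 / a\<close>.\<close>
   also have "... <= (a + r)^2 + 2 * ((a + r) * (B^2 / a))"
   proof -
    have "B^2 = 2 * ((a / 2) * (B^2 / a))" using a0 by simp
    also have "... <= 2 * ((a + r) * (B^2 / a))" using ar a0 by (intro mult_left_mono mult_right_mono) auto
    finally show ?thesis using i2 by linarith
   qed
   also have "... <= (a + r + B^2 / a)^2"
    using sum_sq[of "a + r" "B^2 / a"] .
   finally have "norm (A h + of_real a) <= a + r + B^2 / a"
   proof (rule power2_le_imp_le)
    have "0 <= B^2 / a" using a0 by simp
    then show "0 <= a + r + B^2 / a" using ar a0 by linarith
   qed
   then show ?thesis using M[OF h] by (simp add: r_def)
  qed
  then have "norm (ek (%g. A g + of_real a) g) <= exp (a + M + B^2 / a)"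
   using ek_mono[of "%g. A g + of_real a" "%_. a + M + B^2 / a" g] g ek_const by simp
  then have "exp a * norm (ek A g) <= exp a * exp (M + B^2 / a)"
   unfolding ek_shift[OF g] by (simp add: norm_mult mult_exp_exp add.assoc norm_exp_eq_Re)
  then show ?thesis by simp
 qed
 have "((%a. exp (M + B^2 / a)) \<longlongrightarrow> exp (M + 0)) at_top"
  by (intro tendsto_intros real_tendsto_divide_at_top[OF tendsto_const filterlim_ident])
 then show ?thesis
  using * by (intro tendsto_lowerbound[where F = at_top and f = "%a. exp (M + B^2 / a)"])
   (auto intro: eventually_mono[OF eventually_gt_at_top[of "2 * B"]])
qed

lemma ek_of_real: "g \<in> G ==> ek (%h. of_real (a h)) g = of_real (ek a g)"
 unfolding ek_def by (simp add: en_of_real suminf_of_real[symmetric] en_summable)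

text \<open>Monotonicity is available only for exponents bounded in absolute value by others. A
  common shift by \<open>B\<close> makes the smaller exponent nonnegative, and
  \<open>ek_shift\<close> removes it afterwards.\<close>

lemma ek_compare:
 fixes a b :: "_ => real"
 assumes c: "!!g. g \<in> G ==> a g <= b g + c" and g: "g \<in> G"
 shows "ek a g <= exp c * ek b g"
proof -
 obtain B where B: "ALL g:G. norm (a g) <= B" using ex_bound by blast
 have "norm (ek (%g. a g + B) g) <= ek (%g. b g + (c + B)) g"
 proof (rule ek_mono[OF _ g])
  fix h assume "h \<in> G"
  then show "norm (a h + B) <= b h + (c + B)" using B c by force
 qed
 then have "ek (%g. a g + B) g <= ek (%g. b g + (c + B)) g"
  using abs_ge_self order_trans unfolding real_norm_def by blast
 then have "exp B * ek a g <= exp B * (exp c * ek b g)"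
  unfolding ek_shift[OF g] by (simp add: exp_add mult_ac)
 then show ?thesis by simp
qed

lemma ek_pos: "g \<in> G ==> 0 < ek (a :: _ => real) g"
proof -
 assume g: "g \<in> G"
 obtain B where B: "ALL g:G. norm (a g) <= B" using ex_bound by blast
 have "ek (%_. 0) g <= exp B * ek a g"
  using B g by (intro ek_compare) force+
 then have "1 <= exp B * ek a g" using ek_const[OF g, of 0] by simp
 then show ?thesis by (smt (verit) exp_gt_zero zero_less_mult_pos)
qed

text \<open>The derivative of \<open>en\<close> with respect to the exponents \<open>A\<close> in
  the direction \<open>H\<close>.\<close>

primrec den :: "((real^'n => real^'n) => complex) => ((real^'n => real^'n) => complex) => nat =>
  (real^'n => real^'n) => complex" where
 "den A H 0 g = 0"
| "den A H (Suc m) g = (SUM h:G. resolv (Suc m) h *R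
   (H (h o g) * en A m (h o g) + A (h o g) * den A H m (h o g)))"

definition dek :: "((real^'n => real^'n) => complex) => ((real^'n => real^'n) => complex) =>
  (real^'n => real^'n) => complex" where
 "dek A H g = (\<Sum>n. den A H n g)"

lemma en_has_derivative:
 fixes A :: "'v::real_normed_vector => _ => complex"
 assumes "!!g. g \<in> G ==> ((%p. A p g) has_derivative (%v. A' v g)) (at p within S)" and "g \<in> G"
 shows "((%p. en (A p) n g) has_derivative (%v. den (A p) (A' v) n g)) (at p within S)"
 using assms(2)
proof (induction n arbitrary: g)
 case (Suc m)
 have "((%p. A p (h o g) * en (A p) m (h o g)) has_derivative
   (%v. A p (h o g) * den (A p) (A' v) m (h o g) + A' v (h o g) * en (A p) m (h o g))) (at p within S)"
  if h: "h \<in> G" for h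
  by (rule has_derivative_mult[OF assms(1)[OF G_comp[OF h Suc.prems]] Suc.IH[OF G_comp[OF h Suc.prems]]])
 then have "((%p. en (A p) (Suc m) g) has_derivative (%v. SUM h:G. resolv (Suc m) h *R
   (A p (h o g) * den (A p) (A' v) m (h o g) + A' v (h o g) * en (A p) m (h o g)))) (at p within S)"
  unfolding en.simps by (intro has_derivative_sum has_derivative_scaleR_right) auto
 then show ?case by (simp only: den.simps add.commute)
qed simp

lemma den_scale: "den A (%h. c * H h) n g = c * den A H n g"
 by (induction n arbitrary: g) (simp_all add: sum_distrib_left algebra_simps)

text \<open>The model is the derivative of \<open>M ^ n / fact n\<close> in \<open>M\<close>. In the
  induction the two terms of the recursion contribute in the proportion 1 to \<open>m + 1\<close>,
  and the total weight \<open>1 / (m + 2)\<close> restores the coefficient 1.\<close>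

lemma den_bound:
 assumes M: "!!g. g \<in> G ==> norm (A g) <= M" and H: "!!g. g \<in> G ==> norm (H g) <= et" and "g \<in> G"
 shows "norm (den A H (Suc m) g) <= et * (M ^ m / fact m)"
 using assms(3)
proof (induction m arbitrary: g)
 case 0
 have e: "0 <= et" using H[OF id_in_G] norm_ge_zero order_trans by blast
 have "norm (den A H (Suc 0) g) <= (SUM h:G. norm (resolv (Suc 0) h *R H (h o g)))"
  by simp (rule norm_sum[THEN order_trans], simp)
 also have "... <= (SUM h:G. resolv (Suc 0) h * et)"
  using 0 by (intro sum_mono) (auto simp: resolv_nonneg intro!: mult_left_mono H G_comp)
 also have "... = et" using resolv_sum[of "Suc 0"] by (simp add: sum_distrib_right[symmetric])
 finally show ?case by simp
next
 case (Suc m)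
 have e: "0 <= et" using H[OF id_in_G] norm_ge_zero order_trans by blast
 have M0: "0 <= M" using M[OF id_in_G] norm_ge_zero order_trans by blast
 have "norm (den A H (Suc (Suc m)) g) <= (SUM h:G. norm (resolv (Suc (Suc m)) h *R
   (H (h o g) * en A (Suc m) (h o g) + A (h o g) * den A H (Suc m) (h o g))))"
  unfolding den.simps(2)[of A H "Suc m"] by (rule norm_sum)
 also have "... <= (SUM h:G. resolv (Suc (Suc m)) h * (et * (M ^ Suc m / fact (Suc m)) + M * (et * (M ^ m / fact m))))"
 proof (intro sum_mono)
  fix h assume h: "h \<in> G"
  have hg: "h o g \<in> G" using h Suc.prems by (rule G_comp)
  have "norm (H (h o g) * en A (Suc m) (h o g) + A (h o g) * den A H (Suc m) (h o g))
   <= norm (H (h o g)) * norm (en A (Suc m) (h o g)) + norm (A (h o g)) * norm (den A H (Suc m) (h o g))"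
   unfolding norm_mult[symmetric] by (rule norm_triangle_ineq)
  also have "... <= et * (M ^ Suc m / fact (Suc m)) + M * (et * (M ^ m / fact m))"
   by (intro add_mono mult_mono H M hg en_bound[OF M] Suc.IH norm_ge_zero e M0)
  finally show "norm (resolv (Suc (Suc m)) h *R
   (H (h o g) * en A (Suc m) (h o g) + A (h o g) * den A H (Suc m) (h o g)))
   <= resolv (Suc (Suc m)) h * (et * (M ^ Suc m / fact (Suc m)) + M * (et * (M ^ m / fact m)))"
   using h by (simp add: resolv_nonneg mult_left_mono del: den.simps en.simps)
 qed
 also have "... = (1 / real (Suc (Suc m))) * (et * (M ^ Suc m / fact (Suc m)) + M * (et * (M ^ m / fact m)))"
  by (simp only: sum_distrib_right[symmetric]) (simp add: resolv_sum)
 also have "M * (et * (M ^ m / fact m)) = real (Suc m) * (et * (M ^ Suc m / fact (Suc m)))"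
  by (simp add: divide_simps)
 also have "(1 / real (Suc (Suc m))) * (et * (M ^ Suc m / fact (Suc m)) + ...) = et * (M ^ Suc m / fact (Suc m))"
 proof -
  have "(1 / real (Suc (Suc m))) * (X + real (Suc m) * X) = X" for X :: real
   by (simp add: divide_simps) (simp add: algebra_simps)
  then show ?thesis .
 qed
 finally show ?case .
qed

text \<open>The \<open>M\<close>-derivatives of \<open>M ^ n / fact n\<close>; the index is shifted
  because \<open>den\<close> vanishes in degree 0.\<close>

definition expc :: "real => nat => real" where
 "expc M n = (case n of 0 => 0 | Suc m => M ^ m / fact m)"

lemma expc_summable: "summable (expc M)"
 using exp_summable[of M] by (subst summable_Suc_iff[symmetric]) (simp add: expc_def)

lemma den_bound':
 assumes "!!g. g \<in> G ==> norm (A g) <= M" "!!g. g \<in> G ==> norm (H g) <= et" "g \<in> G"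
 shows "norm (den A H n g) <= et * expc M n"
 using den_bound[OF assms] by (cases n) (simp_all add: expc_def del: den.simps(2))

lemma den_summable: "g \<in> G ==> summable (%n. den A H n g)"
proof -
 assume g: "g \<in> G"
 obtain M where M: "ALL g:G. norm (A g) <= M" using ex_bound by blast
 obtain et where et: "ALL g:G. norm (H g) <= et" using ex_bound by blast
 show ?thesis
  by (rule summable_comparison_test'[OF summable_mult[OF expc_summable[of M], of et]])
   (use M et g in \<open>auto intro!: den_bound'\<close>)
qed

lemma ek_has_derivative:
 fixes A :: "'v::real_normed_vector => _ => complex"
 assumes r: "0 < r"
  and A: "!!p g. p \<in> ball p0 r ==> g \<in> G ==> ((%p. A p g) has_derivative (%v. A' p v g)) (at p)"
  and M: "!!p g. p \<in> ball p0 r ==> g \<in> G ==> norm (A p g) <= M"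
  and K: "!!p g v. p \<in> ball p0 r ==> g \<in> G ==> norm (A' p v g) <= K * norm v"
  and g: "g \<in> G"
 shows "((%p. ek (A p) g) has_derivative (%v. dek (A p0) (A' p0 v) g)) (at p0)"
proof -
 let ?S = "ball p0 r"
 have ex: "EX f. ALL p:?S. (%n. en (A p) n g) sums f p & (f has_derivative (%v. dek (A p) (A' p v) g)) (at p within ?S)"
 proof (rule has_derivative_series)
  show "convex ?S" by simp
  show "((%p. en (A p) n g) has_derivative (%v. den (A p) (A' p v) n g)) (at p within ?S)" if "p \<in> ?S" for n p
   by (rule en_has_derivative[OF has_derivative_at_withinI[OF A[OF that]] g])
  show "p0 \<in> ?S" using r by simp
  show "(%n. en (A p0) n g) sums ek (A p0) g"
   unfolding ek_def by (rule summable_sums[OF en_summable[OF g]])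
  fix e :: real assume e: "e > 0"
  \<comment> \<open>The added 1 guards against \<open>K = 0\<close>.\<close>
  define e' where "e' = e / (\<bar>K\<bar> + 1)"
  have e': "e' > 0" unfolding e'_def using e by simp
  obtain N where N: "!!n. n >= N ==> norm (\<Sum>i. expc M (i + n)) < e'"
   using suminf_exist_split[OF e' expc_summable] by blast
  have "norm ((\<Sum>i<n. den (A p) (A' p h) i g) - dek (A p) (A' p h) g) <= e * norm h"
   if n: "n >= N" and p: "p \<in> ?S" for n p h
  proof -
   have b: "norm (den (A p) (A' p h) i g) <= K * norm h * expc M i" for i
    by (rule den_bound'[OF M[OF p] K[OF p] g])
   have sm: "summable (%i. K * norm h * expc M (i + n))"
    using summable_ignore_initial_segment[OF expc_summable] by (intro summable_mult)
   have "norm ((\<Sum>i<n. den (A p) (A' p h) i g) - dek (A p) (A' p h) g)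
     = norm (\<Sum>i. den (A p) (A' p h) (i + n) g)"
    unfolding dek_def using suminf_minus_initial_segment[OF den_summable[OF g], of "A p" "A' p h" n]
    by (simp add: norm_minus_commute)
   also have "... <= (\<Sum>i. K * norm h * expc M (i + n))"
   proof -
    have s: "summable (%i. norm (den (A p) (A' p h) (i + n) g))"
     by (rule summable_comparison_test'[OF sm]) (use b in simp)
    show ?thesis
     by (rule order_trans[OF summable_norm[OF s] suminf_le[OF _ s sm]]) (use b in simp)
   qed
   also have "... = K * norm h * (\<Sum>i. expc M (i + n))"
    using summable_ignore_initial_segment[OF expc_summable] by (rule suminf_mult)
   also have "... <= \<bar>K\<bar> * norm h * e'"
   proof -
    have "K * norm h * (\<Sum>i. expc M (i + n)) <= \<bar>K * norm h * (\<Sum>i. expc M (i + n))\<bar>" by simp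
    also have "... <= \<bar>K\<bar> * norm h * e'"
     unfolding abs_mult using N[OF n] by (intro mult_mono) auto
    finally show ?thesis .
   qed
   also have "... = (\<bar>K\<bar> * e') * norm h" by simp
   also have "... <= e * norm h"
    using e by (intro mult_right_mono) (auto simp: e'_def field_simps)
   finally show ?thesis .
  qed
  then show "\<forall>\<^sub>F n in sequentially. ALL p:?S. ALL h.
    norm ((\<Sum>i<n. den (A p) (A' p h) i g) - dek (A p) (A' p h) g) <= e * norm h"
   unfolding eventually_sequentially by blast
 qed
 then obtain f where f: "!!p. p \<in> ?S ==> (%n. en (A p) n g) sums f p"
  "(f has_derivative (%v. dek (A p0) (A' p0 v) g)) (at p0 within ?S)"
  using r by (metis centre_in_ball)
 have d: "(f has_derivative (%v. dek (A p0) (A' p0 v) g)) (at p0)"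
  using f(2) r by (simp add: at_within_open[of p0 ?S])
 have eq: "f p = ek (A p) g" if "p \<in> ?S" for p
  using f(1)[OF that] unfolding ek_def by (simp add: sums_iff)
 show ?thesis
  using has_derivative_transform_within_open[OF d open_ball _ eq, of p0 r] r by simp
qed

lemma ek_holomorphic:
 assumes g: "g \<in> G"
 shows "(%z. ek (%h. A h + z * H h) g) field_differentiable (at z0)"
  and "deriv (%z. ek (%h. A h + z * H h) g) z0 = dek (%h. A h + z0 * H h) H g"
proof -
 obtain M where M: "ALL g:G. norm (A g) <= M" using ex_bound by blast
 obtain et where et: "0 <= et" "ALL g:G. norm (H g) <= et" using ex_bound by blast
 have "((%z. ek (%h. A h + z * H h) g) has_derivative
   (%v. dek (%h. A h + z0 * H h) (%h. v * H h) g)) (at z0)"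
 proof (rule ek_has_derivative[where r = 1 and M = "M + (norm z0 + 1) * et" and K = et])
  fix p h assume p: "p \<in> ball z0 1" "h \<in> G"
  show "((%z. A h + z * H h) has_derivative (%v. v * H h)) (at p)"
   by (auto intro!: derivative_eq_intros)
  have "norm p <= norm z0 + 1" using p(1) by (simp add: dist_norm) (smt (verit) norm_triangle_sub norm_minus_commute)
  then have "norm (p * H h) <= (norm z0 + 1) * et" using p et unfolding norm_mult by (intro mult_mono) auto
  then show "norm (A h + p * H h) <= M + (norm z0 + 1) * et"
   using M p norm_triangle_ineq[of "A h" "p * H h"] by force
  show "norm (v * H h) <= et * norm v" for v
   using et p mult_right_mono[of "norm (H h)" et "norm v"] by (simp add: norm_mult mult.commute)
 qed (use g in auto)
 moreover have "(%v. dek (%h. A h + z0 * H h) (%h. v * H h) g) = (%v. dek (%h. A h + z0 * H h) H g * v)"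
  unfolding dek_def den_scale using suminf_mult[OF den_summable[OF g]] by (simp add: mult.commute)
 ultimately have d: "((%z. ek (%h. A h + z * H h) g) has_field_derivative dek (%h. A h + z0 * H h) H g) (at z0)"
  by (simp add: has_field_derivative_def)
 then show "(%z. ek (%h. A h + z * H h) g) field_differentiable (at z0)"
  and "deriv (%z. ek (%h. A h + z * H h) g) z0 = dek (%h. A h + z0 * H h) H g"
  using field_differentiable_def DERIV_imp_deriv by blast+
qed

text \<open>Termwise estimates would lose the real part. Cauchy's inequality on the disc of radius
  \<open>1 / et\<close> keeps it: there the perturbation raises the real part of the exponents by at
  most 1, so \<open>ek_le\<close> bounds the function by \<open>exp (M + 1)\<close>, and 3 bounds
  the constant e.\<close>

lemma dek_le:
 assumes M: "!!g. g \<in> G ==> Re (A g) <= M" and H: "!!g. g \<in> G ==> norm (H g) <= et" and g: "g \<in> G"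
 shows "norm (dek A H g) <= 3 * et * exp M"
proof (cases "et = 0")
 case True
 have "norm (den A H n g) <= 0" for n
 proof -
  obtain B where B: "ALL g:G. norm (A g) <= B" using ex_bound by blast
  show ?thesis using den_bound'[of A B H et g n] B H g True by simp
 qed
 then have "dek A H g = 0" unfolding dek_def by simp
 then show ?thesis using True by simp
next
 case False
 then have e: "et > 0" using H[OF id_in_G] norm_ge_zero[of "H id"] by linarith
 define f where "f = (%z. ek (%h. A h + z * H h) g)"
 have d: "f field_differentiable (at z)" for z unfolding f_def by (rule ek_holomorphic[OF g])
 have "norm ((deriv ^^ 1) f 0) <= fact 1 * exp (M + 1) / (1 / et) ^ 1"
 proof (rule Cauchy_inequality)
  show "f holomorphic_on ball 0 (1 / et)" using d by (simp add: holomorphic_on_def field_differentiable_at_within)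
  show "continuous_on (cball 0 (1 / et)) f"
   using d by (intro continuous_at_imp_continuous_on) (auto intro: field_differentiable_imp_continuous_at)
  show "norm (f z) <= exp (M + 1)" if "norm (0 - z) = 1 / et" for z
   unfolding f_def
  proof (rule ek_le[OF _ g])
   fix h assume h: "h \<in> G"
   have "Re (z * H h) <= norm z * norm (H h)" using complex_Re_le_cmod[of "z * H h"] by (simp add: norm_mult)
   also have "... <= 1 / et * et" using that H[OF h] e by (intro mult_mono) auto
   finally show "Re (A h + z * H h) <= M + 1" using M[OF h] e by simp
  qed
 qed (use e in simp)
 then have "norm (dek A H g) <= exp (M + 1) * et"
  using ek_holomorphic(2)[OF g, of A H 0] by (simp add: f_def)
 also have "... = exp 1 * (et * exp M)" by (simp add: exp_add)
 also have "... <= 3 * (et * exp M)" using exp_le e by (intro mult_right_mono) auto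
 finally show ?thesis by simp
qed

lemma ek_continuous:
 fixes A :: "'v::topological_space => _ => complex"
 assumes A: "!!g. g \<in> G ==> continuous_on S (%p. A p g)"
  and H: "!!g. g \<in> G ==> continuous_on S (%p. H p g)"
  and M: "!!p g. p \<in> S ==> g \<in> G ==> norm (A p g) <= M"
  and K: "!!p g. p \<in> S ==> g \<in> G ==> norm (H p g) <= K"
  and g: "g \<in> G"
 shows "continuous_on S (%p. dek (A p) (H p) g)"
proof (rule uniform_limit_theorem[where F = sequentially])
 have en: "g \<in> G ==> continuous_on S (%p. en (A p) n g)" for n g
 proof (induction n arbitrary: g)
  case (Suc m)
  show ?case unfolding en.simps
   by (intro continuous_on_sum continuous_on_scaleR continuous_on_mult A Suc.IH G_comp Suc.prems continuous_on_const)
 qed simp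
 have den: "g \<in> G ==> continuous_on S (%p. den (A p) (H p) n g)" for n g
 proof (induction n arbitrary: g)
  case (Suc m)
  show ?case unfolding den.simps
   by (intro continuous_on_sum continuous_on_scaleR continuous_on_add continuous_on_mult A H en
     Suc.IH G_comp Suc.prems continuous_on_const)
 qed simp
 show "\<forall>\<^sub>F n in sequentially. continuous_on S (%p. \<Sum>i<n. den (A p) (H p) i g)"
  by (intro always_eventually allI continuous_on_sum den g)
 show "uniform_limit S (%n p. \<Sum>i<n. den (A p) (H p) i g) (%p. dek (A p) (H p) g) sequentially"
  unfolding dek_def
 proof (rule Weierstrass_m_test)
  show "norm (den (A p) (H p) n g) <= K * expc M n" if "p \<in> S" for n p
   by (rule den_bound'[OF M[OF that] K[OF that] g])
  show "summable (%n. K * expc M n)" by (intro summable_mult expc_summable)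
 qed
qed simp

end

section \<open>Dunkl operators and the Dunkl kernel\<close>

context dunkl begin

abbreviation T :: "real^'n => (real^'n => complex) => real^'n => complex" where
 "T \<equiv> dunkl_operator R k"

lemma quot_at:
 assumes "al \<in> R" "(f has_derivative f') (at x)"
 shows "dunkl_quotient al f x =
  (if al \<cdot> x = 0 then f' al else (f x - f (rf al x)) /R (al \<cdot> x))"
 using assms frechet_derivative_at[OF assms(2)]
 by (simp add: dunkl_quotient_def power2_norm_eq_inner)

lemma T_at:
 assumes "(f has_derivative f') (at x)"
 shows "T xi f x = f' xi + (SUM al:R. (k al / 2 * (al \<cdot> xi)) *R
  (if al \<cdot> x = 0 then f' al else (f x - f (rf al x)) /R (al \<cdot> x)))"
 unfolding dunkl_operator_def using frechet_derivative_at[OF assms, symmetric]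
 by (simp add: quot_at[OF _ assms])

lemma refl_inner_left: "al \<in> R ==> rf al x \<cdot> y = x \<cdot> y - (al \<cdot> x) * (al \<cdot> y)"
 by (simp only: refl_eq inner_diff_left inner_scaleR_left inner_commute[of al x])

lemma refl_fixed: "al \<in> R ==> al \<cdot> x = 0 ==> rf al x = x"
 by (simp add: refl_eq inner_commute)

lemma refl_has_derivative: "al \<in> R ==> (rf al has_derivative rf al) (at x within S)"
 using G_linear[OF refl_in_G] linear_imp_has_derivative by blast

lemma G_has_derivative: "g \<in> G ==> (g has_derivative g) (at x within S)"
 using G_linear linear_imp_has_derivative by blast

text \<open>Euler's identity: in the direction of the point itself the factor
  \<open>al \<cdot> x\<close> cancels the denominators, and on a mirror both forms of the term
  vanish.\<close>

lemma T_euler: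
 assumes "(f has_derivative f') (at x)"
 shows "T x f x = f' x + (SUM al:R. (k al / 2) *R (f x - f (rf al x)))"
 unfolding T_at[OF assms]
 by (intro arg_cong2[of _ _ _ _ "(+)"] refl sum.cong) (auto simp: refl_fixed)

lemma T_add:
 assumes "f differentiable (at x)" "g differentiable (at x)"
 shows "T xi (%x. f x + g x) x = T xi f x + T xi g x"
proof -
 obtain f' g' where f: "(f has_derivative f') (at x)" and g: "(g has_derivative g') (at x)"
  using assms by (auto simp: differentiable_def)
 show ?thesis
  unfolding T_at[OF f] T_at[OF g] T_at[OF has_derivative_add[OF f g]] sum.distrib[symmetric] add.assoc
   add.left_commute[of "sum _ _" "g' xi"]
  by (simp add: sum.distrib[symmetric] algebra_simps)
   (intro sum.cong refl, simp add: scaleR_add_right algebra_simps)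
qed

lemma T_cmul:
 assumes "f differentiable (at x)"
 shows "T xi (%x. c * f x) x = c * T xi f x"
proof -
 obtain f' where f: "(f has_derivative f') (at x)"
  using assms by (auto simp: differentiable_def)
 show ?thesis
  unfolding T_at[OF f] T_at[OF has_derivative_mult_right[OF f]] distrib_left sum_distrib_left
  by (intro arg_cong2[of _ _ _ _ "(+)"] refl sum.cong) (simp add: algebra_simps)
qed

lemma T_const: "T xi (%x. c) x = 0"
 unfolding T_at[OF has_derivative_const] by (simp add: if_distrib cong: if_cong)

lemma T_sum:
 assumes "finite I" "!!i. i \<in> I ==> f i differentiable (at x)"
 shows "T xi (%x. SUM i:I. f i x) x = (SUM i:I. T xi (f i) x)"
 using assms
proof (induction I rule: finite_induct)
 case (insert i I)
 then show ?case by (simp add: T_add differentiable_sum)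
qed (simp add: T_const)

lemma T_comp:
 assumes g: "g \<in> G" and "f differentiable (at (g x))"
 shows "T xi (%x. f (g x)) x = T (g xi) f (g x)"
proof -
 obtain f' where f: "(f has_derivative f') (at (g x))"
  using assms by (auto simp: differentiable_def)
 have fg: "((%x. f (g x)) has_derivative (%v. f' (g v))) (at x)"
  by (rule has_derivative_compose[OF G_has_derivative[OF g] f])
 let ?q = "%al. (if al \<cdot> g x = 0 then f' al else (f (g x) - f (rf al (g x))) /R (al \<cdot> g x))"
 have "(SUM al:R. (k al / 2 * (al \<cdot> xi)) *R (if al \<cdot> x = 0 then f' (g al)
   else (f (g x) - f (g (rf al x))) /R (al \<cdot> x)))
  = (SUM al:R. (k (g al) / 2 * (g al \<cdot> g xi)) *R ?q (g al))"
  using g by (intro sum.cong refl) (simp add: G_refl)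
 also have "... = (SUM al:R. (k al / 2 * (al \<cdot> g xi)) *R ?q al)"
  by (rule sum_roots[OF g, where f = "%al. (k al / 2 * (al \<cdot> g xi)) *R ?q al"])
 finally show ?thesis unfolding T_at[OF f] T_at[OF fg] by simp
qed

text \<open>Reflecting changes \<open>x \<cdot> v\<close> by
  \<open>(al \<cdot> x) * (al \<cdot> v)\<close>; after division by \<open>al \<cdot> x\<close> this
  leaves a reflected value of \<open>f\<close>.\<close>

lemma T_mult_inner:
 assumes "f differentiable (at x)"
 shows "T xi (%x. of_real (x \<cdot> v) * f x) x = of_real (x \<cdot> v) * T xi f x + of_real (xi \<cdot> v) * f x
  + (SUM al:R. (k al / 2 * (al \<cdot> xi) * (al \<cdot> v)) *R f (rf al x))"
proof -
 obtain f' where f: "(f has_derivative f') (at x)"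
  using assms by (auto simp: differentiable_def)
 have d: "((%x. complex_of_real (x \<cdot> v) * f x) has_derivative
   (%h. of_real (x \<cdot> v) * f' h + of_real (h \<cdot> v) * f x)) (at x)"
  by (intro has_derivative_mult f has_derivative_of_real has_derivative_inner_left has_derivative_ident)
 have q: "(if al \<cdot> x = 0 then of_real (x \<cdot> v) * f' al + of_real (al \<cdot> v) * f x
    else (of_real (x \<cdot> v) * f x - of_real (rf al x \<cdot> v) * f (rf al x)) /R (al \<cdot> x))
   = of_real (x \<cdot> v) * (if al \<cdot> x = 0 then f' al else (f x - f (rf al x)) /R (al \<cdot> x))
    + (al \<cdot> v) *R f (rf al x)" if a: "al \<in> R" for al
 proof (cases "al \<cdot> x = 0")
  case True
  then show ?thesis by (simp add: refl_fixed[OF a] scaleR_conv_of_real)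
 next
  case False
  have "rf al x \<cdot> v = x \<cdot> v - (al \<cdot> x) * (al \<cdot> v)"
   by (simp add: refl_eq[OF a] inner_diff_left) (simp add: inner_commute)
  then show ?thesis unfolding \<open>rf al x \<cdot> v = _\<close>
   using False by (simp add: scaleR_conv_of_real divide_simps) (simp add: algebra_simps)
 qed
 let ?q = "%al. if al \<cdot> x = 0 then f' al else (f x - f (rf al x)) /R (al \<cdot> x)"
 have "T xi (%x. of_real (x \<cdot> v) * f x) x = of_real (x \<cdot> v) * f' xi + of_real (xi \<cdot> v) * f x
  + (SUM al:R. (k al / 2 * (al \<cdot> xi)) *R (of_real (x \<cdot> v) * ?q al + (al \<cdot> v) *R f (rf al x)))"
  unfolding T_at[OF d] by (intro arg_cong2[of _ _ _ _ "(+)"] refl sum.cong) (simp only: q)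
 also have "(SUM al:R. (k al / 2 * (al \<cdot> xi)) *R (of_real (x \<cdot> v) * ?q al + (al \<cdot> v) *R f (rf al x)))
  = of_real (x \<cdot> v) * (SUM al:R. (k al / 2 * (al \<cdot> xi)) *R ?q al)
   + (SUM al:R. (k al / 2 * (al \<cdot> xi) * (al \<cdot> v)) *R f (rf al x))"
  by (simp only: scaleR_add_right sum.distrib sum_distrib_left mult_scaleR_right scaleR_scaleR)
 finally show ?thesis unfolding T_at[OF f] by (simp only: distrib_left add_ac)
qed

definition Aker :: "complex => real^'n => real^'n => (real^'n => real^'n) => complex" where
 "Aker th x y g = th * of_real (g x \<cdot> y)"

text \<open>The part of the kernel of degree \<open>n\<close> in \<open>x\<close>. Evaluating
  \<open>en\<close> at another group element only moves \<open>x\<close> along its orbit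
  (\<open>en_Aker\<close>), which turns the walk on \<open>G\<close> into a walk on the
  orbit.\<close>

definition En :: "nat => real^'n => real^'n => complex" where
 "En n x y = en (Aker 1 x y) n id"

definition Ek :: "complex => real^'n => real^'n => complex" where
 "Ek th x y = ek (Aker th x y) id"

lemma en_Aker: "en (Aker 1 x y) n g = En n (g x) y"
 using en_comp[of "Aker 1 x y" g n id] by (simp add: En_def Aker_def[abs_def])

lemma En_0 [simp]: "En 0 x y = 1"
 by (simp add: En_def)

lemma En_rec: "(real (Suc m) + gam) *R En (Suc m) x y
  - (SUM al:R. (k al / 2) *R En (Suc m) (rf al x) y) = of_real (x \<cdot> y) * En m x y"
 using en_rec[OF id_in_G, of m "Aker 1 x y"] unfolding en_Aker by (simp add: Aker_def)

lemma Ek_sums: "(%n. th ^ n * En n x y) sums Ek th x y"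
proof -
 have "Aker th x y = (%g. th * Aker 1 x y g)" by (simp add: Aker_def fun_eq_iff)
 then have "en (Aker th x y) n id = th ^ n * En n x y" for n
  using en_scale[of th "Aker 1 x y" n id] by (simp add: En_def)
 then show ?thesis
  using summable_sums[OF en_summable[OF id_in_G, of "Aker th x y"]] by (simp add: Ek_def ek_def)
qed

lemma En_G: "g \<in> G ==> En n (g x) (g y) = En n x y"
proof (induction n arbitrary: x)
 case (Suc m)
 have "En (Suc m) (g (id x)) (g y) - En (Suc m) (id x) y = 0"
 proof (rule walk_unique[where \<phi> = "%h. En (Suc m) (g (h x)) (g y) - En (Suc m) (h x) y" and n = "real (Suc m)"])
  fix h assume h: "h \<in> G"
  have "(SUM al:R. (k al / 2) *R En (Suc m) (g (rf al (h x))) (g y))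
    = (SUM al:R. (k (g al) / 2) *R En (Suc m) (rf (g al) (g (h x))) (g y))"
   using Suc.prems by (intro sum.cong refl) (simp add: G_refl)
  also have "... = (SUM al:R. (k al / 2) *R En (Suc m) (rf al (g (h x))) (g y))"
   by (rule sum_roots[OF Suc.prems, where f = "%al. (k al / 2) *R En (Suc m) (rf al (g (h x))) (g y)"])
  finally show "(real (Suc m) + gam) *R (En (Suc m) (g (h x)) (g y) - En (Suc m) (h x) y)
   = (SUM al:R. (k al / 2) *R (En (Suc m) (g ((rf al o h) x)) (g y)
     - En (Suc m) ((rf al o h) x) y))"
   using En_rec[of m "g (h x)" "g y"] En_rec[of m "h x" y] Suc.IH[OF Suc.prems, of "h x"] Suc.prems
   by (simp only: G_inner scaleR_diff_right sum_subtractf comp_apply) (simp add: algebra_simps del: of_nat_Suc)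
 qed (simp only: of_nat_0_less_iff zero_less_Suc, rule id_in_G)
 then show ?case by simp
qed simp

text \<open>The recursion concerns the first argument only; \<open>En_G\<close> moves a reflection
  to the other argument, so both sides solve the same walk equation along the orbit of
  \<open>x\<close>.\<close>

lemma En_sym: "En n x y = En n y x"
proof (induction n arbitrary: x)
 case (Suc m)
 have "En (Suc m) (id x) y - En (Suc m) y (id x) = 0"
 proof (rule walk_unique[where \<phi> = "%h. En (Suc m) (h x) y - En (Suc m) y (h x)" and n = "real (Suc m)"])
  fix h assume h: "h \<in> G"
  have "(SUM al:R. (k al / 2) *R En (Suc m) (rf al y) (h x))
    = (SUM al:R. (k al / 2) *R En (Suc m) y (rf al (h x)))"
  proof (intro sum.cong refl)
   fix al assume "al \<in> R"
   then show "(k al / 2) *R En (Suc m) (rf al y) (h x)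
    = (k al / 2) *R En (Suc m) y (rf al (h x))"
    using En_G[OF refl_in_G, of al "Suc m" y "rf al (h x)"] by simp
  qed
  then show "(real (Suc m) + gam) *R (En (Suc m) (h x) y - En (Suc m) y (h x))
   = (SUM al:R. (k al / 2) *R (En (Suc m) ((rf al o h) x) y
     - En (Suc m) y ((rf al o h) x)))"
   using En_rec[of m "h x" y] En_rec[of m y "h x"] Suc.IH[of "h x"]
   by (simp only: inner_commute[of "h x" y] scaleR_diff_right sum_subtractf comp_apply) (simp add: algebra_simps del: of_nat_Suc)
 qed (simp only: of_nat_0_less_iff zero_less_Suc, rule id_in_G)
 then show ?case by simp
qed simp

lemma Ek_sym: "Ek th x y = Ek th y x"
 using Ek_sums[of th x y] Ek_sums[of th y x] by (simp add: En_sym[of _ x y] sums_iff)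

lemma Ek_scale: "Ek th (c *R x) y = Ek (th * of_real c) x y"
 unfolding Ek_def by (intro ek_cong) (auto simp: Aker_def linear_cmul[OF G_linear])

lemma Ek_scale_right: "Ek th x (c *R y) = Ek (th * of_real c) x y"
 by (metis Ek_scale Ek_sym)

lemma Ek_0 [simp]: "Ek th 0 y = 1" "Ek th x 0 = 1"
proof -
 have 1: "Ek th 0 y = 1" for y
 proof -
  have "Aker th 0 y g = of_real 0" if "g \<in> G" for g
   by (simp add: Aker_def linear_0[OF G_linear[OF that]])
  then have "Ek th 0 y = of_real (ek (%_. 0) id)"
   using ek_cong[of "Aker th 0 y" "%g. of_real 0" id] ek_of_real[OF id_in_G, of "%_. 0"]
   by (simp only: Ek_def id_in_G)
  then show ?thesis by (simp only: ek_const[OF id_in_G]) simp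
 qed
 show "Ek th 0 y = 1" by (rule 1)
 show "Ek th x 0 = 1" using 1 Ek_sym by metis
qed

lemma En_differentiable: "(%x. En n x y) differentiable (at x)"
proof -
 have "((%p. en (Aker 1 p y) n id) has_derivative (%v. den (Aker 1 x y) (Aker 1 v y) n id)) (at x)"
  by (rule en_has_derivative[OF _ id_in_G]) (auto simp: Aker_def intro!: derivative_eq_intros G_has_derivative)
 then show ?thesis unfolding En_def differentiable_def by blast
qed

text \<open>Apply \<open>T xi\<close> to the recursion \<open>En_rec\<close>. By equivariance the
  defect \<open>u\<close> satisfies the homogeneous walk equation along the joint orbit of
  \<open>xi\<close> and \<open>x\<close>, so \<open>walk_unique\<close> makes it vanish. The
  reflected terms of the product rule and those of the previous degree combine to the reflected
  direction \<open>rf al xi\<close>.\<close>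

lemma T_En: "T xi (%x. En (Suc m) x y) x = of_real (xi \<cdot> y) * En m x y"
proof (induction m arbitrary: xi x rule: less_induct)
 case (less n)
 let ?e = "%n x. En n x y"
 let ?N = "real (Suc n)"
 define u where "u xi x = T xi (?e (Suc n)) x - of_real (xi \<cdot> y) * ?e n x" for xi x
 have IH: "of_real (x \<cdot> y) * T xi (?e n) x = of_real (xi \<cdot> y) *
   ((real n + gam) *R ?e n x - (SUM al:R. (k al / 2) *R ?e n (rf al x)))" for xi x
 proof (cases n)
  case 0
  have "(SUM al:R. (k al / 2) *R (1::complex)) = gam *R 1"
   unfolding gam_def by (simp only: scaleR_sum_left)
  then show ?thesis unfolding 0 En_0 T_const by simp
 next
  case (Suc m)
  show ?thesis unfolding Suc using less[of m xi x] En_rec[of m x y] Suc by (simp add: mult_ac)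
 qed
 have main: "(?N + gam) *R u xi x = (SUM al:R. (k al / 2) *R u (rf al xi) (rf al x))" for xi x
 proof -
  have d: "(%x. ?e (Suc n) (rf al x)) differentiable (at x)" if "al \<in> R" for al
   by (rule differentiable_compose[OF En_differentiable differentiableI[OF refl_has_derivative[OF that]]])
  have e1: "T xi (%x. of_real (?N + gam) * ?e (Suc n) x +
    (SUM al:R. - of_real (k al / 2) * ?e (Suc n) (rf al x))) x
   = of_real (?N + gam) * T xi (?e (Suc n)) x +
    (SUM al:R. - of_real (k al / 2) * T (rf al xi) (?e (Suc n)) (rf al x))"
  proof -
   have t: "T xi (%x. - of_real (k al / 2) * ?e (Suc n) (rf al x)) x
     = - of_real (k al / 2) * T (rf al xi) (?e (Suc n)) (rf al x)"
    if "al \<in> R" for al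
    by (simp only: T_cmul[OF d[OF that]] T_comp[OF refl_in_G[OF that] En_differentiable[of "Suc n" y "rf al x"]])
   have d2: "(%x. - of_real (k al / 2) * ?e (Suc n) (rf al x)) differentiable (at x)"
    if "al \<in> R" for al
    by (rule differentiable_mult[OF differentiable_const d[OF that]])
   have "T xi (%x. of_real (?N + gam) * ?e (Suc n) x +
    (SUM al:R. - of_real (k al / 2) * ?e (Suc n) (rf al x))) x
    = T xi (%x. of_real (?N + gam) * ?e (Suc n) x) x +
    T xi (%x. (SUM al:R. - of_real (k al / 2) * ?e (Suc n) (rf al x))) x"
    by (rule T_add[OF differentiable_mult[OF differentiable_const En_differentiable] differentiable_sum[OF finite_R]])
     (use d2 in blast)
   also have "T xi (%x. (SUM al:R. - of_real (k al / 2) * ?e (Suc n) (rf al x))) x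
     = (SUM al:R. - of_real (k al / 2) * T (rf al xi) (?e (Suc n)) (rf al x))"
    by (subst T_sum[OF finite_R d2], assumption, intro sum.cong refl t)
   finally show ?thesis unfolding T_cmul[OF En_differentiable] .
  qed
  have e2: "(%x. of_real (?N + gam) * ?e (Suc n) x +
    (SUM al:R. - of_real (k al / 2) * ?e (Suc n) (rf al x))) = (%x. of_real (x \<cdot> y) * ?e n x)"
   using En_rec[of n _ y] by (simp only: scaleR_conv_of_real) (simp add: sum_negf)
  have e3: "T xi (%x. of_real (x \<cdot> y) * ?e n x) x = of_real (x \<cdot> y) * T xi (?e n) x + of_real (xi \<cdot> y) * ?e n x
    + (SUM al:R. (k al / 2 * (al \<cdot> xi) * (al \<cdot> y)) *R ?e n (rf al x))"
   by (rule T_mult_inner[OF En_differentiable])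
  have fin: "of_real (?N + gam) * T xi (?e (Suc n)) x
     + (SUM al:R. - of_real (k al / 2) * T (rf al xi) (?e (Suc n)) (rf al x))
     = of_real (x \<cdot> y) * T xi (?e n) x + of_real (xi \<cdot> y) * ?e n x
    + (SUM al:R. (k al / 2 * (al \<cdot> xi) * (al \<cdot> y)) *R ?e n (rf al x))"
   by (rule trans[OF e1[symmetric] e3[folded e2]])
  have "of_real (?N + gam) * T xi (?e (Suc n)) x - (SUM al:R. of_real (k al / 2) * T (rf al xi) (?e (Suc n)) (rf al x))
   = of_real (xi \<cdot> y) * of_real (?N + gam) * ?e n x
    - (SUM al:R. of_real (k al / 2) * (of_real (xi \<cdot> y) - of_real (al \<cdot> xi) * of_real (al \<cdot> y)) * ?e n (rf al x))"
  proof -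
   have "(SUM al:R. of_real (k al / 2) * (of_real (xi \<cdot> y) - of_real (al \<cdot> xi) * of_real (al \<cdot> y)) * ?e n (rf al x))
    = of_real (xi \<cdot> y) * (SUM al:R. (k al / 2) *R ?e n (rf al x))
     - (SUM al:R. (k al / 2 * (al \<cdot> xi) * (al \<cdot> y)) *R ?e n (rf al x))"
    unfolding sum_distrib_left sum_subtractf[symmetric]
    by (intro sum.cong refl) (simp add: scaleR_conv_of_real algebra_simps)
   then show ?thesis using fin
    unfolding IH by (simp only: sum_negf mult_minus_left) (simp add: scaleR_conv_of_real algebra_simps)
  qed
  also have "(SUM al:R. of_real (k al / 2) * (of_real (xi \<cdot> y) - of_real (al \<cdot> xi) * of_real (al \<cdot> y)) * ?e n (rf al x))
    = (SUM al:R. of_real (k al / 2) * (of_real (rf al xi \<cdot> y) * ?e n (rf al x)))"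
   by (intro sum.cong refl) (simp only: refl_inner_left of_real_diff of_real_mult mult.assoc)
  finally have fin2: "of_real (?N + gam) * T xi (?e (Suc n)) x - (SUM al:R. of_real (k al / 2) * T (rf al xi) (?e (Suc n)) (rf al x))
   = of_real (xi \<cdot> y) * of_real (?N + gam) * ?e n x
    - (SUM al:R. of_real (k al / 2) * (of_real (rf al xi \<cdot> y) * ?e n (rf al x)))" .
  have "a * X - S1 = b * a * Z - S2 ==> a * X - a * (b * Z) = S1 - S2" for a X S1 b Z S2 :: complex
   by (simp add: algebra_simps)
  from this[OF fin2] show ?thesis unfolding u_def
   by (simp only: scaleR_conv_of_real right_diff_distrib sum_subtractf)
 qed
 have "u (id xi) (id x) = 0"
  by (rule walk_unique[where n = ?N and \<phi> = "%h. u (h xi) (h x)"]) (simp_all only: main comp_apply of_nat_0_less_iff zero_less_Suc id_in_G)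
 then show ?case by (simp add: u_def)
qed

lemma ident_in_G [simp]: "(%x. x) \<in> G"
 using id_in_G by (simp only: id_def)

lemma norm_Aker: "g \<in> G ==> norm (Aker th x y g) <= norm th * norm x * norm y"
 using Cauchy_Schwarz_ineq2[of "g x" y] by (simp add: Aker_def norm_mult mult_left_mono mult.assoc)

definition dEk :: "complex => real^'n => real^'n => real^'n => complex" where
 "dEk th x y v = dek (Aker th x y) (Aker th v y) id"

lemma Aker_has_derivative:
 assumes g: "g \<in> G"
 shows "((%p. Aker th (fst p) (snd p) g) has_derivative (%v. Aker th (fst v) (snd p) g + Aker th (fst p) (snd v) g)) (at p)"
proof -
 have "((%p. g (fst p) \<cdot> snd p) has_derivative (%v. g (fst p) \<cdot> snd v + g (fst v) \<cdot> snd p)) (at p)"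
  by (intro has_derivative_inner has_derivative_compose[OF has_derivative_fst[OF has_derivative_ident] G_has_derivative[OF g]]
    has_derivative_snd has_derivative_ident)
 from has_derivative_mult_right[OF has_derivative_of_real[OF this], of th]
 show ?thesis unfolding Aker_def by (simp add: algebra_simps)
qed

lemma norm_fst_snd_le: "norm (fst p) <= norm p" "norm (snd p) <= norm p"
 using norm_fst_le[of "fst p" "snd p"] norm_snd_le[of "snd p" "fst p"] by simp_all

lemma ball_pair_bound:
 fixes p p0 :: "'a::real_normed_vector \<times> 'b::real_normed_vector"
 assumes "p \<in> ball p0 1"
 shows "norm (fst p) <= norm p0 + 1" "norm (snd p) <= norm p0 + 1"
proof -
 have "norm p <= norm p0 + norm (p - p0)" using norm_triangle_sub[of p p0] by simp
 then have "norm p <= norm p0 + 1" using assms by (simp add: dist_norm norm_minus_commute)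
 then show "norm (fst p) <= norm p0 + 1" "norm (snd p) <= norm p0 + 1"
  using norm_fst_snd_le[of p] by linarith+
qed

lemma Ek_has_derivative_pair:
 "((%p. Ek th (fst p) (snd p)) has_derivative
   (%v. dek (Aker th (fst p0) (snd p0)) (%g. Aker th (fst v) (snd p0) g + Aker th (fst p0) (snd v) g) id)) (at p0)"
 unfolding Ek_def
proof (rule ek_has_derivative[where r = 1])
 let ?K = "norm p0 + 1"
 fix p :: "(real^'n) \<times> (real^'n)" and g assume p: "p \<in> ball p0 1" and g: "g \<in> G"
 note b = ball_pair_bound[OF p]
 show "((%p. Aker th (fst p) (snd p) g) has_derivative (%v. Aker th (fst v) (snd p) g + Aker th (fst p) (snd v) g)) (at p)"
  by (rule Aker_has_derivative[OF g])
 show "norm (Aker th (fst p) (snd p) g) <= norm th * ?K * ?K"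
  by (rule order_trans[OF norm_Aker[OF g]]) (intro mult_mono b mult_nonneg_nonneg, auto)
 fix v :: "(real^'n) \<times> (real^'n)"
 have "norm (Aker th (fst v) (snd p) g) <= norm th * norm v * ?K"
  by (rule order_trans[OF norm_Aker[OF g]]) (intro mult_mono b mult_nonneg_nonneg norm_fst_snd_le, auto)
 moreover have "norm (Aker th (fst p) (snd v) g) <= norm th * ?K * norm v"
  by (rule order_trans[OF norm_Aker[OF g]]) (intro mult_mono b mult_nonneg_nonneg norm_fst_snd_le, auto)
 ultimately show "norm (Aker th (fst v) (snd p) g + Aker th (fst p) (snd v) g) <= (2 * norm th * ?K) * norm v"
  using norm_triangle_ineq[of "Aker th (fst v) (snd p) g" "Aker th (fst p) (snd v) g"] by (simp add: algebra_simps)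
qed (simp, rule id_in_G)

lemma Ek_has_derivative: "((%x. Ek th x y) has_derivative dEk th x y) (at x)"
proof -
 have "((%x. (x, y)) has_derivative (%v. (v, 0))) (at x)"
  by (intro has_derivative_Pair has_derivative_ident has_derivative_const)
 from has_derivative_compose[OF this, OF Ek_has_derivative_pair[of th "(x, y)", unfolded fst_conv snd_conv]]
 show ?thesis by (simp add: dEk_def[abs_def] Aker_def[abs_def])
qed

lemma Ek_continuous_pair: "continuous_on UNIV (%p. Ek th (fst p) (snd p))"
 by (intro continuous_at_imp_continuous_on ballI has_derivative_continuous[OF Ek_has_derivative_pair])

lemma Ek_continuous: "continuous_on S f ==> continuous_on S h ==> continuous_on S (%p. Ek th (f p) (h p))"
 using continuous_on_compose2[OF Ek_continuous_pair continuous_on_Pair[of S f h]] by simp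

lemma dEk_continuous_pair: "continuous_on UNIV (%p. dEk th (fst p) (snd p) v)"
proof (intro continuous_at_imp_continuous_on ballI)
 fix p0 :: "(real^'n) \<times> (real^'n)"
 let ?K = "norm p0 + 1"
 have c: "continuous_on S (%p. g (fst p))" if "g \<in> G" for g and S :: "((real^'n) \<times> (real^'n)) set"
  by (rule continuous_on_compose2[OF G_cont[OF that] continuous_on_fst[OF continuous_on_id] subset_UNIV])
 have "continuous_on (ball p0 1) (%p. dEk th (fst p) (snd p) v)"
  unfolding dEk_def
 proof (rule ek_continuous)
  fix g assume g: "g \<in> G"
  show "continuous_on (ball p0 1) (%p. Aker th (fst p) (snd p) g)"
   unfolding Aker_def by (intro continuous_intros c g)
  show "continuous_on (ball p0 1) (%p. Aker th v (snd p) g)"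
   unfolding Aker_def by (intro continuous_intros)
  fix p :: "(real^'n) \<times> (real^'n)" assume p: "p \<in> ball p0 1"
  note b = ball_pair_bound[OF p]
  show "norm (Aker th (fst p) (snd p) g) <= norm th * ?K * ?K"
   by (rule order_trans[OF norm_Aker[OF g]]) (intro mult_mono b mult_nonneg_nonneg, auto)
  show "norm (Aker th v (snd p) g) <= norm th * norm v * ?K"
   by (rule order_trans[OF norm_Aker[OF g]]) (intro mult_mono b mult_nonneg_nonneg, auto)
 qed (rule id_in_G)
 then show "continuous (at p0) (%p. dEk th (fst p) (snd p) v)"
  using continuous_on_eq_continuous_at[OF open_ball] centre_in_ball[of p0 1] by fastforce
qed

lemma dEk_continuous: "continuous_on S f ==> continuous_on S h ==> continuous_on S (%p. dEk th (f p) (h p) v)"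
 using continuous_on_compose2[OF dEk_continuous_pair continuous_on_Pair[of S f h]] by simp

lemma Ek_le: "(!!g. g \<in> G ==> Re (th * of_real (g x \<cdot> y)) <= M) ==> norm (Ek th x y) <= exp M"
 unfolding Ek_def by (rule ek_le) (simp_all add: Aker_def)

lemma dEk_le: "(!!g. g \<in> G ==> Re (th * of_real (g x \<cdot> y)) <= M) ==>
  norm (dEk th x y v) <= 3 * (norm th * norm v * norm y) * exp M"
 unfolding dEk_def by (rule dek_le[OF _ norm_Aker]) (simp_all add: Aker_def)

lemma Ek_le_norm: "norm (Ek th x y) <= exp (norm th * norm x * norm y)"
proof (rule Ek_le)
 fix g assume "g \<in> G"
 from norm_Aker[OF this, of th x y] complex_Re_le_cmod[of "Aker th x y g"]
 show "Re (th * of_real (g x \<cdot> y)) <= norm th * norm x * norm y" unfolding Aker_def by linarith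
qed

lemma dEk_le_norm: "norm (dEk th x y v) <= 3 * (norm th * norm v * norm y) * exp (norm th * norm x * norm y)"
proof (rule dEk_le)
 fix g assume "g \<in> G"
 from norm_Aker[OF this, of th x y] complex_Re_le_cmod[of "Aker th x y g"]
 show "Re (th * of_real (g x \<cdot> y)) <= norm th * norm x * norm y" unfolding Aker_def by linarith
qed

text \<open>For imaginary \<open>th\<close> all exponents have real part 0. This uniform bound
  dominates the oscillatory integrals below.\<close>

lemma Ek_imag_le: "Re th = 0 ==> norm (Ek th x y) <= 1"
 using Ek_le[of th x y 0] by simp

lemma dEk_imag_le: "Re th = 0 ==> norm (dEk th x y v) <= 3 * (norm th * norm v * norm y)"
 using dEk_le[of th x y 0 v] by simp

definition Er :: "real^'n => real^'n => real" where
 "Er x y = ek (%g. g x \<cdot> y) id"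

lemma Ek_Er: "Ek 1 x y = of_real (Er x y)"
 unfolding Ek_def Er_def Aker_def mult_1 by (rule ek_of_real[OF id_in_G])

lemma Er_pos: "0 < Er x y"
 unfolding Er_def by (rule ek_pos[OF id_in_G])

lemma Er_sym: "Er x y = Er y x"
 using Ek_sym[of 1 x y] by (simp add: Ek_Er)

lemma Er_compare: "(!!g. g \<in> G ==> g x \<cdot> y <= g x' \<cdot> y' + c) ==> Er x y <= exp c * Er x' y'"
 unfolding Er_def by (rule ek_compare[OF _ id_in_G])

lemma den_scale2: "den (%g. c * A g) (%g. c * H g) n g = c ^ n * den A H n g"
proof (induction n arbitrary: g)
 case (Suc m)
 have "en (%g. c * A g) m h = c ^ m * en A m h" for h by (rule en_scale)
 then show ?case unfolding den.simps Suc.IH sum_distrib_left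
  by (intro sum.cong refl) (simp only: mult_scaleR_right power_Suc, simp add: algebra_simps)
qed simp

text \<open>\<open>T\<close> lowers the degree by one (\<open>T_En\<close>) and annihilates the term
  of degree 0, so applying it termwise shifts the series by one index.\<close>

lemma T_Ek: "T xi (%x. Ek th x y) x = th * of_real (xi \<cdot> y) * Ek th x y"
proof -
 define d where "d n v = den (Aker 1 x y) (Aker 1 v y) n id" for n v
 have A: "Aker th v y = (%g. th * Aker 1 v y g)" for v by (simp add: Aker_def[abs_def])
 have ds: "(%n. th ^ n * d n v) sums dEk th x y v" for v
  using summable_sums[OF den_summable[OF id_in_G, of "Aker th x y" "Aker th v y"]]
  unfolding dEk_def dek_def d_def A[of x] A[of v] den_scale2 .
 have dn: "((%x. En n x y) has_derivative d n) (at x)" for n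
  unfolding En_def d_def
  by (rule en_has_derivative[OF _ id_in_G]) (auto simp: Aker_def intro!: derivative_eq_intros G_has_derivative)
 have q: "(%n. th ^ n * (if al \<cdot> x = 0 then d n al else (En n x y - En n (rf al x) y) /R (al \<cdot> x)))
  sums (if al \<cdot> x = 0 then dEk th x y al else (Ek th x y - Ek th (rf al x) y) /R (al \<cdot> x))" for al
 proof (cases "al \<cdot> x = 0")
  case True
  then show ?thesis using ds by simp
 next
  case False
  have "(%n. (th ^ n * En n x y - th ^ n * En n (rf al x) y) /R (al \<cdot> x))
   sums ((Ek th x y - Ek th (rf al x) y) /R (al \<cdot> x))"
   by (intro sums_scaleR_right sums_diff Ek_sums)
  then show ?thesis using False by (simp add: algebra_simps)
 qed
 have "(%n. th ^ n * d n xi + (SUM al:R. (k al / 2 * (al \<cdot> xi)) *R (th ^ n *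
   (if al \<cdot> x = 0 then d n al else (En n x y - En n (rf al x) y) /R (al \<cdot> x)))))
  sums T xi (%x. Ek th x y) x"
  unfolding T_at[OF Ek_has_derivative] by (intro sums_add ds sums_sum sums_scaleR_right q)
 also have "(%n. th ^ n * d n xi + (SUM al:R. (k al / 2 * (al \<cdot> xi)) *R (th ^ n *
   (if al \<cdot> x = 0 then d n al else (En n x y - En n (rf al x) y) /R (al \<cdot> x)))))
  = (%n. th ^ n * T xi (%x. En n x y) x)"
  unfolding T_at[OF dn] by (simp only: distrib_left sum_distrib_left mult_scaleR_right)
 finally have s: "(%n. th ^ n * T xi (%x. En n x y) x) sums T xi (%x. Ek th x y) x" .
 have "(%n. th ^ Suc n * T xi (%x. En (Suc n) x y) x) sums T xi (%x. Ek th x y) x"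
  using s sums_Suc_iff[of "%n. th ^ n * T xi (%x. En n x y) x" "T xi (%x. Ek th x y) x"]
  by (simp add: T_const del: power_Suc)
 then have "(%n. (th * of_real (xi \<cdot> y)) * (th ^ n * En n x y)) sums T xi (%x. Ek th x y) x"
  by (simp add: T_En mult_ac)
 moreover have "(%n. (th * of_real (xi \<cdot> y)) * (th ^ n * En n x y)) sums (th * of_real (xi \<cdot> y) * Ek th x y)"
  by (intro sums_mult Ek_sums)
 ultimately show ?thesis by (rule sums_unique2)
qed

text \<open>The generator of the walk is symmetric and nonnegative. Pointwise,
  \<open>Re (cnj a * (a - b))\<close> is at least half the difference of the squared moduli, and
  these differences cancel in the sum over \<open>G\<close> for each reflection.\<close>

lemma walk_energy:
 fixes D :: "_ => complex"
 shows "0 <= (SUM g:G. SUM al:R. k al / 2 * Re (cnj (D g) * (D g - D (rf al o g))))"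
proof -
 have Re_ge: "((cmod a)^2 - (cmod b)\<^sup>2) / 2 <= Re (cnj a * (a - b))" for a b
 proof -
  have "0 <= (Re a - Re b)^2 + (Im a - Im b)^2" by simp
  also have "... = 2 * Re (cnj a * (a - b)) - ((cmod a)^2 - (cmod b)\<^sup>2)"
   unfolding cmod_power2 by (simp add: power2_eq_square algebra_simps)
  finally show ?thesis by simp
 qed
 have "(SUM g:G. (cmod (D (rf al o g)))\<^sup>2) = (SUM g:G. (cmod (D g))\<^sup>2)" if "al \<in> R" for al
  by (rule sum_left[OF refl_in_G[OF that], where f = "%g. (cmod (D g))\<^sup>2"])
 then have "0 = (SUM al:R. k al / 2 * (SUM g:G. ((cmod (D g))^2 - (cmod (D (rf al o g)))\<^sup>2) / 2))"
  by (simp add: sum_subtractf sum_divide_distrib[symmetric])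
 also have "... <= (SUM al:R. k al / 2 * (SUM g:G. Re (cnj (D g) * (D g - D (rf al o g)))))"
  by (intro sum_mono mult_left_mono Re_ge) simp
 also have "... = (SUM g:G. SUM al:R. k al / 2 * Re (cnj (D g) * (D g - D (rf al o g))))"
  unfolding sum_distrib_left by (rule sum.swap)
 finally show ?thesis .
qed

text \<open>The energy \<open>SUM g:G. |f (r g z)|\<^sup>2\<close> grows at most exponentially in \<open>r\<close>, because \<open>L\<close> is positive.\<close>

lemma eigen_unique:
 assumes diff: "!!x. f differentiable (at x)"
  and eig: "!!x. T x f x = th * of_real (x \<cdot> y) * f x"
  and f0: "f 0 = 0"
 shows "f z = 0"
proof -
 obtain f' where f': "!!x. (f has_derivative f' x) (at x)"
  using diff unfolding differentiable_def by metis
 define D where "D r g = f (r *R g z)" for r g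
 define e where "e r = (SUM g:G. (cmod (D r g))\<^sup>2)" for r :: real
 define e' where "e' r = (SUM g:G. 2 * Re (cnj (D r g) * f' (r *R g z) (g z)))" for r
 define C where "C = 2 * norm th * norm z * norm y"
 have dD: "((%r. D r g) has_vector_derivative f' (r *R g z) (g z)) (at r)" for r g
 proof -
  have "((%r. r *R g z) has_derivative (%h. h *R g z)) (at r)"
   by (intro has_derivative_scaleR_left has_derivative_ident)
  from has_derivative_compose[OF this f']
  have "((%r. D r g) has_derivative (%h. f' (r *R g z) (h *R g z))) (at r)" unfolding D_def .
  then show ?thesis
   by (simp add: has_vector_derivative_def linear_cmul[OF has_derivative_linear[OF f']])
 qed
 have de: "(e has_real_derivative e' r) (at r)" for r
 proof -
  have "((%r. (cmod (D r g))\<^sup>2) has_real_derivative 2 * Re (cnj (D r g) * f' (r *R g z) (g z))) (at r)" for g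
  proof -
   have "((%r. (Re (D r g))\<^sup>2 + (Im (D r g))^2) has_real_derivative
     2 * Re (cnj (D r g) * f' (r *R g z) (g z))) (at r)"
    by (auto intro!: derivative_eq_intros dD simp: algebra_simps)
   then show ?thesis by (simp add: cmod_power2)
  qed
  then show ?thesis unfolding e_def e'_def by (intro DERIV_sum)
 qed
 have Drefl: "f (rf al (r *R g z)) = D r (rf al o g)" if "al \<in> R" for al r g
  by (simp add: D_def linear_cmul[OF G_linear[OF refl_in_G[OF that]]])
 have bound: "e' r <= C * e r" if r: "0 < r" for r
 proof -
  have *: "r *R f' (r *R g z) (g z) = th * of_real (r * (g z \<cdot> y)) * D r g
    - (SUM al:R. (k al / 2) *R (D r g - D r (rf al o g)))" for g
  proof -
   have "(SUM al:R. (k al / 2) *R (f (r *R g z) - f (rf al (r *R g z))))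
     = (SUM al:R. (k al / 2) *R (D r g - D r (rf al o g)))"
    by (intro sum.cong refl) (simp only: Drefl, simp only: D_def)
   then show ?thesis
    using T_euler[OF f', of "r *R g z"] eig[of "r *R g z"]
    by (simp add: linear_cmul[OF has_derivative_linear[OF f']] D_def[symmetric] algebra_simps)
  qed
  have "r * e' r = (SUM g:G. 2 * Re (cnj (D r g) * (r *R f' (r *R g z) (g z))))"
   unfolding e'_def sum_distrib_left by (intro sum.cong refl) (simp add: algebra_simps)
  also have "... = (SUM g:G. 2 * Re (cnj (D r g) * (th * of_real (r * (g z \<cdot> y)) * D r g)))
    - 2 * (SUM g:G. SUM al:R. k al / 2 * Re (cnj (D r g) * (D r g - D r (rf al o g))))"
   unfolding * right_diff_distrib minus_complex.sel sum_subtractf sum_distrib_left Re_sum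
    mult_scaleR_right scaleR_complex.sel by simp
  also have "... <= (SUM g:G. 2 * Re (cnj (D r g) * (th * of_real (r * (g z \<cdot> y)) * D r g)))"
   using walk_energy[of "D r"] by simp
  also have "... <= (SUM g:G. r * C * (cmod (D r g))^2)"
  proof (intro sum_mono)
   fix g assume g: "g \<in> G"
   have "Re (cnj (D r g) * (th * of_real (r * (g z \<cdot> y)) * D r g)) <= norm (cnj (D r g) * (th * of_real (r * (g z \<cdot> y)) * D r g))"
    by (rule complex_Re_le_cmod)
   also have "... = r * (norm th * \<bar>g z \<cdot> y\<bar>) * (cmod (D r g))^2"
    using r by (simp add: norm_mult power2_eq_square abs_mult)
   also have "... <= r * (norm th * (norm z * norm y)) * (cmod (D r g))^2"
    using Cauchy_Schwarz_ineq2[of "g z" y] g r by (intro mult_right_mono mult_left_mono) auto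
   finally show "2 * Re (cnj (D r g) * (th * of_real (r * (g z \<cdot> y)) * D r g)) <= r * C * (cmod (D r g))^2"
    by (simp add: C_def)
  qed
  also have "... = r * (C * e r)" by (simp add: e_def sum_distrib_left mult.assoc)
  finally show ?thesis using r by simp
 qed
 have e0: "e 0 = 0" by (simp add: e_def D_def f0)
 have e'0: "e' 0 = 0" by (simp add: e'_def D_def f0)
 have "e 1 * exp (- C * 1) <= e 0 * exp (- C * 0)"
 proof (rule DERIV_nonpos_imp_nonincreasing[where f = "%r. e r * exp (- C * r)"])
  fix r :: real assume r: "0 <= r" "r <= 1"
  have "((%r. e r * exp (- C * r)) has_real_derivative (e' r - C * e r) * exp (- C * r)) (at r)"
   by (auto intro!: derivative_eq_intros de simp: algebra_simps)
  moreover have "(e' r - C * e r) * exp (- C * r) <= 0"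
   \<comment> \<open>The estimate came from dividing by \<open>r\<close>; at \<open>r = 0\<close>
     both \<open>e\<close> and \<open>e'\<close> vanish because \<open>f 0 = 0\<close>.\<close>
   using bound[of r] r e0 e'0 by (cases "r = 0") (auto intro: mult_nonpos_nonneg)
  ultimately show "EX y. ((%r. e r * exp (- C * r)) has_real_derivative y) (at r) & y <= 0" by blast
 qed simp
 then have "e 1 <= 0" using e0 by (simp add: mult_le_0_iff)
 moreover have "(cmod (D 1 id))^2 <= e 1"
  unfolding e_def by (rule member_le_sum) auto
 ultimately have "(cmod (D 1 id))^2 <= 0" by linarith
 then show ?thesis by (simp add: D_def)
qed

lemma C1_Ek: "C1_function (%x. Ek th x y)"
proof -
 have fd: "fd (%x. Ek th x y) x = dEk th x y" for x
  by (rule frechet_derivative_at[OF Ek_has_derivative, symmetric])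
 have "continuous_on UNIV (%x. dEk th x y v)" for v
  by (intro dEk_continuous continuous_intros)
 then show ?thesis
  unfolding C1_function_def fd using differentiableI[OF Ek_has_derivative] by simp
qed

lemma T_diff:
 assumes "f differentiable (at x)" "g differentiable (at x)"
 shows "T xi (%x. f x - g x) x = T xi f x - T xi g x"
 using T_add[OF assms(1) differentiable_mult[OF differentiable_const assms(2)], of xi "-1"] T_cmul[OF assms(2), of xi "-1"]
 by simp

lemma eigen_eq_Ek:
 assumes diff: "!!x. f differentiable (at x)"
  and eig: "!!x xi. T xi f x = th * of_real (xi \<cdot> y) * f x"
 shows "f z = f 0 * Ek th z y"
proof -
 have d: "(%x. f 0 * Ek th x y) differentiable (at x)" for x
  by (intro differentiable_mult differentiable_const differentiableI[OF Ek_has_derivative])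
 have "f z - f 0 * Ek th z y = 0"
 proof (rule eigen_unique[where f = "%z. f z - f 0 * Ek th z y" and th = th and y = y])
  show "(%z. f z - f 0 * Ek th z y) differentiable (at x)" for x
   by (intro differentiable_diff diff d)
  show "T x (%z. f z - f 0 * Ek th z y) x = th * of_real (x \<cdot> y) * (f x - f 0 * Ek th x y)" for x
   unfolding T_diff[OF diff d] T_cmul[OF differentiableI[OF Ek_has_derivative]] eig T_Ek by (simp add: algebra_simps)
 qed simp
 then show ?thesis by simp
qed

lemma kernel_real_eq: "dunkl_kernel_real R k x y = Ek 1 x y"
proof -
 have "(THE f. C1_function f & f 0 = 1 & (ALL xi z. dunkl_operator R k xi f z = (xi \<cdot> y) *R f z)) = (%x. Ek 1 x y)"
 proof (rule the_equality)
  show "C1_function (%x. Ek 1 x y) & Ek 1 0 y = 1 & (ALL xi z. T xi (%x. Ek 1 x y) z = (xi \<cdot> y) *R Ek 1 z y)"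
   using C1_Ek T_Ek[of _ 1] by (simp add: scaleR_conv_of_real)
  fix f assume f: "C1_function f & f 0 = 1 & (ALL xi z. T xi f z = (xi \<cdot> y) *R f z)"
  then have "f z = f 0 * Ek 1 z y" for z
   by (intro eigen_eq_Ek) (auto simp: C1_function_def scaleR_conv_of_real)
  then show "f = (%x. Ek 1 x y)" using f by auto
 qed
 then show ?thesis unfolding dunkl_kernel_real_def by simp
qed

text \<open>The complex-bilinear extension of \<open>g x \<cdot> y\<close>, written with the matrix
  of \<open>g\<close>.\<close>

definition cpair :: "(real^'n => real^'n) => complex^'n => complex^'n => complex" where
 "cpair g z w = (SUM i:UNIV. SUM j:UNIV. of_real (g (axis j 1) $ i) * (z $ j) * (w $ i))"

lemma cpair_cvec:
 assumes g: "g \<in> G"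
 shows "cpair g (cvec x) (cvec y) = of_real (g x \<cdot> y)"
proof -
 have "g x = (SUM j:UNIV. x $ j *R g (axis j 1))"
  using linear_sum[OF G_linear[OF g], of "%j. x $ j *R axis j 1" UNIV] basis_expansion[of x]
  by (simp add: linear_cmul[OF G_linear[OF g]] scalar_mult_eq_scaleR)
 then have "g x $ i = (SUM j:UNIV. g (axis j 1) $ i * x $ j)" for i
  by (simp add: mult.commute)
 then show ?thesis
  by (simp add: cpair_def cvec_def inner_vec_def sum_distrib_right)
qed

lemma cpair_smult: "cpair g (c *s z) w = c * cpair g z w" "cpair g z (c *s w) = c * cpair g z w"
 by (simp_all add: cpair_def sum_distrib_left mult_ac)

lemma cpair_bilinear: "bounded_bilinear (cpair g)"
proof (unfold_locales)
 show "cpair g (a + a') b = cpair g a b + cpair g a' b" for a a' b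
  by (simp add: cpair_def algebra_simps sum.distrib)
 show "cpair g a (b + b') = cpair g a b + cpair g a b'" for a b b'
  by (simp add: cpair_def algebra_simps sum.distrib)
 show "cpair g (r *R a) b = r *R cpair g a b" for r a b
  by (simp add: cpair_def scaleR_sum_right)
 show "cpair g a (r *R b) = r *R cpair g a b" for r a b
  by (simp add: cpair_def scaleR_sum_right)
 have "norm (cpair g a b) <= norm a * norm b * (SUM i:UNIV. SUM j:UNIV. \<bar>g (axis j 1) $ i\<bar>)" for a b
 proof -
  have "norm (cpair g a b) <= (SUM i:UNIV. SUM j:UNIV. norm (of_real (g (axis j 1) $ i) * (a $ j) * (b $ i)))"
   unfolding cpair_def by (intro order_trans[OF norm_sum] sum_mono norm_sum)
  also have "... <= (SUM i:UNIV. SUM j:UNIV. \<bar>g (axis j 1) $ i\<bar> * (norm a * norm b))"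
  proof (intro sum_mono)
   fix i j :: 'n
   have "norm (a $ j) * norm (b $ i) <= norm a * norm b"
    using Finite_Cartesian_Product.norm_nth_le[of a j] Finite_Cartesian_Product.norm_nth_le[of b i] by (intro mult_mono) auto
   then show "norm (of_real (g (axis j 1) $ i) * (a $ j) * (b $ i)) <= \<bar>g (axis j 1) $ i\<bar> * (norm a * norm b)"
    by (simp add: norm_mult mult.assoc mult_left_mono)
  qed
  finally show ?thesis by (simp add: sum_distrib_left mult.commute)
 qed
 then show "EX K. ALL a b. norm (cpair g a b) <= norm a * norm b * K" by blast
qed

definition Ec :: "complex^'n => complex^'n => complex" where
 "Ec z w = ek (%g. cpair g z w) id"

lemma Ec_Ek: "Ec (th *s cvec x) (cvec y) = Ek th x y"
 unfolding Ec_def Ek_def cpair_smult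
 by (rule ek_cong[OF _ id_in_G]) (simp add: Aker_def cpair_cvec)

lemma entire_Ec: "entire2 Ec"
 unfolding entire2_def
proof (intro allI exI conjI)
 fix p0 :: "(complex^'n) \<times> (complex^'n)"
 \<comment> \<open>Summing a chosen bound for each group element gives one constant that serves the
   whole group.\<close>
 define K where "K = (SUM g:G. SOME K. 0 <= K & (ALL a b. norm (cpair g a b) <= norm a * norm b * K))"
 have K1: "0 <= (SOME K. 0 <= K & (ALL a b. norm (cpair g a b) <= norm a * norm b * K)) &
   (ALL a b. norm (cpair g a b) <= norm a * norm b * (SOME K. 0 <= K & (ALL a b. norm (cpair g a b) <= norm a * norm b * K)))" for g
  using bounded_bilinear.nonneg_bounded[OF cpair_bilinear, of g] by (rule someI_ex)
 have K0: "0 <= K" unfolding K_def using K1 by (intro sum_nonneg) blast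
 have K: "norm (cpair g a b) <= norm a * norm b * K" if "g \<in> G" for g a b
 proof -
  have "(SOME K. 0 <= K & (ALL a b. norm (cpair g a b) <= norm a * norm b * K)) <= K"
   unfolding K_def using K1 that by (intro member_le_sum) auto
  then show ?thesis using K1[of g] by (meson mult_left_mono mult_nonneg_nonneg norm_ge_zero order_trans)
 qed
 let ?D = "%v. dek (%g. cpair g (fst p0) (snd p0)) (%g. cpair g (fst p0) (snd v) + cpair g (fst v) (snd p0)) id"
 have "((%p. ek (%g. cpair g (fst p) (snd p)) id) has_derivative ?D) (at p0)"
 proof (rule ek_has_derivative[where r = 1])
  let ?B = "norm p0 + 1"
  fix p :: "(complex^'n) \<times> (complex^'n)" and g assume p: "p \<in> ball p0 1" and g: "g \<in> G"
  note b = ball_pair_bound[OF p]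
  show "((%p. cpair g (fst p) (snd p)) has_derivative (%v. cpair g (fst p) (snd v) + cpair g (fst v) (snd p))) (at p)"
   by (rule bounded_bilinear.FDERIV[OF cpair_bilinear has_derivative_fst[OF has_derivative_ident]
      has_derivative_snd[OF has_derivative_ident]])
  show "norm (cpair g (fst p) (snd p)) <= ?B * ?B * K"
   by (rule order_trans[OF K[OF g]]) (intro mult_mono b mult_nonneg_nonneg K0, auto)
  fix v :: "(complex^'n) \<times> (complex^'n)"
  have "norm (cpair g (fst v) (snd p)) <= norm v * ?B * K"
   by (rule order_trans[OF K[OF g]]) (intro mult_mono b mult_nonneg_nonneg norm_fst_snd_le K0, auto)
  moreover have "norm (cpair g (fst p) (snd v)) <= ?B * norm v * K"
   by (rule order_trans[OF K[OF g]]) (intro mult_mono b mult_nonneg_nonneg norm_fst_snd_le K0, auto)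
  ultimately show "norm (cpair g (fst p) (snd v) + cpair g (fst v) (snd p)) <= (2 * ?B * K) * norm v"
   using norm_triangle_ineq[of "cpair g (fst p) (snd v)" "cpair g (fst v) (snd p)"] by (simp add: algebra_simps)
 qed (simp, rule id_in_G)
 then show "((%(z, w). Ec z w) has_derivative ?D) (at p0)"
  by (simp add: Ec_def case_prod_unfold)
 show "?D (c *s u, c *s v) = c * ?D (u, v)" for c u v
  unfolding dek_def fst_conv snd_conv cpair_smult distrib_left[symmetric] den_scale
  by (rule suminf_mult[OF den_summable[OF id_in_G]])
qed

lemma entire2_line:
 fixes F :: "complex^'n => complex^'n => complex"
 assumes F: "entire2 F"
 shows "(%\<zeta>. F (cvec a + \<zeta> *s cvec b) (cvec c + \<zeta> *s cvec d)) holomorphic_on UNIV"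
proof (rule holomorphic_onI)
 fix \<zeta>0 :: complex
 let ?l = "%\<zeta>. (cvec a + \<zeta> *s cvec b, cvec c + \<zeta> *s cvec d)"
 obtain D where D: "((%(z, w). F z w) has_derivative D) (at (?l \<zeta>0))"
  "ALL c u v. D (c *s u, c *s v) = c * D (u, v)"
  using F unfolding entire2_def by blast
 have s: "bounded_linear (%\<zeta>. \<zeta> *s (x :: complex^'n))" for x
 proof -
  have "(%\<zeta>. \<zeta> *s x) = (%\<zeta>. \<chi> i. \<zeta> * x $ i)" by (auto simp: vec_eq_iff)
  moreover have "linear (%\<zeta>. \<chi> i. \<zeta> * x $ i)"
   by (rule linearI) (auto simp: vec_eq_iff algebra_simps)
  ultimately show ?thesis by (simp add: linear_conv_bounded_linear)
 qed
 have "(?l has_derivative (%h. (h *s cvec b, h *s cvec d))) (at \<zeta>0)"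
  by (intro has_derivative_Pair) (auto intro!: derivative_eq_intros bounded_linear_imp_has_derivative s)
 from has_derivative_compose[OF this D(1)]
 have "((%\<zeta>. F (cvec a + \<zeta> *s cvec b) (cvec c + \<zeta> *s cvec d)) has_derivative (%h. D (cvec b, cvec d) * h)) (at \<zeta>0)"
  using D(2) by (simp add: mult.commute)
 then show "(%\<zeta>. F (cvec a + \<zeta> *s cvec b) (cvec c + \<zeta> *s cvec d)) field_differentiable at \<zeta>0 within UNIV"
  unfolding field_differentiable_def has_field_derivative_def by auto
qed

lemma cvec_lin: "cvec a + of_real t *s cvec b = cvec (a + t *R b)"
 by (simp add: cvec_def vec_eq_iff)

lemma complex_vec_decomp: "z = cvec (\<chi> i. Re (z $ i)) + \<i> *s cvec (\<chi> i. Im (z $ i))"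
 by (simp add: cvec_def vec_eq_iff complex_eq)

text \<open>Write \<open>z = a + i b\<close> and \<open>w = c + i d\<close> with real vectors. On
  the complex line with base point (a, c) and direction (b, d) the two functions agree at real
  parameters, hence also at the parameter i, which is the point (z, w).\<close>

lemma entire2_unique:
 fixes F H :: "complex^'n => complex^'n => complex"
 assumes F: "entire2 F" and H: "entire2 H" and eq: "!!x y. F (cvec x) (cvec y) = H (cvec x) (cvec y)"
 shows "F = H"
proof (intro ext)
 fix z w :: "complex^'n"
 define a b c d where "a = (\<chi> i. Re (z $ i))" "b = (\<chi> i. Im (z $ i))" "c = (\<chi> i. Re (w $ i))" "d = (\<chi> i. Im (w $ i))"
 define f where "f \<zeta> = F (cvec a + \<zeta> *s cvec b) (cvec c + \<zeta> *s cvec d) - H (cvec a + \<zeta> *s cvec b) (cvec c + \<zeta> *s cvec d)" for \<zeta>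
 have "f \<i> = 0"
 proof (rule analytic_continuation[where f = f and S = UNIV and U = "\<real>" and \<xi> = 0])
  show "f holomorphic_on UNIV" unfolding f_def by (intro holomorphic_on_diff entire2_line F H)
  show "f t = 0" if "t \<in> \<real>" for t
   using that by (auto simp: f_def cvec_lin eq elim!: Reals_cases)
  show "(0::complex) islimpt \<real>"
  proof (rule islimptI)
   fix S :: "complex set" assume "0 \<in> S" "open S"
   then obtain e where e: "e > 0" "ball 0 e \<subseteq> S" using openE by blast
   then have "complex_of_real (e / 2) \<in> S" by (intro subsetD[OF e(2)]) auto
   then show "EX y:\<real>. y \<in> S & y ~= 0" using e(1) by (intro bexI[of _ "of_real (e / 2)"]) auto
  qed
 qed auto
 then show "F z w = H z w"
  using complex_vec_decomp[of z] complex_vec_decomp[of w] by (simp add: f_def a_b_c_d_def)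
qed

text \<open>Both definite descriptions are resolved here, and the work continues with
  \<open>Ek\<close>. The scalar \<open>th\<close> covers the imaginary multiples that occur in the
  transform and the translation.\<close>

lemma kernel_eq: "dunkl_kernel R k (th *s cvec x) (cvec y) = Ek th x y"
proof -
 have r: "Ec (cvec x) (cvec y) = dunkl_kernel_real R k x y" for x y
  unfolding kernel_real_eq using Ec_Ek[of 1 x y] by (simp only: vector_smult_lid)
 have "dunkl_kernel R k = Ec"
  unfolding dunkl_kernel_def
 proof (rule the_equality)
  show "entire2 Ec & (ALL x y. Ec (cvec x) (cvec y) = dunkl_kernel_real R k x y)"
   by (intro conjI allI entire_Ec r)
  fix F assume F: "entire2 F & (ALL x y. F (cvec x) (cvec y) = dunkl_kernel_real R k x y)"
  show "F = Ec"
   by (rule entire2_unique[OF conjunct1[OF F] entire_Ec]) (simp only: F r)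
 qed
 then show ?thesis by (simp add: Ec_Ek)
qed

end

section \<open>Integration lemmas\<close>

lemma has_derivative_diffquot:
 assumes "(f has_derivative f') (at x)"
 shows "(%n. (f (x + (1 / real (Suc n)) *R v) - f x) /R (1 / real (Suc n))) \<longlonglongrightarrow> f' v"
proof -
 have "((%t. x + t *R v) has_derivative (%h. h *R v)) (at 0)"
  by (auto intro!: derivative_eq_intros)
 moreover have "(f has_derivative f') (at (x + 0 *R v))" using assms by simp
 ultimately have "((%t. f (x + t *R v)) has_derivative (%h. f' (h *R v))) (at (0::real))"
  by (rule has_derivative_compose)
 then have "((%t. f (x + t *R v)) has_vector_derivative f' v) (at (0::real))"
  by (simp add: has_vector_derivative_def linear_cmul[OF has_derivative_linear[OF assms]])
 then have "((%t. (f (x + t *R v) - f x) /R t) \<longlongrightarrow> f' v) (at (0::real))"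
  unfolding has_vector_derivative_def has_derivative_at
 proof (elim conjE)
  assume a: "(%h. norm (f (x + (0 + h) *R v) - f (x + 0 *R v) - h *R f' v) / norm h) \<midarrow>0\<rightarrow> 0"
  have eq: "norm (f (x + (0 + h) *R v) - f (x + 0 *R v) - h *R f' v) / norm h
    = norm ((f (x + h *R v) - f x) /R h - f' v)" if "h ~= 0" for h
  proof -
   have "(f (x + h *R v) - f x) /R h - f' v = (f (x + h *R v) - f x - h *R f' v) /R h"
    using that by (simp add: scaleR_diff_right)
   then show ?thesis by (simp add: divide_inverse mult.commute)
  qed
  have "(%h. norm ((f (x + h *R v) - f x) /R h - f' v)) \<midarrow>0\<rightarrow> 0"
   by (rule Lim_transform_eventually[OF a]) (use eq in \<open>auto simp: eventually_at intro!: exI[of _ 1]\<close>)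
  then show ?thesis unfolding tendsto_norm_zero_iff LIM_zero_iff .
 qed
 from this[unfolded tendsto_at_iff_sequentially, rule_format, of "%n. 1 / real (Suc n)"]
 show ?thesis using LIMSEQ_inverse_real_of_nat by (simp add: comp_def inverse_eq_divide)
qed

text \<open>A directional derivative is a limit of difference quotients; the offset \<open>N\<close>
  in the step sizes keeps their points inside the ball.\<close>

lemma derivative_measurable:
 fixes f :: "'v::real_normed_vector => 'z => complex"
 assumes "!!p. p \<in> ball p0 r ==> f p \<in> borel_measurable M" "0 < r"
  and "!!z. z \<in> space M ==> ((%p. f p z) has_derivative f' z) (at p0)"
 shows "(%z. f' z v) \<in> borel_measurable M"
proof -
 obtain N where N: "norm v < real N * r"
  using reals_Archimedean3[OF assms(2)] by blast
 define s where "s n = 1 / real (Suc (n + N))" for n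
 have "p0 + s n *R v \<in> ball p0 r" for n
 proof -
  have "norm v < real (Suc (n + N)) * r"
   using N assms(2) mult_right_mono[of "real N" "real (Suc (n + N))" r] by linarith
  then show ?thesis by (simp add: dist_norm s_def field_simps)
 qed
 then have m: "(%z. (f (p0 + s n *R v) z - f p0 z) /R s n) \<in> borel_measurable M" for n
  using assms(1)[of p0] assms(1) assms(2) by (intro borel_measurable_scaleR borel_measurable_diff) auto
 show ?thesis
 proof (rule borel_measurable_LIMSEQ_metric[OF m])
  fix z assume z: "z \<in> space M"
  show "(%n. (f (p0 + s n *R v) z - f p0 z) /R s n) \<longlonglongrightarrow> f' z v"
   unfolding s_def using LIMSEQ_ignore_initial_segment[OF has_derivative_diffquot[OF assms(3)[OF z]], of N] .
 qed
qed

text \<open>Dominated convergence for the remainder of the first-order expansion divided by the norm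
  of the increment: the mean value inequality on the ball bounds it by \<open>2 * g\<close>.\<close>

lemma has_derivative_LINT:
 fixes f :: "'v::real_normed_vector => 'z => complex"
 assumes r: "0 < r"
  and f': "!!p z. p \<in> ball p0 r ==> z \<in> space M ==> ((%p. f p z) has_derivative f' p z) (at p)"
  and int: "!!p. p \<in> ball p0 r ==> integrable M (f p)"
  and bound: "!!p z v. p \<in> ball p0 r ==> z \<in> space M ==> norm (f' p z v) <= g z * norm v"
  and g: "integrable M g"
 shows "integrable M (%z. f' p0 z v)"
  and "((%p. LINT z|M. f p z) has_derivative (%v. LINT z|M. f' p0 z v)) (at p0)"
proof -
 have p0: "p0 \<in> ball p0 r" using r by simp
 have intf': "integrable M (%z. f' p0 z v)" for v
 proof (rule integrable_bound[OF integrable_mult_left[OF g, of "norm v"]])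
  show "(%z. f' p0 z v) \<in> borel_measurable M"
   by (rule derivative_measurable[OF borel_measurable_integrable[OF int] r f'[OF p0]])
  show "AE z in M. norm (f' p0 z v) <= norm (g z * norm v)"
   using bound[OF p0] by (intro AE_I2) (smt (verit) real_norm_def)
 qed
 then show "integrable M (%z. f' p0 z v)" .
 have lin: "linear (f' p0 z)" if "z \<in> space M" for z
  by (rule has_derivative_linear[OF f'[OF p0 that]])
 have bl: "bounded_linear (%v. LINT z|M. f' p0 z v)"
 proof (rule bounded_linear_intro[where K = "LINT z|M. g z"])
  show "(LINT z|M. f' p0 z (v + w)) = (LINT z|M. f' p0 z v) + (LINT z|M. f' p0 z w)" for v w
   by (subst integral_add[symmetric, OF intf' intf'])
    (intro integral_cong refl linear_add lin)
  show "(LINT z|M. f' p0 z (c *R v)) = c *R (LINT z|M. f' p0 z v)" for c v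
   by (subst integral_scaleR_right[symmetric])
    (intro integral_cong refl linear_cmul lin)
  show "norm (LINT z|M. f' p0 z v) <= norm v * (LINT z|M. g z)" for v
  proof -
   have "norm (LINT z|M. f' p0 z v) <= (LINT z|M. norm (f' p0 z v))" by (rule integral_norm_bound)
   also have "... <= (LINT z|M. g z * norm v)"
    by (intro integral_mono integrable_norm intf' integrable_mult_left g bound p0)
   finally show ?thesis by (simp add: mult.commute)
  qed
 qed
 have "((%h. (LINT z|M. norm (f (p0 + h) z - f p0 z - f' p0 z h) / norm h)) \<longlongrightarrow> 0) (at 0)"
  unfolding tendsto_at_iff_sequentially
 proof (intro allI impI)
  fix X :: "nat => 'v" assume X: "ALL i. X i \<in> UNIV - {0}" "X \<longlonglongrightarrow> 0"
  obtain N where N: "!!n. n >= N ==> norm (X n) < r"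
   using X(2) r unfolding LIMSEQ_iff by auto
  have in_ball: "p0 + X (n + N) \<in> ball p0 r" for n using N[of "n + N"] by (simp add: dist_norm)
  have "(%n. LINT z|M. norm (f (p0 + X (n + N)) z - f p0 z - f' p0 z (X (n + N))) / norm (X (n + N)))
   \<longlonglongrightarrow> (LINT z|M. 0)"
  proof (rule integral_dominated_convergence[where w = "%z. 2 * g z"])
   show "(%z. norm (f (p0 + X (n + N)) z - f p0 z - f' p0 z (X (n + N))) / norm (X (n + N))) \<in> borel_measurable M" for n
   proof -
    note [measurable] = borel_measurable_integrable[OF int[OF in_ball, of n]] borel_measurable_integrable[OF int[OF p0]]
     borel_measurable_integrable[OF intf']
    show ?thesis by measurable
   qed
   show "AE z in M. (%n. norm (f (p0 + X (n + N)) z - f p0 z - f' p0 z (X (n + N))) / norm (X (n + N))) \<longlonglongrightarrow> 0"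
   proof (rule AE_I2)
    fix z assume z: "z \<in> space M"
    have "((%h. norm (f (p0 + h) z - f p0 z - f' p0 z h) / norm h) \<longlongrightarrow> 0) (at 0)"
     using f'[OF p0 z] unfolding has_derivative_at by simp
    then have "(%n. norm (f (p0 + X n) z - f p0 z - f' p0 z (X n)) / norm (X n)) \<longlonglongrightarrow> 0"
     using X unfolding tendsto_at_iff_sequentially by (simp add: comp_def)
    from LIMSEQ_ignore_initial_segment[OF this, of N]
    show "(%n. norm (f (p0 + X (n + N)) z - f p0 z - f' p0 z (X (n + N))) / norm (X (n + N))) \<longlonglongrightarrow> 0" .
   qed
   show "AE z in M. norm (norm (f (p0 + X (n + N)) z - f p0 z - f' p0 z (X (n + N))) / norm (X (n + N))) <= 2 * g z" for n
   proof (rule AE_I2)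
    fix z assume z: "z \<in> space M"
    let ?h = "X (n + N)"
    have h: "norm ?h > 0" using X(1) by simp
    have g0: "0 <= g z"
     using order_trans[OF norm_ge_zero bound[OF p0 z, of ?h]] h by (simp add: zero_le_mult_iff)
    have "norm (f (p0 + ?h) z - f p0 z) <= g z * norm (p0 + ?h - p0)"
    proof (rule differentiable_bound[where S = "ball p0 r" and f' = "%p. f' p z"])
     show "((%p. f p z) has_derivative f' p z) (at p within ball p0 r)" if "p \<in> ball p0 r" for p
      by (rule has_derivative_at_withinI[OF f'[OF that z]])
     show "onorm (f' p z) <= g z" if "p \<in> ball p0 r" for p
      by (rule onorm_bound[OF g0 bound[OF that z]])
    qed (use in_ball p0 in auto)
    moreover have "norm (f' p0 z ?h) <= g z * norm ?h" by (rule bound[OF p0 z])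
    moreover have "norm (f (p0 + ?h) z - f p0 z - f' p0 z ?h) <= norm (f (p0 + ?h) z - f p0 z) + norm (f' p0 z ?h)"
     by (rule norm_triangle_ineq4)
    ultimately have "norm (f (p0 + ?h) z - f p0 z - f' p0 z ?h) <= 2 * g z * norm ?h" by simp
    then show "norm (norm (f (p0 + ?h) z - f p0 z - f' p0 z ?h) / norm ?h) <= 2 * g z"
     using h by (simp add: divide_le_eq)
   qed
  qed (use g in auto)
  then show "((%h. LINT z|M. norm (f (p0 + h) z - f p0 z - f' p0 z h) / norm h) o X) \<longlonglongrightarrow> 0"
   unfolding comp_def integral_zero
   by (rule LIMSEQ_offset[of "%n. LINT z|M. norm (f (p0 + X n) z - f p0 z - f' p0 z (X n)) / norm (X n)" N])
 qed
 then have "((%h. norm ((LINT z|M. f (p0 + h) z) - (LINT z|M. f p0 z) - (LINT z|M. f' p0 z h)) / norm h) \<longlongrightarrow> 0) (at 0)"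
 proof (rule Lim_null_comparison[rotated])
  show "\<forall>\<^sub>F h in at 0. norm (norm ((LINT z|M. f (p0 + h) z) - (LINT z|M. f p0 z) - (LINT z|M. f' p0 z h)) / norm h)
    <= (LINT z|M. norm (f (p0 + h) z - f p0 z - f' p0 z h) / norm h)"
   unfolding eventually_at
  proof (intro exI[of _ r] conjI r ballI impI)
   fix h :: 'v assume h: "h ~= 0 & dist h 0 < r"
   then have i: "integrable M (f (p0 + h))" by (intro int) (simp add: dist_norm)
   have "(LINT z|M. f (p0 + h) z) - (LINT z|M. f p0 z) - (LINT z|M. f' p0 z h) = (LINT z|M. f (p0 + h) z - f p0 z - f' p0 z h)"
    using i int[OF p0] intf' by simp
   then show "norm (norm ((LINT z|M. f (p0 + h) z) - (LINT z|M. f p0 z) - (LINT z|M. f' p0 z h)) / norm h)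
    <= (LINT z|M. norm (f (p0 + h) z - f p0 z - f' p0 z h) / norm h)"
    using integral_norm_bound[of M "%z. f (p0 + h) z - f p0 z - f' p0 z h"]
    by (simp add: divide_right_mono)
  qed
 qed
 with bl show "((%p. LINT z|M. f p z) has_derivative (%v. LINT z|M. f' p0 z v)) (at p0)"
  unfolding has_derivative_at by blast
qed

lemma pow_exp_le: "(0::real) <= s ==> s ^ m <= fact m * exp s"
proof -
 assume s: "0 <= s"
 have sm: "summable (%n. s ^ n / fact n)" using summable_exp[of s] by (simp add: field_simps)
 have "s ^ m / fact m <= (\<Sum>n. s ^ n / fact n)"
  using sum_le_suminf[OF sm, of "{m}"] s by simp
 also have "... = exp s" by (simp add: exp_def field_simps)
 finally show ?thesis by (simp add: divide_le_eq mult.commute)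
qed

text \<open>The polynomial factor is absorbed into \<open>exp (1 + r)\<close>, and completing the
  square bounds the remaining exponent.\<close>

lemma gauss_bound:
 assumes "0 < t"
 shows "EX C>0. ALL r>=0. (1 + r) ^ m * exp (c * r - t * r^2) <= (C::real)"
proof -
 define C where "C = fact m * exp (1 + (c + 1)^2 / (4 * t))"
 have "(1 + r) ^ m * exp (c * r - t * r^2) <= C" if r: "0 <= r" for r
 proof -
  have "(1 + r) ^ m * exp (c * r - t * r^2) <= (fact m * exp (1 + r)) * exp (c * r - t * r^2)"
   using pow_exp_le[of "1 + r" m] r by (intro mult_right_mono) auto
  also have "... = fact m * exp (1 + ((c + 1) * r - t * r^2))"
   by (simp add: mult.assoc mult_exp_exp algebra_simps)
  also have "(c + 1) * r - t * r^2 = (c + 1)^2 / (4 * t) - t * (r - (c + 1) / (2 * t))^2"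
   using assms by (simp add: power2_eq_square field_simps)
  also have "fact m * exp (1 + ...) <= C"
   unfolding C_def using assms by (intro mult_left_mono) auto
  finally show ?thesis .
 qed
 then show ?thesis by (intro exI[of _ C]) (auto simp: C_def)
qed

text \<open>Cut the space into unit shells. Growth of order \<open>q\<close> of the balls against
  decay of order \<open>q + 2\<close> leaves the sum of the inverse squares.\<close>

lemma nn_integral_shells:
 fixes M :: "(real^'n) measure"
 assumes sets: "sets M = sets borel" and b: "!!r. r >= 1 ==> emeasure M (ball 0 r) <= ennreal (C * r ^ q)"
 shows "(\<integral>\<^sup>+x. ennreal (1 / (1 + norm x) ^ (q + 2)) \<partial>M) < \<infinity>"
proof -
 have le_suminf: "t n <= (\<Sum>n. t n)" for t :: "nat => ennreal" and n
  using sum_le_suminf[of t "{n}"] by simp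
 have "(\<integral>\<^sup>+x. ennreal (1 / (1 + norm x) ^ (q + 2)) \<partial>M)
   <= (\<integral>\<^sup>+x. (\<Sum>n. ennreal (1 / (1 + real n) ^ (q + 2)) * indicator (ball 0 (real n + 1)) x) \<partial>M)"
 proof (rule nn_integral_mono)
  fix x :: "real^'n"
  define n where "n = nat \<lfloor>norm x\<rfloor>"
  have "real n = real_of_int \<lfloor>norm x\<rfloor>" by (simp add: n_def)
  then have n: "real n <= norm x" "norm x < real n + 1" by linarith+
  have "ennreal (1 / (1 + norm x) ^ (q + 2)) <= ennreal (1 / (1 + real n) ^ (q + 2)) * indicator (ball 0 (real n + 1)) x"
  proof -
   have "1 / (1 + norm x) ^ (q + 2) <= 1 / (1 + real n) ^ (q + 2)"
    by (rule divide_left_mono) (use n in \<open>auto intro!: power_mono mult_pos_pos zero_less_power add_pos_nonneg simp del: power_Suc add_2_eq_Suc'\<close>)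
   then show ?thesis using n(2) by (simp add: indicator_def ennreal_leI del: add_2_eq_Suc')
  qed
  also have "... <= (\<Sum>n. ennreal (1 / (1 + real n) ^ (q + 2)) * indicator (ball 0 (real n + 1)) x)"
   using le_suminf[of "%n. ennreal (1 / (1 + real n) ^ (q + 2)) * indicator (ball 0 (real n + 1)) x" n] .
  finally show "ennreal (1 / (1 + norm x) ^ (q + 2))
   <= (\<Sum>n. ennreal (1 / (1 + real n) ^ (q + 2)) * indicator (ball 0 (real n + 1)) x)" .
 qed
 also have "... = (\<Sum>n. ennreal (1 / (1 + real n) ^ (q + 2)) * emeasure M (ball 0 (real n + 1)))"
 proof (subst nn_integral_suminf)
  have bm: "ball 0 r \<in> sets M" for r using sets by simp
  show "(%x. ennreal (1 / (1 + real n) ^ (q + 2)) * indicator (ball 0 (real n + 1)) x) \<in> borel_measurable M" for n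
   by (intro borel_measurable_times_ennreal borel_measurable_const borel_measurable_indicator bm)
  show "(\<Sum>n. \<integral>\<^sup>+ x. ennreal (1 / (1 + real n) ^ (q + 2)) * indicator (ball 0 (real n + 1)) x \<partial>M)
   = (\<Sum>n. ennreal (1 / (1 + real n) ^ (q + 2)) * emeasure M (ball 0 (real n + 1)))"
   by (simp only: nn_integral_cmult_indicator[OF bm])
 qed
 also have "... <= (\<Sum>n. ennreal (C * (1 / (1 + real n) ^ 2)))"
 proof (rule suminf_le)
  fix n
  have "ennreal (1 / (1 + real n) ^ (q + 2)) * emeasure M (ball 0 (real n + 1))
    <= ennreal (1 / (1 + real n) ^ (q + 2)) * ennreal (C * (real n + 1) ^ q)"
   by (intro mult_left_mono b) auto
  also have "... = ennreal (C * (1 / (1 + real n) ^ 2))"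
  proof -
   have "1 / (1 + real n) ^ (q + 2) * (C * (real n + 1) ^ q) = C * (1 / (1 + real n) ^ 2)"
    by (simp add: power_add add.commute power2_eq_square)
   then show ?thesis by (subst ennreal_mult'[symmetric]) auto
  qed
  finally show "ennreal (1 / (1 + real n) ^ (q + 2)) * emeasure M (ball 0 (real n + 1)) <= ennreal (C * (1 / (1 + real n) ^ 2))" .
 qed auto
 also have "... <= (\<Sum>n. ennreal (\<bar>C\<bar> * (1 / (1 + real n) ^ 2)))"
  by (intro suminf_le ennreal_leI mult_right_mono) auto
 also have "... < \<infinity>"
 proof -
  have "summable (%n. 1 / (1 + real n) ^ 2)"
   using inverse_power_summable[of 2, where 'a = real] summable_Suc_iff[of "%n. inverse (real n ^ 2)"]
   by (simp add: inverse_eq_divide add.commute)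
  then have "(\<Sum>n. ennreal (\<bar>C\<bar> * (1 / (1 + real n) ^ 2))) = ennreal (\<Sum>n. \<bar>C\<bar> * (1 / (1 + real n) ^ 2))"
   by (intro suminf_ennreal2 summable_mult) auto
  then show ?thesis by simp
 qed
 finally show ?thesis .
qed

lemma lborel_decay: "(NL x. ennreal (1 / (1 + norm (x :: real^'n)) ^ (CARD('n) + 2))) < \<infinity>"
 by (rule nn_integral_shells[where C = "unit_ball_vol CARD('n)"]) (simp_all add: emeasure_ball)

lemma lborel_integrable_decay:
 fixes f :: "real^'n => complex"
 assumes "f \<in> BM" "!!x. norm (f x) <= C / (1 + norm x) ^ (CARD('n) + 2)"
 shows "integrable lborel f"
proof (rule integrable_bound)
 have "integrable lborel (%x::real^'n. 1 / (1 + norm x) ^ (CARD('n) + 2))"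
  using lborel_decay by (intro integrableI_nonneg) auto
 then show "integrable lborel (%x::real^'n. C * (1 / (1 + norm x) ^ (CARD('n) + 2)))"
  by (rule integrable_mult_right)
 show "AE x in lborel. norm (f x) <= norm (C * (1 / (1 + norm x) ^ (CARD('n) + 2)))"
  by (intro AE_I2 order_trans[OF assms(2)]) (simp only: real_norm_def times_divide_eq_right mult_1_right abs_ge_self)
qed (use assms in simp)

text \<open>Peetre's inequality: moving the point by \<open>d\<close> changes
  \<open>1 + norm\<close> at most by the factor \<open>1 + d\<close>.\<close>

lemma decay_shift:
 fixes x y :: "'a::real_normed_vector"
 assumes "norm (x - y) <= d"
 shows "1 / (1 + norm y) ^ m <= (1 + d) ^ m / (1 + norm x) ^ m"
proof -
 have d: "0 <= d" using assms norm_ge_zero order_trans by blast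
 have "1 + norm x <= 1 + norm y + d" using norm_triangle_sub[of x y] assms by linarith
 also have "... <= (1 + d) * (1 + norm y)" using d by (simp add: algebra_simps)
 finally have "(1 + norm x) ^ m <= ((1 + d) * (1 + norm y)) ^ m" by (intro power_mono) auto
 then show ?thesis by (simp add: power_mult_distrib divide_simps add_pos_nonneg)
qed

lemma lborel_integral_translate:
 fixes f :: "real^'n => complex"
 assumes "f \<in> BM"
 shows "(LINT x|lborel. f (v + x)) = (LINT x|lborel. f x)"
proof -
 have "(LINT x|lborel. f x) = (LINT x|distr lborel borel ((+) v). f x)"
  by (simp add: lborel_distr_plus)
 also have "... = (LINT x|lborel. f (v + x))"
  using assms by (subst integral_distr) auto
 finally show ?thesis by simp
qed

text \<open>By translation invariance the integral of \<open>H (p + x)\<close> does not depend on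
  \<open>p\<close>, so its derivative in \<open>p\<close> is zero; the decay permits differentiation
  under the integral.\<close>

lemma lborel_integral_derivative:
 fixes H :: "real^'n => complex"
 assumes H': "!!x. (H has_derivative H' x) (at x)"
  and H: "!!x. norm (H x) <= C / (1 + norm x) ^ (CARD('n) + 2)"
  and bound: "!!x u. norm (H' x u) <= C * norm u / (1 + norm x) ^ (CARD('n) + 2)"
 shows "(LINT x|lborel. H' x v) = 0"
proof -
 let ?m = "CARD('n) + 2"
 have C: "0 <= C" using order_trans[OF norm_ge_zero H[of 0]] by simp
 have Hc: "continuous_on UNIV H"
  by (intro continuous_at_imp_continuous_on ballI has_derivative_continuous[OF H'])
 have Hm: "H \<in> BM" by (rule cont_BM[OF Hc])
 have hm: "(%x. H (p + x)) \<in> BM" for p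
  by (intro cont_BM continuous_intros continuous_on_compose2[OF Hc]) auto
 have Hint: "integrable lborel (%x. H (p + x))" for p
 proof (rule lborel_integrable_decay[OF hm])
  fix x
  have "norm (H (p + x)) <= C * (1 / (1 + norm (p + x)) ^ ?m)" using H[of "p + x"] by simp
  also have "... <= C * ((1 + norm p) ^ ?m / (1 + norm x) ^ ?m)"
   by (intro mult_left_mono decay_shift C) simp
  finally show "norm (H (p + x)) <= (C * (1 + norm p) ^ ?m) / (1 + norm x) ^ ?m" by simp
 qed
 have "((%p. LINT x|lborel. H (p + x)) has_derivative (%v. LINT x|lborel. H' (0 + x) v)) (at 0)"
 proof (rule has_derivative_LINT(2)[where r = 1 and g = "%x. C * 2 ^ ?m * (1 / (1 + norm x) ^ ?m)" and f' = "%p x. H' (p + x)"])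
  show "((%p. H (p + x)) has_derivative H' (p + x)) (at p)" for p x
  proof -
   have "((%p. p + x) has_derivative (%h. h)) (at p)" by (auto intro!: derivative_eq_intros)
   from has_derivative_compose[OF this H'] show ?thesis .
  qed
  show "norm (H' (p + x) u) <= C * 2 ^ ?m * (1 / (1 + norm x) ^ ?m) * norm u" if "p \<in> ball 0 1" for p x u
  proof -
   have "norm (H' (p + x) u) <= (C * norm u) * (1 / (1 + norm (p + x)) ^ ?m)" using bound[of "p + x" u] by simp
   also have "... <= (C * norm u) * ((1 + 1) ^ ?m / (1 + norm x) ^ ?m)"
    using that C by (intro mult_left_mono decay_shift) auto
   finally show ?thesis by (simp add: mult_ac)
  qed
  show "integrable lborel (%x::real^'n. C * 2 ^ ?m * (1 / (1 + norm x) ^ ?m))"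
   using lborel_decay by (intro integrable_mult_right integrableI_nonneg) auto
 qed (auto intro: Hint)
 moreover have "(%p. LINT x|lborel. H (p + x)) = (%p. LINT x|lborel. H x)"
  using lborel_integral_translate[OF Hm] by blast
 ultimately have "((%p::real^'n. LINT x|lborel. H x) has_derivative (%v. LINT x|lborel. H' x v)) (at 0)" by simp
 from has_derivative_unique[OF this has_derivative_const]
 show ?thesis by (rule fun_cong)
qed

section \<open>The measure and integration by parts\<close>

context dunkl begin

abbreviation dw :: "(real^'n) measure" where "dw \<equiv> dunkl_measure R k"
abbreviation nni :: "(real^'n => ennreal) => ennreal" (binder "NI " 10) where "nni f \<equiv> nn_integral dw f"

abbreviation NN :: real where "NN \<equiv> homogeneous_dim R k"

definition wt :: "real^'n => real" where "wt x = (\<Prod>al\<in>R. \<bar>x \<cdot> al\<bar> powr k al)"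

definition sk :: real where "sk = (SUM al:R. k al)"

definition ks :: nat where "ks = nat \<lceil>sk\<rceil>"

text \<open>The density grows at most like the power \<open>ks\<close> of \<open>1 + norm x\<close>.
  Decay of order \<open>Nd\<close> absorbs this and leaves the order \<open>CARD('n) + 2\<close>,
  which is integrable for Lebesgue measure.\<close>

definition Nd :: nat where "Nd = CARD('n) + 2 + ks"

lemma NN_eq: "NN = real CARD('n) + sk"
 by (simp add: homogeneous_dim_def sk_def)

lemma sk_nonneg [simp]: "0 <= sk"
 unfolding sk_def by (intro sum_nonneg) auto

lemma sk_le: "sk <= real ks"
 unfolding ks_def by linarith

lemma wt_nonneg [simp]: "0 <= wt x"
 by (simp add: wt_def prod_nonneg)

lemma wt_measurable [measurable]: "wt \<in> BM"
 unfolding wt_def by measurable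

lemma dw_density: "dw = density lborel (%x. ennreal (wt x))"
 by (simp add: dunkl_measure_def wt_def)

lemma sets_dw [simp, measurable_cong]: "sets dw = sets borel"
 by (simp add: dw_density)

lemma space_dw [simp]: "space dw = UNIV"
 by (simp add: dw_density)

lemma meas_dw: "borel_measurable dw = borel_measurable borel"
 by (rule measurable_cong_sets) simp_all

lemma nn_int_dw: "f \<in> BM ==> (NI x. f x) = (NL x. ennreal (wt x) * f x)"
 unfolding dw_density by (subst nn_integral_density) auto

lemma integrable_dw:
 fixes f :: "real^'n => 'b::{banach, second_countable_topology}"
 shows "f \<in> BM ==> integrable dw f \<longleftrightarrow> integrable lborel (%x. wt x *R f x)"
 unfolding dw_density by (rule integrable_density) auto

lemma integral_dw:
 fixes f :: "real^'n => 'b::{banach, second_countable_topology}"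
 shows "f \<in> BM ==> (LINT x|dw. f x) = (LINT x|lborel. wt x *R f x)"
 unfolding dw_density by (rule integral_density) auto

lemma sigma_finite_dw: "sigma_finite_measure dw"
 unfolding dw_density
 by (subst sigma_finite_measure.sigma_finite_iff_density_finite[OF sigma_finite_lborel]) auto

lemma inner_root_le: "al \<in> R ==> \<bar>x \<cdot> al\<bar> <= 2 * norm x"
proof -
 assume a: "al \<in> R"
 have "sqrt 2 <= 2" by (rule real_le_lsqrt) auto
 then have "norm x * norm al <= norm x * 2" by (intro mult_left_mono) (simp_all add: norm_root[OF a])
 then show ?thesis using Cauchy_Schwarz_ineq2[of x al] by linarith
qed

lemma wt_G: "g \<in> G ==> wt (g x) = wt x"
proof -
 assume g: "g \<in> G"
 have "wt x = (\<Prod>al\<in>R. \<bar>g x \<cdot> g al\<bar> powr k (g al))"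
  unfolding wt_def using g by (intro prod.cong) auto
 also have "... = wt (g x)"
  unfolding wt_def by (rule prod.reindex_bij_betw[OF G_bij_betw_R[OF g]])
 finally show ?thesis by simp
qed

lemma G_measurable: "g \<in> G ==> g \<in> BM"
 using cont_BM G_cont by blast

text \<open>Uniqueness of Haar measure, with the constant read off from a ball.\<close>

lemma lborel_nn_integral_G:
 assumes g: "g \<in> G" and [measurable]: "h \<in> BM"
 shows "(NL y. h (g y)) = (NL y. h y)"
proof -
 have [measurable]: "g \<in> BM" using g by (rule G_measurable)
 have shift: "(NL y. f (v + y)) = (NL y. f y)"
  if [measurable]: "f \<in> BM" for f :: "real^'n => ennreal" and v
  using nn_integral_distr[of "(+) v" lborel borel f] by (simp add: lborel_distr_plus)
 define b where "b = emeasure lborel (ball (0::real^'n) 1)"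
 have "0 < unit_ball_vol (real CARD('n))" by (rule unit_ball_vol_pos) simp
 then have "unit_ball_vol (real CARD('n)) ~= 0" by linarith
 then have b: "b ~= 0" "b ~= \<infinity>" by (simp_all only: b_def emeasure_ball) simp_all
 let ?B = "indicator (ball 0 1) :: real^'n => ennreal"
 let ?P = "(lborel :: (real^'n) measure) \<Otimes>\<^sub>M (lborel :: (real^'n) measure)"
 have fs [measurable]: "fst \<in> borel_measurable ?P" "snd \<in> borel_measurable ?P"
  using measurable_fst[of lborel lborel] measurable_snd[of lborel lborel] by simp_all
 have B [measurable]: "?B \<in> BM" by (rule borel_measurable_indicator) simp
 have gf: "(%p. g (fst p)) \<in> borel_measurable ?P" "(%p. g (snd p)) \<in> borel_measurable ?P"
  by (rule measurable_compose[OF fs(1)] measurable_compose[OF fs(2)], fact)+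
 have m1: "(%p. ?B (snd p) * h (snd p + g (fst p))) \<in> borel_measurable ?P"
  by (intro borel_measurable_times_ennreal measurable_compose[OF fs(2) B]
    measurable_compose[OF borel_measurable_add[OF fs(2) gf(1)]]) fact
 have m2: "(%p. ?B (fst p - g (snd p)) * h (fst p)) \<in> borel_measurable ?P"
  by (intro borel_measurable_times_ennreal measurable_compose[OF borel_measurable_diff[OF fs(1) gf(2)] B]
    measurable_compose[OF fs(1)]) fact
 have "b * (NL y. h (g y)) = (NL x. ?B x * (NL y. h (g y)))"
 proof -
  have "(NL x. ?B x * c) = (NL x. ?B x) * c" for c
   by (rule nn_integral_multc[OF borel_measurable_indicator]) (simp only: sets_lborel borel_open open_ball)
  then show ?thesis by (simp only: b_def nn_integral_indicator sets_lborel borel_open open_ball)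
 qed
 also have "... = (NL x. (NL y. ?B x * h (x + g y)))"
 proof (rule nn_integral_cong)
  fix x
  have "(NL y. h (g y)) = (NL y. h (g (inv g x + y)))"
   by (rule shift[symmetric]) simp
  also have "... = (NL y. h (x + g y))"
   using g by (simp add: linear_add[OF G_linear[OF g]])
  finally show "?B x * (NL y. h (g y)) = (NL y. ?B x * h (x + g y))"
   by (simp add: nn_integral_cmult)
 qed
 also have "... = (NL y. (NL x. ?B x * h (x + g y)))"
  by (rule lborel_pair.Fubini') (use m1 in \<open>simp add: case_prod_unfold\<close>)
 \<comment> \<open>Translating the inner integral by \<open>g y\<close> frees the argument of
   \<open>h\<close> from \<open>g\<close>. The \<open>y\<close>-integral that remains is the volume
   of a unit ball, whatever its centre.\<close>
 also have "... = (NL y. (NL x. ?B (x - g y) * h x))"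
 proof (rule nn_integral_cong)
  fix y
  show "(NL x. ?B x * h (x + g y)) = (NL x. ?B (x - g y) * h x)"
   using shift[of "%x. ?B (x - g y) * h x" "g y"] by (simp add: add.commute)
 qed
 also have "... = (NL x. (NL y. ?B (x - g y) * h x))"
  by (rule lborel_pair.Fubini') (use m2 in \<open>simp add: case_prod_unfold\<close>)
 also have "... = (NL x. b * h x)"
 proof (rule nn_integral_cong)
  fix x
  have i: "?B (x - g y) = indicator (ball (inv g x) 1) y" for y
  proof -
   have "norm (x - g y) = norm (g (inv g x - y))"
    using g by (simp add: linear_diff[OF G_linear[OF g]])
   then show ?thesis using g by (simp add: indicator_def dist_norm norm_minus_commute[of "g y" x])
  qed
  have "(NL y. ?B (x - g y) * h x) = emeasure lborel (ball (inv g x) 1) * h x"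
  proof -
   have "(NL y. indicator (ball (inv g x) 1) y * c) = (NL y. indicator (ball (inv g x) 1) y) * c" for c
    by (rule nn_integral_multc[OF borel_measurable_indicator]) (simp only: sets_lborel borel_open open_ball)
   then show ?thesis by (simp only: i nn_integral_indicator sets_lborel borel_open open_ball)
  qed
  then show "(NL y. ?B (x - g y) * h x) = b * h x"
   by (simp add: b_def emeasure_ball)
 qed
 also have "... = b * (NL x. h x)" by (simp add: nn_integral_cmult)
 finally show ?thesis using b by (simp add: ennreal_mult_cancel_left)
qed

lemma lborel_G:
 assumes g: "g \<in> G"
 shows "distr lborel borel g = lborel"
proof (rule measure_eqI)
 fix A assume "A \<in> sets (distr lborel borel g)"
 then have [measurable]: "A \<in> sets borel" by simp
 have [measurable]: "g \<in> BM" using g by (rule G_measurable)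
 have "emeasure (distr lborel borel g) A = (\<integral>\<^sup>+x. indicator A x \<partial>distr lborel borel g)" by simp
 also have "... = (NL x. indicator A (g x))" by (subst nn_integral_distr) auto
 also have "... = (NL x. indicator A x)" by (rule lborel_nn_integral_G[OF g]) simp
 finally show "emeasure (distr lborel borel g) A = emeasure lborel A" by simp
qed simp

lemma lborel_integral_G:
 fixes f :: "real^'n => complex"
 assumes g: "g \<in> G" and [measurable]: "f \<in> BM"
 shows "(LINT x|lborel. f (g x)) = (LINT x|lborel. f x)"
proof -
 note [measurable] = G_measurable[OF g]
 have "(LINT x|lborel. f x) = (LINT x|distr lborel borel g. f x)" by (simp add: lborel_G[OF g])
 also have "... = (LINT x|lborel. f (g x))" using g by (subst integral_distr) auto
 finally show ?thesis by simp
qed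

lemma dw_G: "g \<in> G ==> distr dw dw g = dw"
proof (rule measure_eqI)
 assume g: "g \<in> G"
 show "sets (distr dw dw g) = sets dw" by simp
 fix A assume "A \<in> sets (distr dw dw g)"
 then have A [measurable]: "A \<in> sets borel" by simp
 have v: "indicator (g -` A) x = (indicator A (g x) :: ennreal)" for x by (simp add: indicator_def)
 have [measurable]: "g \<in> BM" using g by (rule G_measurable)
 have gd: "g \<in> measurable dw dw" using measurable_cong_sets[OF sets_dw sets_dw] by simp
 have b: "g -` A \<in> sets dw" using measurable_sets[OF gd, of A] by simp
 have "emeasure (distr dw dw g) A = (NI x. indicator (g -` A) x)"
  using b gd by (simp add: emeasure_distr)
 also have "... = (NL x. ennreal (wt (g x)) * indicator A (g x))"
  by (simp add: nn_int_dw v wt_G[OF g])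
 also have "... = (\<integral>\<^sup>+x. ennreal (wt x) * indicator A x \<partial>distr lborel borel g)"
  by (subst nn_integral_distr) auto
 also have "... = (NI x. indicator A x)"
  by (simp only: lborel_G[OF g] nn_int_dw[OF borel_measurable_indicator[OF A]])
 also have "... = emeasure dw A" by (rule nn_integral_indicator) simp
 finally show "emeasure (distr dw dw g) A = emeasure dw A" .
qed

lemma G_measurable_dw: "g \<in> G ==> g \<in> measurable dw dw"
 using measurable_cong_sets[OF sets_dw sets_dw] G_measurable by simp

lemma integral_dw_G:
 fixes f :: "real^'n => complex"
 assumes g: "g \<in> G" and f: "f \<in> BM"
 shows "(LINT x|dw. f (g x)) = (LINT x|dw. f x)"
proof -
 have "(LINT x|dw. f x) = (LINT x|distr dw dw g. f x)" by (simp add: dw_G[OF g])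
 also have "... = (LINT x|dw. f (g x))" by (subst integral_distr[OF G_measurable_dw[OF g]]) (simp_all add: meas_dw f)
 finally show ?thesis by simp
qed

lemma nn_integral_dw_G:
 assumes g: "g \<in> G" and f: "f \<in> BM"
 shows "(NI x. f (g x)) = (NI x. f x)"
proof -
 have "(NI x. f x) = (\<integral>\<^sup>+x. f x \<partial>distr dw dw g)" by (simp add: dw_G[OF g])
 also have "... = (NI x. f (g x))" by (subst nn_integral_distr[OF G_measurable_dw[OF g]]) (simp_all add: meas_dw f)
 finally show ?thesis by simp
qed

lemma wt_scale: "0 < c ==> wt (c *R x) = c powr sk * wt x"
 by (simp add: wt_def abs_mult powr_mult prod.distrib sk_def powr_sum)

lemma nn_integral_dw_scale:
 assumes c: "0 < c" and f: "f \<in> BM"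
 shows "(NI x. f x) = ennreal (c powr NN) * (NI x. f (c *R x))"
proof -
 have [measurable]: "f \<in> BM" by (rule f)
 have l: "(lborel :: (real^'n) measure) = density (distr lborel borel (%x. c *R x)) (%_. ennreal (c ^ CARD('n)))"
  using lborel_affine[of c "0 :: real^'n"] c by simp
 have "(NI x. f x) = (NL x. ennreal (wt x) * f x)" by (rule nn_int_dw[OF f])
 also have "... = (NL x. ennreal (c ^ CARD('n)) * (ennreal (wt (c *R x)) * f (c *R x)))"
  by (subst l) (simp add: nn_integral_density nn_integral_distr)
 also have "... = (NL x. ennreal (c powr NN) * (ennreal (wt x) * f (c *R x)))"
 proof -
  have "ennreal (c ^ CARD('n)) * (ennreal (wt (c *R x)) * u) = ennreal (c powr NN) * (ennreal (wt x) * u)" for x u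
  proof -
   have "c powr NN = c ^ CARD('n) * c powr sk" using c by (simp add: NN_eq powr_add powr_realpow)
   then show ?thesis using c by (simp add: wt_scale ennreal_mult mult_ac)
  qed
  then show ?thesis by simp
 qed
 also have "... = ennreal (c powr NN) * (NI x. f (c *R x))"
  by (subst nn_integral_cmult) (auto simp: nn_int_dw)
 finally show ?thesis .
qed

lemma dw_scale:
 assumes c: "0 < c"
 shows "dw = density (distr dw borel (%x. c *R x)) (%_. ennreal (c powr NN))"
proof (rule measure_eqI)
 fix A assume "A \<in> sets dw"
 then have [measurable]: "A \<in> sets borel" by simp
 have "emeasure dw A = ennreal (c powr NN) * (NI x. indicator A (c *R x))"
  using nn_integral_dw_scale[OF c, of "indicator A"] by simp
 also have "(NI x. indicator A (c *R x)) = (\<integral>\<^sup>+x. indicator A x \<partial>distr dw borel (%x. c *R x))"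
  by (subst nn_integral_distr) auto
 also have "... = emeasure (distr dw borel (%x. c *R x)) A" by simp
 also have "ennreal (c powr NN) * ... = emeasure (density (distr dw borel (%x. c *R x)) (%_. ennreal (c powr NN))) A"
  by (subst emeasure_density) (auto simp: nn_integral_cmult_indicator)
 finally show "emeasure dw A = emeasure (density (distr dw borel (%x. c *R x)) (%_. ennreal (c powr NN))) A" .
qed simp

lemma integral_dw_scale:
 fixes f :: "real^'n => 'b::{banach, second_countable_topology}"
 assumes c: "0 < c" and [measurable]: "f \<in> BM"
 shows "(LINT x|dw. f x) = c powr NN *R (LINT x|dw. f (c *R x))"
 by (subst dw_scale[OF c]) (simp add: integral_density integral_distr)

lemma AE_regular: "AE x in lborel. ALL al:R. al \<cdot> x ~= 0"
proof -
 have "AE x in lborel. al \<cdot> x ~= 0" if "al \<in> R" for al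
 proof -
  have "negligible {x. al \<cdot> x = 0}" using root_nz[OF that] by (intro negligible_hyperplane) simp
  moreover have "{x. al \<cdot> x = 0} \<in> sets lborel" by simp
  ultimately have "{x. al \<cdot> x = 0} \<in> null_sets lborel"
   using negligible_iff_null_sets null_sets_completion_iff by blast
  from AE_not_in[OF this] show ?thesis by simp
 qed
 then show ?thesis by (rule AE_finite_allI[OF finite_R])
qed

lemma powr_le_ks: "1 <= a ==> a powr sk <= a ^ ks"
 using powr_mono[OF sk_le, of a] by (simp add: powr_realpow)

lemma wt_bound: "wt x <= (2 * (1 + norm x)) ^ ks"
proof -
 have "wt x <= (\<Prod>al\<in>R. (2 * (1 + norm x)) powr k al)"
  unfolding wt_def
 proof (intro prod_mono conjI)
  fix al assume a: "al \<in> R"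
  show "\<bar>x \<cdot> al\<bar> powr k al <= (2 * (1 + norm x)) powr k al"
   using inner_root_le[OF a, of x] a by (intro powr_mono2) auto
 qed simp
 also have "... = (2 * (1 + norm x)) powr sk"
  unfolding sk_def by (simp add: powr_sum add_nonneg_eq_0_iff)
 also have "... <= (2 * (1 + norm x)) ^ ks" by (rule powr_le_ks) simp
 finally show ?thesis .
qed

lemma decay_wt:
 assumes "w <= (2 * (1 + norm x)) ^ ks" "0 <= w" "r <= C / (1 + norm x) ^ Nd" "0 <= r"
 shows "w * r <= (2 ^ ks * C) / (1 + norm (x :: real^'n)) ^ (CARD('n) + 2)"
proof -
 have "w * r <= (2 * (1 + norm x)) ^ ks * (C / (1 + norm x) ^ Nd)"
  using assms by (intro mult_mono) auto
 also have "... = (2 ^ ks * C) / (1 + norm x) ^ (CARD('n) + 2)"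
 proof -
  have "(2 * b) ^ ks * (C / b ^ Nd) = (2 ^ ks * C) / b ^ (CARD('n) + 2)" if "b > 0" for b :: real
   unfolding Nd_def power_add[of b "CARD('n) + 2"] power_mult_distrib using that by simp
  from this[of "1 + norm x"] show ?thesis by (simp only: add_pos_nonneg zero_less_one norm_ge_zero)
 qed
 finally show ?thesis .
qed

lemma integrable_decay:
 fixes f :: "real^'n => complex"
 assumes m: "f \<in> BM" and f: "!!x. norm (f x) <= C / (1 + norm x) ^ Nd"
 shows "integrable dw f"
proof -
 have "integrable lborel (%x. wt x *R f x)"
 proof (rule lborel_integrable_decay)
  show "(%x. wt x *R f x) \<in> BM" using m by measurable
  show "norm (wt x *R f x) <= (2 ^ ks * C) / (1 + norm x) ^ (CARD('n) + 2)" for x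
   using decay_wt[OF wt_bound wt_nonneg f, of x] by simp
 qed
 then show ?thesis using integrable_dw[OF m] by simp
qed

lemma integrable_decay_real:
 fixes f :: "real^'n => real"
 assumes m: "f \<in> BM" and f: "!!x. \<bar>f x\<bar> <= C / (1 + norm x) ^ Nd"
 shows "integrable dw f"
proof -
 have "integrable dw (%x. complex_of_real (f x))"
  using m f by (intro integrable_decay[where C = C]) auto
 from integrable_Re[OF this] show ?thesis by simp
qed

text \<open>Smooth approximations of \<open>wt\<close>, for which integration by parts is classical.\<close>

definition rwt :: "real => real^'n => real" where
 "rwt dd x = exp (SUM al:R. k al / 2 * ln ((al \<cdot> x)^2 + dd))"

lemma rwt_derivative:
 assumes "0 < dd"
 shows "(rwt dd has_derivative (%v. rwt dd x * (SUM al:R. k al * (al \<cdot> v) * ((al \<cdot> x) / ((al \<cdot> x)^2 + dd))))) (at x)"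
proof -
 have p: "0 < (al \<cdot> x)^2 + dd" for al using assms by (simp add: add_nonneg_pos)
 have q: "((%x. (al \<cdot> x)\<^sup>2 + dd) has_derivative (%v. 2 * (al \<cdot> v) * (al \<cdot> x))) (at x)" for al
  by (auto intro!: derivative_eq_intros)
 have l: "((%x. ln ((al \<cdot> x)^2 + dd)) has_derivative (%v. inverse ((al \<cdot> x)^2 + dd) * (2 * (al \<cdot> v) * (al \<cdot> x)))) (at x)" for al
  using has_derivative_compose[OF q DERIV_ln[OF p, unfolded has_field_derivative_def]] by (simp add: mult.commute)
 have s: "((%x. SUM al:R. k al / 2 * ln ((al \<cdot> x)^2 + dd)) has_derivative
   (%v. SUM al:R. k al / 2 * (inverse ((al \<cdot> x)^2 + dd) * (2 * (al \<cdot> v) * (al \<cdot> x))))) (at x)"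
  by (intro has_derivative_sum has_derivative_mult_right l)
 have "(rwt dd has_derivative (%v. rwt dd x *
   (SUM al:R. k al / 2 * (inverse ((al \<cdot> x)^2 + dd) * (2 * (al \<cdot> v) * (al \<cdot> x)))))) (at x)"
  unfolding rwt_def
  using has_derivative_compose[OF s DERIV_exp[unfolded has_field_derivative_def]] by simp
 moreover have "c / 2 * (inverse q * (2 * a * b)) = c * a * (b / q)" for a b c q :: real
  by (cases "q = 0") (simp_all add: field_simps)
 ultimately show ?thesis by (simp only:)
qed

lemma rwt_G: "g \<in> G ==> rwt dd (g x) = rwt dd x"
proof -
 assume g: "g \<in> G"
 have "(SUM al:R. k al / 2 * ln ((al \<cdot> x)^2 + dd)) = (SUM al:R. k (g al) / 2 * ln ((g al \<cdot> g x)^2 + dd))"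
  using g by (intro sum.cong) auto
 also have "... = (SUM al:R. k al / 2 * ln ((al \<cdot> g x)^2 + dd))"
  by (rule sum_roots[OF g, where f = "%al. k al / 2 * ln ((al \<cdot> g x)^2 + dd)"])
 finally show ?thesis by (simp add: rwt_def)
qed

lemma rwt_pos: "0 < rwt dd x"
 by (simp add: rwt_def)

lemma rwt_bound:
 assumes "0 < dd" "dd <= 1"
 shows "rwt dd x <= (2 * (1 + norm x)) ^ ks"
proof -
 have "(SUM al:R. k al / 2 * ln ((al \<cdot> x)^2 + dd)) <= (SUM al:R. k al * ln (2 * (1 + norm x)))"
 proof (intro sum_mono)
  fix al assume a: "al \<in> R"
  have "\<bar>al \<cdot> x\<bar> <= \<bar>2 * norm x\<bar>" using inner_root_le[OF a, of x] by (simp add: inner_commute)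
  then have "(al \<cdot> x)^2 <= (2 * norm x)^2" by (simp only: abs_le_square_iff)
  also have "... <= (2 * (1 + norm x))^2 - 1" by (simp add: power2_eq_square algebra_simps)
  finally have "(al \<cdot> x)^2 + dd <= (2 * (1 + norm x))^2" using assms by linarith
  moreover have "0 < (al \<cdot> x)^2 + dd" using assms by (simp add: add_nonneg_pos)
  moreover have "0 < 2 * (1 + norm x)" by (simp add: add_pos_nonneg)
  ultimately have "ln ((al \<cdot> x)^2 + dd) <= 2 * ln (2 * (1 + norm x))"
   using ln_mono[of "(al \<cdot> x)^2 + dd" "(2 * (1 + norm x))^2"] ln_realpow[of "2 * (1 + norm x)" 2] by linarith
  then show "k al / 2 * ln ((al \<cdot> x)^2 + dd) <= k al * ln (2 * (1 + norm x))"
   using mult_left_mono[of "ln ((al \<cdot> x)^2 + dd)" "2 * ln (2 * (1 + norm x))" "k al / 2"] a by simp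
 qed
 also have "... = sk * ln (2 * (1 + norm x))" by (simp add: sk_def sum_distrib_right)
 finally have "rwt dd x <= exp (sk * ln (2 * (1 + norm x)))" by (simp add: rwt_def)
 also have "... = (2 * (1 + norm x)) powr sk" by (simp add: powr_def add_nonneg_eq_0_iff)
 also have "... <= (2 * (1 + norm x)) ^ ks" by (rule powr_le_ks) simp
 finally show ?thesis .
qed

lemma rwt_lim:
 assumes x: "ALL al:R. al \<cdot> x ~= 0"
 shows "(%n. rwt (1 / real (Suc n)) x) \<longlonglongrightarrow> wt x"
proof -
 have l0: "(%n. 1 / real (Suc n)) \<longlonglongrightarrow> 0"
  using LIMSEQ_inverse_real_of_nat by (simp add: inverse_eq_divide)
 have "(%n. rwt (1 / real (Suc n)) x) \<longlonglongrightarrow> exp (SUM al:R. k al / 2 * ln ((al \<cdot> x)^2 + 0))"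
  unfolding rwt_def using x by (intro tendsto_intros l0) auto
 also have "exp (SUM al:R. k al / 2 * ln ((al \<cdot> x)^2 + 0)) = wt x"
  unfolding wt_def exp_sum[OF finite_R]
 proof (intro prod.cong refl)
  fix al assume "al \<in> R"
  then have nz: "al \<cdot> x ~= 0" using x by blast
  have "ln ((al \<cdot> x)^2) = 2 * ln \<bar>al \<cdot> x\<bar>"
   using ln_realpow[of "\<bar>al \<cdot> x\<bar>" 2] nz by simp
  then show "exp (k al / 2 * ln ((al \<cdot> x)^2 + 0)) = \<bar>x \<cdot> al\<bar> powr k al"
   using nz by (simp add: powr_def inner_commute)
 qed
 finally show ?thesis .
qed

lemma refl_dist: "al \<in> R ==> norm (x - rf al x) <= 2 * \<bar>al \<cdot> x\<bar>"
proof -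
 assume a: "al \<in> R"
 have "sqrt 2 <= 2" by (rule real_le_lsqrt) auto
 then have "\<bar>al \<cdot> x\<bar> * sqrt 2 <= \<bar>al \<cdot> x\<bar> * 2" by (rule mult_left_mono) simp
 then show ?thesis using a by (simp add: refl_eq norm_root inner_commute mult.commute)
qed

lemma segment_bound:
 fixes F :: "real^'n => complex"
 assumes F': "!!x. (F has_derivative F' x) (at x)" and a: "al \<in> R"
  and B: "!!y u. y \<in> closed_segment x (rf al x) ==> norm (F' y u) <= B * norm u" and B0: "0 <= B"
 shows "norm (F x - F (rf al x)) <= 2 * B * \<bar>al \<cdot> x\<bar>"
proof -
 have "norm (F x - F (rf al x)) <= B * norm (x - rf al x)"
 proof (rule differentiable_bound[where S = "closed_segment x (rf al x)" and f' = F'])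
  show "(F has_derivative F' y) (at y within closed_segment x (rf al x))" for y
   by (rule has_derivative_at_withinI[OF F'])
  show "onorm (F' y) <= B" if "y \<in> closed_segment x (rf al x)" for y
   by (rule onorm_bound[OF B0 B[OF that]])
 qed auto
 also have "... <= B * (2 * \<bar>al \<cdot> x\<bar>)" by (rule mult_left_mono[OF refl_dist[OF a] B0])
 finally show ?thesis by simp
qed

text \<open>Far from the mirror the decay of \<open>F\<close> suffices. Near it the mean value
  inequality applies on the segment from \<open>x\<close> to its reflection, whose points are within
  distance 2 of \<open>x\<close>; this is the origin of \<open>3 ^ m\<close>.\<close>

lemma diffquot_bound:
 fixes F :: "real^'n => complex"
 assumes F': "!!x. (F has_derivative F' x) (at x)" and a: "al \<in> R"
  and F: "!!x. norm (F x) <= C / (1 + norm x) ^ m"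
  and bound: "!!x u. norm (F' x u) <= C * norm u / (1 + norm x) ^ m"
 shows "norm (F x - F (rf al x)) <= \<bar>al \<cdot> x\<bar> * ((2 * 3 ^ m * C) / (1 + norm x) ^ m)"
proof -
 have C: "0 <= C" using order_trans[OF norm_ge_zero F[of 0]] by simp
 have p: "0 < (1 + norm x) ^ m" by (simp add: add_pos_nonneg)
 show ?thesis
 proof (cases "1 <= \<bar>al \<cdot> x\<bar>")
  case True
  have "norm (F x - F (rf al x)) <= norm (F x) + norm (F (rf al x))"
   by (rule norm_triangle_ineq4)
  also have "... <= C / (1 + norm x) ^ m + C / (1 + norm x) ^ m"
   using F[of x] F[of "rf al x"] G_norm[OF refl_in_G[OF a]] by (intro add_mono) simp_all
  also have "... = (2 * C) / (1 + norm x) ^ m" by simp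
  also have "... <= (2 * 3 ^ m * C) / (1 + norm x) ^ m"
  proof (rule divide_right_mono)
   have "1 * C <= 3 ^ m * C" by (rule mult_right_mono[OF _ C]) simp
   then show "2 * C <= 2 * 3 ^ m * C" by simp
  qed (use p in simp)
  also have "... <= \<bar>al \<cdot> x\<bar> * ((2 * 3 ^ m * C) / (1 + norm x) ^ m)"
   using mult_right_mono[OF True, of "(2 * 3 ^ m * C) / (1 + norm x) ^ m"] p C by simp
  finally show ?thesis .
 next
  case False
  have "norm (F x - F (rf al x)) <= 2 * (C * (3 ^ m / (1 + norm x) ^ m)) * \<bar>al \<cdot> x\<bar>"
  proof (rule segment_bound[OF F' a])
   fix y u :: "real^'n" assume y: "y \<in> closed_segment x (rf al x)"
   have "norm (x - y) <= norm (x - rf al x)"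
    using segment_bound1[OF y] by (simp add: norm_minus_commute)
   also have "... <= 2" using refl_dist[OF a, of x] False by linarith
   finally have "1 / (1 + norm y) ^ m <= (1 + 2) ^ m / (1 + norm x) ^ m" by (rule decay_shift)
   then have "(C * norm u) * (1 / (1 + norm y) ^ m) <= (C * norm u) * (3 ^ m / (1 + norm x) ^ m)"
    using C by (intro mult_left_mono) simp_all
   then show "norm (F' y u) <= C * (3 ^ m / (1 + norm x) ^ m) * norm u"
    using bound[of y u] by (simp add: mult_ac)
  qed (use C p in simp)
  then show ?thesis by (simp add: mult_ac)
 qed
qed

lemma T_measurable:
 assumes F': "!!x. (F has_derivative F' x) (at x)"
 shows "T v F \<in> BM"
proof -
 have Fc: "continuous_on UNIV F"
  by (intro continuous_at_imp_continuous_on ballI has_derivative_continuous[OF F'])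
 have Fm: "F \<in> BM" by (rule cont_BM[OF Fc])
 have hm: "(%x. F (p + x)) \<in> BM" for p
  by (intro cont_BM continuous_intros continuous_on_compose2[OF Fc]) auto
 have Fd: "((%p. F (p + x)) has_derivative F' x) (at 0)" for x
 proof -
  have a: "((%p. p + x) has_derivative (%h. h)) (at 0)" by (auto intro!: derivative_eq_intros)
  show ?thesis using has_derivative_compose[OF a, of F "F' x"] F'[of x] by simp
 qed
 have F'm: "(%x. F' x u) \<in> BM" for u
  by (rule derivative_measurable[where r = 1 and f = "%p x. F (p + x)", OF hm _ Fd]) simp
 have Frm: "(%x. F (rf al x)) \<in> BM" if "al \<in> R" for al
  by (rule measurable_compose[OF G_measurable[OF refl_in_G[OF that]] Fm])
 have s: "{x \<in> space borel. al \<cdot> x = 0} \<in> sets borel" for al :: "real^'n" by measurable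
 have im: "(%x::real^'n. al \<cdot> x) \<in> BM" for al by measurable
 have "(%x. if al \<cdot> x = 0 then F' x al else (F x - F (rf al x)) /R (al \<cdot> x)) \<in> BM"
  if "al \<in> R" for al
  using im[of al]
  by (intro measurable_If F'm borel_measurable_scaleR borel_measurable_inverse borel_measurable_diff Fm Frm[OF that] s)
 then show ?thesis
  unfolding T_at[OF F', abs_def]
  by (intro borel_measurable_add F'm borel_measurable_sum borel_measurable_scaleR borel_measurable_const)
qed

text \<open>In the limit \<open>dd --> 0\<close> the logarithmic derivative of \<open>rwt dd\<close>, symmetrised under the
 reflections, becomes the difference part of the Dunkl operator.\<close>

lemma T_integral_zero:
 fixes F :: "real^'n => complex"
 assumes F': "!!x. (F has_derivative F' x) (at x)"
  and F: "!!x. norm (F x) <= C / (1 + norm x) ^ Nd"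
  and bound: "!!x u. norm (F' x u) <= C * norm u / (1 + norm x) ^ Nd"
 shows "integrable dw (T v F)" and "(LINT x|dw. T v F x) = 0"
proof -
 let ?m = "CARD('n) + 2"
 have C: "0 <= C" using order_trans[OF norm_ge_zero F[of 0]] by simp
 have Fc: "continuous_on UNIV F"
  by (intro continuous_at_imp_continuous_on ballI has_derivative_continuous[OF F'])
 have Fm: "F \<in> BM" by (rule cont_BM[OF Fc])
 have hm: "(%x. F (p + x)) \<in> BM" for p
  by (intro cont_BM continuous_intros continuous_on_compose2[OF Fc]) auto
 have Fd: "((%p. F (p + x)) has_derivative F' x) (at 0)" for x
 proof -
  have a: "((%p. p + x) has_derivative (%h. h)) (at 0)" by (auto intro!: derivative_eq_intros)
  show ?thesis using has_derivative_compose[OF a, of F "F' x"] F'[of x] by simp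
 qed
 have F'm: "(%x. F' x u) \<in> BM" for u
  by (rule derivative_measurable[where r = 1 and f = "%p x. F (p + x)", OF hm _ Fd]) simp
 have Frm: "(%x. F (rf al x)) \<in> BM" if "al \<in> R" for al
  by (rule measurable_compose[OF G_measurable[OF refl_in_G[OF that]] Fm])
 define q where "q dd al x = (al \<cdot> x) / ((al \<cdot> x)^2 + dd)" for dd :: real and al x :: "real^'n"
 define I where "I dd x = rwt dd x *R (F' x v + (SUM al:R. (k al / 2 * (al \<cdot> v) * q dd al x) *R (F x - F (rf al x))))" for dd x
 have qb: "\<bar>q dd al x\<bar> <= 1 / dd" if d: "0 < dd" "dd <= 1" for dd al x
 proof -
  have p: "0 < (al \<cdot> x)^2 + dd" using d by (simp add: add_nonneg_pos)
  have "0 <= (\<bar>al \<cdot> x\<bar> - 1)^2" by simp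
  then have "\<bar>al \<cdot> x\<bar> <= (al \<cdot> x)^2 + 1" by (simp add: power2_eq_square algebra_simps)
  then have "\<bar>al \<cdot> x\<bar> * dd <= ((al \<cdot> x)^2 + 1) * dd" using d by (intro mult_right_mono) auto
  also have "... <= (al \<cdot> x)^2 + dd" using mult_left_mono[OF d(2), of "(al \<cdot> x)^2"] by (simp add: algebra_simps)
  finally show ?thesis using p d by (simp add: q_def abs_divide divide_simps)
 qed
 have qm: "q dd al \<in> BM" for dd al unfolding q_def by measurable
 have rm: "rwt dd \<in> BM" for dd unfolding rwt_def by measurable
 \<comment> \<open>For fixed \<open>dd\<close> the weight is smooth, so the derivative of
   \<open>rwt dd\<close> times \<open>F\<close> integrates to zero. Reflecting the integrals turns
   its logarithmic term into the difference term of \<open>I\<close>.\<close>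
 have zero: "(LINT x|lborel. I dd x) = 0" if d: "0 < dd" "dd <= 1" for dd
 proof -
  have dec: "norm (F x) * rwt dd x <= (2 ^ ks * C) / (1 + norm x) ^ ?m" for x
   using decay_wt[OF rwt_bound[OF d] _ F norm_ge_zero, of x] rwt_pos[of dd x] by (simp add: mult.commute)
  have dec': "norm (F' x u) * rwt dd x <= (2 ^ ks * C) * norm u / (1 + norm x) ^ ?m" for x u
   using decay_wt[OF rwt_bound[OF d] _ bound norm_ge_zero, of x u] rwt_pos[of dd x] by (simp add: mult_ac)
  have dH: "((%x. rwt dd x *R F x) has_derivative
    (%u. rwt dd x *R F' x u + (rwt dd x * (SUM al:R. k al * (al \<cdot> u) * q dd al x)) *R F x)) (at x)" for x
   unfolding q_def by (rule has_derivative_scaleR[OF rwt_derivative[OF d(1)] F'])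
  define K where "K = 2 ^ ks * C * (1 + 2 * sk / dd)"
  have K: "2 ^ ks * C <= K" using d C mult_left_mono[of 1 "1 + 2 * sk / dd" "2 ^ ks * C"] by (simp add: K_def)
  have sb: "\<bar>SUM al:R. k al * (al \<cdot> u) * q dd al x\<bar> <= 2 * sk / dd * norm u" for u x
  proof -
   have "\<bar>SUM al:R. k al * (al \<cdot> u) * q dd al x\<bar> <= (SUM al:R. \<bar>k al * (al \<cdot> u) * q dd al x\<bar>)" by (rule sum_abs)
   also have "... <= (SUM al:R. k al * (2 * norm u) * (1 / dd))"
    unfolding abs_mult
   proof (intro sum_mono mult_mono qb d)
    fix al assume a: "al \<in> R"
    show "\<bar>al \<cdot> u\<bar> <= 2 * norm u" using inner_root_le[OF a, of u] by (simp add: inner_commute)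
   qed (auto)
   also have "... = 2 * sk / dd * norm u" by (simp add: sk_def sum_distrib_left sum_distrib_right sum_divide_distrib mult_ac)
   finally show ?thesis .
  qed
  have z0: "(LINT x|lborel. rwt dd x *R F' x v + (rwt dd x * (SUM al:R. k al * (al \<cdot> v) * q dd al x)) *R F x) = 0"
  proof (rule lborel_integral_derivative[OF dH, where C = K])
   fix x u :: "real^'n"
   have p: "0 < (1 + norm x) ^ ?m" by (simp add: add_pos_nonneg)
   have "norm (rwt dd x *R F x) <= (2 ^ ks * C) / (1 + norm x) ^ ?m"
    using dec[of x] rwt_pos[of dd x] by (simp add: mult.commute)
   also have "... <= K / (1 + norm x) ^ ?m" by (rule divide_right_mono[OF K]) (use p in simp)
   finally show "norm (rwt dd x *R F x) <= K / (1 + norm x) ^ ?m" .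
   have "norm (rwt dd x *R F' x u + (rwt dd x * (SUM al:R. k al * (al \<cdot> u) * q dd al x)) *R F x)
    <= norm (F' x u) * rwt dd x + \<bar>SUM al:R. k al * (al \<cdot> u) * q dd al x\<bar> * (norm (F x) * rwt dd x)"
    using norm_triangle_ineq[of "rwt dd x *R F' x u" "(rwt dd x * (SUM al:R. k al * (al \<cdot> u) * q dd al x)) *R F x"]
     rwt_pos[of dd x] by (simp add: abs_mult mult_ac)
   also have "... <= (2 ^ ks * C) * norm u / (1 + norm x) ^ ?m + (2 * sk / dd * norm u) * ((2 ^ ks * C) / (1 + norm x) ^ ?m)"
    using d by (intro add_mono dec' mult_mono sb dec) (use rwt_pos[of dd x] in auto)
   also have "... = K * norm u / (1 + norm x) ^ ?m"
   proof -
    have "A * n / p + (s * n) * (A / p) = (A * (1 + s)) * n / p" for A n p s :: real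
     by (simp add: divide_inverse algebra_simps)
    then show ?thesis by (simp only: K_def)
   qed
   finally show "norm (rwt dd x *R F' x u + (rwt dd x * (SUM al:R. k al * (al \<cdot> u) * q dd al x)) *R F x)
     <= K * norm u / (1 + norm x) ^ ?m" .
  qed
  have i1: "integrable lborel (%x. rwt dd x *R F' x v)"
  proof (rule lborel_integrable_decay[where C = "2 ^ ks * C * norm v"])
   show "(%x. rwt dd x *R F' x v) \<in> BM" by (intro borel_measurable_scaleR rm F'm)
   show "norm (rwt dd x *R F' x v) <= (2 ^ ks * C) * norm v / (1 + norm x) ^ ?m" for x
    using dec'[of x v] rwt_pos[of dd x] by (simp add: mult.commute)
  qed
  have i2: "integrable lborel (%x. (rwt dd x * q dd al x) *R F x)" for al
  proof (rule lborel_integrable_decay[where C = "1 / dd * (2 ^ ks * C)"])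
   show "(%x. (rwt dd x * q dd al x) *R F x) \<in> BM"
    by (intro borel_measurable_scaleR borel_measurable_times rm qm Fm)
   show "norm ((rwt dd x * q dd al x) *R F x) <= 1 / dd * (2 ^ ks * C) / (1 + norm x) ^ ?m" for x
    using mult_mono[OF qb[OF d, of al x] dec[of x]] rwt_pos[of dd x] d by (simp add: abs_mult mult_ac)
  qed
  \<comment> \<open>Under the reflection \<open>rwt dd\<close> is even and \<open>q\<close> is odd.
    Hence the difference of \<open>F\<close> and its reflection integrates to twice the integral of
    \<open>F\<close>, which turns \<open>k al / 2\<close> into \<open>k al\<close>.\<close>
  have rfl: "(LINT x|lborel. (rwt dd x * q dd al x) *R F (rf al x)) = - (LINT x|lborel. (rwt dd x * q dd al x) *R F x)"
   "integrable lborel (%x. (rwt dd x * q dd al x) *R F (rf al x))" if a: "al \<in> R" for al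
  proof -
   have e: "(rwt dd x * q dd al x) *R F (rf al x)
     = - ((rwt dd (rf al x) * q dd al (rf al x)) *R F (rf al x))" for x
    by (simp add: rwt_G[OF refl_in_G[OF a]] q_def refl_inner_root[OF a])
   show "(LINT x|lborel. (rwt dd x * q dd al x) *R F (rf al x)) = - (LINT x|lborel. (rwt dd x * q dd al x) *R F x)"
    unfolding e by (subst lborel_integral_G[OF refl_in_G[OF a], where f = "%x. - ((rwt dd x * q dd al x) *R F x)"])
     (auto intro!: borel_measurable_uminus borel_measurable_scaleR borel_measurable_times rm qm Fm)
   have "integrable (distr lborel borel (rf al)) (%x. (rwt dd x * q dd al x) *R F x)"
    using i2[of al] by (simp add: lborel_G[OF refl_in_G[OF a]])
   then have "integrable lborel (%x. (rwt dd (rf al x) * q dd al (rf al x)) *R F (rf al x))"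
    by (rule integrable_distr[rotated]) (simp add: G_measurable[OF refl_in_G[OF a]])
   then show "integrable lborel (%x. (rwt dd x * q dd al x) *R F (rf al x))"
    unfolding e by (rule integrable_minus)
  qed
  have s2: "(rwt dd x * (SUM al:R. k al * (al \<cdot> v) * q dd al x)) *R F x
    = (SUM al:R. (k al * (al \<cdot> v)) *R ((rwt dd x * q dd al x) *R F x))" for x
   by (simp add: sum_distrib_left scaleR_sum_left mult_ac)
  have I_eq: "I dd x = rwt dd x *R F' x v + (SUM al:R. (k al / 2 * (al \<cdot> v)) *R ((rwt dd x * q dd al x) *R F x -
    (rwt dd x * q dd al x) *R F (rf al x)))" for x
   unfolding I_def scaleR_add_right scaleR_sum_right
   by (intro arg_cong2[of _ _ _ _ "(+)"] refl sum.cong) (simp add: scaleR_diff_right mult_ac)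
  have "(LINT x|lborel. I dd x) = (LINT x|lborel. rwt dd x *R F' x v)
    + (SUM al:R. (k al / 2 * (al \<cdot> v)) *R ((LINT x|lborel. (rwt dd x * q dd al x) *R F x) -
     (LINT x|lborel. (rwt dd x * q dd al x) *R F (rf al x))))"
  proof -
   have i3: "integrable lborel (%x. (k al / 2 * (al \<cdot> v)) *R ((rwt dd x * q dd al x) *R F x -
     (rwt dd x * q dd al x) *R F (rf al x)))" if "al \<in> R" for al
    by (intro integrable_scaleR_right integrable_diff i2 rfl(2)[OF that])
   show ?thesis
    unfolding I_eq
   proof (subst integral_add[OF i1 integrable_sum[OF i3]], assumption,
     subst integral_sum[OF i3], assumption, intro arg_cong2[of _ _ _ _ "(+)"] sum.cong refl)
    fix al assume "al \<in> R"
    then show "(LINT x|lborel. (k al / 2 * (al \<cdot> v)) *R ((rwt dd x * q dd al x) *R F x -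
       (rwt dd x * q dd al x) *R F (rf al x)))
      = (k al / 2 * (al \<cdot> v)) *R ((LINT x|lborel. (rwt dd x * q dd al x) *R F x) -
       (LINT x|lborel. (rwt dd x * q dd al x) *R F (rf al x)))"
     by (simp only: integral_scaleR_right integral_diff[OF i2 rfl(2)])
   qed
  qed
  also have "... = (LINT x|lborel. rwt dd x *R F' x v)
    + (SUM al:R. (k al * (al \<cdot> v)) *R (LINT x|lborel. (rwt dd x * q dd al x) *R F x))"
  proof (intro arg_cong2[of _ _ _ _ "(+)"] sum.cong refl)
   fix al assume "al \<in> R"
   have "(c / 2 * b) *R (z - - z) = (c * b) *R z" for c b and z :: complex
    by (simp add: scaleR_conv_of_real field_simps)
   then show "(k al / 2 * (al \<cdot> v)) *R ((LINT x|lborel. (rwt dd x * q dd al x) *R F x) -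
     (LINT x|lborel. (rwt dd x * q dd al x) *R F (rf al x)))
     = (k al * (al \<cdot> v)) *R (LINT x|lborel. (rwt dd x * q dd al x) *R F x)"
    unfolding rfl(1)[OF \<open>al \<in> R\<close>] .
  qed
  also have "... = (LINT x|lborel. rwt dd x *R F' x v + (rwt dd x * (SUM al:R. k al * (al \<cdot> v) * q dd al x)) *R F x)"
  proof -
   have i4: "integrable lborel (%x. (k al * (al \<cdot> v)) *R ((rwt dd x * q dd al x) *R F x))" for al
    by (intro integrable_scaleR_right i2)
   show ?thesis
    unfolding s2 integral_add[OF i1 integrable_sum[OF i4]]
     integral_sum[OF i4] integral_scaleR_right ..
  qed
  finally show ?thesis unfolding z0 .
 qed
 define dd where "dd n = 1 / real (Suc n)" for n
 have d: "0 < dd n" "dd n <= 1" for n by (simp_all add: dd_def)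
 define K where "K = C * norm v + (SUM al:R. k al / 2 * \<bar>al \<cdot> v\<bar> * (2 * 3 ^ Nd * C))"
 have K0: "0 <= K" unfolding K_def using C by (intro add_nonneg_nonneg sum_nonneg mult_nonneg_nonneg) auto
 \<comment> \<open>This bound has to be independent of \<open>n\<close>, while \<open>q\<close>
   alone is only bounded by \<open>1 / dd n\<close>. The difference of the values of
   \<open>F\<close> supplies a factor \<open>al \<cdot> x\<close>, and its product with
   \<open>q\<close> is at most 1.\<close>
 have Ib: "norm (I (dd n) x) <= (2 ^ ks * K) / (1 + norm x) ^ ?m" for n x
 proof -
  have p: "0 < (1 + norm x) ^ Nd" by (simp add: add_pos_nonneg)
  have t: "norm ((k al / 2 * (al \<cdot> v) * q (dd n) al x) *R (F x - F (rf al x)))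
    <= k al / 2 * \<bar>al \<cdot> v\<bar> * ((2 * 3 ^ Nd * C) / (1 + norm x) ^ Nd)" if a: "al \<in> R" for al
  proof -
   have p2: "0 < (al \<cdot> x)^2 + dd n" using d by (simp add: add_nonneg_pos)
   have "\<bar>q (dd n) al x\<bar> * \<bar>al \<cdot> x\<bar> = (al \<cdot> x)^2 / ((al \<cdot> x)^2 + dd n)"
    using p2 by (simp add: q_def abs_divide power2_eq_square abs_mult[symmetric])
   also have "... <= 1" using p2 d[of n] by (simp add: divide_le_eq)
   finally have q1: "\<bar>q (dd n) al x\<bar> * \<bar>al \<cdot> x\<bar> <= 1" .
   have "\<bar>q (dd n) al x\<bar> * norm (F x - F (rf al x))
     <= \<bar>q (dd n) al x\<bar> * (\<bar>al \<cdot> x\<bar> * ((2 * 3 ^ Nd * C) / (1 + norm x) ^ Nd))"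
    by (intro mult_left_mono diffquot_bound[OF F' a F bound]) simp
   also have "... <= 1 * ((2 * 3 ^ Nd * C) / (1 + norm x) ^ Nd)"
    unfolding mult.assoc[symmetric] using q1 C p
    by (simp add: mult.assoc) (intro divide_right_mono, metis mult.assoc mult_left_le_one_le mult_nonneg_nonneg abs_ge_zero zero_le_numeral zero_le_power, simp)
   finally have "(k al / 2 * \<bar>al \<cdot> v\<bar>) * (\<bar>q (dd n) al x\<bar> * norm (F x - F (rf al x)))
     <= (k al / 2 * \<bar>al \<cdot> v\<bar>) * (1 * ((2 * 3 ^ Nd * C) / (1 + norm x) ^ Nd))"
    using a by (intro mult_left_mono) auto
   then show ?thesis using a by (simp add: abs_mult mult_ac)
  qed
  have "norm (F' x v + (SUM al:R. (k al / 2 * (al \<cdot> v) * q (dd n) al x) *R (F x - F (rf al x))))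
   <= C * norm v / (1 + norm x) ^ Nd + (SUM al:R. k al / 2 * \<bar>al \<cdot> v\<bar> * ((2 * 3 ^ Nd * C) / (1 + norm x) ^ Nd))"
   by (rule order_trans[OF norm_triangle_ineq]) (intro add_mono bound sum_norm_le t)
  also have "... = K / (1 + norm x) ^ Nd"
   by (simp add: K_def add_divide_distrib sum_divide_distrib)
  finally have b: "norm (F' x v + (SUM al:R. (k al / 2 * (al \<cdot> v) * q (dd n) al x) *R (F x - F (rf al x))))
   <= K / (1 + norm x) ^ Nd" .
  show ?thesis
   unfolding I_def norm_scaleR abs_of_pos[OF rwt_pos]
   by (rule decay_wt[OF rwt_bound[OF d] less_imp_le[OF rwt_pos] b norm_ge_zero])
 qed
 have Tm: "T v F \<in> BM" by (rule T_measurable[OF F'])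
 have Im: "I dd' \<in> BM" for dd'
  unfolding I_def by (intro borel_measurable_scaleR borel_measurable_add borel_measurable_sum borel_measurable_times
    borel_measurable_diff borel_measurable_const rm F'm qm Fm Frm)
 have lim: "AE x in lborel. (%n. I (dd n) x) \<longlonglongrightarrow> wt x *R T v F x"
  using AE_regular
 proof (eventually_elim)
  fix x :: "real^'n" assume x: "ALL al:R. al \<cdot> x ~= 0"
  have dl: "dd \<longlonglongrightarrow> 0" unfolding dd_def using LIMSEQ_inverse_real_of_nat by (simp add: inverse_eq_divide)
  have rl: "(%n. rwt (dd n) x) \<longlonglongrightarrow> wt x" unfolding dd_def by (rule rwt_lim[OF x])
  have ql: "(%n. q (dd n) al x) \<longlonglongrightarrow> 1 / (al \<cdot> x)" if "al \<in> R" for al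
  proof -
   have "(%n. q (dd n) al x) \<longlonglongrightarrow> (al \<cdot> x) / ((al \<cdot> x)^2 + 0)"
    unfolding q_def using x that by (intro tendsto_intros dl) auto
   then show ?thesis using x that by (simp add: power2_eq_square)
  qed
  have "(%n. I (dd n) x) \<longlonglongrightarrow> wt x *R (F' x v + (SUM al:R. (k al / 2 * (al \<cdot> v) * (1 / (al \<cdot> x))) *R (F x - F (rf al x))))"
   unfolding I_def by (intro tendsto_intros rl ql)
  also have "F' x v + (SUM al:R. (k al / 2 * (al \<cdot> v) * (1 / (al \<cdot> x))) *R (F x - F (rf al x))) = T v F x"
   unfolding T_at[OF F']
  proof (intro arg_cong2[of _ _ _ _ "(+)"] refl sum.cong)
   fix al assume "al \<in> R"
   then have "al \<cdot> x ~= 0" using x by simp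
   then show "(k al / 2 * (al \<cdot> v) * (1 / (al \<cdot> x))) *R (F x - F (rf al x)) =
    (k al / 2 * (al \<cdot> v)) *R (if al \<cdot> x = 0 then F' x al else (F x - F (rf al x)) /R (al \<cdot> x))"
    by (simp only: if_False scaleR_scaleR inverse_eq_divide)
  qed
  finally show "(%n. I (dd n) x) \<longlonglongrightarrow> wt x *R T v F x" .
 qed
 have wi: "integrable lborel (%x::real^'n. (2 ^ ks * K) * (1 / (1 + norm x) ^ ?m))"
  using lborel_decay by (intro integrable_mult_right integrableI_nonneg) auto
 have wm: "(%x. wt x *R T v F x) \<in> borel_measurable lborel" using Tm by measurable
 have b: "AE x in lborel. norm (I (dd n) x) <= (2 ^ ks * K) * (1 / (1 + norm x) ^ ?m)" for n
  by (rule AE_I2) (use Ib in simp)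
 have Im': "I (dd n) \<in> borel_measurable lborel" for n using Im by simp
 show "integrable dw (T v F)"
  unfolding integrable_dw[OF Tm] by (rule integrable_dominated_convergence[OF wm Im' wi lim b])
 have "(%n. LINT x|lborel. I (dd n) x) \<longlonglongrightarrow> (LINT x|lborel. wt x *R T v F x)"
  by (rule integral_dominated_convergence[OF wm Im' wi lim b])
 then have "(%n. 0::complex) \<longlonglongrightarrow> (LINT x|lborel. wt x *R T v F x)" by (simp only: zero[OF d])
 then have "(LINT x|lborel. wt x *R T v F x) = 0" using LIMSEQ_unique[OF _ tendsto_const] by blast
 then show "(LINT x|dw. T v F x) = 0" by (simp add: integral_dw[OF Tm])
qed

text \<open>The segment from \<open>x\<close> to its reflection stays in the ball of radius
  \<open>norm x\<close>, so a derivative bound on that ball controls the difference quotients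
  too.\<close>

lemma T_bound:
 fixes f :: "real^'n => complex"
 assumes f': "!!x. (f has_derivative f' x) (at x)"
  and B: "!!y u. norm y <= norm x ==> norm (f' y u) <= B * norm u" and B0: "0 <= B"
 shows "norm (T v f x) <= (1 + 2 * sk) * (B * norm v)"
  and "!!al. al \<in> R ==> norm (f x - f (rf al x)) <= 2 * B * \<bar>al \<cdot> x\<bar>"
proof -
 show seg: "norm (f x - f (rf al x)) <= 2 * B * \<bar>al \<cdot> x\<bar>" if a: "al \<in> R" for al
 proof (rule segment_bound[OF f' a _ B0])
  fix y u :: "real^'n" assume "y \<in> closed_segment x (rf al x)"
  then obtain t where t: "0 <= t" "t <= 1" "y = (1 - t) *R x + t *R rf al x"
   unfolding closed_segment_def by blast
  have "norm y <= norm ((1 - t) *R x) + norm (t *R rf al x)"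
   unfolding t(3) by (rule norm_triangle_ineq)
  also have "... = norm x"
   using t by (simp only: norm_scaleR G_norm[OF refl_in_G[OF a]] abs_of_nonneg diff_ge_0_iff_ge) (simp add: algebra_simps)
  finally show "norm (f' y u) <= B * norm u" by (rule B)
 qed
 have "norm (T v f x) <= norm (f' x v) + (SUM al:R. norm ((k al / 2 * (al \<cdot> v)) *R
  (if al \<cdot> x = 0 then f' x al else (f x - f (rf al x)) /R (al \<cdot> x))))"
  unfolding T_at[OF f'] by (intro order_trans[OF norm_triangle_ineq] add_mono order_refl norm_sum)
 also have "... <= B * norm v + (SUM al:R. k al * (2 * (B * norm v)))"
 proof (intro add_mono B sum_mono order_refl)
  fix al assume a: "al \<in> R"
  have "norm (if al \<cdot> x = 0 then f' x al else (f x - f (rf al x)) /R (al \<cdot> x)) <= 2 * B"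
  proof (cases "al \<cdot> x = 0")
   case True
   have "sqrt 2 <= 2" by (rule real_le_lsqrt) auto
   then show ?thesis using True order_trans[OF B[OF order_refl, of al] mult_left_mono[OF _ B0, of "norm al" 2]]
    by (simp add: norm_root[OF a] mult.commute)
  next
   case False
   then show ?thesis using seg[OF a] by (simp add: divide_simps)
  qed
  moreover have "\<bar>al \<cdot> v\<bar> <= 2 * norm v" using inner_root_le[OF a, of v] by (simp add: inner_commute)
  ultimately have "(k al / 2 * \<bar>al \<cdot> v\<bar>) * norm (if al \<cdot> x = 0 then f' x al else (f x - f (rf al x)) /R (al \<cdot> x))
    <= (k al / 2 * (2 * norm v)) * (2 * B)"
   using a by (intro mult_mono mult_left_mono) auto
  then show "norm ((k al / 2 * (al \<cdot> v)) *R
   (if al \<cdot> x = 0 then f' x al else (f x - f (rf al x)) /R (al \<cdot> x))) <= k al * (2 * (B * norm v))"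
   using a by (simp only: norm_scaleR abs_mult abs_divide abs_of_nonneg k_nonneg) (simp add: mult_ac)
 qed
 also have "... = (1 + 2 * sk) * (B * norm v)"
  unfolding sk_def sum_distrib_right[symmetric] by (simp add: algebra_simps)
 finally show "norm (T v f x) <= (1 + 2 * sk) * (B * norm v)" .
qed

text \<open>A factor invariant under the reflections passes through the difference part. On a
  mirror, where the quotient is a derivative, \<open>perp\<close> removes the extra term.\<close>

lemma T_mult_inv:
 assumes \<psi>: "(\<psi> has_derivative \<psi>') (at x)" and f: "(f has_derivative f') (at x)"
  and inv: "!!al. al \<in> R ==> \<psi> (rf al x) = \<psi> x"
  and perp: "!!al. al \<in> R ==> al \<cdot> x = 0 ==> \<psi>' al = 0"
 shows "T v (%x. \<psi> x * f x) x = \<psi> x * T v f x + \<psi>' v * f x"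
proof -
 have "(SUM al:R. (k al / 2 * (al \<cdot> v)) *R (if al \<cdot> x = 0 then \<psi> x * f' al + \<psi>' al * f x
   else (\<psi> x * f x - \<psi> (rf al x) * f (rf al x)) /R (al \<cdot> x)))
  = \<psi> x * (SUM al:R. (k al / 2 * (al \<cdot> v)) *R (if al \<cdot> x = 0 then f' al
   else (f x - f (rf al x)) /R (al \<cdot> x)))"
  unfolding sum_distrib_left
 proof (intro sum.cong refl)
  fix al assume a: "al \<in> R"
  show "(k al / 2 * (al \<cdot> v)) *R (if al \<cdot> x = 0 then \<psi> x * f' al + \<psi>' al * f x
   else (\<psi> x * f x - \<psi> (rf al x) * f (rf al x)) /R (al \<cdot> x))
   = \<psi> x * ((k al / 2 * (al \<cdot> v)) *R (if al \<cdot> x = 0 then f' al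
   else (f x - f (rf al x)) /R (al \<cdot> x)))"
  proof (cases "al \<cdot> x = 0")
   case True
   then show ?thesis using perp[OF a True] by simp
  next
   case False
   have "\<psi> x * f x - \<psi> x * f (rf al x) = \<psi> x * (f x - f (rf al x))"
    by (simp add: right_diff_distrib)
   then show ?thesis using False by (simp only: if_False inv[OF a] mult_scaleR_right)
  qed
 qed
 then show ?thesis
  unfolding T_at[OF f] T_at[OF has_derivative_mult[OF \<psi> f]] by (simp only: distrib_left add_ac)
qed

text \<open>The failure of the product rule is a product of two differences over
  \<open>al \<cdot> x\<close>. It is odd under the reflection and therefore integrates to zero in
  \<open>T_skew\<close>.\<close>

lemma T_leibniz_defect:
 assumes f: "(f has_derivative f') (at x)" and g: "(g has_derivative g') (at x)"
 shows "T v f x * g x + f x * T v g x = T v (%x. f x * g x) x + (SUM al:R. (k al / 2 * (al \<cdot> v)) *R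
   (if al \<cdot> x = 0 then 0 else ((f x - f (rf al x)) * (g x - g (rf al x))) /R (al \<cdot> x)))"
proof -
 let ?q = "%f f' al. if al \<cdot> x = 0 then f' al else (f x - f (rf al x)) /R (al \<cdot> x)"
 have "(SUM al:R. (k al / 2 * (al \<cdot> v)) *R ?q f f' al) * g x + f x * (SUM al:R. (k al / 2 * (al \<cdot> v)) *R ?q g g' al)
   = (SUM al:R. (k al / 2 * (al \<cdot> v)) *R (if al \<cdot> x = 0 then f x * g' al + f' al * g x
     else (f x * g x - f (rf al x) * g (rf al x)) /R (al \<cdot> x)))
   + (SUM al:R. (k al / 2 * (al \<cdot> v)) *R
   (if al \<cdot> x = 0 then 0 else ((f x - f (rf al x)) * (g x - g (rf al x))) /R (al \<cdot> x)))"
  unfolding sum_distrib_left sum_distrib_right sum.distrib[symmetric]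
 proof (intro sum.cong refl)
  fix al assume "al \<in> R"
  have *: "c *R (r *R A) * G' + F * c *R (r *R B) = c *R (r *R P) + c *R (r *R Q)"
   if "A * G' + F * B = P + Q" for A B P Q G' F :: complex and c r :: real
   unfolding mult_scaleR_left mult_scaleR_right scaleR_add_right[symmetric] that ..
  show "(k al / 2 * (al \<cdot> v)) *R ?q f f' al * g x + f x * (k al / 2 * (al \<cdot> v)) *R ?q g g' al
   = (k al / 2 * (al \<cdot> v)) *R (if al \<cdot> x = 0 then f x * g' al + f' al * g x
     else (f x * g x - f (rf al x) * g (rf al x)) /R (al \<cdot> x))
   + (k al / 2 * (al \<cdot> v)) *R
   (if al \<cdot> x = 0 then 0 else ((f x - f (rf al x)) * (g x - g (rf al x))) /R (al \<cdot> x))"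
  proof (cases "al \<cdot> x = 0")
   case True
   then show ?thesis by (simp add: scaleR_add_right)
  next
   case False
   show ?thesis unfolding if_not_P[OF False] by (rule *) (simp add: algebra_simps)
  qed
 qed
 then show ?thesis
  unfolding T_at[OF f] T_at[OF g] T_at[OF has_derivative_mult[OF f g]]
  by (simp only: distrib_left distrib_right add_ac)
qed

text \<open>\<open>T_integral_zero\<close> disposes of the operator applied to the product and
  oddness of the Leibniz defect. The exponentials allow \<open>f\<close> to be a kernel with real
  exponents while \<open>g\<close> carries a Gaussian; \<open>c = 0\<close> is the bounded
  case.\<close>

lemma T_skew:
 fixes f g :: "real^'n => complex"
 assumes f': "!!x. (f has_derivative f' x) (at x)" and g': "!!x. (g has_derivative g' x) (at x)"
  and f: "!!x. norm (f x) <= A * exp (c * norm x)"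
  and fb: "!!x u. norm (f' x u) <= A * exp (c * norm x) * norm u"
  and g: "!!x. norm (g x) <= C * exp (- c * norm x) / (1 + norm x) ^ Nd"
  and gb: "!!x u. norm (g' x u) <= C * exp (- c * norm x) * norm u / (1 + norm x) ^ Nd"
  and c: "0 <= c"
 shows "integrable dw (%x. T v f x * g x)" and "integrable dw (%x. f x * T v g x)"
  and "(LINT x|dw. T v f x * g x) = - (LINT x|dw. f x * T v g x)"
proof -
 have A: "0 <= A" using order_trans[OF norm_ge_zero f[of 0]] by simp
 have C: "0 <= C" using order_trans[OF norm_ge_zero g[of 0]] by simp
 have p: "0 < (1 + norm x) ^ Nd" for x :: "real^'n" by (simp add: add_pos_nonneg)
 have cont: "continuous_on UNIV f" "continuous_on UNIV g"
  by (intro continuous_at_imp_continuous_on ballI has_derivative_continuous[OF f'] has_derivative_continuous[OF g'])+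
 have fm: "f \<in> BM" and gm: "g \<in> BM"
  by (intro cont_BM cont)+
 have fb': "norm (f' y u) <= A * exp (c * norm x) * norm u" if "norm y <= norm x" for x y u
  using that c A by (intro order_trans[OF fb] mult_right_mono mult_left_mono) (auto intro: mult_left_mono)
 have e1: "exp (c * norm x) * (exp (- c * norm x) * u) = u" for x :: "real^'n" and u
  by (simp add: exp_minus)
 have prod: "norm a * norm b <= (K * C) / (1 + norm x) ^ Nd"
  if "norm a <= K * exp (c * norm x)" "norm b <= C * exp (- c * norm x) / (1 + norm x) ^ Nd" "0 <= K" for a b :: complex and K and x :: "real^'n"
 proof -
  have "norm a * norm b <= (K * exp (c * norm x)) * (C * exp (- c * norm x) / (1 + norm x) ^ Nd)"
   using that by (intro mult_mono) auto
  also have "... = (K * C) * (exp (c * norm x) * (exp (- c * norm x) * (1 / (1 + norm x) ^ Nd)))" by simp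
  finally show ?thesis unfolding e1 by simp
 qed
 have Tf: "norm (T v f x) <= ((1 + 2 * sk) * A * norm v) * exp (c * norm x)" for x
 proof -
  have "norm (T v f x) <= (1 + 2 * sk) * ((A * exp (c * norm x)) * norm v)"
   by (rule T_bound(1)[OF f' fb']) (use A in simp_all)
  then show ?thesis by (simp only: mult_ac)
 qed
 show i1: "integrable dw (%x. T v f x * g x)"
 proof (rule integrable_decay)
  show "(%x. T v f x * g x) \<in> BM"
   by (intro borel_measurable_times T_measurable[OF f'] gm)
  show "norm (T v f x * g x) <= ((1 + 2 * sk) * A * norm v * C) / (1 + norm x) ^ Nd" for x
   unfolding norm_mult using A by (intro prod Tf g mult_nonneg_nonneg add_nonneg_nonneg) auto
 qed
 have fg': "((%x. f x * g x) has_derivative (%u. f x * g' x u + f' x u * g x)) (at x)" for x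
  by (rule has_derivative_mult[OF f' g'])
 have fg1: "norm (f x * g x) <= (2 * A * C) / (1 + norm x) ^ Nd" for x
 proof -
  have "norm (f x) * norm (g x) <= (A * C) / (1 + norm x) ^ Nd" by (rule prod[OF f g A])
  also have "... <= (2 * A * C) / (1 + norm x) ^ Nd" using A C p[of x] by (intro divide_right_mono) auto
  finally show ?thesis by (simp add: norm_mult)
 qed
 have fg2: "norm (f x * g' x u + f' x u * g x) <= (2 * A * C) * norm u / (1 + norm x) ^ Nd" for x u
 proof -
  have "norm (f x) * norm (g' x u) <= (A * exp (c * norm x)) * (C * exp (- c * norm x) * norm u / (1 + norm x) ^ Nd)"
   using A by (intro mult_mono f gb) auto
  also have "... = (A * C) * (exp (c * norm x) * (exp (- c * norm x) * (norm u / (1 + norm x) ^ Nd)))" by simp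
  finally have 1: "norm (f x * g' x u) <= (A * C) * (norm u / (1 + norm x) ^ Nd)" unfolding e1 norm_mult .
  have "norm (f' x u) * norm (g x) <= ((A * norm u) * C) / (1 + norm x) ^ Nd"
   by (rule prod[OF _ g]) (use fb[of x u] A in \<open>simp_all add: mult_ac\<close>)
  then have 2: "norm (f' x u * g x) <= (A * C) * (norm u / (1 + norm x) ^ Nd)" by (simp add: norm_mult mult_ac)
  have "norm (f x * g' x u + f' x u * g x) <= (A * C) * (norm u / (1 + norm x) ^ Nd) + (A * C) * (norm u / (1 + norm x) ^ Nd)"
   by (rule order_trans[OF norm_triangle_ineq add_mono[OF 1 2]])
  then show ?thesis by simp
 qed
 note fg = T_integral_zero[OF fg' fg1 fg2, of v]
 define Od where "Od al x = (if al \<cdot> x = 0 then 0 else ((f x - f (rf al x)) * (g x - g (rf al x))) /R (al \<cdot> x))" for al x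
 have Om: "Od al \<in> BM" if "al \<in> R" for al
 proof -
  have s: "{x \<in> space borel. al \<cdot> x = 0} \<in> sets borel" by measurable
  have im: "(%x::real^'n. al \<cdot> x) \<in> BM" by measurable
  note r = G_measurable[OF refl_in_G[OF that]]
  show ?thesis unfolding Od_def
   by (intro measurable_If s borel_measurable_const borel_measurable_scaleR borel_measurable_inverse im borel_measurable_times
     borel_measurable_diff fm gm measurable_compose[OF r fm] measurable_compose[OF r gm])
 qed
 have Oi: "integrable dw (Od al)" if a: "al \<in> R" for al
 proof (rule integrable_decay[OF Om[OF a]])
  fix x
  show "norm (Od al x) <= (2 * A * (2 * C)) / (1 + norm x) ^ Nd"
  proof (cases "al \<cdot> x = 0")
   case True
   then show ?thesis using A C p[of x] by (simp add: Od_def)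
  next
   case False
   have "norm (f x - f (rf al x)) <= 2 * (A * exp (c * norm x)) * \<bar>al \<cdot> x\<bar>"
    using A by (intro T_bound(2)[OF f' fb' _ a]) auto
   then have 1: "norm ((f x - f (rf al x)) /R (al \<cdot> x)) <= (2 * A) * exp (c * norm x)"
    using False by (simp add: divide_simps)
   have "norm (g x - g (rf al x)) <= 2 * (C * exp (- c * norm x) / (1 + norm x) ^ Nd)"
    using norm_triangle_ineq4[of "g x" "g (rf al x)"] g[of x] g[of "rf al x"]
     G_norm[OF refl_in_G[OF a], of x] by simp
   then have 2: "norm ((g x - g (rf al x)) / 2) <= C * exp (- c * norm x) / (1 + norm x) ^ Nd"
    by (simp only: norm_divide norm_numeral)
   have "norm (Od al x) = 2 * (norm ((f x - f (rf al x)) /R (al \<cdot> x)) * norm ((g x - g (rf al x)) / 2))"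
    using False by (simp add: Od_def norm_mult norm_divide)
   also have "... <= 2 * (((2 * A) * C) / (1 + norm x) ^ Nd)"
    using A by (intro mult_left_mono prod[OF 1 2]) auto
   finally show ?thesis by simp
  qed
 qed
 have O0: "(LINT x|dw. Od al x) = 0" if a: "al \<in> R" for al
 proof -
  have "Od al (rf al x) = - Od al x" for x
   unfolding Od_def by (simp add: refl_inner_root[OF a] refl_refl[OF a]) (simp add: algebra_simps)
  then have "(LINT x|dw. Od al x) = - (LINT x|dw. Od al x)"
   using integral_dw_G[OF refl_in_G[OF a] Om[OF a]] by simp
  then have "2 * (LINT x|dw. Od al x) = 0" by (simp only: mult_2 add_eq_0_iff)
  then show ?thesis by simp
 qed
 have eq: "f x * T v g x = (T v (%x. f x * g x) x + (SUM al:R. (k al / 2 * (al \<cdot> v)) *R Od al x)) - T v f x * g x" for x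
  using T_leibniz_defect[OF f' g', of v x] unfolding Od_def[symmetric] by (simp add: algebra_simps)
 have iO: "integrable dw (%x. (k al / 2 * (al \<cdot> v)) *R Od al x)" if "al \<in> R" for al
  by (intro integrable_scaleR_right Oi that)
 have iS: "integrable dw (%x. SUM al:R. (k al / 2 * (al \<cdot> v)) *R Od al x)"
  by (rule integrable_sum[OF iO])
 have S0: "(LINT x|dw. (SUM al:R. (k al / 2 * (al \<cdot> v)) *R Od al x)) = 0"
  by (subst integral_sum[OF iO], assumption) (simp add: O0)
 show "integrable dw (%x. f x * T v g x)"
  unfolding eq by (intro integrable_diff integrable_add fg(1) iS i1)
 have "(LINT x|dw. f x * T v g x) = (LINT x|dw. T v (%x. f x * g x) x) + (LINT x|dw. (SUM al:R. (k al / 2 * (al \<cdot> v)) *R Od al x))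
   - (LINT x|dw. T v f x * g x)"
  unfolding eq by (simp only: integral_diff[OF integrable_add[OF fg(1) iS] i1]
    integral_add[OF fg(1) iS])
 then show "(LINT x|dw. T v f x * g x) = - (LINT x|dw. f x * T v g x)"
  unfolding fg(2) S0 by simp
qed

text \<open>The difference part passes through the integral by linearity; the domination serves the
  derivative part.\<close>

lemma T_LINT:
 fixes f :: "real^'n => 'z => complex"
 assumes f': "!!p z. z \<in> space M ==> ((%p. f p z) has_derivative f' p z) (at p)"
  and int: "!!p. integrable M (f p)"
  and bound: "!!p z v. p \<in> ball x 1 ==> z \<in> space M ==> norm (f' p z v) <= g z * norm v"
  and g: "integrable M g"
 shows "((%p. LINT z|M. f p z) has_derivative (%v. LINT z|M. f' x z v)) (at x)"
  and "T v (%p. LINT z|M. f p z) x = (LINT z|M. T v (%p. f p z) x)"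
proof -
 have i: "integrable M (%z. f' x z u)" for u
  by (rule has_derivative_LINT(1)[OF zero_less_one f' int bound g])
 show d: "((%p. LINT z|M. f p z) has_derivative (%v. LINT z|M. f' x z v)) (at x)"
  by (rule has_derivative_LINT(2)[OF zero_less_one f' int bound g])
 let ?q = "%al z. if al \<cdot> x = 0 then f' x z al else (f x z - f (rf al x) z) /R (al \<cdot> x)"
 have qi: "integrable M (?q al)" for al
  using i int by (cases "al \<cdot> x = 0") simp_all
 have qL: "(LINT z|M. ?q al z) = (if al \<cdot> x = 0 then (LINT z|M. f' x z al)
   else ((LINT z|M. f x z) - (LINT z|M. f (rf al x) z)) /R (al \<cdot> x))" for al
  using int by (cases "al \<cdot> x = 0") simp_all
 have iq: "integrable M (%z. (k al / 2 * (al \<cdot> v)) *R ?q al z)" for al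
  by (intro integrable_scaleR_right qi)
 have "(LINT z|M. T v (%p. f p z) x) = (LINT z|M. f' x z v + (SUM al:R. (k al / 2 * (al \<cdot> v)) *R ?q al z))"
  by (intro integral_cong refl) (simp only: T_at[OF f'])
 also have "... = (LINT z|M. f' x z v) + (SUM al:R. (k al / 2 * (al \<cdot> v)) *R (LINT z|M. ?q al z))"
  by (simp only: integral_add[OF i integrable_sum[OF iq]]
    integral_sum[OF iq] integral_scaleR_right)
 also have "... = T v (%p. LINT z|M. f p z) x"
  unfolding T_at[OF d] qL ..
 finally show "T v (%p. LINT z|M. f p z) x = (LINT z|M. T v (%p. f p z) x)" ..
qed

end

section \<open>Gaussian integrals and the heat kernel\<close>

context dunkl begin

definition gs :: "real^'n => real" where "gs z = exp (- (norm z)\<^sup>2 / 2)"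

lemma gs_pos [simp]: "0 < gs z"
 by (simp add: gs_def)

lemma gs_cont: "continuous_on S gs"
 unfolding gs_def by (intro continuous_intros) auto

lemma gs_measurable [measurable]: "gs \<in> BM"
 by (rule cont_BM[OF gs_cont])

lemma cgauss_has_derivative:
 "((%a. exp (c * of_real ((norm a)^2) :: complex)) has_derivative
   (%v. exp (c * of_real ((norm a)^2)) * (2 * c * of_real (a \<cdot> v)))) (at a)"
proof -
 have "((%a. c * of_real (a \<cdot> a) :: complex) has_derivative (%v. 2 * c * of_real (a \<cdot> v))) (at a)"
  by (auto intro!: derivative_eq_intros simp: inner_commute algebra_simps)
 from has_derivative_compose[OF this DERIV_exp[unfolded has_field_derivative_def]]
 show ?thesis by (simp add: power2_norm_eq_inner)
qed

lemma gs_exp: "complex_of_real (gs z) = exp (- (1/2) * of_real ((norm z)^2))"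
 by (simp add: gs_def exp_of_real[symmetric])

lemma gs_has_derivative: "((%z. complex_of_real (gs z)) has_derivative (%v. - of_real (gs z * (z \<cdot> v)))) (at z)"
 using cgauss_has_derivative[of "- (1/2)" z] unfolding gs_exp[symmetric] by simp

lemma gauss_dom: "EX K>0. ALL z. (1 + norm z) ^ m * exp (c * norm z) * gs z <= K * exp (- d * norm z) / (1 + norm (z :: real^'n)) ^ Nd"
proof -
 obtain K where K: "K > 0" "ALL r>=0. (1 + r) ^ (m + Nd) * exp ((c + d) * r - 1/2 * r^2) <= K"
  using gauss_bound[of "1/2" "m + Nd" "c + d"] by auto
 have "(1 + norm z) ^ m * exp (c * norm z) * gs z <= K * exp (- d * norm z) / (1 + norm z) ^ Nd" for z :: "real^'n"
 proof -
  have p: "0 < (1 + norm z) ^ Nd" by (simp add: add_pos_nonneg)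
  have "(1 + norm z) ^ m * exp (c * norm z) * gs z * (1 + norm z) ^ Nd
   = ((1 + norm z) ^ (m + Nd) * exp ((c + d) * norm z - 1/2 * (norm z)^2)) * exp (- d * norm z)"
   by (simp add: gs_def power_add mult_exp_exp mult.assoc algebra_simps)
  also have "... <= K * exp (- d * norm z)" using K(2) by (intro mult_right_mono) auto
  finally show ?thesis using p by (simp add: pos_le_divide_eq)
 qed
 then show ?thesis using K(1) by blast
qed

lemma integrable_gauss_real:
 fixes f :: "real^'n => real"
 assumes "f \<in> BM" "!!z. \<bar>f z\<bar> <= A * ((1 + norm z) ^ m * exp (c * norm z))"
 shows "integrable dw (%z. f z * gs z)"
proof -
 obtain K where K: "!!z::real^'n. (1 + norm z) ^ m * exp (c * norm z) * gs z <= K * exp (- 0 * norm z) / (1 + norm z) ^ Nd"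
  using gauss_dom[of m c 0] by blast
 have A: "0 <= A" using order_trans[OF abs_ge_zero assms(2)[of 0]] by simp
 show ?thesis
 proof (rule integrable_decay_real)
  show "(%z. f z * gs z) \<in> BM" using assms(1) by measurable
  fix z :: "real^'n"
  have "\<bar>f z * gs z\<bar> <= A * ((1 + norm z) ^ m * exp (c * norm z)) * gs z"
   unfolding abs_mult using assms(2)[of z] by (simp add: mult_right_mono less_imp_le)
  also have "... = A * ((1 + norm z) ^ m * exp (c * norm z) * gs z)" by simp
  also have "... <= A * (K * exp (- 0 * norm z) / (1 + norm z) ^ Nd)" by (rule mult_left_mono[OF K A])
  finally show "\<bar>f z * gs z\<bar> <= (A * K) / (1 + norm z) ^ Nd" by simp
 qed
qed

lemma integrable_gauss:
 fixes f :: "real^'n => complex"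
 assumes "f \<in> BM" "!!z. norm (f z) <= A * ((1 + norm z) ^ m * exp (c * norm z))"
 shows "integrable dw (%z. f z * of_real (gs z))"
proof (rule integrable_bound)
 show "integrable dw (%z. norm (f z) * gs z)"
  using assms by (intro integrable_gauss_real[where A = A and m = m and c = c]) auto
 show "(%z. f z * of_real (gs z)) \<in> borel_measurable dw" unfolding meas_dw using assms(1) by measurable
qed (simp add: norm_mult)

lemma Ek_measurable: "(%z. Ek th z a) \<in> BM"
 by (intro cont_BM Ek_continuous continuous_intros)

lemma T_Ek_gauss:
 "T xi (%z. of_real (gs z) * Ek th z b) z = of_real (gs z) * ((th * of_real (xi \<cdot> b) - of_real (xi \<cdot> z)) * Ek th z b)"
proof -
 have "T xi (%z. of_real (gs z) * Ek th z b) z = of_real (gs z) * T xi (%z. Ek th z b) z + - of_real (gs z * (z \<cdot> xi)) * Ek th z b"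
 proof (rule T_mult_inv[OF gs_has_derivative Ek_has_derivative])
  fix al assume a: "al \<in> R"
  show "complex_of_real (gs (rf al z)) = of_real (gs z)"
   using G_norm[OF refl_in_G[OF a], of z] by (simp add: gs_def)
  show "al \<cdot> z = 0 ==> - complex_of_real (gs z * (z \<cdot> al)) = 0" by (simp add: inner_commute)
 qed
 then show ?thesis by (simp add: T_Ek inner_commute algebra_simps)
qed

definition gJ :: "complex => real^'n => complex => real^'n => complex" where
 "gJ th a th' b = (LINT z|dw. Ek th z a * Ek th' z b * of_real (gs z))"

lemma EE_bound: "norm (Ek th z a * Ek th' z b) <= exp ((norm th * norm a + norm th' * norm b) * norm z)"
proof -
 have "norm (Ek th z a * Ek th' z b) <= exp (norm th * norm z * norm a) * exp (norm th' * norm z * norm b)"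
  unfolding norm_mult by (intro mult_mono Ek_le_norm) auto
 also have "... = exp ((norm th * norm a + norm th' * norm b) * norm z)"
  by (simp add: mult_exp_exp algebra_simps)
 finally show ?thesis .
qed

lemma gJ_integrable: "integrable dw (%z. Ek th z a * Ek th' z b * of_real (gs z))"
 by (rule integrable_gauss[where A = 1 and m = 0 and c = "norm th * norm a + norm th' * norm b"])
  (use EE_bound in \<open>auto intro!: borel_measurable_times Ek_measurable\<close>)

lemma gJ_integrable1: "integrable dw (%z. of_real (xi \<cdot> z) * (Ek th z a * Ek th' z b) * of_real (gs z))"
proof (rule integrable_gauss[where A = "norm xi" and m = 1 and c = "norm th * norm a + norm th' * norm b"])
 show "(%z. complex_of_real (xi \<cdot> z) * (Ek th z a * Ek th' z b)) \<in> BM"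
  by (intro borel_measurable_times Ek_measurable) measurable
 fix z
 have "\<bar>xi \<cdot> z\<bar> <= norm xi * (1 + norm z)"
  using Cauchy_Schwarz_ineq2[of xi z] mult_left_mono[of "norm z" "1 + norm z" "norm xi"] by simp
 then have "\<bar>xi \<cdot> z\<bar> * norm (Ek th z a * Ek th' z b) <= (norm xi * (1 + norm z)) * exp ((norm th * norm a + norm th' * norm b) * norm z)"
  using EE_bound[of th z a th' b] by (intro mult_mono) auto
 then show "norm (complex_of_real (xi \<cdot> z) * (Ek th z a * Ek th' z b)) <= norm xi * ((1 + norm z) ^ 1 * exp ((norm th * norm a + norm th' * norm b) * norm z))"
  by (simp add: norm_mult mult.assoc)
qed

lemma gJ_derivative:
 "(%p. gJ th p th' b) differentiable (at a)"
 "T xi (%p. gJ th p th' b) a = th * (LINT z|dw. of_real (xi \<cdot> z) * (Ek th z a * Ek th' z b) * of_real (gs z))"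
proof -
 let ?C = "%z. Ek th' z b * of_real (gs z)"
 let ?c = "norm th' * norm b + norm th * (norm a + 1)"
 have J: "gJ th p th' b = (LINT z|dw. ?C z * Ek th p z)" for p
  unfolding gJ_def by (intro integral_cong refl) (simp add: Ek_sym[of th _ p] mult_ac)
 have bd: "norm (?C z * dEk th p z v) <= (3 * norm th * ((1 + norm z) * exp (?c * norm z)) * gs z) * norm v"
  if p: "p \<in> ball a 1" for p z v
 proof -
  have "norm p <= norm a + 1" using p norm_triangle_sub[of p a] by (simp add: dist_norm norm_minus_commute)
  then have "norm th * norm p * norm z <= norm th * (norm a + 1) * norm z" by (intro mult_right_mono mult_left_mono) auto
  then have "norm (dEk th p z v) <= 3 * (norm th * norm v * norm z) * exp (norm th * (norm a + 1) * norm z)"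
   using dEk_le_norm[of th p z v] by (smt (verit) exp_le_cancel_iff mult_left_mono mult_nonneg_nonneg norm_ge_zero)
  moreover have "norm (Ek th' z b) <= exp (norm th' * norm z * norm b)" by (rule Ek_le_norm)
  ultimately have "norm (Ek th' z b) * norm (dEk th p z v) <= exp (norm th' * norm z * norm b) *
    (3 * (norm th * norm v * norm z) * exp (norm th * (norm a + 1) * norm z))"
   by (intro mult_mono) auto
  also have "... = (3 * (norm th * norm v)) * (norm z * (exp (norm th' * norm z * norm b) * exp (norm th * (norm a + 1) * norm z)))"
   by simp
  also have "exp (norm th' * norm z * norm b) * exp (norm th * (norm a + 1) * norm z) = exp (?c * norm z)"
   by (simp add: mult_exp_exp algebra_simps)
  also have "(3 * (norm th * norm v)) * (norm z * exp (?c * norm z)) <= (3 * (norm th * norm v)) * ((1 + norm z) * exp (?c * norm z))"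
   by (intro mult_left_mono mult_right_mono) auto
  finally have "norm (Ek th' z b) * norm (dEk th p z v) * gs z <= (3 * (norm th * norm v)) * ((1 + norm z) * exp (?c * norm z)) * gs z"
   by (intro mult_right_mono) (auto intro: less_imp_le)
  then show ?thesis by (simp add: norm_mult abs_of_pos mult_ac)
 qed
 have gi: "integrable dw (%z. 3 * norm th * ((1 + norm z) * exp (?c * norm z)) * gs z)"
  by (rule integrable_gauss_real[where A = "3 * norm th" and m = 1 and c = ?c]) auto
 have ii: "integrable dw (%z. ?C z * Ek th p z)" for p
  using gJ_integrable[of th p th' b] by (simp add: Ek_sym[of th _ p] mult_ac)
 note TL = T_LINT[where f = "%p z. ?C z * Ek th p z" and f' = "%p z v. ?C z * dEk th p z v" and x = a,
   OF has_derivative_mult_right[OF Ek_has_derivative] ii bd gi]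
 show "(%p. gJ th p th' b) differentiable (at a)"
  unfolding J by (rule differentiableI[OF TL(1)])
 have "T xi (%p. gJ th p th' b) a = (LINT z|dw. T xi (%p. ?C z * Ek th p z) a)"
  unfolding J by (rule TL(2))
 also have "... = (LINT z|dw. th * (of_real (xi \<cdot> z) * (Ek th z a * Ek th' z b) * of_real (gs z)))"
  by (intro integral_cong refl)
   (simp only: T_cmul[OF differentiableI[OF Ek_has_derivative]] T_Ek Ek_sym[of th a], simp only: mult_ac)
 finally show "T xi (%p. gJ th p th' b) a = th * (LINT z|dw. of_real (xi \<cdot> z) * (Ek th z a * Ek th' z b) * of_real (gs z))"
  by simp
qed

text \<open>Multiplying the Gaussian by \<open>xi \<cdot> z\<close> is, up to sign, applying
  \<open>T xi\<close> to it. Skewness moves the operator to the two kernels, which are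
  eigenfunctions.\<close>

lemma gJ_ibp:
 "(LINT z|dw. of_real (xi \<cdot> z) * (Ek th z a * Ek th' z b) * of_real (gs z))
  = (th * of_real (xi \<cdot> a) + th' * of_real (xi \<cdot> b)) * gJ th a th' b"
proof -
 let ?c = "norm th * norm a"
 let ?c' = "norm th' * norm b"
 obtain K where K: "K > 0" "!!z::real^'n. (1 + norm z) ^ 1 * exp (?c' * norm z) * gs z <= K * exp (- ?c * norm z) / (1 + norm z) ^ Nd"
  using gauss_dom[of 1 ?c' ?c] by blast
 let ?f = "%z. Ek th z a" and ?g = "%z. of_real (gs z) * Ek th' z b"
 let ?A = "1 + 3 * (norm th * norm a)" and ?B = "(1 + 3 * (norm th' * norm b)) * K"
 have skew: "(LINT z|dw. T xi ?f z * ?g z) = - (LINT z|dw. ?f z * T xi ?g z)"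
 proof (rule T_skew(3)[where A = ?A and c = ?c and C = ?B])
  fix z u :: "real^'n"
  show "(?f has_derivative dEk th z a) (at z)" by (rule Ek_has_derivative)
  show "(?g has_derivative (%v. of_real (gs z) * dEk th' z b v + - of_real (gs z * (z \<cdot> v)) * Ek th' z b)) (at z)"
   by (rule has_derivative_mult[OF gs_has_derivative Ek_has_derivative])
  have "norm (?f z) <= 1 * exp (?c * norm z)" using Ek_le_norm[of th z a] by (simp add: mult_ac)
  also have "... <= ?A * exp (?c * norm z)" by (intro mult_right_mono) auto
  finally show "norm (?f z) <= ?A * exp (?c * norm z)" .
  have "norm (dEk th z a u) <= (3 * (norm th * norm a)) * exp (?c * norm z) * norm u"
   using dEk_le_norm[of th z a u] by (simp add: mult_ac)
  also have "... <= ?A * exp (?c * norm z) * norm u" by (intro mult_right_mono) auto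
  finally show "norm (dEk th z a u) <= ?A * exp (?c * norm z) * norm u" .
  have E: "norm (Ek th' z b) <= exp (?c' * norm z)" using Ek_le_norm[of th' z b] by (simp add: mult_ac)
  have D: "norm (dEk th' z b u) <= 3 * ?c' * norm u * exp (?c' * norm z)"
   using dEk_le_norm[of th' z b u] by (simp add: mult_ac)
  have p: "0 < (1 + norm z) ^ Nd" by (simp add: add_pos_nonneg)
  have KB: "K <= ?B" using mult_right_mono[of 1 "1 + 3 * (norm th' * norm b)" K] K(1) by simp
  have K': "(1 + norm z) * exp (?c' * norm z) * gs z <= K * exp (- ?c * norm z) / (1 + norm z) ^ Nd" using K(2)[of z] by simp
  have "gs z * norm (Ek th' z b) <= gs z * exp (?c' * norm z)" by (intro mult_left_mono E less_imp_le gs_pos)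
  also have "... = 1 * exp (?c' * norm z) * gs z" by simp
  also have "... <= (1 + norm z) * exp (?c' * norm z) * gs z" by (intro mult_right_mono) (simp_all add: less_imp_le)
  also note K'
  also have "K * exp (- ?c * norm z) / (1 + norm z) ^ Nd <= ?B * exp (- ?c * norm z) / (1 + norm z) ^ Nd"
   by (rule divide_right_mono[OF mult_right_mono[OF KB exp_ge_zero] less_imp_le[OF p]])
  finally show "norm (?g z) <= ?B * exp (- ?c * norm z) / (1 + norm z) ^ Nd" by (simp add: norm_mult abs_of_pos)
  have "norm (of_real (gs z) * dEk th' z b u + - of_real (gs z * (z \<cdot> u)) * Ek th' z b)
   <= gs z * norm (dEk th' z b u) + gs z * \<bar>z \<cdot> u\<bar> * norm (Ek th' z b)"
   by (rule order_trans[OF norm_triangle_ineq]) (simp add: norm_mult abs_mult abs_of_pos)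
  also have "... <= gs z * (3 * ?c' * norm u * exp (?c' * norm z)) + gs z * (norm z * norm u) * exp (?c' * norm z)"
   using Cauchy_Schwarz_ineq2[of z u] by (intro add_mono mult_mono mult_left_mono D E less_imp_le[OF gs_pos])
    (auto intro!: mult_nonneg_nonneg less_imp_le[OF gs_pos])
  also have "... = (3 * ?c' + norm z) * (exp (?c' * norm z) * gs z) * norm u" by (simp add: algebra_simps)
  also have "... <= (1 + 3 * ?c') * ((1 + norm z) * exp (?c' * norm z) * gs z) * norm u"
  proof -
   have "3 * ?c' + norm z <= (1 + 3 * ?c') * (1 + norm z)" by (simp add: algebra_simps)
   then have "(3 * ?c' + norm z) * (exp (?c' * norm z) * gs z) <= ((1 + 3 * ?c') * (1 + norm z)) * (exp (?c' * norm z) * gs z)"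
    by (rule mult_right_mono) (auto intro: less_imp_le)
   then show ?thesis by (intro mult_right_mono) (simp_all add: mult.assoc)
  qed
  also have "... <= (1 + 3 * ?c') * (K * exp (- ?c * norm z) / (1 + norm z) ^ Nd) * norm u"
   by (intro mult_right_mono mult_left_mono K') auto
  finally show "norm (of_real (gs z) * dEk th' z b u + - of_real (gs z * (z \<cdot> u)) * Ek th' z b)
    <= ?B * exp (- ?c * norm z) * norm u / (1 + norm z) ^ Nd" by (simp add: mult_ac)
 qed auto
 let ?P = "%z. Ek th z a * Ek th' z b * of_real (gs z)"
 let ?Q = "%z. of_real (xi \<cdot> z) * (Ek th z a * Ek th' z b) * of_real (gs z)"
 have "(LINT z|dw. T xi ?f z * ?g z) = (LINT z|dw. (th * of_real (xi \<cdot> a)) * ?P z)"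
  by (intro integral_cong refl) (simp add: T_Ek mult_ac)
 also have "... = (th * of_real (xi \<cdot> a)) * gJ th a th' b" by (simp only: gJ_def integral_mult_right_zero)
 finally have 1: "(LINT z|dw. T xi ?f z * ?g z) = (th * of_real (xi \<cdot> a)) * gJ th a th' b" .
 have "(LINT z|dw. ?f z * T xi ?g z) = (LINT z|dw. (th' * of_real (xi \<cdot> b)) * ?P z - ?Q z)"
  by (intro integral_cong refl) (simp add: T_Ek_gauss algebra_simps)
 also have "... = (th' * of_real (xi \<cdot> b)) * gJ th a th' b - (LINT z|dw. ?Q z)"
  unfolding gJ_def
  by (simp only: integral_diff[OF integrable_mult_right[OF gJ_integrable] gJ_integrable1] integral_mult_right_zero)
 finally have 2: "(LINT z|dw. ?f z * T xi ?g z) = (th' * of_real (xi \<cdot> b)) * gJ th a th' b - (LINT z|dw. ?Q z)" .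
 show ?thesis using skew unfolding 1 2 by (simp add: algebra_simps)
qed

text \<open>As a function of \<open>a\<close>, \<open>gJ\<close> times a Gaussian is a joint
  eigenfunction: the term \<open>th^2 * (xi \<cdot> a)\<close> of \<open>gJ_ibp\<close> cancels
  against the derivative of that Gaussian, leaving the eigenvalue
  \<open>th * th' * (xi \<cdot> b)\<close>. \<open>eigen_eq_Ek\<close> then determines it from its
  value at 0.\<close>

lemma gJ_step: "gJ th a th' b = gJ th 0 th' b * exp (th^2 / 2 * of_real ((norm a)^2)) * Ek (th * th') a b"
proof -
 define f where "f a = exp (- th\<^sup>2 / 2 * of_real ((norm a)^2)) * gJ th a th' b" for a :: "real^'n"
 have f: "f a = f 0 * Ek (th * th') a b"
 proof (rule eigen_eq_Ek)
  fix x xi :: "real^'n"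
  obtain J' where J': "((%p. gJ th p th' b) has_derivative J') (at x)"
   using gJ_derivative(1) unfolding differentiable_def by blast
  note \<psi>' = cgauss_has_derivative[of "- th\<^sup>2 / 2" x]
  show "f differentiable (at x)"
   unfolding f_def using has_derivative_mult[OF \<psi>' J'] differentiableI by blast
  have "T xi f x = exp (- th\<^sup>2 / 2 * of_real ((norm x)^2)) * T xi (%p. gJ th p th' b) x
   + exp (- th\<^sup>2 / 2 * of_real ((norm x)^2)) * (2 * (- th\<^sup>2 / 2) * of_real (x \<cdot> xi)) * gJ th x th' b"
   unfolding f_def
  proof (rule T_mult_inv[OF \<psi>' J'])
   fix al assume a: "al \<in> R"
   show "exp (- th\<^sup>2 / 2 * complex_of_real ((norm (rf al x))^2)) = exp (- th\<^sup>2 / 2 * of_real ((norm x)^2))"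
    using G_norm[OF refl_in_G[OF a], of x] by simp
   show "al \<cdot> x = 0 ==> exp (- th\<^sup>2 / 2 * of_real ((norm x)^2)) * (2 * (- th\<^sup>2 / 2) * of_real (x \<cdot> al)) = 0"
    by (simp add: inner_commute)
  qed
  then show "T xi f x = th * th' * of_real (xi \<cdot> b) * f x"
   unfolding gJ_derivative(2) gJ_ibp f_def by (simp add: inner_commute power2_eq_square algebra_simps)
 qed
 have "exp (th^2 / 2 * of_real ((norm a)^2)) * f a = gJ th a th' b"
  unfolding f_def by (simp add: mult.assoc[symmetric] mult_exp_exp)
 moreover have "f 0 = gJ th 0 th' b" by (simp add: f_def)
 ultimately show ?thesis using f by (metis mult.assoc mult.commute)
qed

abbreviation ck :: real where "ck \<equiv> dunkl_const R k"

text \<open>\<open>gJ_step\<close> is used for \<open>a\<close> and, with the two kernels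
  interchanged, for \<open>b\<close>; at \<open>a = b = 0\<close> the integral is
  \<open>ck\<close>.\<close>

lemma gauss_formula:
 "(LINT z|dw. Ek th z a * Ek th' z b * of_real (gs z))
  = of_real ck * exp (th^2 / 2 * of_real ((norm a)^2)) * exp (th'^2 / 2 * of_real ((norm b)^2)) * Ek (th * th') a b"
proof -
 have "gJ th 0 th' b = gJ th' b th 0" by (simp add: gJ_def mult.commute)
 also have "... = gJ th' 0 th 0 * exp (th'^2 / 2 * of_real ((norm b)^2))"
  using gJ_step[of th' b th 0] by simp
 also have "gJ th' 0 th 0 = of_real ck"
  by (simp add: gJ_def dunkl_const_def gs_def)
 finally show ?thesis using gJ_step[of th a th' b] by (simp add: gJ_def mult_ac)
qed

lemma gs_integrable: "integrable dw gs"
 using integrable_gauss_real[of "%_. 1" 1 0 0] by simp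

lemma ck_pos: "0 < ck"
proof -
 have ck: "ck = (LINT z|dw. gs z)" by (simp add: dunkl_const_def gs_def)
 have "0 <= ck" unfolding ck by (intro integral_nonneg_AE AE_I2 less_imp_le gs_pos)
 moreover have "ck ~= 0"
 proof
  assume "ck = 0"
  then have "AE z in dw. gs z = 0"
   using integral_nonneg_eq_0_iff_AE[OF gs_integrable] by (simp add: ck less_imp_le)
  then have "AE z in dw. False" by eventually_elim (metis gs_pos less_irrefl)
  then have "AE z in lborel. wt z <= 0"
   unfolding dw_density by (subst (asm) AE_density) (auto elim: eventually_mono)
  then have "AE z in (lborel :: (real^'n) measure). False"
   using AE_regular
  proof eventually_elim
   fix z :: "real^'n" assume z: "ALL al:R. al \<cdot> z ~= 0" and w: "wt z <= 0"
   have "0 < wt z" unfolding wt_def using z by (intro prod_pos) (auto simp: inner_commute)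
   then show False using w by simp
  qed
  then have "emeasure lborel (UNIV :: (real^'n) set) = 0"
   by (simp add: AE_iff_measurable[of UNIV])
  then show False by simp
 qed
 ultimately show ?thesis by simp
qed

text \<open>The Dunkl heat kernel at time 1/2, whose multiplier is \<open>gs\<close>.\<close>

definition hk :: "real^'n => real^'n => real" where
 "hk x y = gs x * gs y * Er x y / ck"

lemma hk_pos: "0 < hk x y"
 by (simp add: hk_def Er_pos ck_pos)

lemma hk_fourier: "(LINT z|dw. Ek \<i> z x * Ek (- \<i>) z y * of_real (gs z)) = of_real (ck^2 * hk x y)"
proof -
 have "(LINT z|dw. Ek \<i> z x * Ek (- \<i>) z y * of_real (gs z)) = of_real ck * of_real (gs x) * of_real (gs y) * Ek 1 x y"
  unfolding gauss_formula by (simp add: gs_exp)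
 then show ?thesis using ck_pos by (simp add: hk_def Ek_Er power2_eq_square)
qed

text \<open>Integrating against \<open>hk y\<close> multiplies a frequency integrand by another
  \<open>gs\<close>; in \<open>BB_1\<close> this is the semigroup property.\<close>

lemma hk_semigroup: "(LINT z|dw. of_real (hk y z) * Ek (- \<i>) z xi) = of_real (gs xi) * Ek (- \<i>) y xi"
proof -
 have "(LINT z|dw. of_real (hk y z) * Ek (- \<i>) z xi) = (LINT z|dw. of_real (gs y / ck) * (Ek 1 z y * Ek (- \<i>) z xi * of_real (gs z)))"
  by (intro integral_cong refl) (simp add: hk_def Ek_Er Er_sym[of y] mult_ac)
 also have "... = of_real (gs y / ck) * (of_real ck * exp (1/2 * of_real ((norm y)^2)) * of_real (gs xi) * Ek (- \<i>) y xi)"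
  unfolding integral_mult_right_zero gauss_formula gs_exp[of xi] by simp
 also have "exp (1/2 * of_real ((norm y)^2)) = complex_of_real (inverse (gs y))"
  unfolding of_real_inverse gs_exp exp_minus[symmetric] by simp
 finally show ?thesis using ck_pos gs_pos[of y] by (simp add: field_simps)
qed

lemma Er_cont: "continuous_on S f ==> continuous_on S h ==> continuous_on S (%p. Er (f p) (h p))"
 using continuous_on_Re[OF Ek_continuous[of S f h 1]] by (simp add: Ek_Er)

lemma hk_cont: "continuous_on S f ==> continuous_on S h ==> continuous_on S (%p. hk (f p) (h p))"
 unfolding hk_def gs_def using ck_pos
 by (intro continuous_intros Er_cont) auto

lemma hk_integrable: "integrable dw (%z. hk y z)"
proof -
 have "integrable dw (%z. Re (Ek 1 z y * Ek 1 z 0 * of_real (gs z)))"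
  by (rule integrable_Re[OF gJ_integrable])
 then have "integrable dw (%z. (gs y / ck) * (Er z y * gs z))" by (intro integrable_mult_right) (simp add: Ek_Er)
 then show ?thesis by (simp add: hk_def Er_sym[of y] mult_ac)
qed

lemma hk_int: "(LINT z|dw. hk y z) = 1"
proof -
 have "complex_of_real (LINT z|dw. hk y z) = (LINT z|dw. of_real (hk y z) * Ek (- \<i>) z 0)"
  by (simp add: integral_complex_of_real)
 also have "... = 1" unfolding hk_semigroup by (simp add: gs_def)
 finally show ?thesis by (simp only: of_real_eq_1_iff)
qed

end

section \<open>Volumes of balls and heat kernel bounds\<close>

context dunkl begin

text \<open>Up to constants the measure of the unit ball at \<open>x\<close>, by
  \<open>ball_upper\<close> and \<open>ball_lower\<close>.\<close>

definition Vol :: "real^'n => real" where "Vol x = (\<Prod>al\<in>R. (\<bar>x \<cdot> al\<bar> + 1) powr k al)"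

lemma Vol_pos [simp]: "0 < Vol x"
 unfolding Vol_def by (intro prod_pos) (auto simp: add_nonneg_eq_0_iff)

lemma prod_powr_const: "0 <= c ==> (\<Prod>al\<in>R. (c * f al) powr k al) = c powr sk * (\<Prod>al\<in>R. f al powr k al)"
 if "0 < c" "!!al. 0 <= f al" for c and f :: "real^'n => real"
 using that by (simp add: powr_mult prod.distrib sk_def powr_sum)

lemma prod_powr_mono:
 fixes f h :: "real^'n => real"
 assumes "!!al. al \<in> R ==> 0 <= f al" "!!al. al \<in> R ==> f al <= h al"
 shows "(\<Prod>al\<in>R. f al powr k al) <= (\<Prod>al\<in>R. h al powr k al)"
 using assms by (intro prod_mono conjI powr_mono2) auto

lemma Vol_G: "g \<in> G ==> Vol (g x) = Vol x"
proof -
 assume g: "g \<in> G"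
 have "Vol x = (\<Prod>al\<in>R. (\<bar>g x \<cdot> g al\<bar> + 1) powr k (g al))"
  unfolding Vol_def using g by (intro prod.cong) auto
 also have "... = Vol (g x)"
  unfolding Vol_def by (rule prod.reindex_bij_betw[OF G_bij_betw_R[OF g]])
 finally show ?thesis by simp
qed

lemma Vol_compare: "Vol x <= (1 + 2 * norm (x - y)) ^ ks * Vol y"
proof -
 have "Vol x <= (\<Prod>al\<in>R. ((1 + 2 * norm (x - y)) * (\<bar>y \<cdot> al\<bar> + 1)) powr k al)"
  unfolding Vol_def
 proof (rule prod_powr_mono)
  fix al assume a: "al \<in> R"
  have "\<bar>x \<cdot> al\<bar> <= \<bar>y \<cdot> al\<bar> + \<bar>(x - y) \<cdot> al\<bar>" by (simp add: inner_diff_left)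
  also have "... <= \<bar>y \<cdot> al\<bar> + 2 * norm (x - y)" using inner_root_le[OF a] by (intro add_left_mono)
  finally show "\<bar>x \<cdot> al\<bar> + 1 <= (1 + 2 * norm (x - y)) * (\<bar>y \<cdot> al\<bar> + 1)"
   by (simp add: algebra_simps) (smt (verit) mult_nonneg_nonneg norm_ge_zero abs_ge_zero)
 qed simp
 also have "... = (1 + 2 * norm (x - y)) powr sk * Vol y"
  unfolding Vol_def by (rule prod_powr_const) (auto intro: add_pos_nonneg)
 also have "... <= (1 + 2 * norm (x - y)) ^ ks * Vol y"
  by (intro mult_right_mono powr_le_ks less_imp_le[OF Vol_pos]) simp
 finally show ?thesis .
qed

lemma Vol_shrink:
 assumes "1 <= s"
 shows "Vol (x /R s) <= Vol x" "Vol x <= s ^ ks * Vol (x /R s)"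
proof -
 show "Vol (x /R s) <= Vol x"
  unfolding Vol_def
 proof (rule prod_powr_mono)
  fix al assume "al \<in> R"
  have "\<bar>x \<cdot> al\<bar> / s <= \<bar>x \<cdot> al\<bar> / 1" using assms by (intro divide_left_mono) auto
  then show "\<bar>(x /R s) \<cdot> al\<bar> + 1 <= \<bar>x \<cdot> al\<bar> + 1" using assms by (simp add: abs_mult divide_inverse mult.commute)
 qed simp
 have "Vol x <= (\<Prod>al\<in>R. (s * (\<bar>(x /R s) \<cdot> al\<bar> + 1)) powr k al)"
  unfolding Vol_def
 proof (rule prod_powr_mono)
  fix al assume "al \<in> R"
  have "s * (\<bar>(x /R s) \<cdot> al\<bar> + 1) = \<bar>x \<cdot> al\<bar> + s" using assms by (simp add: abs_mult algebra_simps)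
  then show "\<bar>x \<cdot> al\<bar> + 1 <= s * (\<bar>(x /R s) \<cdot> al\<bar> + 1)" using assms by simp
 qed simp
 also have "... = s powr sk * Vol (x /R s)"
  unfolding Vol_def using assms by (intro prod_powr_const) auto
 also have "... <= s ^ ks * Vol (x /R s)"
  by (intro mult_right_mono powr_le_ks less_imp_le[OF Vol_pos] assms)
 finally show "Vol x <= s ^ ks * Vol (x /R s)" .
qed

lemma emeasure_dw: "A \<in> sets borel ==> emeasure dw A = (NL x. ennreal (wt x) * indicator A x)"
 unfolding dw_density by (rule emeasure_density) auto

lemma ball_upper: "EX C>0. ALL x. emeasure dw (ball x 1) <= ennreal (C * Vol x)"
proof (intro exI conjI allI)
 let ?v = "unit_ball_vol (real CARD('n))"
 have v: "0 < ?v" by (rule unit_ball_vol_pos) simp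
 show "0 < 2 powr sk * ?v" using v by simp
 fix x :: "real^'n"
 have w: "wt y <= 2 powr sk * Vol x" if "y \<in> ball x 1" for y
 proof -
  have "wt y <= (\<Prod>al\<in>R. (2 * (\<bar>x \<cdot> al\<bar> + 1)) powr k al)"
   unfolding wt_def
  proof (rule prod_powr_mono)
   fix al assume a: "al \<in> R"
   have "\<bar>y \<cdot> al\<bar> <= \<bar>x \<cdot> al\<bar> + \<bar>(y - x) \<cdot> al\<bar>" by (simp add: inner_diff_left)
   also have "\<bar>(y - x) \<cdot> al\<bar> <= 2 * norm (y - x)" by (rule inner_root_le[OF a])
   finally show "\<bar>y \<cdot> al\<bar> <= 2 * (\<bar>x \<cdot> al\<bar> + 1)" using that by (simp add: dist_norm norm_minus_commute)
  qed simp
  also have "... = 2 powr sk * Vol x" unfolding Vol_def by (rule prod_powr_const) auto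
  finally show ?thesis .
 qed
 have "emeasure dw (ball x 1) <= (NL y. ennreal (2 powr sk * Vol x) * indicator (ball x 1) y)"
  unfolding emeasure_dw[OF borel_open[OF open_ball]]
  by (intro nn_integral_mono) (use w in \<open>auto simp: indicator_def intro!: ennreal_leI\<close>)
 also have "... = ennreal (2 powr sk * Vol x) * ennreal ?v"
  by (subst nn_integral_cmult_indicator) (simp_all add: emeasure_ball)
 also have "... = ennreal (2 powr sk * ?v * Vol x)"
  using v by (simp add: ennreal_mult'[symmetric] less_imp_le mult_ac)
 finally show "emeasure dw (ball x 1) <= ennreal (2 powr sk * ?v * Vol x)" .
qed

lemma ex_regular: "EX e. norm e <= 1 & (ALL al:R. al \<cdot> e ~= 0)"
proof -
 have "EX e. ALL al:R. al \<cdot> e ~= 0"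
 proof (rule ccontr)
  assume n: "\<nexists>e. ALL al:R. al \<cdot> e ~= 0"
  have "AE x in (lborel :: (real^'n) measure). False" by (rule eventually_mono[OF AE_regular]) (use n in blast)
  then have "emeasure lborel (UNIV :: (real^'n) set) = 0" by (simp add: AE_iff_measurable[of UNIV])
  then show False by simp
 qed
 then obtain e where e: "ALL al:R. al \<cdot> e ~= 0" by blast
 have p: "1 + norm e > 0" by (simp add: add_pos_nonneg)
 have "norm (e /R (1 + norm e)) <= 1" using p by (simp add: divide_simps)
 moreover have "ALL al:R. al \<cdot> (e /R (1 + norm e)) ~= 0" using e p by simp
 ultimately show ?thesis by blast
qed

text \<open>By the pigeonhole principle one of finitely many translates of \<open>x\<close> along a regular direction
 keeps a fixed distance from all hyperplanes.\<close>

lemma good_point: "EX et>0. et <= 1 & (ALL x. EX p. norm (p - x) <= 1/2 & (ALL al:R. et <= \<bar>p \<cdot> al\<bar>))"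
proof -
 obtain e where e: "norm e <= 1" "ALL al:R. al \<cdot> e ~= 0" using ex_regular by blast
 define dd where "dd = Min (insert 1 ((%al. \<bar>al \<cdot> e\<bar>) ` R))"
 have dd: "0 < dd" "dd <= 1" "!!al. al \<in> R ==> dd <= \<bar>al \<cdot> e\<bar>"
  unfolding dd_def using e(2) by (auto intro: Min_le)
 define m where "m = card R"
 \<comment> \<open>Two translates within \<open>et\<close> of the same hyperplane would force the
   spacing \<open>1 / (2 * (real m + 1))\<close> times \<open>dd\<close> below
   \<open>2 * et\<close>; the choice makes these two numbers equal.\<close>
 define et where "et = dd / (4 * (real m + 1))"
 have et: "0 < et" "et <= 1" using dd by (simp_all add: et_def divide_simps)
 have "EX p. norm (p - x) <= 1/2 & (ALL al:R. et <= \<bar>p \<cdot> al\<bar>)" for x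
 proof (rule ccontr)
  assume neg: "\<not> ?thesis"
  define s where "s j = real j / (2 * (real m + 1))" for j :: nat
  have "EX al:R. \<bar>(x + s j *R e) \<cdot> al\<bar> < et" if j: "j <= m" for j
  proof -
   have "0 <= s j" by (simp add: s_def)
   moreover have "s j <= 1/2" using j by (simp add: s_def divide_simps)
   ultimately have "norm (s j *R e) <= 1/2" using mult_mono[of "s j" "1/2" "norm e" 1] e(1) by simp
   then show ?thesis using neg by (metis add_diff_cancel_left' not_le)
  qed
  then obtain f where f: "!!j. j <= m ==> f j \<in> R" "!!j. j <= m ==> \<bar>(x + s j *R e) \<cdot> f j\<bar> < et" by metis
  have "inj_on f {..m}"
  proof (rule inj_onI, rule ccontr)
   fix i j assume ij: "i \<in> {..m}" "j \<in> {..m}" "f i = f j" "i ~= j"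
   let ?a = "f i"
   have "\<bar>(x + s i *R e) \<cdot> ?a\<bar> < et" "\<bar>(x + s j *R e) \<cdot> ?a\<bar> < et"
    using f(2)[of i] f(2)[of j] ij by simp_all
   then have "\<bar>(x + s i *R e) \<cdot> ?a - (x + s j *R e) \<cdot> ?a\<bar> < 2 * et" by linarith
   then have "\<bar>s i - s j\<bar> * \<bar>?a \<cdot> e\<bar> < 2 * et"
    unfolding abs_mult[symmetric] by (simp add: inner_add_left inner_commute algebra_simps)
   moreover have "1 / (2 * (real m + 1)) <= \<bar>s i - s j\<bar>"
   proof -
    have "1 <= \<bar>real i - real j\<bar>" using ij(4) by linarith
    then have "1 / (2 * (real m + 1)) <= \<bar>real i - real j\<bar> / (2 * (real m + 1))" by (intro divide_right_mono) auto
    then show ?thesis by (simp add: s_def diff_divide_distrib[symmetric])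
   qed
   ultimately have "1 / (2 * (real m + 1)) * dd < 2 * et"
    using mult_mono[of "1 / (2 * (real m + 1))" "\<bar>s i - s j\<bar>" dd "\<bar>?a \<cdot> e\<bar>"] dd f(1) ij by force
   moreover have "1 / (2 * M) * dd = 2 * (dd / (4 * M))" for M :: real by simp
   ultimately show False unfolding et_def by (metis less_irrefl)
  qed
  then have "card {..m} <= card R" using f(1) by (intro card_inj_on_le) auto
  then show False by (simp add: m_def)
 qed
 then show ?thesis using et by blast
qed

text \<open>A ball of radius \<open>et / 4\<close> around a good point lies in the unit ball, and on
  it every factor of the density is comparable to the corresponding factor of
  \<open>Vol x\<close>.\<close>

lemma ball_lower: "EX c>0. ALL x. ennreal (c * Vol x) <= emeasure dw (ball x 1)"
proof -
 obtain et where et: "0 < et" "et <= 1" "!!x. EX p. norm (p - x) <= 1/2 & (ALL al:R. et <= \<bar>p \<cdot> al\<bar>)"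
  using good_point by blast
 \<comment> \<open>For a root with \<open>\<bar>x \<cdot> al\<bar> < 4\<close> the bound required is
   at most \<open>5 * c0 = et / 2\<close>, the distance still left at \<open>y\<close>; otherwise
   1/10 suffices, since \<open>(s + 1) / 10 <= s - 2\<close> for \<open>s >= 4\<close>.\<close>
 define c0 where "c0 = et / 10"
 define v where "v = unit_ball_vol (real CARD('n)) * (et / 4) ^ CARD('n)"
 have "0 < unit_ball_vol (real CARD('n))" by (rule unit_ball_vol_pos) simp
 then have v: "0 < v" using et by (simp add: v_def)
 have c0: "0 < c0" "c0 <= 1/10" using et by (simp_all add: c0_def)
 have "ennreal (c0 powr sk * v * Vol x) <= emeasure dw (ball x 1)" for x
 proof -
  obtain p where p: "norm (p - x) <= 1/2" "!!al. al \<in> R ==> et <= \<bar>p \<cdot> al\<bar>" using et(3) by blast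
  have w: "c0 powr sk * Vol x <= wt y" "y \<in> ball x 1" if y: "y \<in> ball p (et / 4)" for y
  proof -
   have yp: "norm (y - p) < et / 4" using y by (simp add: dist_norm norm_minus_commute)
   have "norm (y - x) <= norm (y - p) + norm (p - x)" using norm_triangle_ineq[of "y - p" "p - x"] by simp
   then have yx: "norm (y - x) < 1" using yp p(1) et by linarith
   then show "y \<in> ball x 1" by (simp add: dist_norm norm_minus_commute)
   have "c0 powr sk * Vol x = (\<Prod>al\<in>R. (c0 * (\<bar>x \<cdot> al\<bar> + 1)) powr k al)"
    unfolding Vol_def using c0 by (intro prod_powr_const[symmetric]) auto
   also have "... <= wt y" unfolding wt_def
   proof (rule prod_powr_mono)
    fix al assume a: "al \<in> R"
    have "\<bar>p \<cdot> al\<bar> <= \<bar>y \<cdot> al\<bar> + \<bar>(y - p) \<cdot> al\<bar>" by (simp add: inner_diff_left)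
    then have 1: "et / 2 <= \<bar>y \<cdot> al\<bar>" using inner_root_le[OF a, of "y - p"] yp p(2)[OF a] by linarith
    have "\<bar>x \<cdot> al\<bar> <= \<bar>y \<cdot> al\<bar> + \<bar>(y - x) \<cdot> al\<bar>" by (simp add: inner_diff_left)
    then have 2: "\<bar>x \<cdot> al\<bar> - 2 <= \<bar>y \<cdot> al\<bar>" using inner_root_le[OF a, of "y - x"] yx by linarith
    show "c0 * (\<bar>x \<cdot> al\<bar> + 1) <= \<bar>y \<cdot> al\<bar>"
    proof (cases "4 <= \<bar>x \<cdot> al\<bar>")
     case True
     have "c0 * (\<bar>x \<cdot> al\<bar> + 1) <= 1/10 * (\<bar>x \<cdot> al\<bar> + 1)" using c0 by (intro mult_right_mono) auto
     also have "... <= \<bar>x \<cdot> al\<bar> - 2" using True by simp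
     also note 2
     finally show ?thesis .
    next
     case False
     have "c0 * (\<bar>x \<cdot> al\<bar> + 1) <= c0 * 5" using c0 False by (intro mult_left_mono) auto
     then show ?thesis using 1 by (simp add: c0_def)
    qed
   qed (use c0 in auto)
   finally show "c0 powr sk * Vol x <= wt y" .
  qed
  have "ennreal (c0 powr sk * v * Vol x) = ennreal (c0 powr sk * Vol x) * ennreal v"
   using v by (simp add: ennreal_mult'[symmetric] less_imp_le mult_ac)
  also have "... = (NL y. ennreal (c0 powr sk * Vol x) * indicator (ball p (et / 4)) y)"
   using et by (subst nn_integral_cmult_indicator) (simp_all add: emeasure_ball v_def)
  also have "... <= emeasure dw (ball x 1)"
   unfolding emeasure_dw[OF borel_open[OF open_ball]]
   by (intro nn_integral_mono) (use w in \<open>auto simp: indicator_def intro!: ennreal_leI\<close>)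
  finally show ?thesis .
 qed
 then show ?thesis using c0 v by (intro exI[of _ "c0 powr sk * v"]) auto
qed

text \<open>The integrand is the heat kernel at time 1 without its normalising power of 2; a
  dilation by \<open>sqrt 2\<close> reduces its mass to that of \<open>hk\<close>.\<close>

lemma hk2_int: "(NI x. ennreal (exp (- ((norm x)^2 + (norm y)^2) / 4) * Er x (y /R 2) / ck)) = ennreal (sqrt 2 powr NN)"
proof -
 let ?f = "%x. ennreal (exp (- ((norm x)^2 + (norm y)^2) / 4) * Er x (y /R 2) / ck)"
 let ?y = "y /R sqrt 2"
 have cont: "continuous_on UNIV (%x. exp (- ((norm x)^2 + (norm y)^2) / 4) * Er x (y /R 2) / ck)"
  using ck_pos by (intro continuous_intros Er_cont) auto
 have "?f \<in> BM"
  by (rule measurable_compose[OF cont_BM[OF cont] measurable_ennreal])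
 from nn_integral_dw_scale[OF _ this, of "sqrt 2"]
 have "(NI x. ?f x) = ennreal (sqrt 2 powr NN) * (NI x. ?f (sqrt 2 *R x))" by simp
 also have "(%x. ?f (sqrt 2 *R x)) = (%x. ennreal (hk ?y x))"
 proof
  fix x
  have "Er (sqrt 2 *R x) (y /R 2) = Er x ?y"
  proof -
   have r: "inverse 2 * sqrt 2 = inverse (sqrt 2)" by (simp add: field_simps)
   have "complex_of_real (Er (sqrt 2 *R x) (y /R 2)) = of_real (Er x ?y)"
    unfolding Ek_Er[symmetric] Ek_scale Ek_scale_right mult_1 of_real_mult[symmetric] r ..
   then show ?thesis by (simp only: of_real_eq_iff)
  qed
  moreover have "exp (- ((norm (sqrt 2 *R x))^2 + (norm y)^2) / 4) = gs ?y * gs x"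
   unfolding gs_def mult_exp_exp
   by (rule arg_cong[where f = exp]) (simp add: power_mult_distrib power_divide divide_simps)
  ultimately show "?f (sqrt 2 *R x) = ennreal (hk ?y x)"
   by (simp only: hk_def Er_sym[of ?y x])
 qed
 also have "(NI x. ennreal (hk ?y x)) = ennreal 1"
  using nn_integral_eq_integral[OF hk_integrable, of ?y] hk_int hk_pos by (simp add: less_imp_le)
 finally show ?thesis by simp
qed

text \<open>Comparison of \<open>hk\<close> with the heat kernel at twice the time; averaging the latter over a ball
 produces the volume factor.\<close>

lemma hk_compare:
 assumes "norm e <= 1"
 shows "hk x y <= exp 1 * (SUM g:G. exp (- (norm (g x - y))\<^sup>2 / 8)) *
   (exp (- ((norm (x + e))^2 + (norm y)^2) / 4) * Er (x + e) (y /R 2) / ck)"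
proof -
 \<comment> \<open>The difference of the exponents of the two kernels along the orbit.
   \<open>Er_compare\<close> costs its largest value, which is attained at some
   \<open>h\<close>.\<close>
 define q where "q g = g x \<cdot> y - g (x + e) \<cdot> (y /R 2)" for g :: "real^'n => real^'n"
 have "Max (q ` G) \<in> q ` G" by (intro Max_in) auto
 then obtain h where h: "Max (q ` G) = q h" "h \<in> G" by (rule imageE)
 have q: "q g <= q h" if "g \<in> G" for g unfolding h(1)[symmetric] using that by (intro Max_ge) auto
 have "Er x y <= exp (q h) * Er (x + e) (y /R 2)"
 proof (rule Er_compare)
  fix g assume "g \<in> G"
  from q[OF this] show "g x \<cdot> y <= g (x + e) \<cdot> (y /R 2) + q h" by (simp add: q_def)
 qed
 then have "hk x y <= gs x * gs y * (exp (q h) * Er (x + e) (y /R 2)) / ck"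
  unfolding hk_def using ck_pos by (intro divide_right_mono mult_left_mono) (auto intro: less_imp_le)
 also have "... = exp (q h - (norm x)\<^sup>2 / 2 - (norm y)\<^sup>2 / 2 + ((norm (x + e))^2 + (norm y)^2) / 4) *
   (exp (- ((norm (x + e))^2 + (norm y)^2) / 4) * Er (x + e) (y /R 2) / ck)"
 proof -
  have "gs x * gs y * exp (q h) = exp (q h - (norm x)\<^sup>2 / 2 - (norm y)\<^sup>2 / 2 + ((norm (x + e))^2 + (norm y)^2) / 4) *
    exp (- ((norm (x + e))^2 + (norm y)^2) / 4)"
   unfolding gs_def mult_exp_exp by (rule arg_cong[where f = exp]) (simp add: field_simps)
  then show ?thesis by (simp only: mult.assoc[symmetric] times_divide_eq_right)
 qed
 also have "... <= (exp 1 * (SUM g:G. exp (- (norm (g x - y))\<^sup>2 / 8))) *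
   (exp (- ((norm (x + e))^2 + (norm y)^2) / 4) * Er (x + e) (y /R 2) / ck)"
 proof (rule mult_right_mono)
  define u f where "u = h x - y" and "f = h e"
  have nf: "f \<cdot> f <= 1"
  proof -
   have "(norm e)^2 <= 1" using assms by (simp add: power_le_one)
   then show ?thesis using h(2) by (simp add: f_def power2_norm_eq_inner)
  qed
  \<comment> \<open>This square bounds \<open>f \<cdot> u / 2\<close> by
    \<open>(u \<cdot> u) / 8 + (f \<cdot> f) / 2\<close>: half of the quadratic decay in
    \<open>u\<close> survives the displacement by \<open>e\<close>.\<close>
  have sq: "0 <= (u - 2 *R f) \<cdot> (u - 2 *R f)" by simp
  have hx: "h x = u + y" by (simp add: u_def)
  have "(norm (x + e))^2 = (h x + f) \<cdot> (h x + f)" "(norm x)^2 = h x \<cdot> h x"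
   using h(2) by (simp_all add: f_def power2_norm_eq_inner linear_add[OF G_linear[OF h(2)], symmetric])
  then have "q h - (norm x)\<^sup>2 / 2 - (norm y)\<^sup>2 / 2 + ((norm (x + e))^2 + (norm y)^2) / 4
   = - (u \<cdot> u) / 4 + (f \<cdot> u) / 2 + (f \<cdot> f) / 4"
   unfolding q_def linear_add[OF G_linear[OF h(2)]] f_def[symmetric] hx
   by (simp add: power2_norm_eq_inner inner_add_left inner_add_right inner_commute field_simps)
  also have "... <= 1 + - (u \<cdot> u) / 8"
   using sq nf by (simp add: inner_diff_left inner_diff_right inner_commute algebra_simps)
  finally have "exp (q h - (norm x)\<^sup>2 / 2 - (norm y)\<^sup>2 / 2 + ((norm (x + e))^2 + (norm y)^2) / 4)
    <= exp 1 * exp (- (norm (h x - y))\<^sup>2 / 8)"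
   unfolding mult_exp_exp by (simp add: u_def power2_norm_eq_inner)
  also have "... <= exp 1 * (SUM g:G. exp (- (norm (g x - y))\<^sup>2 / 8))"
   using member_le_sum[of h G "%g. exp (- (norm (g x - y))\<^sup>2 / 8)"] h(2) by simp
  finally show "exp (q h - (norm x)\<^sup>2 / 2 - (norm y)\<^sup>2 / 2 + ((norm (x + e))^2 + (norm y)^2) / 4)
    <= exp 1 * (SUM g:G. exp (- (norm (g x - y))\<^sup>2 / 8))" .
  show "0 <= exp (- ((norm (x + e))^2 + (norm y)^2) / 4) * Er (x + e) (y /R 2) / ck"
   using ck_pos Er_pos[of "x + e" "y /R 2"] by simp
 qed
 finally show ?thesis .
qed

text \<open>\<open>hk_compare\<close> holds at every point of the unit ball around \<open>x\<close>.
  Integrating it over the ball produces the volume on the left, while on the right the kernel at the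
  later time has constant total mass.\<close>

lemma hk_bound: "EX C>0. ALL x y. hk x y <= C / Vol x * (SUM g:G. exp (- (norm (g x - y))\<^sup>2 / 8))"
proof -
 obtain c where c: "0 < c" "!!x. ennreal (c * Vol x) <= emeasure dw (ball x 1)" using ball_lower by blast
 have "hk x y <= (exp 1 * sqrt 2 powr NN / c) / Vol x * (SUM g:G. exp (- (norm (g x - y))\<^sup>2 / 8))" for x y
 proof -
  let ?S = "SUM g:G. exp (- (norm (g x - y))\<^sup>2 / 8)"
  let ?f = "%x'. exp (- ((norm x')^2 + (norm y)^2) / 4) * Er x' (y /R 2) / ck"
  have S0: "0 <= ?S" by (intro sum_nonneg) simp
  have fp: "0 <= ?f x'" for x' using Er_pos ck_pos by (simp add: less_imp_le)
  have "continuous_on UNIV ?f" using ck_pos by (intro continuous_intros Er_cont) auto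
  then have fm [measurable]: "?f \<in> BM" by (rule cont_BM)
  have "ennreal (hk x y * (c * Vol x)) = ennreal (hk x y) * ennreal (c * Vol x)"
   using hk_pos by (simp add: ennreal_mult' less_imp_le)
  also have "... <= ennreal (hk x y) * emeasure dw (ball x 1)" by (intro mult_left_mono c) simp
  also have "... = (NI x'. ennreal (hk x y) * indicator (ball x 1) x')"
   by (subst nn_integral_cmult_indicator) simp_all
  also have "... <= (NI x'. ennreal (exp 1 * ?S) * ennreal (?f x'))"
  proof (rule nn_integral_mono)
   fix x'
   show "ennreal (hk x y) * indicator (ball x 1) x' <= ennreal (exp 1 * ?S) * ennreal (?f x')"
   proof (cases "x' \<in> ball x 1")
    case True
    then have "norm (x' - x) <= 1" by (simp add: dist_norm norm_minus_commute)
    from hk_compare[OF this, of x y] have "hk x y <= (exp 1 * ?S) * ?f x'" by simp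
    then show ?thesis using True S0 by (simp add: ennreal_mult'[symmetric] ennreal_leI)
   qed simp
  qed
  also have "... = ennreal (exp 1 * ?S) * ennreal (sqrt 2 powr NN)"
  proof -
   have "(%x'. ennreal (?f x')) \<in> borel_measurable dw"
    unfolding meas_dw by (rule measurable_compose[OF fm measurable_ennreal])
   from nn_integral_cmult[OF this] show ?thesis by (simp only: hk2_int)
  qed
  also have "... = ennreal (exp 1 * ?S * sqrt 2 powr NN)" using S0 by (simp add: ennreal_mult'[symmetric])
  finally have "hk x y * (c * Vol x) <= exp 1 * ?S * sqrt 2 powr NN" using S0 by (simp add: ennreal_le_iff)
  then have "hk x y <= exp 1 * ?S * sqrt 2 powr NN / (c * Vol x)" using c(1) by (simp add: pos_le_divide_eq)
  then show ?thesis by (simp add: mult_ac)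
 qed
 then show ?thesis using c(1) by (intro exI[of _ "exp 1 * sqrt 2 powr NN / c"]) auto
qed

section \<open>Smooth substitutes for the distance between orbits\<close>

definition kap :: "real^'n => real^'n => real" where
 "kap x z = (SUM g:G. 1 / (1 + (norm (z - g x))^2))"

lemma one_plus_sq_pos [simp]: "0 < 1 + (norm v)^2"
 by (simp add: add_pos_nonneg)

lemma kap_member: "g \<in> G ==> 1 / (1 + (norm (z - g x))^2) <= kap x z"
 unfolding kap_def by (rule member_le_sum) (auto intro: less_imp_le)

lemma kap_pos [simp]: "0 < kap x z"
 using kap_member[OF id_in_G, of z x] one_plus_sq_pos[of "z - x"] by (smt (verit) id_apply divide_pos_pos)

lemma kap_nz [simp]: "kap x z ~= 0"
 using kap_pos[of x z] by linarith

lemma Vol_nz [simp]: "Vol x ~= 0"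
 using Vol_pos[of x] by linarith

lemma kap_le: "kap x z <= real (card G)"
proof -
 have "kap x z <= (SUM g:G. 1)" unfolding kap_def
  by (intro sum_mono) (simp add: divide_le_eq)
 then show ?thesis by simp
qed

lemma kap_G: "h \<in> G ==> kap x (h z) = kap x z"
proof -
 assume h: "h \<in> G"
 have "kap x (h z) = (SUM g:G. 1 / (1 + (norm (h z - (h o g) x))^2))"
  unfolding kap_def by (rule sum_left[OF h, symmetric])
 also have "... = kap x z"
  unfolding kap_def using h by (intro sum.cong refl) (simp add: linear_diff[OF G_linear[OF h], symmetric])
 finally show ?thesis .
qed

text \<open>The triangle inequality between orbits in multiplicative form:
  \<open>1 + (a + b)^2 <= 2 * ((1 + a^2) * (1 + b^2))\<close>. Invariance of \<open>kap\<close>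
  collapses the second sum.\<close>

lemma kap_triangle: "kap x z * kap y z <= 2 * real (card G) * kap x y"
proof -
 have "kap x z * kap y z = (SUM g:G. SUM h:G. 1 / (1 + (norm (z - g x))^2) * (1 / (1 + (norm (z - h y))^2)))"
  by (simp add: kap_def sum_product)
 also have "... <= (SUM g:G. SUM h:G. 2 * (1 / (1 + (norm (h y - g x))^2)))"
 proof (intro sum_mono)
  fix g h
  let ?a = "norm (z - g x)" and ?b = "norm (z - h y)"
  have "norm (h y - g x) <= ?a + ?b"
   using norm_triangle_ineq4[of "z - g x" "z - h y"] by simp
  then have "(norm (h y - g x))^2 <= (?a + ?b)^2" by (intro power_mono) auto
  also have "... <= 2 * ?a^2 + 2 * ?b^2"
   using zero_le_power2[of "?a - ?b"] by (simp add: power2_eq_square algebra_simps)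
  also have "... <= 2 * ((1 + ?a^2) * (1 + ?b^2)) - 1" by (simp add: algebra_simps)
  finally have "1 + (norm (h y - g x))^2 <= 2 * ((1 + ?a^2) * (1 + ?b^2))" by simp
  then have "2 / (2 * ((1 + ?a^2) * (1 + ?b^2))) <= 2 / (1 + (norm (h y - g x))^2)"
   by (intro divide_left_mono) (auto intro!: mult_pos_pos)
  then show "1 / (1 + ?a^2) * (1 / (1 + ?b^2)) <= 2 * (1 / (1 + (norm (h y - g x))^2))" by simp
 qed
 also have "... = (SUM g:G. 2 * kap x y)"
 proof -
  have "(SUM g:G. SUM h:G. 2 * (1 / (1 + (norm (h y - g x))^2))) = (SUM h:G. 2 * kap x (h y))"
   unfolding kap_def sum_distrib_left by (rule sum.swap)
  also have "... = (SUM h:G. 2 * kap x y)" by (intro sum.cong refl) (simp add: kap_G)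
  finally show ?thesis .
 qed
 finally show ?thesis by simp
qed

text \<open>A Gaussian in the orbit distance is below every power of \<open>kap\<close>, by
  \<open>pow_exp_le\<close> applied to \<open>(1 + s) / 8\<close>.\<close>

lemma hk_kap: "EX C>0. ALL x y. hk x y <= C * kap x y ^ M / Vol x"
proof -
 obtain C where C: "C > 0" "!!x y. hk x y <= C / Vol x * (SUM g:G. exp (- (norm (g x - y))\<^sup>2 / 8))"
  using hk_bound by blast
 define D where "D = fact M * 8 ^ M * exp (1/8 :: real)"
 have D: "D > 0" by (simp add: D_def)
 have e: "exp (- s / 8) <= D * (1 / (1 + s)) ^ M" if s: "0 <= s" for s :: real
 proof -
  have "((1 + s) / 8) ^ M <= fact M * exp ((1 + s) / 8)" using s by (intro pow_exp_le) simp
  then have "(1 + s) ^ M <= 8 ^ M * (fact M * exp ((1 + s) / 8))"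
   by (simp add: power_divide divide_le_eq mult.commute)
  also have "... = D * exp (s / 8)" by (simp add: D_def add_divide_distrib exp_add)
  finally have "(1 + s) ^ M * exp (- s / 8) <= D * exp (s / 8) * exp (- s / 8)" by (intro mult_right_mono) auto
  then have "(1 + s) ^ M * exp (- s / 8) <= D" by (simp add: mult.assoc mult_exp_exp)
  moreover have "0 < (1 + s) ^ M" using s by simp
  ultimately show ?thesis by (simp add: power_divide pos_le_divide_eq mult.commute)
 qed
 have "hk x y <= (C * D * real (card G)) * kap x y ^ M / Vol x" for x y
 proof -
  have "(SUM g:G. exp (- (norm (g x - y))\<^sup>2 / 8)) <= (SUM g:G. D * kap x y ^ M)"
  proof (intro sum_mono)
   fix g assume g: "g \<in> G"
   have "exp (- (norm (g x - y))\<^sup>2 / 8) <= D * (1 / (1 + (norm (y - g x))^2)) ^ M"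
    using e[of "(norm (y - g x))^2"] by (simp add: norm_minus_commute)
   also have "... <= D * kap x y ^ M"
    using D by (intro mult_left_mono power_mono kap_member g) (auto intro: less_imp_le)
   finally show "exp (- (norm (g x - y))\<^sup>2 / 8) <= D * kap x y ^ M" .
  qed
  then have "C / Vol x * (SUM g:G. exp (- (norm (g x - y))\<^sup>2 / 8)) <= C / Vol x * (real (card G) * (D * kap x y ^ M))"
   using C(1) Vol_pos[of x] by (intro mult_left_mono) (auto intro: less_imp_le)
  then show ?thesis using C(2)[of x y] by (simp add: mult_ac)
 qed
 then show ?thesis using C(1) D card_G_pos by (intro exI[of _ "C * D * real (card G)"]) auto
qed

text \<open>\<open>kap x z\<close> lies between \<open>1 / (1 + d^2)\<close> and
  \<open>card G\<close> times this, with \<open>d\<close> the distance of the orbits, so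
  \<open>rho\<close> is comparable to \<open>1 + d\<close>. Unlike \<open>d\<close> it is smooth, as
  the energy argument requires, and it is still 1-Lipschitz.\<close>

definition rho :: "real^'n => real^'n => real" where "rho x z = kap x z powr (-1/2)"

lemma rho_pos [simp]: "0 < rho x z"
 by (simp add: rho_def)

lemma rho_sq: "(rho x z)^2 = 1 / kap x z"
 unfolding rho_def power2_eq_square powr_add[symmetric] by (simp add: powr_minus_divide less_imp_le)

lemma rho_G: "h \<in> G ==> rho x (h z) = rho x z"
 by (simp add: rho_def kap_G)

lemma rho_le: "rho x z <= 1 + norm x + norm z"
proof -
 have "1 / (1 + (norm (z - x))^2) <= kap x z" using kap_member[OF id_in_G, of z x] by simp
 then have "1 / kap x z <= 1 + (norm (z - x))^2" by (simp add: divide_le_eq mult.commute)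
 also have "... <= (1 + norm (z - x))^2" by (simp add: power2_eq_square algebra_simps)
 finally have "(rho x z)^2 <= (1 + norm (z - x))^2" by (simp add: rho_sq)
 then have "rho x z <= 1 + norm (z - x)" by (rule power2_le_imp_le) simp
 then show ?thesis using norm_triangle_ineq4[of z x] by linarith
qed

lemma rho_ge: "1 <= real (card G) * rho x z"
proof -
 have c: "1 <= real (card G)" using card_G_pos by linarith
 have "1 / real (card G) <= (rho x z)^2"
  unfolding rho_sq using kap_le[of x z] card_G_pos by (intro divide_left_mono) (auto intro!: mult_pos_pos simp del: card_gt_0_iff)
 then have "1^2 <= real (card G) * (rho x z)^2" using c by (simp add: divide_le_eq mult.commute)
 also have "... <= (real (card G) * real (card G)) * (rho x z)^2"
  using mult_left_mono[OF c, of "real (card G)"] by (intro mult_right_mono) auto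
 also have "... = (real (card G) * rho x z)^2" by (simp add: power2_eq_square)
 finally show ?thesis by (rule power2_le_imp_le) (simp add: less_imp_le)
qed

definition drho :: "real^'n => real^'n => real^'n => real" where
 "drho x z v = (-1/2) * kap x z powr (-3/2) * (SUM g:G. - (2 * ((z - g x) \<cdot> v)) / (1 + (norm (z - g x))^2)^2)"

lemma rho_has_derivative: "(rho x has_derivative drho x z) (at z)"
proof -
 have "((%z. 1 / (1 + (norm (z - g x))^2)) has_derivative (%v. - (2 * ((z - g x) \<cdot> v)) / (1 + (norm (z - g x))^2)^2)) (at z)" for g
 proof -
  have "((%z. 1 + (z - g x) \<cdot> (z - g x)) has_derivative (%v. 2 * ((z - g x) \<cdot> v))) (at z)"
   by (auto intro!: derivative_eq_intros simp: inner_commute)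
  moreover have "1 + (z - g x) \<cdot> (z - g x) ~= 0" using one_plus_sq_pos[of "z - g x"] by (simp add: power2_norm_eq_inner)
  ultimately have "((%z. inverse (1 + (z - g x) \<cdot> (z - g x))) has_derivative
    (%v. - (inverse (1 + (z - g x) \<cdot> (z - g x)) * (2 * ((z - g x) \<cdot> v)) * inverse (1 + (z - g x) \<cdot> (z - g x))))) (at z)"
   by (intro Deriv.has_derivative_inverse)
  then show ?thesis unfolding power2_norm_eq_inner by (simp add: divide_inverse power2_eq_square mult_ac)
 qed
 then have d: "(kap x has_derivative (%v. SUM g:G. - (2 * ((z - g x) \<cdot> v)) / (1 + (norm (z - g x))^2)^2)) (at z)"
  unfolding kap_def by (intro has_derivative_sum)
 have "((%t. t powr (-1/2)) has_real_derivative (-1/2) * kap x z powr (-1/2 - 1)) (at (kap x z))"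
  by (rule has_real_derivative_powr[OF kap_pos])
 from has_derivative_compose[OF d this[unfolded has_field_derivative_def]]
 show ?thesis unfolding rho_def drho_def by simp
qed

text \<open>With \<open>n = norm (z - g x)\<close> and \<open>s = 1 + n^2\<close>, a summand of
  \<open>kap\<close> has gradient at most \<open>2 * n / s^2\<close>, and \<open>n / s\<close> is at
  most the square root of \<open>kap\<close>. The sum is thus bounded by
  \<open>2 * kap powr (3/2)\<close>, which the chain rule factor cancels exactly.\<close>

lemma drho_le: "\<bar>drho x z v\<bar> <= norm v"
proof -
 let ?k = "kap x z"
 have "\<bar>SUM g:G. - (2 * ((z - g x) \<cdot> v)) / (1 + (norm (z - g x))^2)^2\<bar>
   <= (SUM g:G. \<bar>- (2 * ((z - g x) \<cdot> v)) / (1 + (norm (z - g x))^2)^2\<bar>)" by (rule sum_abs)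
 also have "... <= (SUM g:G. (2 * norm v * sqrt ?k) * (1 / (1 + (norm (z - g x))^2)))"
 proof (intro sum_mono)
  fix g assume g: "g \<in> G"
  define n s where "n = norm (z - g x)" and "s = 1 + n^2"
  have s: "0 < s" by (simp add: s_def n_def)
  have "n <= sqrt s" by (rule real_le_rsqrt) (simp add: s_def)
  then have "n / s <= sqrt s / s" using s by (intro divide_right_mono) auto
  also have "... = sqrt (1 / s)" using s by (simp add: real_sqrt_divide real_div_sqrt divide_simps)
  also have "... <= sqrt ?k" using kap_member[OF g, of z x] by (simp add: s_def n_def)
  finally have ns: "n / s <= sqrt ?k" .
  have "\<bar>- (2 * ((z - g x) \<cdot> v)) / (1 + (norm (z - g x))^2)^2\<bar> = 2 * \<bar>(z - g x) \<cdot> v\<bar> / s^2"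
   by (simp add: s_def n_def abs_mult)
  also have "... <= 2 * (n * norm v) / s^2"
   using Cauchy_Schwarz_ineq2[of "z - g x" v] by (intro divide_right_mono) (auto simp: n_def)
  also have "... = (2 * norm v) * (n / s) * (1 / s)" by (simp add: power2_eq_square)
  also have "... <= (2 * norm v) * sqrt ?k * (1 / s)" using s by (intro mult_right_mono mult_left_mono ns) auto
  finally show "\<bar>- (2 * ((z - g x) \<cdot> v)) / (1 + (norm (z - g x))^2)^2\<bar> <= (2 * norm v * sqrt ?k) * (1 / (1 + (norm (z - g x))^2))"
   by (simp add: s_def n_def)
 qed
 also have "... = 2 * norm v * (sqrt ?k * ?k)" by (simp add: kap_def sum_distrib_left)
 also have "sqrt ?k * ?k = ?k powr (3/2)"
  using powr_add[of ?k "1/2" 1] kap_pos[of x z] by (simp add: powr_half_sqrt less_imp_le)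
 finally have S: "\<bar>SUM g:G. - (2 * ((z - g x) \<cdot> v)) / (1 + (norm (z - g x))^2)^2\<bar> <= 2 * norm v * ?k powr (3/2)" .
 have "\<bar>drho x z v\<bar> = 1/2 * ?k powr (-3/2) * \<bar>SUM g:G. - (2 * ((z - g x) \<cdot> v)) / (1 + (norm (z - g x))^2)^2\<bar>"
  by (simp add: drho_def abs_mult)
 also have "... <= 1/2 * ?k powr (-3/2) * (2 * norm v * ?k powr (3/2))" by (intro mult_left_mono S) simp
 also have "... = norm v * (?k powr (-3/2) * ?k powr (3/2))" by simp
 also have "?k powr (-3/2) * ?k powr (3/2) = 1" using kap_pos[of x z] by (simp add: powr_add[symmetric])
 finally show ?thesis by simp
qed

lemma rho_cont: "continuous_on UNIV (rho x)"
 by (intro continuous_at_imp_continuous_on ballI has_derivative_continuous[OF rho_has_derivative])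

lemma kap_cont: "continuous_on UNIV (kap x)"
 unfolding kap_def by (intro continuous_intros ballI less_imp_neq[OF one_plus_sq_pos, symmetric])

lemma hk_measurable: "hk x \<in> BM"
 by (intro cont_BM hk_cont continuous_intros)

text \<open>One factor \<open>hk\<close> is estimated pointwise by \<open>hk_kap\<close>, which
  cancels the weight; the other has mass 1.\<close>

lemma weighted_hk: "EX C>0. ALL x. (NI z. ennreal ((1 / kap x z) ^ M * (hk x z)^2)) <= ennreal (C / Vol x)"
proof -
 obtain C where C: "C > 0" "!!x y. hk x y <= C * kap x y ^ M / Vol x" using hk_kap by blast
 have "(NI z. ennreal ((1 / kap x z) ^ M * (hk x z)^2)) <= ennreal (C / Vol x)" for x
 proof -
  have "(NI z. ennreal ((1 / kap x z) ^ M * (hk x z)^2)) <= (NI z. ennreal (C / Vol x) * ennreal (hk x z))"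
  proof (rule nn_integral_mono)
   fix z
   have "(1 / kap x z) ^ M * hk x z <= (1 / kap x z) ^ M * (C * kap x z ^ M / Vol x)"
    by (intro mult_left_mono C) (simp add: less_imp_le)
   also have "... = C / Vol x" using kap_pos[of x z] by (simp add: power_divide)
   finally have "((1 / kap x z) ^ M * hk x z) * hk x z <= C / Vol x * hk x z"
    using hk_pos[of x z] by (intro mult_right_mono) (auto intro: less_imp_le)
   then have "ennreal ((1 / kap x z) ^ M * (hk x z)^2) <= ennreal (C / Vol x * hk x z)"
    by (intro ennreal_leI) (simp add: power2_eq_square mult.assoc)
   also have "... = ennreal (C / Vol x) * ennreal (hk x z)"
    using C(1) Vol_pos[of x] by (intro ennreal_mult') (auto intro: less_imp_le)
   finally show "ennreal ((1 / kap x z) ^ M * (hk x z)^2) <= ennreal (C / Vol x) * ennreal (hk x z)" .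
  qed
  also have "... = ennreal (C / Vol x) * (NI z. ennreal (hk x z))"
   by (rule nn_integral_cmult) (unfold meas_dw, rule measurable_compose[OF hk_measurable measurable_ennreal])
  also have "(NI z. ennreal (hk x z)) = ennreal 1"
   using nn_integral_eq_integral[OF hk_integrable, of x] hk_int hk_pos by (simp add: less_imp_le)
  finally show ?thesis by simp
 qed
 then show ?thesis using C(1) by blast
qed

section \<open>Finite propagation\<close>

text \<open>\<open>tri x z p\<close> is, up to a constant, the generalised translation by \<open>p\<close> of the heat kernel with pole \<open>x\<close>,
 evaluated at \<open>z\<close>.\<close>

definition tri :: "real^'n => real^'n => real^'n => complex" where
 "tri x z p = (LINT xi|dw. (Ek \<i> xi x * Ek (- \<i>) xi z * of_real (gs xi)) * Ek (- \<i>) p xi)"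

definition dtri :: "real^'n => real^'n => real^'n => real^'n => complex" where
 "dtri x z p v = (LINT xi|dw. (Ek \<i> xi x * Ek (- \<i>) xi z * of_real (gs xi)) * dEk (- \<i>) p xi v)"

lemma tri_sym: "tri x z p = tri x p z"
 unfolding tri_def by (intro integral_cong refl) (simp add: Ek_sym[of _ p] Ek_sym[of _ z] mult_ac)

lemma tri_measurable: "(%xi. Ek \<i> xi x * Ek (- \<i>) xi z * of_real (gs xi)) \<in> BM"
 by (intro borel_measurable_times Ek_measurable) measurable

lemma tri_coeff: "norm (Ek \<i> xi x * Ek (- \<i>) xi z * of_real (gs xi)) <= gs xi"
proof -
 have "norm (Ek \<i> xi x) * norm (Ek (- \<i>) xi z) * gs xi <= 1 * 1 * gs xi"
  by (intro mult_right_mono mult_mono Ek_imag_le) (auto intro: less_imp_le)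
 then show ?thesis by (simp add: norm_mult abs_of_pos)
qed

lemma tri_integrand: "integrable dw (%xi. (Ek \<i> xi x * Ek (- \<i>) xi z * of_real (gs xi)) * Ek (- \<i>) p xi)"
proof (rule integrable_bound[OF gs_integrable])
 show "(%xi. (Ek \<i> xi x * Ek (- \<i>) xi z * of_real (gs xi)) * Ek (- \<i>) p xi) \<in> borel_measurable dw"
  unfolding meas_dw Ek_sym[of _ p] by (intro borel_measurable_times tri_measurable Ek_measurable)
 show "AE xi in dw. norm ((Ek \<i> xi x * Ek (- \<i>) xi z * of_real (gs xi)) * Ek (- \<i>) p xi) <= norm (gs xi)"
 proof (rule AE_I2)
  fix xi
  have "norm (Ek \<i> xi x * Ek (- \<i>) xi z * of_real (gs xi)) * norm (Ek (- \<i>) p xi) <= gs xi * 1"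
   by (intro mult_mono tri_coeff Ek_imag_le) (auto intro: less_imp_le)
  then show "norm ((Ek \<i> xi x * Ek (- \<i>) xi z * of_real (gs xi)) * Ek (- \<i>) p xi) <= norm (gs xi)"
   by (simp add: norm_mult abs_of_pos)
 qed
qed

lemma tri_dbound: "norm ((Ek \<i> xi x * Ek (- \<i>) xi z * of_real (gs xi)) * dEk (- \<i>) p xi v) <= (3 * (norm xi * gs xi)) * norm v"
proof -
 have "norm (Ek \<i> xi x * Ek (- \<i>) xi z * of_real (gs xi)) * norm (dEk (- \<i>) p xi v) <= gs xi * (3 * (norm (- \<i>) * norm v * norm xi))"
  by (intro mult_mono tri_coeff dEk_imag_le) (auto intro: less_imp_le)
 then show ?thesis by (simp add: norm_mult mult_ac)
qed

lemma gs1_integrable: "integrable dw (%xi. 3 * (norm xi * gs xi))"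
 using integrable_gauss_real[of norm 1 1 0] by simp

lemma tri_has_derivative: "((%p. tri x z p) has_derivative dtri x z p) (at p)"
 unfolding tri_def[abs_def] dtri_def[abs_def]
 by (rule T_LINT(1)[OF has_derivative_mult_right[OF Ek_has_derivative] tri_integrand tri_dbound gs1_integrable])

lemma T_tri: "T v (%p. tri x z p) p = (LINT xi|dw. (Ek \<i> xi x * Ek (- \<i>) xi z * of_real (gs xi)) * (- \<i> * of_real (v \<cdot> xi) * Ek (- \<i>) p xi))"
proof -
 have "T v (%p. tri x z p) p = (LINT xi|dw. T v (%p. (Ek \<i> xi x * Ek (- \<i>) xi z * of_real (gs xi)) * Ek (- \<i>) p xi) p)"
  unfolding tri_def[abs_def]
  by (rule T_LINT(2)[OF has_derivative_mult_right[OF Ek_has_derivative] tri_integrand tri_dbound gs1_integrable])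
 then show ?thesis by (simp only: T_cmul[OF differentiableI[OF Ek_has_derivative]] T_Ek)
qed

text \<open>The poles \<open>z\<close> and \<open>p\<close> enter through the same kernel, so either
  operator multiplies the integrand by \<open>- \<i> * (v \<cdot> xi)\<close>. This converts
  transport in the pole \<open>p\<close> into an operator in \<open>z\<close> that can be integrated
  by parts.\<close>

lemma T_tri_exchange: "T v (%p. tri x z p) p = T v (%z. tri x z p) z"
proof -
 have "(%z. tri x z p) = (%z. tri x p z)" using tri_sym by blast
 then show ?thesis
  unfolding T_tri
  by (simp only: T_tri) (intro integral_cong refl, simp add: Ek_sym[of _ p] Ek_sym[of _ z] mult_ac)
qed

lemma tri_has_derivative_z: "((%z. tri x z p) has_derivative dtri x p z) (at z)"
 using tri_has_derivative[of x p z] tri_sym[of x _ p] by simp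

lemma tri_le: "norm (tri x z p) <= ck"
proof -
 have "norm (tri x z p) <= (LINT xi|dw. norm ((Ek \<i> xi x * Ek (- \<i>) xi z * of_real (gs xi)) * Ek (- \<i>) p xi))"
  unfolding tri_def by (rule integral_norm_bound)
 also have "... <= (LINT xi|dw. gs xi)"
 proof (rule integral_mono[OF integrable_norm[OF tri_integrand] gs_integrable])
  fix xi
  have "norm (Ek \<i> xi x * Ek (- \<i>) xi z * of_real (gs xi)) * norm (Ek (- \<i>) p xi) <= gs xi * 1"
   by (intro mult_mono tri_coeff Ek_imag_le) (auto intro: less_imp_le)
  then show "norm ((Ek \<i> xi x * Ek (- \<i>) xi z * of_real (gs xi)) * Ek (- \<i>) p xi) <= gs xi" by (simp add: norm_mult)
 qed
 finally show ?thesis by (simp add: dunkl_const_def gs_def)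
qed

definition ck1 :: real where "ck1 = (LINT xi|dw. 3 * (norm xi * gs xi))"

lemma ck1_nonneg: "0 <= ck1"
 unfolding ck1_def by (intro integral_nonneg_AE AE_I2) (simp add: less_imp_le)

lemma dtri_le: "norm (dtri x z p v) <= ck1 * norm v"
proof -
 have i: "integrable dw (%xi. (3 * (norm xi * gs xi)) * norm v)" by (rule integrable_mult_left[OF gs1_integrable])
 have "norm (dtri x z p v) <= (LINT xi|dw. (3 * (norm xi * gs xi)) * norm v)"
  unfolding dtri_def by (rule integral_norm_bound_integral[OF _ i tri_dbound])
   (rule has_derivative_LINT(1)[OF zero_less_one has_derivative_mult_right[OF Ek_has_derivative] tri_integrand tri_dbound gs1_integrable])
 then show ?thesis unfolding ck1_def by simp
qed

lemma tri_0: "tri x z 0 = of_real (ck^2 * hk x z)"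
 unfolding hk_fourier[symmetric] tri_def by simp

lemma T_cnj:
 assumes "(f has_derivative f') (at x)"
 shows "T v (%x. cnj (f x)) x = cnj (T v f x)"
proof -
 have "((%x. cnj (f x)) has_derivative (%v. cnj (f' v))) (at x)"
  using bounded_linear.has_derivative[OF bounded_linear_cnj assms] .
 from T_at[OF this] show ?thesis unfolding T_at[OF assms]
  by (simp add: if_distrib[of cnj] cong: if_cong)
qed

section \<open>Weights for the energy estimate\<close>

definition eta :: "real => nat => real^'n => real" where
 "eta ep K z = inverse (1 + ep^2 * (z \<cdot> z)) ^ K"

definition deta :: "real => nat => real^'n => real^'n => real" where
 "deta ep K z v = real K * - (inverse (1 + ep^2 * (z \<cdot> z)) * (2 * ep^2 * (z \<cdot> v)) * inverse (1 + ep^2 * (z \<cdot> z)))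
   * inverse (1 + ep^2 * (z \<cdot> z)) ^ (K - 1)"

lemma eta_base_pos [simp]: "0 < 1 + ep^2 * (z \<cdot> z)" for z :: "real^'n"
 by (simp add: add_pos_nonneg)

lemma eta_pos [simp]: "0 < eta ep K z"
 by (simp add: eta_def)

lemma eta_le1: "eta ep K z <= 1"
 unfolding eta_def by (intro power_le_one) (simp_all add: inverse_le_1_iff)

lemma eta_G: "h \<in> G ==> eta ep K (h z) = eta ep K z"
 by (simp add: eta_def)

lemma eta_has_derivative: "(eta ep K has_derivative deta ep K z) (at z)"
proof -
 have "((%z. 1 + ep^2 * (z \<cdot> z)) has_derivative (%v. 2 * ep^2 * (z \<cdot> v))) (at z)"
  by (auto intro!: derivative_eq_intros simp: inner_commute)
 moreover have "1 + ep^2 * (z \<cdot> z) ~= 0" using eta_base_pos by (metis less_irrefl)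
 ultimately have "((%z. inverse (1 + ep^2 * (z \<cdot> z))) has_derivative
   (%v. - (inverse (1 + ep^2 * (z \<cdot> z)) * (2 * ep^2 * (z \<cdot> v)) * inverse (1 + ep^2 * (z \<cdot> z))))) (at z)"
  by (intro Deriv.has_derivative_inverse)
 from has_derivative_power[OF this, of K] show ?thesis unfolding eta_def deta_def .
qed

text \<open>Since \<open>2 * ep * norm z <= 1 + ep^2 * (z \<cdot> z)\<close>, the logarithmic
  gradient of \<open>eta\<close> is of order \<open>ep\<close>. It is the error term that disappears
  in the limit.\<close>

lemma deta_le:
 assumes e: "0 < ep"
 shows "\<bar>deta ep K z v\<bar> <= real K * ep * norm v * eta ep K z"
proof (cases K)
 case 0
 then show ?thesis by (simp add: deta_def)
next
 case (Suc m)
 define b where "b = inverse (1 + ep^2 * (z \<cdot> z))"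
 have b: "0 < b" by (simp add: b_def)
 have "2 * ep * norm z <= 1 + ep^2 * (z \<cdot> z)"
  using zero_le_power2[of "ep * norm z - 1"] by (simp add: power2_eq_square algebra_simps flip: power2_norm_eq_inner)
 then have "(2 * ep * norm z) * b <= (1 + ep^2 * (z \<cdot> z)) * b" by (rule mult_right_mono) (use b in simp)
 also have "... = 1" using eta_base_pos[of ep z] unfolding b_def by (intro right_inverse) linarith
 finally have zb: "(2 * ep * norm z) * b <= 1" .
 have "\<bar>2 * ep^2 * (z \<cdot> v)\<bar> * b <= (2 * ep^2 * (norm z * norm v)) * b"
  using b mult_left_mono[OF Cauchy_Schwarz_ineq2[of z v], of "2 * ep^2"] by (intro mult_right_mono) (auto simp: abs_mult)
 also have "... = (ep * norm v) * ((2 * ep * norm z) * b)" by (simp add: power2_eq_square)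
 also have "... <= (ep * norm v) * 1" using e by (intro mult_left_mono zb) auto
 finally have 1: "\<bar>2 * ep^2 * (z \<cdot> v)\<bar> * b <= ep * norm v" by simp
 have "\<bar>deta ep K z v\<bar> = (\<bar>2 * ep^2 * (z \<cdot> v)\<bar> * b) * (real K * (b * b ^ m))"
  using b by (simp add: deta_def b_def[symmetric] Suc abs_mult)
 also have "... <= (ep * norm v) * (real K * (b * b ^ m))" using b by (intro mult_right_mono 1) simp
 also have "... = real K * ep * norm v * eta ep K z" by (simp add: eta_def b_def[symmetric] Suc)
 finally show ?thesis .
qed

text \<open>The power of the distance grows with order \<open>2 * M\<close> in \<open>z\<close> and
  \<open>eta\<close> decays with order \<open>2 * (M + Nd)\<close>, so \<open>psi\<close> decays
  with order \<open>2 * Nd\<close>, enough for all integrals against \<open>dw\<close>.\<close>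

definition psi :: "real => nat => real^'n => real => real => real^'n => real" where
 "psi ep M x Q r z = eta ep (M + Nd) z * (rho x z + (1 - r) * Q) ^ (2 * M)"

definition dpsi :: "real => nat => real^'n => real => real => real^'n => real^'n => real" where
 "dpsi ep M x Q r z v = eta ep (M + Nd) z * (real (2 * M) * drho x z v * (rho x z + (1 - r) * Q) ^ (2 * M - 1))
   + deta ep (M + Nd) z v * (rho x z + (1 - r) * Q) ^ (2 * M)"

text \<open>The partial derivative of \<open>psi\<close> in \<open>r\<close>; \<open>dpsi\<close> is
  the one in \<open>z\<close>.\<close>

definition rpsi :: "real => nat => real^'n => real => real => real^'n => real" where
 "rpsi ep M x Q r z = eta ep (M + Nd) z * (real (2 * M) * (- Q) * (rho x z + (1 - r) * Q) ^ (2 * M - 1))"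

lemma psi_has_derivative: "(psi ep M x Q r has_derivative dpsi ep M x Q r z) (at z)"
proof -
 have "((%z. rho x z + (1 - r) * Q) has_derivative drho x z) (at z)"
  using has_derivative_add[OF rho_has_derivative has_derivative_const] by simp
 from has_derivative_mult[OF eta_has_derivative[of ep "M + Nd"] has_derivative_power[OF this, of "2 * M"]]
 show ?thesis unfolding psi_def dpsi_def .
qed

lemma psi_r_derivative: "((%r. psi ep M x Q r z) has_derivative (%h. rpsi ep M x Q r z * h)) (at r)"
proof -
 have "((%r. rho x z + (1 - r) * Q) has_derivative (%h. - Q * h)) (at r)"
  by (auto intro!: derivative_eq_intros)
 from has_derivative_mult_right[OF has_derivative_power[OF this], of "eta ep (M + Nd) z" "2 * M"]
 show ?thesis unfolding psi_def rpsi_def by (simp add: mult_ac)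
qed

lemma psi_nonneg: "0 <= psi ep M x Q r z"
 unfolding psi_def by (intro mult_nonneg_nonneg less_imp_le[OF eta_pos]) (simp add: power_mult)

lemma psi_G: "h \<in> G ==> psi ep M x Q r (h z) = psi ep M x Q r z"
 by (simp add: psi_def eta_G rho_G)

text \<open>\<open>(1 + norm z)^2\<close> is at most \<open>2 * (1 + 1 / ep^2)\<close> times the
  base of \<open>eta\<close>. The constant degenerates as \<open>ep\<close> tends to 0; it enters
  integrability and differentiation, not the final energy estimate.\<close>

lemma eta_decay:
 assumes e: "0 < ep" and B: "0 <= B"
 shows "eta ep (M + Nd) z * (B * (1 + norm z)) ^ (2 * M)
  <= ((2 * (1 + 1 / ep^2)) ^ (M + Nd) * B ^ (2 * M)) / (1 + norm z) ^ Nd"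
proof -
 define L where "L = 1 + 1 / ep^2"
 define n where "n = 1 + norm z"
 have n: "1 <= n" by (simp add: n_def)
 have L: "0 < L" using e by (simp add: L_def add_pos_pos)
 have "n^2 <= 2 * (1 + z \<cdot> z)"
  using zero_le_power2[of "norm z - 1"] by (simp add: n_def power2_eq_square algebra_simps flip: power2_norm_eq_inner)
 also have "1 + z \<cdot> z <= L * (1 + ep^2 * (z \<cdot> z))"
  using e by (simp add: L_def algebra_simps)
 finally have "n^2 <= (2 * L) * (1 + ep^2 * (z \<cdot> z))" by simp
 then have "inverse (1 + ep^2 * (z \<cdot> z)) <= (2 * L) / n^2"
  using n eta_base_pos[of ep z] by (simp add: divide_simps mult.commute)
 then have "eta ep (M + Nd) z <= ((2 * L) / n^2) ^ (M + Nd)"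
  unfolding eta_def by (intro power_mono) (simp_all add: less_imp_le)
 then have "eta ep (M + Nd) z * (B * n) ^ (2 * M) <= ((2 * L) / n^2) ^ (M + Nd) * (B * n) ^ (2 * M)"
  using B n by (intro mult_right_mono) auto
 also have "... = ((2 * L) ^ (M + Nd) * B ^ (2 * M)) * (n ^ (2 * M) / (n ^ (2 * M) * n ^ (2 * Nd)))"
  by (simp add: power_divide power_mult_distrib power_mult[symmetric] power_add distrib_left)
 also have "... = ((2 * L) ^ (M + Nd) * B ^ (2 * M)) * (1 / n ^ (2 * Nd))"
  using n by simp
 also have "... <= ((2 * L) ^ (M + Nd) * B ^ (2 * M)) * (1 / n ^ Nd)"
 proof (rule mult_left_mono)
  show "1 / n ^ (2 * Nd) <= 1 / n ^ Nd"
   using n by (intro divide_left_mono power_increasing) auto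
 qed (use L B in simp)
 finally show ?thesis by (simp add: n_def L_def)
qed

lemma weight_le:
 assumes r: "\<bar>1 - r\<bar> <= 2" and Q: "0 <= Q"
 shows "\<bar>rho x z + (1 - r) * Q\<bar> <= (1 + norm x + 2 * Q) * (1 + norm z)"
  and "j <= 2 * M ==> \<bar>(rho x z + (1 - r) * Q) ^ j\<bar> <= ((1 + norm x + 2 * Q) * (1 + norm z)) ^ (2 * M)"
proof -
 have "\<bar>(1 - r) * Q\<bar> <= 2 * Q" using r Q by (simp add: abs_mult mult_right_mono)
 then have "\<bar>rho x z + (1 - r) * Q\<bar> <= 1 + norm x + norm z + 2 * Q" using rho_le[of x z] rho_pos[of x z] by linarith
 also have "... <= (1 + norm x + 2 * Q) * (1 + norm z)" using Q by (simp add: algebra_simps)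
 finally show 1: "\<bar>rho x z + (1 - r) * Q\<bar> <= (1 + norm x + 2 * Q) * (1 + norm z)" .
 have "1 * 1 <= (1 + norm x + 2 * Q) * (1 + norm z)" using Q by (intro mult_mono) auto
 then have g1: "1 <= (1 + norm x + 2 * Q) * (1 + norm z)" by simp
 assume "j <= 2 * M"
 have "\<bar>(rho x z + (1 - r) * Q) ^ j\<bar> <= ((1 + norm x + 2 * Q) * (1 + norm z)) ^ j"
  unfolding power_abs by (intro power_mono 1) simp
 also have "... <= ((1 + norm x + 2 * Q) * (1 + norm z)) ^ (2 * M)" by (rule power_increasing[OF \<open>j <= 2 * M\<close> g1])
 finally show "\<bar>(rho x z + (1 - r) * Q) ^ j\<bar> <= ((1 + norm x + 2 * Q) * (1 + norm z)) ^ (2 * M)" .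
qed

text \<open>The range \<open>\<bar>1 - r\<bar> <= 2\<close> contains the unit balls around the
  points of \<open>[0, 1]\<close>, on which the energy is differentiated in
  \<open>r\<close>.\<close>

lemma psi_bounds:
 assumes e: "0 < ep" and Q: "0 <= Q"
 shows "EX C>=0. ALL r z v. \<bar>1 - r\<bar> <= 2 --> psi ep M x Q r z <= C / (1 + norm z) ^ Nd
  & \<bar>dpsi ep M x Q r z v\<bar> <= C * norm v / (1 + norm z) ^ Nd & \<bar>rpsi ep M x Q r z\<bar> <= C / (1 + norm z) ^ Nd"
proof -
 define B where "B = 1 + norm x + 2 * Q"
 define C0 where "C0 = (2 * (1 + 1 / ep^2)) ^ (M + Nd) * B ^ (2 * M)"
 define C where "C = (1 + 2 * real M + 2 * real M * Q + real (M + Nd) * ep) * C0"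
 have B: "0 <= B" using Q by (simp add: B_def)
 have C0: "0 <= C0" using B by (simp add: C0_def)
 have Cg: "C0 <= C" "(2 * real M + real (M + Nd) * ep) * C0 <= C" "2 * real M * Q * C0 <= C"
  unfolding C_def using e Q C0 by (intro mult_right_mono order_trans[OF eq_refl[OF mult_1[symmetric]] mult_right_mono]; simp)+
 have "psi ep M x Q r z <= C / (1 + norm z) ^ Nd
  & \<bar>dpsi ep M x Q r z v\<bar> <= C * norm v / (1 + norm z) ^ Nd & \<bar>rpsi ep M x Q r z\<bar> <= C / (1 + norm z) ^ Nd"
  if r: "\<bar>1 - r\<bar> <= 2" for r z v
 proof -
  let ?a = "rho x z + (1 - r) * Q" and ?e = "eta ep (M + Nd) z"
  let ?W = "(B * (1 + norm z)) ^ (2 * M)"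
  note w = weight_le(2)[OF r Q, of _ M x z, folded B_def]
  have dec: "?e * ?W <= C0 / (1 + norm z) ^ Nd" unfolding C0_def by (rule eta_decay[OF e B])
  have e0: "0 <= ?e" by (simp add: less_imp_le)
  have W0: "0 <= ?W" using B by simp
  have p: "0 < (1 + norm z) ^ Nd" by (simp add: add_pos_nonneg)
  have "psi ep M x Q r z <= ?e * ?W"
   unfolding psi_def using w[of "2 * M"] by (intro mult_left_mono e0) auto
  also note dec
  also have "C0 / (1 + norm z) ^ Nd <= C / (1 + norm z) ^ Nd" by (rule divide_right_mono[OF Cg(1) less_imp_le[OF p]])
  finally have 1: "psi ep M x Q r z <= C / (1 + norm z) ^ Nd" .
  have "\<bar>dpsi ep M x Q r z v\<bar> <= ?e * (real (2 * M) * \<bar>drho x z v\<bar> * \<bar>?a ^ (2 * M - 1)\<bar>) + \<bar>deta ep (M + Nd) z v\<bar> * \<bar>?a ^ (2 * M)\<bar>"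
   unfolding dpsi_def by (rule order_trans[OF abs_triangle_ineq]) (simp add: abs_mult abs_of_nonneg[OF e0])
  also have "... <= ?e * (real (2 * M) * norm v * ?W) + (real (M + Nd) * ep * norm v * ?e) * ?W"
   by (intro add_mono mult_mono mult_left_mono e0 drho_le w deta_le[OF e] mult_nonneg_nonneg W0) (auto simp: e less_imp_le)
  also have "... = ((2 * real M + real (M + Nd) * ep) * norm v) * (?e * ?W)" by (simp add: algebra_simps)
  also have "... <= ((2 * real M + real (M + Nd) * ep) * norm v) * (C0 / (1 + norm z) ^ Nd)"
   using e by (intro mult_left_mono dec) auto
  also have "... = ((2 * real M + real (M + Nd) * ep) * C0) * (norm v / (1 + norm z) ^ Nd)" by simp
  also have "... <= C * (norm v / (1 + norm z) ^ Nd)" using p by (intro mult_right_mono Cg) auto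
  finally have 2: "\<bar>dpsi ep M x Q r z v\<bar> <= C * norm v / (1 + norm z) ^ Nd" by simp
  have "\<bar>rpsi ep M x Q r z\<bar> = (2 * real M * Q) * (?e * \<bar>?a ^ (2 * M - 1)\<bar>)"
   unfolding rpsi_def using Q by (simp add: abs_mult abs_of_nonneg[OF e0])
  also have "... <= (2 * real M * Q) * (?e * ?W)" using Q by (intro mult_left_mono w e0) auto
  also have "... <= (2 * real M * Q) * (C0 / (1 + norm z) ^ Nd)" using Q by (intro mult_left_mono dec) auto
  also have "... = (2 * real M * Q * C0) / (1 + norm z) ^ Nd" by simp
  also have "... <= C / (1 + norm z) ^ Nd" by (rule divide_right_mono[OF Cg(3) less_imp_le[OF p]])
  finally have 3: "\<bar>rpsi ep M x Q r z\<bar> <= C / (1 + norm z) ^ Nd" .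
  from 1 2 3 show ?thesis by blast
 qed
 then show ?thesis using C0 Cg(1) by (intro exI[of _ C]) auto
qed

text \<open>The weight was chosen so that its decrease in \<open>r\<close> compensates its gradient.\<close>

lemma psi_monotone:
 assumes e: "0 < ep" and r: "r <= 1" and Q: "norm v = Q"
 shows "rpsi ep M x Q r z - dpsi ep M x Q r z v <= real (M + Nd) * ep * Q * psi ep M x Q r z"
proof -
 let ?a = "rho x z + (1 - r) * Q" and ?e = "eta ep (M + Nd) z"
 have Q0: "0 <= Q" using Q norm_ge_zero by metis
 have a0: "0 <= ?a" using rho_pos[of x z] r Q0 by (simp add: add_nonneg_nonneg less_imp_le)
 have "- deta ep (M + Nd) z v * ?a ^ (2 * M) <= (real (M + Nd) * ep * Q * ?e) * ?a ^ (2 * M)"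
  using deta_le[OF e, of "M + Nd" z v] a0 unfolding Q by (intro mult_right_mono) auto
 moreover have "?e * (real (2 * M) * ?a ^ (2 * M - 1)) * (- Q - drho x z v) <= 0"
  using drho_le[of x z v] a0 unfolding Q by (intro mult_nonneg_nonpos) (auto intro!: mult_nonneg_nonneg simp: less_imp_le)
 ultimately show ?thesis unfolding rpsi_def dpsi_def psi_def by (simp add: algebra_simps)
qed

lemma eq_neg_iff_zero: "a = - a ==> a = 0" for a :: "'b :: real_vector"
proof -
 assume "a = - a"
 then have "a + a = 0" by (metis add.right_inverse)
 then have "2 *R a = 0" by (simp only: scaleR_2)
 then show "a = 0" by simp
qed

text \<open>At a point of the mirror, invariance equates the derivative in direction
  \<open>al\<close> with that in direction \<open>rf al al = - al\<close>.\<close>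

lemma inv_perp:
 assumes "(\<psi> has_derivative \<psi>') (at z)" "!!z. \<psi> (rf al z) = \<psi> z" "al \<in> R" "al \<cdot> z = 0"
 shows "\<psi>' al = (0 :: 'b :: real_normed_vector)"
proof -
 have fx: "rf al z = z" by (rule refl_fixed[OF assms(3,4)])
 have "((%z. \<psi> (rf al z)) has_derivative (%v. \<psi>' (rf al v))) (at z)"
  by (rule has_derivative_compose[OF refl_has_derivative[OF assms(3)]]) (simp add: fx assms(1))
 then have "(\<psi> has_derivative (%v. \<psi>' (rf al v))) (at z)" by (simp only: assms(2))
 from has_derivative_unique[OF assms(1) this] have "\<psi>' al = \<psi>' (rf al al)" by metis
 also have "... = - \<psi>' al"
  using linear_neg[OF has_derivative_linear[OF assms(1)]] by (simp add: refl_root[OF assms(3)])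
 finally show ?thesis by (rule eq_neg_iff_zero)
qed

lemma tri_measurable_z: "(%z. tri x z p) \<in> BM"
 by (intro cont_BM continuous_at_imp_continuous_on ballI
   has_derivative_continuous[OF tri_has_derivative_z])

text \<open>\<open>T v\<close> is skew and treats the invariant weight as a derivation would, so the
  real part of the pairing retains only the gradient of the weight.\<close>

lemma energy_identity:
 assumes e: "0 < ep" and Q: "0 <= Q" and r: "\<bar>1 - r\<bar> <= 2"
 shows "integrable dw (%z. T v (%z. tri x z p) z * (of_real (psi ep M x Q r z) * cnj (tri x z p)))"
  and "2 * Re (LINT z|dw. T v (%z. tri x z p) z * (of_real (psi ep M x Q r z) * cnj (tri x z p)))
   = - (LINT z|dw. dpsi ep M x Q r z v * (cmod (tri x z p))^2)"
  and "integrable dw (%z. dpsi ep M x Q r z v * (cmod (tri x z p))^2)"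
proof -
 obtain C where C: "C >= 0" "!!z. psi ep M x Q r z <= C / (1 + norm z) ^ Nd"
  "!!z v. \<bar>dpsi ep M x Q r z v\<bar> <= C * norm v / (1 + norm z) ^ Nd"
  using psi_bounds[OF e Q, of M x] r by blast
 let ?u = "%z. tri x z p"
 let ?g = "%z. of_real (psi ep M x Q r z) * cnj (tri x z p)"
 let ?g' = "%z v. of_real (psi ep M x Q r z) * cnj (dtri x p z v) + of_real (dpsi ep M x Q r z v) * cnj (tri x z p)"
 have ck0: "0 <= ck" by (rule less_imp_le[OF ck_pos])
 have du: "(?u has_derivative dtri x p z) (at z)" for z by (rule tri_has_derivative_z)
 have dcu: "((%z. cnj (tri x z p)) has_derivative (%v. cnj (dtri x p z v))) (at z)" for z
  by (rule bounded_linear.has_derivative[OF bounded_linear_cnj du])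
 have dg: "(?g has_derivative ?g' z) (at z)" for z
  by (rule has_derivative_mult[OF has_derivative_of_real[OF psi_has_derivative] dcu])
 have b1: "norm (?u z) <= (ck + ck1) * exp (0 * norm z)" for z using tri_le[of x z p] ck1_nonneg by simp
 have b2: "norm (dtri x p z v) <= (ck + ck1) * exp (0 * norm z) * norm v" for z v
  using dtri_le[of x p z v] mult_right_mono[OF ck0, of "norm v"] by (simp add: algebra_simps)
 have b3: "norm (?g z) <= (C * (ck + ck1)) * exp (- 0 * norm z) / (1 + norm z) ^ Nd" for z
 proof -
  have "psi ep M x Q r z * norm (tri x z p) <= C / (1 + norm z) ^ Nd * (ck + ck1)"
   using tri_le[of x z p] ck1_nonneg psi_nonneg C(1) by (intro mult_mono C(2)) auto
  then show ?thesis using psi_nonneg[of ep M x Q r z] by (simp add: norm_mult)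
 qed
 have b4: "norm (?g' z v) <= (C * (ck + ck1)) * exp (- 0 * norm z) * norm v / (1 + norm z) ^ Nd" for z v
 proof -
  have "norm (?g' z v) <= psi ep M x Q r z * norm (dtri x p z v) + \<bar>dpsi ep M x Q r z v\<bar> * norm (tri x z p)"
   by (rule order_trans[OF norm_triangle_ineq]) (simp add: norm_mult psi_nonneg)
  also have "... <= C / (1 + norm z) ^ Nd * (ck1 * norm v) + C * norm v / (1 + norm z) ^ Nd * ck"
   using C(1) psi_nonneg by (intro add_mono mult_mono C(2,3) dtri_le tri_le) auto
  also have "... = (C * (ck + ck1)) * norm v / (1 + norm z) ^ Nd" by (simp add: add_divide_distrib algebra_simps)
  finally show ?thesis by simp
 qed
 note skew = T_skew[OF du dg b1 b2 b3 b4 order_refl, of v]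
 show i1: "integrable dw (%z. T v ?u z * ?g z)" by (rule skew(1))
 let ?A = "LINT z|dw. T v ?u z * ?g z"
 have Tg: "T v ?g z = of_real (psi ep M x Q r z) * cnj (T v ?u z) + of_real (dpsi ep M x Q r z v) * cnj (tri x z p)" for z
  unfolding T_cnj[OF du, symmetric]
 proof (rule T_mult_inv[OF has_derivative_of_real[OF psi_has_derivative] dcu])
  fix al assume a: "al \<in> R"
  show "complex_of_real (psi ep M x Q r (rf al z)) = of_real (psi ep M x Q r z)"
   by (simp only: psi_G[OF refl_in_G[OF a]])
  show "complex_of_real (dpsi ep M x Q r z al) = 0" if "al \<cdot> z = 0"
   using inv_perp[OF psi_has_derivative psi_G[OF refl_in_G[OF a]] a that] by (simp only: of_real_0)
 qed
 have i2: "integrable dw (%z. cnj (T v ?u z * ?g z))" using i1 by (simp only: integrable_cnj)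
 have pt: "?u z * T v ?g z = cnj (T v ?u z * ?g z) + of_real (dpsi ep M x Q r z v * (cmod (tri x z p))^2)" for z
 proof -
  have "?u z * cnj (?u z) = of_real ((cmod (?u z))^2)" by (metis complex_norm_square)
  then have "?u z * (of_real (dpsi ep M x Q r z v) * cnj (tri x z p)) = of_real (dpsi ep M x Q r z v * (cmod (tri x z p))^2)"
   by (simp add: mult.left_commute)
  then show ?thesis unfolding Tg distrib_left by (simp add: mult_ac)
 qed
 have i3: "integrable dw (%z. of_real (dpsi ep M x Q r z v * (cmod (tri x z p))^2) :: complex)"
  using integrable_diff[OF skew(2) i2] unfolding pt add_diff_cancel_left' .
 then show "integrable dw (%z. dpsi ep M x Q r z v * (cmod (tri x z p))^2)"
  by (simp only: complex_of_real_integrable_eq)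
 have "?A = - (LINT z|dw. cnj (T v ?u z * ?g z) + of_real (dpsi ep M x Q r z v * (cmod (tri x z p))^2))"
  unfolding skew(3) pt ..
 also have "... = - (cnj ?A + of_real (LINT z|dw. dpsi ep M x Q r z v * (cmod (tri x z p))^2))"
  by (simp only: integral_add[OF i2 i3] integral_cnj integral_complex_of_real)
 finally have "Re ?A = Re (- (cnj ?A + of_real (LINT z|dw. dpsi ep M x Q r z v * (cmod (tri x z p))^2)))" by (rule arg_cong)
 then show "2 * Re ?A = - (LINT z|dw. dpsi ep M x Q r z v * (cmod (tri x z p))^2)" by simp
qed

lemma rpsi_measurable: "(%z. rpsi ep M x Q r z) \<in> BM"
proof -
 have "continuous_on UNIV (eta ep (M + Nd))"
  by (intro continuous_at_imp_continuous_on ballI has_derivative_continuous[OF eta_has_derivative])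
 from cont_BM[OF this] show ?thesis
  unfolding rpsi_def using cont_BM[OF rho_cont] by measurable
qed

lemma psi_measurable: "(%z. psi ep M x Q r z) \<in> BM"
 by (intro cont_BM continuous_at_imp_continuous_on ballI
   has_derivative_continuous[OF psi_has_derivative])

text \<open>The weighted energy of the translation by \<open>r *R q\<close>. It is complex-valued to
  fit \<open>has_derivative_LINT\<close>; its value is real by \<open>ene_eq\<close>.\<close>

definition ene :: "real => nat => real^'n => real^'n => real => complex" where
 "ene ep M x q r = (LINT z|dw. of_real (psi ep M x (norm q) r z) * (tri x z (r *R q) * cnj (tri x z (r *R q))))"

definition dene :: "real => nat => real^'n => real^'n => real => real^'n => real => complex" where
 "dene ep M x q r z h = of_real (psi ep M x (norm q) r z) *
   (tri x z (r *R q) * cnj (dtri x z (r *R q) (h *R q)) + dtri x z (r *R q) (h *R q) * cnj (tri x z (r *R q)))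
  + of_real (rpsi ep M x (norm q) r z * h) * (tri x z (r *R q) * cnj (tri x z (r *R q)))"

lemma ene_integrand_derivative:
 "((%r. of_real (psi ep M x (norm q) r z) * (tri x z (r *R q) * cnj (tri x z (r *R q)))) has_derivative dene ep M x q r z) (at r)"
proof -
 have s: "((%r. r *R q) has_derivative (%h. h *R q)) (at r)" by (auto intro!: derivative_eq_intros)
 have u: "((%r. tri x z (r *R q)) has_derivative (%h. dtri x z (r *R q) (h *R q))) (at r)"
  by (rule has_derivative_compose[OF s tri_has_derivative])
 have cu: "((%r. cnj (tri x z (r *R q))) has_derivative (%h. cnj (dtri x z (r *R q) (h *R q)))) (at r)"
  by (rule bounded_linear.has_derivative[OF bounded_linear_cnj u])
 from has_derivative_mult[OF has_derivative_of_real[OF psi_r_derivative] has_derivative_mult[OF u cu]]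
 show ?thesis unfolding dene_def .
qed

lemma tri_sq_bound: "norm (tri x z p * cnj (tri y z p')) <= ck^2"
 unfolding norm_mult complex_mod_cnj power2_eq_square by (intro mult_mono tri_le) (auto simp: less_imp_le[OF ck_pos])

lemma psi_tri_integrable:
 assumes e: "0 < ep" and Q: "0 <= Q" and r: "\<bar>1 - r\<bar> <= 2"
 shows "integrable dw (%z. of_real (psi ep M x Q r z) * (tri x z p * cnj (tri x z p')))"
  and "integrable dw (%z. rpsi ep M x Q r z * (cmod (tri x z p))^2)"
proof -
 obtain C where C: "C >= 0" "!!z. psi ep M x Q r z <= C / (1 + norm z) ^ Nd" "!!z. \<bar>rpsi ep M x Q r z\<bar> <= C / (1 + norm z) ^ Nd"
  using psi_bounds[OF e Q, of M x] r by blast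
 note [measurable] = psi_measurable rpsi_measurable tri_measurable_z
 have [measurable]: "(%z. cnj (tri x z p')) \<in> BM"
  by (rule measurable_compose[OF tri_measurable_z cont_BM[OF continuous_on_cnj[OF continuous_on_id]]])
 show "integrable dw (%z. of_real (psi ep M x Q r z) * (tri x z p * cnj (tri x z p')))"
 proof (rule integrable_decay[where C = "C * ck^2"])
  show "norm (of_real (psi ep M x Q r z) * (tri x z p * cnj (tri x z p'))) <= C * ck^2 / (1 + norm z) ^ Nd" for z
   using mult_mono[OF C(2)[of z] tri_sq_bound[of x z p x p']] C(1) psi_nonneg[of ep M x Q r z]
   by (simp add: norm_mult)
 qed measurable
 show "integrable dw (%z. rpsi ep M x Q r z * (cmod (tri x z p))^2)"
 proof (rule integrable_decay_real[where C = "C * ck^2"])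
  show "\<bar>rpsi ep M x Q r z * (cmod (tri x z p))^2\<bar> <= C * ck^2 / (1 + norm z) ^ Nd" for z
   using mult_mono[OF C(3)[of z] tri_sq_bound[of x z p x p]] C(1) by (simp add: abs_mult norm_mult power2_eq_square)
 qed measurable
qed

lemma ene_has_derivative:
 assumes e: "0 < ep" and r: "0 <= r" "r <= 1"
 shows "(ene ep M x q has_derivative (%h. LINT z|dw. dene ep M x q r z h)) (at r)"
  and "integrable dw (%z. dene ep M x q r z h)"
proof -
 have Q: "0 <= norm q" by simp
 obtain C where C: "C >= 0" "!!r z. \<bar>1 - r\<bar> <= 2 ==> psi ep M x (norm q) r z <= C / (1 + norm z) ^ Nd"
  "!!r z. \<bar>1 - r\<bar> <= 2 ==> \<bar>rpsi ep M x (norm q) r z\<bar> <= C / (1 + norm z) ^ Nd"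
  using psi_bounds[OF e Q, of M x] by blast
 define K where "K = 2 * (ck * (ck1 * norm q)) + ck^2"
 have rr: "\<bar>1 - r'\<bar> <= 2" if "r' \<in> ball r 1" for r' using that r by (auto simp: dist_real_def abs_if split: if_splits)
 have ck0: "0 <= ck" by (rule less_imp_le[OF ck_pos])
 have b: "norm (dene ep M x q r' z h) <= (C * K) / (1 + norm z) ^ Nd * norm h" if r': "r' \<in> ball r 1" for r' z h
 proof -
  let ?u = "tri x z (r' *R q)" and ?d = "dtri x z (r' *R q) (h *R q)"
  have p: "0 <= C / (1 + norm z) ^ Nd" using C(1) by simp
  have t: "norm ?u * norm ?d <= ck * (ck1 * norm q) * norm h"
   using mult_mono[OF tri_le[of x z "r' *R q"] dtri_le[of x z "r' *R q" "h *R q"] ck0 norm_ge_zero]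
   by (simp add: mult_ac)
  have "norm (?u * cnj ?d + ?d * cnj ?u) <= 2 * (norm ?u * norm ?d)"
   by (rule order_trans[OF norm_triangle_ineq]) (simp add: norm_mult)
  also have "... <= 2 * (ck * (ck1 * norm q)) * norm h" using t by simp
  finally have 1: "norm (?u * cnj ?d + ?d * cnj ?u) <= 2 * (ck * (ck1 * norm q)) * norm h" .
  have "norm (dene ep M x q r' z h) <= psi ep M x (norm q) r' z * norm (?u * cnj ?d + ?d * cnj ?u)
    + (\<bar>rpsi ep M x (norm q) r' z\<bar> * norm h) * norm (?u * cnj ?u)"
   unfolding dene_def by (rule order_trans[OF norm_triangle_ineq]) (simp add: norm_mult psi_nonneg abs_mult)
  also have "... <= C / (1 + norm z) ^ Nd * (2 * (ck * (ck1 * norm q)) * norm h) + (C / (1 + norm z) ^ Nd * norm h) * ck^2"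
   using p by (intro add_mono mult_mono C(2,3) rr[OF r'] 1 tri_sq_bound order_refl norm_ge_zero mult_nonneg_nonneg) auto
  also have "... = (C * K) / (1 + norm z) ^ Nd * norm h" by (simp add: K_def add_divide_distrib algebra_simps)
  finally show ?thesis .
 qed
 have gi: "integrable dw (%z :: real^'n. (C * K) / (1 + norm z) ^ Nd)"
 proof (rule integrable_decay_real[where C = "\<bar>C * K\<bar>"])
  have "continuous_on UNIV (%z :: real^'n. (C * K) / (1 + norm z) ^ Nd)"
   by (intro continuous_intros ballI power_not_zero) (metis add_pos_nonneg less_irrefl norm_ge_zero zero_less_one)
  then show "(%z :: real^'n. (C * K) / (1 + norm z) ^ Nd) \<in> BM"
   by (rule cont_BM)
  show "\<bar>C * K / (1 + norm z) ^ Nd\<bar> <= \<bar>C * K\<bar> / (1 + norm z) ^ Nd" for z :: "real^'n"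
   by (simp only: abs_divide power_abs) (simp add: abs_of_pos add_pos_nonneg)
 qed
 note D = has_derivative_LINT[OF zero_less_one ene_integrand_derivative psi_tri_integrable(1)[OF e Q rr] b gi]
 show "(ene ep M x q has_derivative (%h. LINT z|dw. dene ep M x q r z h)) (at r)"
  unfolding ene_def[abs_def] by (rule D(2))
 show "integrable dw (%z. dene ep M x q r z h)" by (rule D(1))
qed

lemma Re_two: "u * cnj w + w * cnj u = of_real (2 * Re (w * cnj u))"
 by (simp add: complex_eq_iff)

text \<open>By \<open>T_euler\<close> in the pole, \<open>r\<close> times the derivative along
  \<open>q\<close> is the Dunkl operator minus the differences to reflected poles, and
  \<open>T_tri_exchange\<close> moves the operator to \<open>z\<close>. The factor \<open>r\<close>
  stays on the left because \<open>T_euler\<close> controls \<open>r\<close> times the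
  derivative.\<close>

lemma dene_eq:
 "of_real r * dene ep M x q r z 1 =
  of_real (2 * Re (T (r *R q) (%z. tri x z (r *R q)) z * (of_real (psi ep M x (norm q) r z) * cnj (tri x z (r *R q))))
   + r * (rpsi ep M x (norm q) r z * (cmod (tri x z (r *R q)))^2)
   - (SUM al:R. k al * Re (of_real (psi ep M x (norm q) r z) * ((tri x z (r *R q) - tri x z (r *R rf al q)) * cnj (tri x z (r *R q))))))"
proof -
 let ?p = "r *R q" and ?\<psi> = "psi ep M x (norm q) r z"
 let ?u = "tri x z ?p" and ?t = "T (r *R q) (%z. tri x z (r *R q)) z"
 let ?S = "SUM al:R. (k al / 2) *R (?u - tri x z (r *R rf al q))"
 have lin: "linear (dtri x z ?p)" by (rule has_derivative_linear[OF tri_has_derivative])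
 have d: "of_real r * dtri x z ?p q = ?t - ?S"
 proof -
  have "of_real r * dtri x z ?p q = dtri x z ?p ?p" using linear_cmul[OF lin, of r q] by (simp only: scaleR_conv_of_real[of r "dtri x z ?p q"])
  also have "... = T ?p (%p. tri x z p) ?p - (SUM al:R. (k al / 2) *R (?u - tri x z (rf al ?p)))"
   unfolding T_euler[OF tri_has_derivative] by simp
  also have "... = ?t - ?S" unfolding T_tri_exchange by (simp add: root_reflection_def algebra_simps)
  finally show ?thesis .
 qed
 have S: "2 * Re (?S * cnj ?u) = (SUM al:R. k al * Re ((?u - tri x z (r *R rf al q)) * cnj ?u))"
  unfolding sum_distrib_right Re_sum sum_distrib_left
  by (intro sum.cong refl) (simp add: algebra_simps)
 have Rd: "2 * Re ((?t - ?S) * cnj ?u) = 2 * Re (?t * cnj ?u) - 2 * Re (?S * cnj ?u)"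
  by (simp only: left_diff_distrib minus_complex.sel right_diff_distrib)
 have Ro: "Re (of_real a * w) = a * Re w" for a w by simp
 have "of_real r * dene ep M x q r z 1 = of_real ?\<psi> * (?u * cnj (of_real r * dtri x z ?p q) + (of_real r * dtri x z ?p q) * cnj ?u)
   + of_real (r * rpsi ep M x (norm q) r z) * (?u * cnj ?u)"
  unfolding dene_def by (simp add: algebra_simps)
 also have "... = of_real (?\<psi> * (2 * Re (?t * cnj ?u) - 2 * Re (?S * cnj ?u)) + r * rpsi ep M x (norm q) r z * (cmod ?u)^2)"
  unfolding d Re_two complex_norm_square[symmetric] Rd by (simp only: of_real_add of_real_mult of_real_power)
 also have "?\<psi> * (2 * Re (?t * cnj ?u) - 2 * Re (?S * cnj ?u)) + r * rpsi ep M x (norm q) r z * (cmod ?u)^2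
  = 2 * Re (?t * (of_real ?\<psi> * cnj ?u)) + r * (rpsi ep M x (norm q) r z * (cmod ?u)^2)
   - (SUM al:R. k al * Re (of_real ?\<psi> * ((?u - tri x z (r *R rf al q)) * cnj ?u)))"
  unfolding S mult.left_commute[of ?t] Ro sum_distrib_left right_diff_distrib mult.left_commute[of ?\<psi>]
  by (simp only: ac_simps)
 finally show ?thesis .
qed

text \<open>\<open>energy_identity\<close> turns the transport term into the gradient of the weight,
  which \<open>psi_monotone\<close> balances against the decrease in \<open>r\<close> up to an error
  of order \<open>ep\<close>. The exchange terms are retained: their sign appears after summation
  over the orbit of \<open>q\<close>.\<close>

lemma energy_derivative_le:
 assumes e: "0 < ep" and r: "0 < r" "r <= 1"
 shows "r * Re (LINT z|dw. dene ep M x q r z 1) <= r * (real (M + Nd) * ep * norm q * Re (ene ep M x q r))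
  - (SUM al:R. k al * Re (LINT z|dw. of_real (psi ep M x (norm q) r z) * ((tri x z (r *R q) - tri x z (r *R rf al q)) * cnj (tri x z (r *R q)))))"
proof -
 let ?p = "r *R q" and ?Q = "norm q"
 let ?u = "%z. tri x z (r *R q)"
 have Q: "0 <= ?Q" and rr: "\<bar>1 - r\<bar> <= 2" using r by auto
 note id = energy_identity[OF e Q rr, where M = M and x = x and v = "r *R q" and p = "r *R q"]
 note pti = psi_tri_integrable[OF e Q rr, where M = M and x = x]
 let ?W = "%al z. of_real (psi ep M x ?Q r z) * ((?u z - tri x z (r *R rf al q)) * cnj (?u z))"
 have Wi: "integrable dw (?W al)" for al
  unfolding left_diff_distrib right_diff_distrib by (intro integrable_diff pti(1))
 have e1: "integrable dw (%z. 2 * Re (T ?p ?u z * (of_real (psi ep M x ?Q r z) * cnj (?u z))))"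
  by (intro integrable_mult_right integrable_Re id(1))
 have e2: "integrable dw (%z. r * (rpsi ep M x ?Q r z * (cmod (?u z))^2))"
  by (intro integrable_mult_right pti(2))
 have e3: "integrable dw (%z. k al * Re (?W al z))" for al
  by (intro integrable_mult_right integrable_Re Wi)
 have e4: "integrable dw (%z. (SUM al:R. k al * Re (?W al z)))" by (intro integrable_sum e3)
 have "of_real r * (LINT z|dw. dene ep M x q r z 1) = (LINT z|dw. of_real r * dene ep M x q r z 1)"
  by simp
 also have "... = of_real (LINT z|dw. (2 * Re (T ?p ?u z * (of_real (psi ep M x ?Q r z) * cnj (?u z)))
   + r * (rpsi ep M x ?Q r z * (cmod (?u z))^2) - (SUM al:R. k al * Re (?W al z))))"
  unfolding dene_eq integral_complex_of_real ..
 also have "(LINT z|dw. (2 * Re (T ?p ?u z * (of_real (psi ep M x ?Q r z) * cnj (?u z)))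
   + r * (rpsi ep M x ?Q r z * (cmod (?u z))^2) - (SUM al:R. k al * Re (?W al z))))
  = 2 * Re (LINT z|dw. T ?p ?u z * (of_real (psi ep M x ?Q r z) * cnj (?u z)))
   + (LINT z|dw. r * (rpsi ep M x ?Q r z * (cmod (?u z))^2)) - (SUM al:R. k al * Re (LINT z|dw. ?W al z))"
  unfolding integral_diff[OF integrable_add[OF e1 e2] e4]
   integral_add[OF e1 e2] integral_sum[OF e3]
   integral_Re[OF id(1), symmetric] integral_Re[OF Wi, symmetric]
   integral_mult_right_zero ..
 also have "... = (LINT z|dw. r * (rpsi ep M x ?Q r z * (cmod (?u z))^2) - dpsi ep M x ?Q r z ?p * (cmod (?u z))^2)
   - (SUM al:R. k al * Re (LINT z|dw. ?W al z))"
  unfolding id(2) integral_diff[OF e2 id(3)] by simp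
 finally have "of_real r * (LINT z|dw. dene ep M x q r z 1) = of_real ((LINT z|dw. r * (rpsi ep M x ?Q r z * (cmod (?u z))^2) - dpsi ep M x ?Q r z ?p * (cmod (?u z))^2)
   - (SUM al:R. k al * Re (LINT z|dw. ?W al z)))" .
 from arg_cong[OF this, of Re]
 have 1: "r * Re (LINT z|dw. dene ep M x q r z 1) = (LINT z|dw. r * (rpsi ep M x ?Q r z * (cmod (?u z))^2) - dpsi ep M x ?Q r z ?p * (cmod (?u z))^2)
   - (SUM al:R. k al * Re (LINT z|dw. ?W al z))" by simp
 have pi: "integrable dw (%z. psi ep M x ?Q r z * (cmod (?u z))^2)"
 proof -
  have "integrable dw (%z. complex_of_real (psi ep M x ?Q r z * (cmod (?u z))^2))"
   using pti(1)[of ?p ?p] unfolding complex_norm_square[symmetric] by simp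
  then show ?thesis by (simp only: complex_of_real_integrable_eq)
 qed
 have "(LINT z|dw. r * (rpsi ep M x ?Q r z * (cmod (?u z))^2) - dpsi ep M x ?Q r z ?p * (cmod (?u z))^2)
  <= (LINT z|dw. (r * (real (M + Nd) * ep * ?Q)) * (psi ep M x ?Q r z * (cmod (?u z))^2))"
 proof (rule integral_mono)
  show "integrable dw (%z. r * (rpsi ep M x ?Q r z * (cmod (?u z))^2) - dpsi ep M x ?Q r z ?p * (cmod (?u z))^2)"
   by (rule integrable_diff[OF e2 id(3)])
  show "integrable dw (%z. (r * (real (M + Nd) * ep * ?Q)) * (psi ep M x ?Q r z * (cmod (?u z))^2))"
   by (intro integrable_mult_right pi)
  fix z
  have l: "dpsi ep M x ?Q r z ?p = r * dpsi ep M x ?Q r z q"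
   using linear_cmul[OF has_derivative_linear[OF psi_has_derivative[of ep M x ?Q r z]], of r q] by simp
  have "(r * (cmod (?u z))^2) * (rpsi ep M x ?Q r z - dpsi ep M x ?Q r z q) <= (r * (cmod (?u z))^2) * (real (M + Nd) * ep * ?Q * psi ep M x ?Q r z)"
   using r by (intro mult_left_mono psi_monotone[OF e]) auto
  then show "r * (rpsi ep M x ?Q r z * (cmod (?u z))^2) - dpsi ep M x ?Q r z ?p * (cmod (?u z))^2
   <= (r * (real (M + Nd) * ep * ?Q)) * (psi ep M x ?Q r z * (cmod (?u z))^2)"
   unfolding l by (simp only: algebra_simps)
 qed
 also have "... = r * (real (M + Nd) * ep * ?Q * Re (ene ep M x q r))"
 proof -
  have "ene ep M x q r = of_real (LINT z|dw. psi ep M x ?Q r z * (cmod (?u z))^2)"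
   unfolding ene_def complex_norm_square[symmetric] of_real_mult[symmetric] of_real_power[symmetric] integral_complex_of_real ..
  then show ?thesis by simp
 qed
 finally show ?thesis unfolding 1 by simp
qed

lemma ene_eq:
 assumes e: "0 < ep" and r: "\<bar>1 - r\<bar> <= 2"
 shows "integrable dw (%z. psi ep M x (norm q) r z * (cmod (tri x z (r *R q)))^2)"
  and "Re (ene ep M x q r) = (LINT z|dw. psi ep M x (norm q) r z * (cmod (tri x z (r *R q)))^2)"
proof -
 have "integrable dw (%z. complex_of_real (psi ep M x (norm q) r z * (cmod (tri x z (r *R q)))^2))"
  using psi_tri_integrable(1)[OF e norm_ge_zero[of q] r, of M x "r *R q" "r *R q"]
  unfolding complex_norm_square[symmetric] by simp
 then show "integrable dw (%z. psi ep M x (norm q) r z * (cmod (tri x z (r *R q)))^2)"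
  by (simp only: complex_of_real_integrable_eq)
 have "ene ep M x q r = of_real (LINT z|dw. psi ep M x (norm q) r z * (cmod (tri x z (r *R q)))^2)"
  unfolding ene_def complex_norm_square[symmetric] of_real_mult[symmetric] of_real_power[symmetric] integral_complex_of_real ..
 then show "Re (ene ep M x q r) = (LINT z|dw. psi ep M x (norm q) r z * (cmod (tri x z (r *R q)))^2)"
  by simp
qed

lemma ene_real_derivative:
 assumes e: "0 < ep" and r: "0 <= r" "r <= 1"
 shows "((%r. Re (ene ep M x q r)) has_real_derivative Re (LINT z|dw. dene ep M x q r z 1)) (at r)"
proof -
 note D = ene_has_derivative(1)[OF e r, of M x q]
 have l: "(LINT z|dw. dene ep M x q r z h) = h *R (LINT z|dw. dene ep M x q r z 1)" for h
  using linear_cmul[OF has_derivative_linear[OF D], of h 1] by simp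
 show ?thesis unfolding has_field_derivative_def
  by (rule has_derivative_eq_rhs[OF bounded_linear.has_derivative[OF bounded_linear_Re D]]) (rule ext, subst l, simp)
qed

text \<open>For each \<open>z\<close> the double sum is the Dirichlet form of
  \<open>walk_energy\<close> for the values of \<open>tri\<close> at the poles
  \<open>r *R g q\<close>. The weight factors out because it is common to all of them.\<close>

lemma exchange_nonneg:
 assumes e: "0 < ep" and r: "\<bar>1 - r\<bar> <= 2" and Q: "0 <= Q"
 shows "0 <= (SUM g:G. SUM al:R. k al * Re (LINT z|dw. of_real (psi ep M x Q r z) *
  ((tri x z (r *R g q) - tri x z (r *R rf al (g q))) * cnj (tri x z (r *R g q)))))"
proof -
 let ?W = "%g al z. of_real (psi ep M x Q r z) * ((tri x z (r *R g q) - tri x z (r *R rf al (g q))) * cnj (tri x z (r *R g q)))"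
 have Wi: "integrable dw (?W g al)" for g al
  unfolding left_diff_distrib right_diff_distrib by (intro integrable_diff psi_tri_integrable(1)[OF e Q r])
 have Wi2: "integrable dw (%z. k al * Re (?W g al z))" for g al
  by (intro integrable_mult_right integrable_Re Wi)
 have "(SUM g:G. SUM al:R. k al * Re (LINT z|dw. ?W g al z)) = (SUM g:G. SUM al:R. LINT z|dw. k al * Re (?W g al z))"
  by (intro sum.cong refl) (simp only: integral_mult_right_zero integral_Re[OF Wi])
 also have "... = (SUM g:G. LINT z|dw. (SUM al:R. k al * Re (?W g al z)))"
  by (intro sum.cong refl integral_sum[symmetric] Wi2)
 also have "... = (LINT z|dw. (SUM g:G. SUM al:R. k al * Re (?W g al z)))"
  by (intro integral_sum[symmetric] integrable_sum Wi2)
 also have "0 <= ..."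
 proof (intro integral_nonneg_AE AE_I2)
  fix z
  have c: "Re (of_real p * ((a - b) * cnj a)) = p * Re (cnj a * (a - b))" for a b p by simp
  have "(SUM g:G. SUM al:R. k al * Re (?W g al z)) = (2 * psi ep M x Q r z) *
   (SUM g:G. SUM al:R. k al / 2 * Re (cnj (tri x z (r *R g q)) * (tri x z (r *R g q) - tri x z (r *R (rf al o g) q))))"
   unfolding sum_distrib_left c by (intro sum.cong refl) (simp only: comp_apply field_simps)
  also have "... >= 0"
   using psi_nonneg[of ep M x Q r z] walk_energy[of "%g. tri x z (r *R g q)"] by (intro mult_nonneg_nonneg) auto
  finally show "0 <= (SUM g:G. SUM al:R. k al * Re (?W g al z))" .
 qed
 finally show ?thesis .
qed

text \<open>The factor \<open>eta\<close> in \<open>psi\<close> only ensures integrability; \<open>ep\<close> tends to 0 in \<open>tri_weighted\<close>.\<close>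

lemma energy_gronwall:
 assumes e: "0 < ep"
 shows "(SUM g:G. Re (ene ep M x (g q) 1)) <= exp (real (M + Nd) * ep * norm q) * (SUM g:G. Re (ene ep M x (g q) 0))"
proof -
 define c where "c = real (M + Nd) * ep * norm q"
 let ?F = "%r. SUM g:G. Re (ene ep M x (g q) r)"
 let ?D = "%r. SUM g:G. Re (LINT z|dw. dene ep M x (g q) r z 1)"
 have der: "((%r. exp (- c * r) * ?F r) has_real_derivative exp (- c * r) * (?D r - c * ?F r)) (at r)"
  if "0 <= r" "r <= 1" for r
 proof -
  have "(?F has_real_derivative ?D r) (at r)"
   by (intro DERIV_sum ene_real_derivative e that)
  moreover have "((%r. exp (- c * r)) has_real_derivative exp (- c * r) * (- c)) (at r)"
   by (auto intro!: derivative_eq_intros)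
  ultimately have "((%r. exp (- c * r) * ?F r) has_real_derivative exp (- c * r) * (- c) * ?F r + ?D r * exp (- c * r)) (at r)"
   by (rule DERIV_mult[rotated])
  then show ?thesis by (rule back_subst[where P = "%d. (_ has_real_derivative d) _"]) (simp only: algebra_simps)
 qed
 have "exp (- c * 1) * ?F 1 <= exp (- c * 0) * ?F 0"
 proof (rule DERIV_nonpos_imp_decreasing_open[where f = "%r. exp (- c * r) * ?F r" and a = 0 and b = 1])
  show "(0::real) <= 1" by simp
  show "continuous_on {0..1} (%r. exp (- c * r) * ?F r)"
   by (intro continuous_at_imp_continuous_on ballI DERIV_isCont[OF der]) auto
  fix r :: real assume r: "0 < r" "r < 1"
  have rr: "\<bar>1 - r\<bar> <= 2" using r by simp
  have "r * ?D r <= (SUM g:G. r * (real (M + Nd) * ep * norm (g q) * Re (ene ep M x (g q) r))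
   - (SUM al:R. k al * Re (LINT z|dw. of_real (psi ep M x (norm (g q)) r z) * ((tri x z (r *R g q) - tri x z (r *R rf al (g q))) * cnj (tri x z (r *R g q))))))"
   unfolding sum_distrib_left using r by (intro sum_mono energy_derivative_le e) auto
  also have "... = (SUM g:G. r * (c * Re (ene ep M x (g q) r))
   - (SUM al:R. k al * Re (LINT z|dw. of_real (psi ep M x (norm q) r z) * ((tri x z (r *R g q) - tri x z (r *R rf al (g q))) * cnj (tri x z (r *R g q))))))"
   unfolding c_def by (intro sum.cong refl) (simp only: G_norm)
  also have "... <= r * (c * ?F r)"
   unfolding sum_subtractf using exchange_nonneg[OF e rr norm_ge_zero[of q], of M x q] by (simp only: sum_distrib_left)
  finally have "?D r - c * ?F r <= 0" using r by simp
  then have "exp (- c * r) * (?D r - c * ?F r) <= 0" by (intro mult_nonneg_nonpos) auto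
  then show "EX y. ((%r. exp (- c * r) * ?F r) has_real_derivative y) (at r) & y <= 0"
   using der[of r] r by (intro exI conjI) auto
 qed
 then have "exp c * (exp (- c) * ?F 1) <= exp c * ?F 0" by (intro mult_left_mono) auto
 then show ?thesis by (simp add: c_def mult.assoc[symmetric] exp_add[symmetric])
qed

text \<open>The energy is compared between \<open>r = 0\<close>, where \<open>tri\<close> is a
  multiple of \<open>hk\<close> and \<open>weighted_hk\<close> applies, and \<open>r = 1\<close>,
  where the weight is the required one. The initial weight contains the extra summand
  \<open>norm q\<close>, the source of the factor \<open>(1 + norm q) ^ (2 * M)\<close>. Taking
  \<open>ep * norm q <= 1\<close> keeps the exponential factor bounded, and Fatou's lemma for
  \<open>ep\<close> tending to 0 removes \<open>eta\<close>.\<close>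

lemma tri_weighted: "EX C>0. ALL x q. (NI z. ennreal ((1 / kap x z) ^ M * (cmod (tri x z q))^2)) <= ennreal (C * (1 + norm q) ^ (2 * M) / Vol x)"
proof -
 obtain C0 where C0: "C0 > 0" "!!x. (NI z. ennreal ((1 / kap x z) ^ M * (hk x z)^2)) <= ennreal (C0 / Vol x)"
  using weighted_hk by blast
 define n where "n = real (card G)"
 have n: "1 <= n" unfolding n_def using finite_G ident_in_G by (metis One_nat_def Suc_leI card_gt_0_iff empty_iff of_nat_1 of_nat_le_iff)
 have rho_kap: "rho x z ^ (2 * M) = (1 / kap x z) ^ M" for x z by (simp only: power_mult rho_sq)
 define C where "C = exp (real (M + Nd)) * (n * (n ^ (2 * M) * ck ^ 4 * C0))"
 have "(NI z. ennreal ((1 / kap x z) ^ M * (cmod (tri x z q))^2)) <= ennreal (C * (1 + norm q) ^ (2 * M) / Vol x)" for x q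
 proof -
  let ?Q = "norm q"
  let ?K = "n ^ (2 * M) * ck ^ 4 * C0 * (1 + ?Q) ^ (2 * M) / Vol x"
  have K0: "0 <= ?K" using n C0(1) Vol_pos[of x] ck_pos by (intro divide_nonneg_pos mult_nonneg_nonneg) auto
  have E0: "Re (ene ep M x p 0) <= ?K" if e: "0 < ep" and p: "norm p = ?Q" for ep p
  proof -
   have "ennreal (Re (ene ep M x p 0)) = (NI z. ennreal (psi ep M x ?Q 0 z * (cmod (tri x z (0 *R p)))^2))"
    using ene_eq[OF e, of 0 M x p] unfolding p
    by (simp add: nn_integral_eq_integral[symmetric] psi_nonneg)
   also have "... <= (NI z. ennreal ((n * (1 + ?Q)) ^ (2 * M) * ck ^ 4) * ennreal ((1 / kap x z) ^ M * (hk x z)^2))"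
   proof (rule nn_integral_mono)
    fix z
    have "rho x z + ?Q <= n * (1 + ?Q) * rho x z"
    proof -
     have "?Q * 1 <= ?Q * (n * rho x z)" using rho_ge[of x z] by (intro mult_left_mono) (auto simp: n_def)
     moreover have "rho x z <= n * rho x z" using mult_right_mono[OF n less_imp_le[OF rho_pos[of x z]]] by simp
     moreover have "n * (1 + ?Q) * rho x z = n * rho x z + ?Q * (n * rho x z)" by (simp add: algebra_simps)
     ultimately show ?thesis by linarith
    qed
    then have "(rho x z + ?Q) ^ (2 * M) <= (n * (1 + ?Q) * rho x z) ^ (2 * M)"
     by (intro power_mono) (auto simp: less_imp_le add_nonneg_nonneg)
    moreover have "psi ep M x ?Q 0 z <= 1 * (rho x z + ?Q) ^ (2 * M)"
     using mult_right_mono[OF eta_le1[of ep "M + Nd" z] zero_le_power[of "rho x z + ?Q" "2 * M"]]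
      less_imp_le[OF rho_pos[of x z]] unfolding psi_def by simp
    ultimately have "psi ep M x ?Q 0 z <= (n * (1 + ?Q)) ^ (2 * M) * (1 / kap x z) ^ M"
     by (simp only: power_mult_distrib rho_kap mult_1 order_trans)
    then have "psi ep M x ?Q 0 z * (ck ^ 4 * (hk x z)^2) <= ((n * (1 + ?Q)) ^ (2 * M) * (1 / kap x z) ^ M) * (ck ^ 4 * (hk x z)^2)"
     by (intro mult_right_mono) auto
    moreover have "(cmod (tri x z (0 *R p)))^2 = ck ^ 4 * (hk x z)^2"
     by (simp add: tri_0 power_mult_distrib norm_mult norm_power flip: power_mult)
    ultimately have "psi ep M x ?Q 0 z * (cmod (tri x z (0 *R p)))^2 <= ((n * (1 + ?Q)) ^ (2 * M) * ck ^ 4) * ((1 / kap x z) ^ M * (hk x z)^2)"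
     by (simp only: mult_ac)
    then show "ennreal (psi ep M x ?Q 0 z * (cmod (tri x z (0 *R p)))^2) <= ennreal ((n * (1 + ?Q)) ^ (2 * M) * ck ^ 4) * ennreal ((1 / kap x z) ^ M * (hk x z)^2)"
     by (subst ennreal_mult[symmetric]) (auto simp: less_imp_le intro!: ennreal_leI)
   qed
   also have "... = ennreal ((n * (1 + ?Q)) ^ (2 * M) * ck ^ 4) * (NI z. ennreal ((1 / kap x z) ^ M * (hk x z)^2))"
   proof (rule nn_integral_cmult)
    note [measurable] = hk_measurable cont_BM[OF kap_cont]
    show "(%z. ennreal ((1 / kap x z) ^ M * (hk x z)^2)) \<in> borel_measurable dw" unfolding meas_dw by measurable
   qed
   also have "... <= ennreal ((n * (1 + ?Q)) ^ (2 * M) * ck ^ 4) * ennreal (C0 / Vol x)"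
    by (intro mult_left_mono C0(2)) simp
   also have "... = ennreal ?K"
    using C0(1) Vol_pos[of x] n by (subst ennreal_mult[symmetric]) (auto simp: less_imp_le power_mult_distrib mult_ac)
   finally show ?thesis using K0 by simp
  qed
  have E1: "Re (ene ep M x q 1) <= C * (1 + ?Q) ^ (2 * M) / Vol x" if e: "0 < ep" and le: "ep * ?Q <= 1" for ep
  proof -
   have "Re (ene ep M x (id q) 1) <= (SUM g:G. Re (ene ep M x (g q) 1))"
   proof (rule member_le_sum)
    show "0 <= Re (ene ep M x (g q) 1)" for g
     using ene_eq(2)[OF e, of 1 M x "g q"] by (simp add: integral_nonneg_AE psi_nonneg)
   qed (use finite_G in \<open>auto simp: id_def\<close>)
   also have "... <= exp (real (M + Nd) * ep * ?Q) * (SUM g:G. Re (ene ep M x (g q) 0))" by (rule energy_gronwall[OF e])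
   also have "... <= exp (real (M + Nd)) * (SUM g:G. ?K)"
   proof (rule mult_mono)
    show "exp (real (M + Nd) * ep * ?Q) <= exp (real (M + Nd))"
     using mult_left_mono[OF le, of "real (M + Nd)"] by (simp add: mult.assoc)
    show "(SUM g:G. Re (ene ep M x (g q) 0)) <= (SUM g:G. ?K)" by (intro sum_mono E0 e) (simp add: G_norm)
    show "0 <= (SUM g:G. Re (ene ep M x (g q) 0))"
     using ene_eq(2)[OF e, of 0 M x "_ q"] by (intro sum_nonneg) (simp add: integral_nonneg_AE psi_nonneg)
   qed simp
   also have "... = C * (1 + ?Q) ^ (2 * M) / Vol x" by (simp add: C_def n_def)
   finally show ?thesis by simp
  qed
  define e where "e j = 1 / ((1 + ?Q) * real (Suc j))" for j
  have e: "0 < e j" for j by (simp add: e_def add_pos_nonneg)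
  have e1: "e j * ?Q <= 1" for j
  proof -
   have "?Q <= (1 + ?Q) * real (Suc j)" by (simp add: algebra_simps add_nonneg_nonneg)
   then show ?thesis by (simp add: e_def divide_le_eq add_pos_nonneg)
  qed
  have elim: "e \<longlonglongrightarrow> 0"
  proof -
   have "(%j. (1 / (1 + ?Q)) * inverse (real (Suc j))) \<longlonglongrightarrow> (1 / (1 + ?Q)) * 0"
    by (intro tendsto_mult tendsto_const LIMSEQ_inverse_real_of_nat)
   then show ?thesis by (simp add: e_def[abs_def] field_simps)
  qed
  let ?f = "%j z. ennreal (psi (e j) M x ?Q 1 z * (cmod (tri x z (1 *R q)))^2)"
  have lim: "liminf (%j. ?f j z) = ennreal ((1 / kap x z) ^ M * (cmod (tri x z q))^2)" for z
  proof (rule lim_imp_Liminf)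
   have "(%j. psi (e j) M x ?Q 1 z * (cmod (tri x z (1 *R q)))^2) \<longlonglongrightarrow> inverse (1 + 0^2 * (z \<cdot> z)) ^ (M + Nd) * (rho x z + (1 - 1) * ?Q) ^ (2 * M) * (cmod (tri x z (1 *R q)))^2"
    unfolding psi_def eta_def by (intro tendsto_intros elim) simp
   then show "(%j. ?f j z) \<longlonglongrightarrow> ennreal ((1 / kap x z) ^ M * (cmod (tri x z q))^2)"
    by (intro tendsto_ennrealI) (simp add: rho_kap)
  qed simp
  have fb: "(NI z. ?f j z) <= ennreal (C * (1 + ?Q) ^ (2 * M) / Vol x)" for j
  proof -
   have "(NI z. ?f j z) = ennreal (Re (ene (e j) M x q 1))"
    using ene_eq[OF e, of 1 j M x q] by (simp add: nn_integral_eq_integral psi_nonneg)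
   also have "... <= ennreal (C * (1 + ?Q) ^ (2 * M) / Vol x)" by (intro ennreal_leI E1 e e1)
   finally show ?thesis .
  qed
  have "(NI z. liminf (%j. ?f j z)) <= liminf (%j. \<integral>\<^sup>+z. ?f j z \<partial>dw)"
  proof (rule nn_integral_liminf)
   note [measurable] = psi_measurable tri_measurable_z
   show "?f j \<in> borel_measurable dw" for j unfolding meas_dw by measurable
  qed
  also have "... <= liminf (%j. ennreal (C * (1 + ?Q) ^ (2 * M) / Vol x))"
   by (intro Liminf_mono always_eventually allI fb)
  also have "... = ennreal (C * (1 + ?Q) ^ (2 * M) / Vol x)" by (simp add: Liminf_const)
  finally show ?thesis unfolding lim .
 qed
 moreover have "C > 0" using n C0(1) ck_pos by (simp add: C_def)
 ultimately show ?thesis by blast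
qed

end

section \<open>The triple kernel\<close>

lemma fubini_bound:
 fixes F :: "'a => 'b => complex"
 assumes s: "sigma_finite_measure M1" "sigma_finite_measure M2"
  and m [measurable]: "case_prod F \<in> borel_measurable (M1 \<Otimes>\<^sub>M M2)"
  and a: "integrable M1 a" and b: "integrable M2 b"
  and le: "!!x y. norm (F x y) <= a x * b y"
 shows "(LINT x|M1. LINT y|M2. F x y) = (LINT y|M2. LINT x|M1. F x y)"
proof -
 interpret pair_sigma_finite M1 M2 using s by (simp add: pair_sigma_finite_def)
 have i2: "integrable M2 (%y. F x y)" if "x \<in> space M1" for x
 proof (rule integrable_bound[of M2 "%y. a x * b y"])
  show "integrable M2 (%y. a x * b y)" by (intro integrable_mult_right b)
  show "(%y. F x y) \<in> borel_measurable M2" using that by measurable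
  show "AE y in M2. norm (F x y) <= norm (a x * b y)" using le by (intro AE_I2 order_trans[OF le]) simp
 qed
 have "integrable (M1 \<Otimes>\<^sub>M M2) (case_prod F)"
 proof (rule Fubini_integrable[OF m])
  show "AE x in M1. integrable M2 (%y. case_prod F (x, y))" by (intro AE_I2) (simp add: i2)
  show "integrable M1 (%x. LINT y|M2. norm (case_prod F (x, y)))"
  proof (rule integrable_bound[of M1 "%x. a x * (LINT y|M2. b y)"])
   show "integrable M1 (%x. a x * (LINT y|M2. b y))" by (intro integrable_mult_left a)
   show "(%x. LINT y|M2. norm (case_prod F (x, y))) \<in> borel_measurable M1" by measurable
   show "AE x in M1. norm (LINT y|M2. norm (case_prod F (x, y))) <= norm (a x * (LINT y|M2. b y))"
   proof (rule AE_I2)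
    fix x assume x: "x \<in> space M1"
    have "(LINT y|M2. norm (case_prod F (x, y))) <= (LINT y|M2. a x * b y)"
     using le integrable_norm[OF i2[OF x]] b by (intro integral_mono) auto
    then show "norm (LINT y|M2. norm (case_prod F (x, y))) <= norm (a x * (LINT y|M2. b y))"
     by (simp add: integral_nonneg_AE)
   qed
  qed
 qed
 then show ?thesis by (rule Fubini_integral[symmetric])
qed

lemma norm_LINT_le: "ennreal (norm (LINT x|M. f x)) <= (\<integral>\<^sup>+x. ennreal (norm (f x :: 'b :: {banach, second_countable_topology})) \<partial>M)"
 by (cases "integrable M f") (auto simp: not_integrable_integral_eq intro: integral_norm_bound_ennreal)

lemma ennreal_power2_le: "a^2 <= (ennreal r)^2 ==> 0 <= r ==> a <= ennreal r"
 by (cases a) (auto simp: ennreal_power power2_le_iff_abs_le power2_eq_square ennreal_mult_top top_unique ennreal_mult[symmetric]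
   intro: power2_le_imp_le[unfolded power2_eq_square])

context dunkl begin

lemma dw_pair_measurable:
 fixes F :: "real^'n => real^'n => complex"
 assumes "continuous_on UNIV (%p. F (fst p) (snd p))"
 shows "case_prod F \<in> borel_measurable (dw \<Otimes>\<^sub>M dw)"
proof -
 have "sets (dw \<Otimes>\<^sub>M dw) = sets (borel :: ((real^'n) \<times> (real^'n)) measure)"
  unfolding borel_prod[symmetric] by (rule sets_pair_measure_cong) (simp_all add: sets_dw)
 then have "borel_measurable (dw \<Otimes>\<^sub>M dw) = (borel_measurable borel :: ((real^'n) \<times> (real^'n) => complex) set)"
  by (rule measurable_cong_sets) simp
 moreover have "case_prod F = (%p. F (fst p) (snd p))" by (simp add: fun_eq_iff)
 ultimately show ?thesis using cont_BM[OF assms] by simp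
qed

text \<open>The kernel \<open>B\<close> of the overview.\<close>

definition BB :: "real => real^'n => real^'n => real^'n => complex" where
 "BB t x y q = (LINT xi|dw. Ek \<i> xi x * Ek (- \<i>) xi y * Ek (- \<i>) xi q * of_real (exp (- t * (norm xi)^2)))"

text \<open>One factor \<open>gs\<close> of the multiplier at time 1 sits in \<open>tri\<close>; the
  other arises from \<open>hk_semigroup\<close> after Fubini.\<close>

lemma BB_1: "BB 1 x y q = (LINT z|dw. of_real (hk y z) * tri x z q)"
proof -
 let ?F = "%z xi. of_real (hk y z) * ((Ek \<i> xi x * Ek (- \<i>) xi z * of_real (gs xi)) * Ek (- \<i>) q xi)"
 have "(LINT z|dw. of_real (hk y z) * tri x z q) = (LINT z|dw. LINT xi|dw. ?F z xi)"
  unfolding tri_def by simp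
 also have "... = (LINT xi|dw. LINT z|dw. ?F z xi)"
 proof (rule fubini_bound[OF sigma_finite_dw sigma_finite_dw dw_pair_measurable hk_integrable gs_integrable])
  have h: "continuous_on UNIV (%p :: (real^'n) \<times> (real^'n). hk y (fst p))" by (intro hk_cont continuous_intros)
  show "continuous_on UNIV (%p. ?F (fst p) (snd p))"
   unfolding gs_def by (intro continuous_intros h Ek_continuous) simp_all
  fix z xi
  have "norm (Ek (- \<i>) q xi) <= 1" by (rule Ek_imag_le) simp
  from mult_mono[OF tri_coeff[of xi x z] this]
  have "norm ((Ek \<i> xi x * Ek (- \<i>) xi z * of_real (gs xi)) * Ek (- \<i>) q xi) <= gs xi"
   unfolding norm_mult[of "Ek \<i> xi x * Ek (- \<i>) xi z * of_real (gs xi)"] by (simp add: less_imp_le)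
  then show "norm (?F z xi) <= hk y z * gs xi"
   using hk_pos[of y z] unfolding norm_mult[of "of_real (hk y z)"] by (simp add: mult_left_mono)
 qed
 also have "... = (LINT xi|dw. (Ek \<i> xi x * of_real (gs xi) * Ek (- \<i>) q xi) * (LINT z|dw. of_real (hk y z) * Ek (- \<i>) z xi))"
 proof (intro integral_cong refl)
  fix xi
  have "(LINT z|dw. ?F z xi) = (LINT z|dw. (Ek \<i> xi x * of_real (gs xi) * Ek (- \<i>) q xi) * (of_real (hk y z) * Ek (- \<i>) z xi))"
   by (intro integral_cong refl) (simp only: Ek_sym[of _ xi] mult_ac)
  then show "(LINT z|dw. ?F z xi) = (Ek \<i> xi x * of_real (gs xi) * Ek (- \<i>) q xi) * (LINT z|dw. of_real (hk y z) * Ek (- \<i>) z xi)"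
   by (simp only: integral_mult_right_zero)
 qed
 also have "... = BB 1 x y q"
  unfolding hk_semigroup BB_def
 proof (intro integral_cong refl)
  fix xi
  have "gs xi * gs xi = exp (- 1 * (norm xi)^2)" by (simp add: gs_def exp_add[symmetric])
  then have "of_real (gs xi) * of_real (gs xi) = complex_of_real (exp (- 1 * (norm xi)^2))"
   by (simp only: of_real_mult[symmetric])
  then show "Ek \<i> xi x * of_real (gs xi) * Ek (- \<i>) q xi * (of_real (gs xi) * Ek (- \<i>) y xi)
   = Ek \<i> xi x * Ek (- \<i>) xi y * Ek (- \<i>) xi q * of_real (exp (- 1 * (norm xi)^2))"
   by (simp add: Ek_sym[of _ q] Ek_sym[of _ y] mult_ac)
 qed
 finally show ?thesis by simp
qed

text \<open>Cauchy-Schwarz for the pairing in \<open>BB_1\<close>, with inverse powers of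
  \<open>kap y z\<close> and \<open>kap x z\<close> as weights for the two factors.
  \<open>kap_triangle\<close> extracts the decay in \<open>kap x y\<close> beforehand. The two
  weighted norms produce the geometric mean of the volumes.\<close>

lemma BB_1_bound: "EX C>0. ALL x y q. norm (BB 1 x y q) <= C * kap x y ^ m * (1 + norm q) ^ (2 * m) / sqrt (Vol x * Vol y)"
proof -
 obtain C1 where C1: "C1 > 0" "!!x. (NI z. ennreal ((1 / kap x z) ^ (2 * m) * (hk x z)^2)) <= ennreal (C1 / Vol x)"
  using weighted_hk[of "2 * m"] by blast
 obtain C2 where C2: "C2 > 0" "!!x q. (NI z. ennreal ((1 / kap x z) ^ (2 * m) * (cmod (tri x z q))^2)) <= ennreal (C2 * (1 + norm q) ^ (2 * (2 * m)) / Vol x)"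
  using tri_weighted[of "2 * m"] by blast
 define n where "n = 2 * real (card G)"
 have n: "0 < n" using card_G_pos by (simp add: n_def)
 define C where "C = n ^ m * sqrt (C1 * C2)"
 note [measurable] = hk_measurable cont_BM[OF kap_cont] tri_measurable_z
 have "norm (BB 1 x y q) <= C * kap x y ^ m * (1 + norm q) ^ (2 * m) / sqrt (Vol x * Vol y)" for x y q
 proof -
  let ?A = "n ^ m * kap x y ^ m"
  let ?f = "%z. ennreal ((1 / kap y z) ^ m * hk y z)" and ?g = "%z. ennreal ((1 / kap x z) ^ m * cmod (tri x z q))"
  have A: "0 <= ?A" using n by (simp add: less_imp_le)
  have "ennreal (norm (BB 1 x y q)) <= (NI z. ennreal (norm (of_real (hk y z) * tri x z q)))"
   unfolding BB_1 by (rule norm_LINT_le)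
  also have "... <= (NI z. ennreal ?A * (?f z * ?g z))"
  proof (rule nn_integral_mono)
   fix z
   let ?a = "kap x z" and ?b = "kap y z"
   have "(?a * ?b) ^ m <= (n * kap x y) ^ m"
    using kap_triangle[of x z y] by (intro power_mono) (simp_all add: n_def less_imp_le)
   then have "(?a * ?b) ^ m * ((1 / ?b) ^ m * (1 / ?a) ^ m) <= ?A * ((1 / ?b) ^ m * (1 / ?a) ^ m)"
    unfolding power_mult_distrib by (intro mult_right_mono) (simp_all add: less_imp_le)
   then have "1 <= ?A * ((1 / ?b) ^ m * (1 / ?a) ^ m)"
    by (simp add: power_mult_distrib power_divide field_simps)
   then have "1 * (hk y z * cmod (tri x z q)) <= (?A * ((1 / ?b) ^ m * (1 / ?a) ^ m)) * (hk y z * cmod (tri x z q))"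
    using hk_pos[of y z] by (intro mult_right_mono) (auto simp: less_imp_le)
   then have "norm (of_real (hk y z) * tri x z q) <= ?A * (((1 / ?b) ^ m * hk y z) * ((1 / ?a) ^ m * cmod (tri x z q)))"
    using hk_pos[of y z] by (simp add: norm_mult abs_of_pos mult_ac)
   then show "ennreal (norm (of_real (hk y z) * tri x z q)) <= ennreal ?A * (?f z * ?g z)"
    using A hk_pos[of y z] by (simp add: ennreal_mult[symmetric] less_imp_le ennreal_leI)
  qed
  also have "... = ennreal ?A * (NI z. ?f z * ?g z)"
   by (rule nn_integral_cmult) (unfold meas_dw, measurable)
  finally have 1: "ennreal (norm (BB 1 x y q)) <= ennreal ?A * (NI z. ?f z * ?g z)" .
  have "(NI z. ?f z * ?g z)^2 <= (NI z. (?f z)\<^sup>2) * (NI z. (?g z)\<^sup>2)"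
   by (rule Cauchy_Schwarz_nn_integral) (unfold meas_dw, measurable)
  also have "... <= ennreal (C1 / Vol y) * ennreal (C2 * (1 + norm q) ^ (2 * (2 * m)) / Vol x)"
  proof (rule mult_mono)
   have "(NI z. (?f z)\<^sup>2) = (NI z. ennreal ((1 / kap y z) ^ (2 * m) * (hk y z)^2))"
    using hk_pos by (intro nn_integral_cong) (simp add: ennreal_power less_imp_le power_mult_distrib power_mult[symmetric] mult.commute)
   then show "(NI z. (?f z)\<^sup>2) <= ennreal (C1 / Vol y)" using C1(2) by simp
   have "(NI z. (?g z)\<^sup>2) = (NI z. ennreal ((1 / kap x z) ^ (2 * m) * (cmod (tri x z q))^2))"
    by (intro nn_integral_cong) (simp add: ennreal_power less_imp_le power_mult_distrib power_mult[symmetric] mult.commute)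
   then show "(NI z. (?g z)\<^sup>2) <= ennreal (C2 * (1 + norm q) ^ (2 * (2 * m)) / Vol x)" using C2(2) by simp
  qed simp_all
  also have "... = (ennreal (sqrt (C1 * C2) * (1 + norm q) ^ (2 * m) / sqrt (Vol x * Vol y)))^2"
   using C1 C2 Vol_pos[of x] Vol_pos[of y]
   by (simp add: ennreal_mult[symmetric] ennreal_power less_imp_le power_divide power_mult_distrib power_mult[symmetric] mult_ac)
  finally have "(NI z. ?f z * ?g z) <= ennreal (sqrt (C1 * C2) * (1 + norm q) ^ (2 * m) / sqrt (Vol x * Vol y))"
   using C1 C2 Vol_pos[of x] Vol_pos[of y] by (intro ennreal_power2_le) (auto simp: less_imp_le)
  with 1 have "ennreal (norm (BB 1 x y q)) <= ennreal ?A * ennreal (sqrt (C1 * C2) * (1 + norm q) ^ (2 * m) / sqrt (Vol x * Vol y))"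
   by (meson mult_left_mono order_trans zero_le)
  also have "... = ennreal (C * kap x y ^ m * (1 + norm q) ^ (2 * m) / sqrt (Vol x * Vol y))"
   using A C1 C2 Vol_pos[of x] Vol_pos[of y]
   by (subst ennreal_mult[symmetric]) (auto simp: C_def less_imp_le mult_ac)
  finally show ?thesis
   using n C1 C2 Vol_pos[of x] Vol_pos[of y] by (simp add: C_def less_imp_le)
 qed
 moreover have "C > 0" using n C1 C2 by (simp add: C_def)
 ultimately show ?thesis by blast
qed

lemma BB_scale:
 assumes s: "0 < s"
 shows "BB (s^2) x y q = (1 / s) powr NN *R BB 1 (x /R s) (y /R s) (q /R s)"
proof -
 have m: "(%xi. Ek \<i> xi x * Ek (- \<i>) xi y * Ek (- \<i>) xi q * of_real (exp (- (s^2) * (norm xi)^2))) \<in> BM"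
  by (intro cont_BM continuous_intros Ek_continuous)
 have e: "exp (- (s^2) * (norm ((1 / s) *R xi))^2) = exp (- 1 * (norm xi)^2)" for xi :: "real^'n"
  using s by (simp add: power_mult_distrib power_divide)
 show ?thesis
  unfolding BB_def integral_dw_scale[OF divide_pos_pos[OF zero_less_one s] m] e Ek_scale Ek_scale_right
  by (simp add: inverse_eq_divide)
qed

text \<open>\<open>s + 1 / s\<close> exceeds \<open>s\<close>, \<open>1 / s\<close> and 1, so a
  single constant covers dilations in both directions.\<close>

lemma kap_scale:
 assumes s: "0 < s"
 shows "kap (x /R s) (y /R s) <= (s + 1 / s)^2 * kap x y"
 unfolding kap_def sum_distrib_left
proof (rule sum_mono)
 fix g assume g: "g \<in> G"
 let ?v = "(norm (y - g x))^2"
 have "norm (y /R s - g (x /R s)) = norm (y - g x) / s"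
  using s by (simp add: linear_cmul[OF G_linear[OF g]] scaleR_diff_right[symmetric] divide_inverse mult.commute)
 then have v: "(norm (y /R s - g (x /R s)))^2 = ?v / s^2" by (simp add: power_divide)
 have "(s + 1 / s)^2 = s^2 + 2 + 1 / s^2" using s by (simp add: power2_eq_square field_simps)
 then have "1 + ?v <= (s + 1 / s)^2 * (1 + ?v / s^2)"
  using s by (simp add: field_simps add_nonneg_nonneg)
 then have "(1 + ?v) / ((1 + ?v) * (1 + ?v / s^2)) <= ((s + 1 / s)^2 * (1 + ?v / s^2)) / ((1 + ?v) * (1 + ?v / s^2))"
  using s by (intro divide_right_mono) (auto intro!: mult_nonneg_nonneg add_nonneg_nonneg)
 moreover have "1 + ?v ~= 0" "1 + ?v / s^2 ~= 0"
  using zero_le_power2[of "norm (y - g x)"] divide_nonneg_nonneg[OF zero_le_power2[of "norm (y - g x)"] zero_le_power2[of s]] by linarith+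
 ultimately show "1 / (1 + (norm (y /R s - g (x /R s)))^2) <= (s + 1 / s)^2 * (1 / (1 + ?v))"
  unfolding v by simp
qed

lemma one_le_add_inverse: "0 < s ==> 1 <= s + 1 / s" for s :: real
 by (cases "1 <= s") (auto simp: add_increasing2 add_increasing)

lemma Vol_scale:
 assumes s: "0 < s"
 shows "Vol x <= (s + 1 / s) ^ ks * Vol (x /R s)"
proof (cases "1 <= s")
 case True
 have "s ^ ks * Vol (x /R s) <= (s + 1 / s) ^ ks * Vol (x /R s)"
  using s by (intro mult_right_mono power_mono) (auto simp: less_imp_le)
 with Vol_shrink(2)[OF True, of x] show ?thesis by linarith
next
 case False
 have "Vol x <= 1 * Vol (x /R s)" using Vol_shrink(1)[of "1 / s" "x /R s"] False s by simp
 also have "... <= (s + 1 / s) ^ ks * Vol (x /R s)"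
  by (intro mult_right_mono one_le_power one_le_add_inverse s) (simp add: less_imp_le)
 finally show ?thesis .
qed

lemma kap_max: "EX g:G. kap x y <= real (card G) * (1 / (1 + (norm (y - g x))^2))"
proof (rule ccontr)
 assume "\<not> ?thesis"
 then have "(SUM g:G. real (card G) * (1 / (1 + (norm (y - g x))^2))) < (SUM g:G. kap x y)"
  using id_in_G by (intro sum_strict_mono) (auto simp: not_le)
 then show False by (simp add: kap_def sum_distrib_left)
qed

text \<open>Volumes at two points compare polynomially in the orbit distance, so \<open>ks\<close>
  powers of \<open>kap\<close> pay for replacing \<open>Vol y\<close> by
  \<open>Vol x\<close>.\<close>

lemma Vol_kap: "Vol x * kap x y ^ ks <= (5 * real (card G)) ^ ks * Vol y"
proof -
 obtain g where g: "g \<in> G" and kg: "kap x y <= real (card G) * (1 / (1 + (norm (y - g x))^2))" using kap_max by blast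
 let ?d = "norm (y - g x)"
 have "1 + 2 * ?d <= 5 * (1 + ?d^2)"
 proof -
  have "2 * ?d <= 1 + ?d^2" using zero_le_power2[of "?d - 1"] by (simp add: power2_diff)
  then have "1 + 2 * ?d <= 1 + (1 + ?d^2)" by simp
  also have "... <= 5 * (1 + ?d^2)" by simp
  finally show ?thesis .
 qed
 then have "(1 + 2 * ?d) * kap x y <= (5 * (1 + ?d^2)) * (real (card G) * (1 / (1 + ?d^2)))"
  by (intro mult_mono kg) (auto simp: less_imp_le)
 also have "... = 5 * real (card G) * ((1 + ?d^2) / (1 + ?d^2))" by (simp only: mult_ac times_divide_eq_right mult_1_right)
 also have "... = 5 * real (card G)" by (simp only: divide_self[OF less_imp_neq[OF one_plus_sq_pos, THEN not_sym]] mult_1_right)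
 finally have "((1 + 2 * ?d) * kap x y) ^ ks <= (5 * real (card G)) ^ ks"
  by (intro power_mono) (auto simp: less_imp_le)
 then have 1: "(1 + 2 * ?d) ^ ks * kap x y ^ ks <= (5 * real (card G)) ^ ks" by (simp only: power_mult_distrib)
 have "Vol x <= (1 + 2 * ?d) ^ ks * Vol y"
  using Vol_compare[of "g x" y] by (simp add: Vol_G[OF g] norm_minus_commute)
 then have "Vol x * kap x y ^ ks <= ((1 + 2 * ?d) ^ ks * Vol y) * kap x y ^ ks"
  by (rule mult_right_mono) (simp add: less_imp_le)
 also have "... = ((1 + 2 * ?d) ^ ks * kap x y ^ ks) * Vol y" by (simp only: mult_ac)
 also have "... <= (5 * real (card G)) ^ ks * Vol y" by (rule mult_right_mono[OF 1]) (simp add: less_imp_le)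
 finally show ?thesis .
qed

text \<open>Rescaling time \<open>t = s^2\<close> to 1 changes each factor by powers of
  \<open>S = s + 1 / s\<close>, whose square is \<open>(1 + t)^2 / t\<close>. The \<open>ks\<close>
  surplus powers of \<open>kap\<close> in \<open>m\<close> convert the geometric mean of the volumes
  into \<open>Vol x\<close>.\<close>

lemma BB_bound: "EX C>0. EX P. ALL t>0. ALL x y q. norm (BB t x y q) <= C * ((1 + t)^2 / t) ^ P * kap x y ^ M * (1 + norm q) ^ P / Vol x"
proof -
 define m where "m = M + ks"
 obtain C where C: "C > 0" "!!x y q. norm (BB 1 x y q) <= C * kap x y ^ m * (1 + norm q) ^ (2 * m) / sqrt (Vol x * Vol y)"
  using BB_1_bound[of m] by blast
 define nn where "nn = nat \<lceil>NN\<rceil>"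
 define P where "P = nn + 4 * m + ks"
 define n where "n = real (card G)"
 have n: "1 <= n" using card_G_pos unfolding n_def by linarith
 have "norm (BB t x y q) <= (C * (5 * n) ^ ks) * ((1 + t)^2 / t) ^ P * kap x y ^ M * (1 + norm q) ^ P / Vol x" if t: "0 < t" for t x y q
 proof -
  define s where "s = sqrt t"
  define S where "S = s + 1 / s"
  have s: "0 < s" "s^2 = t" using t by (auto simp: s_def)
  have S: "1 <= S" unfolding S_def by (rule one_le_add_inverse[OF s(1)])
  let ?x = "x /R s" and ?y = "y /R s" and ?q = "q /R s"
  have S2: "S^2 = (1 + t)^2 / t"
   using s(1) unfolding S_def s(2)[symmetric] by (simp add: power2_eq_square field_simps)
  have a1: "(1 / s) powr NN <= S ^ nn"
  proof -
   have "(1 / s) powr NN <= S powr NN" using s by (intro powr_mono2) (auto simp: S_def NN_eq sk_nonneg)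
   also have "... <= S powr real nn" using S by (intro powr_mono) (auto simp: nn_def real_nat_ceiling_ge)
   finally show ?thesis using S by (simp add: powr_realpow)
  qed
  have a2: "kap ?x ?y ^ m <= (S^2 * kap x y) ^ m"
   unfolding S_def by (intro power_mono kap_scale s) (simp add: less_imp_le)
  have "1 + norm ?q <= S * (1 + norm q)"
  proof -
   have "norm ?q = (1 / s) * norm q" using s by (simp add: divide_inverse)
   also have "... <= S * norm q" using s by (intro mult_right_mono) (auto simp: S_def)
   finally show ?thesis using S by (simp add: distrib_left)
  qed
  then have a3: "(1 + norm ?q) ^ (2 * m) <= (S * (1 + norm q)) ^ (2 * m)" by (intro power_mono) auto
  \<comment> \<open>\<open>Vol_kap\<close> is multiplied by \<open>Vol x\<close> and by one more
    factor \<open>kap x y ^ ks\<close>, itself bounded by a constant, so that both sides become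
    squares.\<close>
  have a4: "1 / sqrt (Vol ?x * Vol ?y) <= S ^ ks * ((5 * n) ^ ks / (kap x y ^ ks * Vol x))"
  proof -
   have "Vol x * Vol x * kap x y ^ ks <= Vol x * ((5 * n) ^ ks * Vol y)"
    using Vol_kap[of x y] mult_left_mono[OF _ less_imp_le[OF Vol_pos[of x]]] unfolding n_def mult.assoc by blast
   also have "... = (5 * n) ^ ks * (Vol x * Vol y)" by (simp only: mult_ac)
   also have "Vol x * Vol y <= (S ^ ks * Vol ?x) * (S ^ ks * Vol ?y)"
    unfolding S_def by (intro mult_mono Vol_scale s) (auto simp: less_imp_le s intro!: mult_nonneg_nonneg zero_le_power add_nonneg_nonneg)
   finally have "Vol x * Vol x * kap x y ^ ks <= (5 * n) ^ ks * ((S ^ ks)^2 * (Vol ?x * Vol ?y))"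
    using n by (simp add: power2_eq_square mult_ac)
   then have "Vol x * Vol x * kap x y ^ ks * kap x y ^ ks <= (5 * n) ^ ks * ((S ^ ks)^2 * (Vol ?x * Vol ?y)) * kap x y ^ ks"
    by (intro mult_right_mono) (auto simp: less_imp_le)
   also have "... <= (5 * n) ^ ks * ((S ^ ks)^2 * (Vol ?x * Vol ?y)) * (5 * n) ^ ks"
    using kap_le[of x y] n S by (intro mult_left_mono power_mono) (auto simp: n_def less_imp_le)
   finally have "(Vol x * kap x y ^ ks)^2 <= ((5 * n) ^ ks * S ^ ks * sqrt (Vol ?x * Vol ?y))^2"
    by (simp add: power_mult_distrib less_imp_le power2_eq_square mult_ac)
   then have "Vol x * kap x y ^ ks <= (5 * n) ^ ks * S ^ ks * sqrt (Vol ?x * Vol ?y)"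
    using n S by (elim power2_le_imp_le) (auto simp: less_imp_le)
   then show ?thesis by (simp add: field_simps)
  qed
  have e4: "S ^ (4 * m) = S ^ (2 * m) * S ^ (2 * m)" by (simp add: power_add[symmetric])
  have "norm (BB t x y q) = (1 / s) powr NN * norm (BB 1 ?x ?y ?q)"
   unfolding s(2)[symmetric] BB_scale[OF s(1)] by simp
  also have "... <= S ^ nn * (C * (S^2 * kap x y) ^ m * (S * (1 + norm q)) ^ (2 * m) * (S ^ ks * ((5 * n) ^ ks / (kap x y ^ ks * Vol x))))"
  proof (rule mult_mono[OF a1])
   have "norm (BB 1 ?x ?y ?q) <= C * kap ?x ?y ^ m * (1 + norm ?q) ^ (2 * m) * (1 / sqrt (Vol ?x * Vol ?y))"
    using C(2)[of ?x ?y ?q] by simp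
   also have "... <= C * (S^2 * kap x y) ^ m * (S * (1 + norm q)) ^ (2 * m) * (S ^ ks * ((5 * n) ^ ks / (kap x y ^ ks * Vol x)))"
    using C(1) S by (intro mult_mono a2 a3 a4 order_refl mult_nonneg_nonneg) (auto simp: less_imp_le)
   finally show "norm (BB 1 ?x ?y ?q) <= ..." .
  qed (use S in auto)
  also have "... = (C * (5 * n) ^ ks) * S ^ P * (kap x y ^ m / kap x y ^ ks) * (1 + norm q) ^ (2 * m) / Vol x"
   by (simp add: P_def e4 power_add power_mult_distrib power_mult[symmetric])
  also have "kap x y ^ m / kap x y ^ ks = kap x y ^ M" by (simp add: m_def power_add)
  also have "(C * (5 * n) ^ ks) * S ^ P * kap x y ^ M * (1 + norm q) ^ (2 * m) / Vol x
   <= (C * (5 * n) ^ ks) * (S^2) ^ P * kap x y ^ M * (1 + norm q) ^ P / Vol x"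
  proof (intro divide_right_mono mult_mono order_refl mult_nonneg_nonneg)
   show "S ^ P <= (S^2) ^ P" unfolding power_mult[symmetric] using S by (intro power_increasing) auto
   show "(1 + norm q) ^ (2 * m) <= (1 + norm q) ^ P" by (intro power_increasing) (auto simp: P_def)
  qed (use C n S in \<open>auto simp: less_imp_le\<close>)
  finally show ?thesis unfolding S2 .
 qed
 moreover have "C * (5 * n) ^ ks > 0" using C n by simp
 ultimately show ?thesis by blast
qed

end

section \<open>Dunkl operators preserve rapid decay\<close>

text \<open>Difference quotients are averages \<open>pop\<close> along segments, on which a weight may degenerate; they are
 therefore controlled by multiplying with monomials, which commute with them up to reflected terms.\<close>

primrec Bn :: "nat => (real^'n => complex) => bool" where
 "Bn 0 f \<longleftrightarrow> f \<in> BM & bounded (range f)"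
| "Bn (Suc n) f \<longleftrightarrow> bounded (range f) & (ALL x. f differentiable (at x)) & (ALL v. Bn n (%x. fd f x v))"

lemma Bn_bounded: "Bn n f ==> bounded (range f)"
 by (cases n) auto

lemma diff_measurable: "(!!x. f differentiable (at x)) ==> f \<in> BM" for f :: "real^'n => complex"
 by (intro cont_BM continuous_at_imp_continuous_on ballI differentiable_imp_continuous_within)

lemma Bn_measurable: "Bn n f ==> f \<in> BM"
 by (cases n) (auto intro: diff_measurable)

lemma Bn_SucI:
 assumes "!!x. (f has_derivative f' x) (at x)" "bounded (range f)" "!!v. Bn n (%x. f' x v)"
 shows "Bn (Suc n) f"
proof -
 have "fd f x = f' x" for x by (rule frechet_derivative_at[OF assms(1), symmetric])
 then show ?thesis using assms by (auto simp: differentiable_def)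
qed

lemma Bn_D: "Bn (Suc n) f ==> (f has_derivative fd f x) (at x)"
 by (simp add: frechet_derivative_works)

lemma Bn_mono: "Bn (Suc n) f ==> Bn n f"
proof (induction n arbitrary: f)
 case 0
 then show ?case using Bn_measurable Bn_bounded by (simp del: Bn.simps(2) add: Bn_measurable)
next
 case (Suc n)
 then show ?case by simp
qed

lemma bounded_range_add: "bounded (range f) ==> bounded (range g) ==> bounded (range (%x. f x + g x))"
 for f g :: "'a => complex"
 by (rule bounded_plus_comp)

lemma bounded_range_cmul: "bounded (range f) ==> bounded (range (%x. c * f x))" for f :: "'a => complex"
 using bounded_linear_image[OF _ bounded_linear_mult_right[of c], of "range f"] by (simp add: image_image)

lemma Bn_add: "Bn n f ==> Bn n g ==> Bn n (%x. f x + g x)"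
proof (induction n arbitrary: f g)
 case 0
 then show ?case by (auto intro: bounded_range_add)
next
 case (Suc n)
 show ?case
  by (rule Bn_SucI[OF has_derivative_add[OF Bn_D[OF Suc.prems(1)] Bn_D[OF Suc.prems(2)]]])
   (use Suc in \<open>auto intro: bounded_range_add\<close>)
qed

lemma Bn_cmul: "Bn n f ==> Bn n (%x. c * f x)"
proof (induction n arbitrary: f)
 case 0
 then show ?case by (auto intro: bounded_range_cmul)
next
 case (Suc n)
 show ?case
  by (rule Bn_SucI[OF has_derivative_mult_right[OF Bn_D[OF Suc.prems]]])
   (use Suc in \<open>auto intro: bounded_range_cmul\<close>)
qed

lemma Bn_zero: "Bn n (%x. 0)"
proof (induction n)
 case (Suc n)
 then show ?case by (intro Bn_SucI[OF has_derivative_const]) auto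
qed auto

lemma Bn_sum: "finite I ==> (!!i. i \<in> I ==> Bn n (f i)) ==> Bn n (%x. SUM i:I. f i x)"
 by (induction I rule: finite_induct) (auto simp: Bn_zero intro: Bn_add)

lemma bounded_range_comp: "bounded (range f) ==> bounded (range (%x. f (h x)))"
 by (rule bounded_subset[of "range f"]) auto

lemma Bn_linear:
 assumes "linear h" "Bn n f"
 shows "Bn n (%x. f (h x))"
 using assms(2)
proof (induction n arbitrary: f)
 case 0
 have "h \<in> BM"
  using assms(1) by (intro cont_BM linear_continuous_on) (simp add: linear_conv_bounded_linear)
 from measurable_compose[OF this, of f borel] show ?case using 0 bounded_range_comp[of f h] by simp
next
 case (Suc n)
 have "bounded_linear h" using assms(1) by (simp add: linear_conv_bounded_linear)
 then have "(h has_derivative h) (at x)" for x by (rule bounded_linear_imp_has_derivative)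
 from has_derivative_compose[OF this Bn_D[OF Suc.prems]] show ?case
  by (rule Bn_SucI) (use Suc bounded_range_comp[of f h] in auto)
qed

lemma sum_axis: "(SUM j:UNIV. (v $ j) *R axis j 1) = (v :: real^'n)"
 by (simp add: vec_eq_iff axis_def if_distrib cong: if_cong)

lemma linear_axis: "linear F ==> F v = (SUM j:UNIV. of_real (v $ j) * F (axis j 1))" for F :: "real^'n => complex"
 using linear_sum[of F "%j. (v $ j) *R axis j 1" UNIV] by (simp add: sum_axis linear_cmul flip: scaleR_conv_of_real)

lemma Bn_deriv_bound:
 assumes "Bn (Suc n) f"
 shows "EX C>=0. ALL x v. norm (fd f x v) <= C * norm v"
proof -
 have "EX c. ALL x. norm (fd f x (axis j 1)) <= c" for j
  using Bn_bounded[of n "%x. fd f x (axis j 1)"] assms by (auto simp: bounded_iff)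
 then obtain c where c: "norm (fd f x (axis j 1)) <= c j" for j x by metis
 have c0: "0 <= c j" for j using c[of _ j] norm_ge_zero order_trans by blast
 have "norm (fd f x v) <= (SUM j:UNIV. c j) * norm v" for x v
 proof -
  have "norm (fd f x v) <= (SUM j:UNIV. norm (of_real (v $ j) * fd f x (axis j 1)))"
   unfolding linear_axis[OF has_derivative_linear[OF Bn_D[OF assms]], of x v] by (rule norm_sum)
  also have "... <= (SUM j:UNIV. norm v * c j)"
   by (intro sum_mono) (simp add: norm_mult mult_mono component_le_norm_cart c c0)
  finally show ?thesis by (simp add: sum_distrib_left mult.commute)
 qed
 then show ?thesis using c0 by (intro exI[of _ "SUM j:UNIV. c j"]) (auto intro: sum_nonneg)
qed

text \<open>For \<open>j = 0\<close> and a derivative of a function this is its difference quotient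
  (\<open>quo_pop\<close>). The factor \<open>s ^ j\<close> appears because each differentiation
  acts on the term \<open>(s * (x \<cdot> al)) *R al\<close> of the argument and brings out an
  \<open>s\<close>.\<close>

definition pop :: "real^'n => nat => (real^'n => complex) => real^'n => complex" where
 "pop al j f x = (LINT s|lborel. indicator {0..1} s *R (of_real (s ^ j) * f (x - (s * (x \<cdot> al)) *R al)))"

lemma pop_integrand:
 assumes "Bn n f"
 shows "(%s. indicator {0..1} s *R (of_real (s ^ j) * f (x - (s * (x \<cdot> al)) *R al))) \<in> borel_measurable lborel"
  and "(!!x. norm (f x) <= C) ==> norm (indicator {0..1} s *R (of_real (s ^ j) * f (x - (s * (x \<cdot> al)) *R al))) <= C * indicator {0..1::real} s"
  and "integrable lborel (%s. indicator {0..1} s *R (of_real (s ^ j) * f (x - (s * (x \<cdot> al)) *R al)))"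
proof -
 note [measurable] = Bn_measurable[OF assms]
 show m: "(%s. indicator {0..1} s *R (of_real (s ^ j) * f (x - (s * (x \<cdot> al)) *R al))) \<in> borel_measurable lborel"
  by measurable
 have b: "norm (indicator {0..1} s *R (of_real (s ^ j) * f (x - (s * (x \<cdot> al)) *R al))) <= C * indicator {0..1::real} s"
  if C: "!!x. norm (f x) <= C" for C s
 proof (cases "s \<in> {0..1}")
  case True
  have "\<bar>s ^ j\<bar> * norm (f (x - (s * (x \<cdot> al)) *R al)) <= 1 * C"
   using True by (intro mult_mono C) (auto simp: power_le_one power_abs)
  then show ?thesis using True by (simp add: norm_mult norm_power power_abs)
 qed simp
 then show "(!!x. norm (f x) <= C) ==> norm (indicator {0..1} s *R (of_real (s ^ j) * f (x - (s * (x \<cdot> al)) *R al))) <= C * indicator {0..1::real} s" .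
 obtain C where C: "!!x. norm (f x) <= C" using Bn_bounded[OF assms] by (auto simp: bounded_iff)
 show "integrable lborel (%s. indicator {0..1} s *R (of_real (s ^ j) * f (x - (s * (x \<cdot> al)) *R al)))"
 proof (rule integrable_bound[OF _ m])
  show "integrable lborel (%s. C * indicator {0..1::real} s)" by simp
  show "AE s in lborel. norm (indicator {0..1} s *R (of_real (s ^ j) * f (x - (s * (x \<cdot> al)) *R al))) <= norm (C * indicator {0..1::real} s)"
   by (intro AE_I2 order_trans[OF b[OF C]]) simp
 qed
qed

lemma pop_bounded:
 assumes "Bn n f"
 shows "bounded (range (pop al j f))"
proof -
 obtain C where C: "!!x. norm (f x) <= C" using Bn_bounded[OF assms] by (auto simp: bounded_iff)
 have "norm (pop al j f x) <= (LINT s|lborel. C * indicator {0..1::real} s)" for x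
  unfolding pop_def by (rule integral_norm_bound_integral[OF pop_integrand(3)[OF assms] _ pop_integrand(2)[OF assms C]]) simp
 then show ?thesis by (auto simp: bounded_iff)
qed

lemma pop_has_derivative:
 assumes f: "Bn (Suc n) f"
 defines "f' \<equiv> %x. fd f x"
 shows "(pop al j f has_derivative (%v. pop al j (%y. f' y v) x - of_real (v \<cdot> al) * pop al (Suc j) (%y. f' y al) x)) (at x)"
proof -
 let ?A = "%s x. x - (s * (x \<cdot> al)) *R al"
 let ?F' = "%x s v. indicator {0..1} s *R (of_real (s ^ j) * f' (?A s x) (?A s v))"
 have f': "(f has_derivative f' y) (at y)" for y unfolding f'_def by (rule Bn_D[OF f])
 have Bf': "Bn n (%y. f' y v)" for v using f by (simp add: f'_def)
 obtain C where C: "0 <= C" "!!x v. norm (f' x v) <= C * norm v" using Bn_deriv_bound[OF f] unfolding f'_def by blast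
 define K where "K = C * (1 + norm al * norm al)"
 have d: "((%x. indicator {0..1} s *R (of_real (s ^ j) * f (?A s x))) has_derivative ?F' x s) (at x)" for s x
 proof -
  have "((%x. ?A s x) has_derivative ?A s) (at x)" by (auto intro!: derivative_eq_intros)
  from has_derivative_compose[OF this f'] have "((%x. f (?A s x)) has_derivative (%v. f' (?A s x) (?A s v))) (at x)" .
  from has_derivative_scaleR_right[OF has_derivative_mult_right[OF this]] show ?thesis .
 qed
 have b: "norm (?F' p s v) <= (K * indicator {0..1} s) * norm v" for p s v
 proof (cases "s \<in> {0..1}")
  case True
  have "norm (?A s v) <= norm v + \<bar>s\<bar> * (\<bar>v \<cdot> al\<bar> * norm al)"
   by (rule order_trans[OF norm_triangle_ineq4]) (simp add: abs_mult)
  also have "... <= norm v + 1 * ((norm v * norm al) * norm al)"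
   using True by (intro add_mono mult_mono order_refl Cauchy_Schwarz_ineq2) auto
  finally have "C * norm (?A s v) <= C * (norm v + 1 * ((norm v * norm al) * norm al))" by (rule mult_left_mono[OF _ C(1)])
  then have A: "norm (f' (?A s p) (?A s v)) <= K * norm v" using C(2)[of "?A s p" "?A s v"] by (simp add: K_def algebra_simps)
  have "\<bar>s ^ j\<bar> * norm (f' (?A s p) (?A s v)) <= 1 * (K * norm v)"
   using True by (intro mult_mono A) (auto simp: power_le_one power_abs)
  then show ?thesis using True by (simp add: norm_mult norm_power power_abs)
 qed simp
 have gi: "integrable lborel (%s. K * indicator {0..1::real} s)" by simp
 note D = has_derivative_LINT[OF zero_less_one d pop_integrand(3)[OF f] b gi]
 have eq: "(LINT s|lborel. ?F' x s v) = pop al j (%y. f' y v) x - of_real (v \<cdot> al) * pop al (Suc j) (%y. f' y al) x" for v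
 proof -
  have p: "?F' x s v = indicator {0..1} s *R (of_real (s ^ j) * f' (?A s x) v)
    - of_real (v \<cdot> al) * (indicator {0..1} s *R (of_real (s ^ Suc j) * f' (?A s x) al))" for s
  proof -
   have l: "f' (?A s x) (?A s v) = f' (?A s x) v - (s * (v \<cdot> al)) *R f' (?A s x) al"
    by (simp only: linear_diff[OF has_derivative_linear[OF f']] linear_cmul[OF has_derivative_linear[OF f']])
   show ?thesis unfolding l by (simp add: scaleR_conv_of_real[where 'a = complex] algebra_simps)
  qed
  show ?thesis unfolding pop_def p
   by (subst integral_diff[OF pop_integrand(3)[OF Bf'] integrable_mult_right[OF pop_integrand(3)[OF Bf']]])
    (simp only: integral_mult_right_zero)
 qed
 have "pop al j f = (%x. LINT s|lborel. indicator {0..1} s *R (of_real (s ^ j) * f (?A s x)))"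
  by (simp add: fun_eq_iff pop_def)
 then show ?thesis using D(2)[of x] unfolding eq by simp
qed

lemma pop_Bn: "Bn n f ==> Bn n (pop al j f)"
proof (induction n arbitrary: f j)
 case 0
 note [measurable] = Bn_measurable[OF 0]
 have "pop al j f \<in> BM" unfolding pop_def[abs_def] by measurable
 then show ?case using pop_bounded[OF 0] by simp
next
 case (Suc n)
 have B: "Bn n (%y. fd f y v)" for v using Suc.prems by simp
 show ?case
 proof (rule Bn_SucI[OF pop_has_derivative[OF Suc.prems] pop_bounded[OF Suc.prems]])
  fix v
  show "Bn n (%x. pop al j (%y. fd f y v) x - of_real (v \<cdot> al) * pop al (Suc j) (%y. fd f y al) x)"
   using Bn_add[OF Suc.IH[OF B[of v], of j] Bn_cmul[OF Suc.IH[OF B[of al], of "Suc j"], of "- of_real (v \<cdot> al)"]] by simp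
 qed
qed

primrec mon :: "(real^'n) list => (real^'n => complex) => real^'n => complex" where
 "mon [] f = f"
| "mon (v # vs) f = mon vs (%x. of_real (x \<cdot> v) * f x)"

text \<open>Decay is encoded as boundedness after multiplication by products of linear forms,
  because plain boundedness passes through the averages \<open>pop\<close>.\<close>

definition Sn :: "nat => (real^'n => complex) => bool" where "Sn n f \<longleftrightarrow> (ALL vs. Bn n (mon vs f))"

lemma Sn_Bn: "Sn n f ==> Bn n f"
 unfolding Sn_def by (metis mon.simps(1))

lemma Sn_times: "Sn n f ==> Sn n (%x. of_real (x \<cdot> v) * f x)"
 unfolding Sn_def by (metis mon.simps(2))

lemma Sn_mono: "Sn (Suc n) f ==> Sn n f"
 unfolding Sn_def using Bn_mono by blast

lemma mon_add: "mon vs (%x. f x + g x) = (%x. mon vs f x + mon vs g x)"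
 by (induction vs arbitrary: f g) (simp_all add: distrib_left)

lemma mon_cmul: "mon vs (%x. c * f x) = (%x. c * mon vs f x)"
 by (induction vs arbitrary: f) (simp_all add: mult.left_commute)

lemma Sn_add: "Sn n f ==> Sn n g ==> Sn n (%x. f x + g x)"
 by (simp add: Sn_def mon_add Bn_add)

lemma Sn_cmul: "Sn n f ==> Sn n (%x. c * f x)"
 by (simp add: Sn_def mon_cmul Bn_cmul)

lemma Sn_zero: "Sn n (%x :: real^'n. 0)"
proof -
 have "mon vs (%x. 0) = (%x. 0)" for vs :: "(real^'n) list" by (induction vs) simp_all
 then show ?thesis by (simp add: Sn_def Bn_zero)
qed

lemma Sn_sum: "finite I ==> (!!i. i \<in> I ==> Sn n (f i)) ==> Sn n (%x. SUM i:I. f i x)"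
 by (induction I rule: finite_induct) (auto simp: Sn_zero intro: Sn_add)

lemma Sn_D:
 assumes "Sn (Suc n) f"
 shows "(f has_derivative fd f x) (at x)"
 by (rule Bn_D[OF Sn_Bn[OF assms]])

lemma D_times:
 assumes "(f has_derivative f') (at x)"
 shows "fd (%x. complex_of_real (x \<cdot> v) * f x) x u = of_real (u \<cdot> v) * f x + of_real (x \<cdot> v) * f' u"
proof -
 have "((%x. complex_of_real (x \<cdot> v) * f x) has_derivative (%u. of_real (x \<cdot> v) * f' u + of_real (u \<cdot> v) * f x)) (at x)"
  by (intro has_derivative_mult has_derivative_of_real has_derivative_inner_left has_derivative_ident assms)
 from frechet_derivative_at[OF this, symmetric] show ?thesis by simp
qed

lemma Sn_deriv: "Sn (Suc n) f ==> Sn n (%x. fd f x w)"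
proof -
 have "Bn n (mon vs (%x. fd f x w))" if "Sn (Suc n) f" for vs
  using that
 proof (induction vs arbitrary: f)
  case Nil
  then show ?case using Sn_Bn[OF Nil] by simp
 next
  case (Cons v vs)
  have "(%x. of_real (x \<cdot> v) * fd f x w)
   = (%x. fd (%x. complex_of_real (x \<cdot> v) * f x) x w + (- of_real (w \<cdot> v)) * f x)"
   by (simp add: D_times[OF Sn_D[OF Cons.prems]])
  moreover have "Bn n (mon vs f)" using Sn_mono[OF Cons.prems] by (simp add: Sn_def)
  ultimately show ?case
   using Cons.IH[OF Sn_times[OF Cons.prems, of v]] by (simp only: mon.simps mon_add mon_cmul Bn_add Bn_cmul)
 qed
 then show "Sn (Suc n) f ==> Sn n (%x. fd f x w)" by (simp add: Sn_def)
qed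

lemma Sn_linear:
 assumes h: "linear h" "!!x y. h x \<cdot> y = x \<cdot> h y" "!!x. h (h x) = x" and f: "Sn n f"
 shows "Sn n (%x. f (h x))"
proof -
 have "mon vs (%x. f (h x)) = (%x. mon (map h vs) f (h x))" for vs
 proof (induction vs arbitrary: f)
  case (Cons v vs)
  have "x \<cdot> v = h x \<cdot> h v" for x using h(2,3) by simp
  then show ?case using Cons[of "%x. of_real (x \<cdot> h v) * f x"] by simp
 qed simp
 then show ?thesis using f Bn_linear[OF h(1)] by (simp add: Sn_def)
qed

text \<open>Each induction step trades a power of \<open>1 + norm x\<close> for the coordinate
  forms, by the comparison of \<open>norm x\<close> with the sum of the absolute
  coordinates.\<close>

lemma Sn_decay: "Sn n f ==> EX C>=0. ALL x. (1 + norm x) ^ m * norm (f x) <= C"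
proof (induction m arbitrary: f)
 case 0
 obtain C where "!!x. norm (f x) <= C" using Bn_bounded[OF Sn_Bn[OF 0]] by (auto simp: bounded_iff)
 moreover from this[of 0] have "0 <= C" using norm_ge_zero order_trans by blast
 ultimately show ?case by auto
next
 case (Suc m)
 obtain C where C: "C >= 0" "!!x. (1 + norm x) ^ m * norm (f x) <= C" using Suc.IH[OF Suc.prems] by blast
 have "ALL j. EX C>=0. ALL x. (1 + norm x) ^ m * norm (of_real (x \<cdot> axis j 1) * f x) <= C"
  using Suc.IH[OF Sn_times[OF Suc.prems]] by blast
 then obtain D where D: "!!j. D j >= 0" "!!j x. (1 + norm x) ^ m * norm (of_real (x \<cdot> axis j 1) * f x) <= D j" by metis
 have "(1 + norm x) ^ Suc m * norm (f x) <= C + (SUM j:UNIV. D j)" for x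
 proof -
  have "norm x <= (SUM j:UNIV. \<bar>x $ j\<bar>)" by (rule norm_le_l1_cart)
  then have "(1 + norm x) ^ m * norm (f x) * norm x <= (1 + norm x) ^ m * norm (f x) * (SUM j:UNIV. \<bar>x $ j\<bar>)"
   by (intro mult_left_mono) auto
  also have "... = (SUM j:UNIV. (1 + norm x) ^ m * norm (of_real (x \<cdot> axis j 1) * f x))"
   unfolding sum_distrib_left by (intro sum.cong refl) (simp add: norm_mult inner_axis)
  also have "... <= (SUM j:UNIV. D j)" by (intro sum_mono D(2))
  finally show ?thesis using C(2)[of x] by (simp add: algebra_simps)
 qed
 moreover have "0 <= C + (SUM j:UNIV. D j)" using C(1) D(1) by (intro add_nonneg_nonneg sum_nonneg) auto
 ultimately show ?case by (intro exI[of _ "C + (SUM j:UNIV. D j)"] conjI allI)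
qed

text \<open>Follows the shape of \<open>schwartz\<close>, with coordinate derivatives and weights
  outside of them, but at a finite order, so that induction can reach \<open>Sn\<close>.\<close>

primrec Dn :: "nat => (real^'n => complex) => bool" where
 "Dn 0 f \<longleftrightarrow> (ALL x. f differentiable (at x)) & (ALL m. bounded (range (%x. (1 + norm x) ^ m *R f x)))"
| "Dn (Suc n) f \<longleftrightarrow> (ALL x. f differentiable (at x)) & (ALL m. bounded (range (%x. (1 + norm x) ^ m *R f x))) & (ALL j. Dn n (%x. fd f x (axis j 1)))"

lemma Dn_Suc: "Dn (Suc n) f \<longleftrightarrow> Dn 0 f & (ALL j. Dn n (%x. fd f x (axis j 1)))"
 by auto

declare Dn.simps [simp del]

lemma Dn_iterated: "f \<in> schwartz ==> Dn n (iterated_partial js f)"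
proof (induction n arbitrary: js)
 case 0
 then show ?case by (auto simp: schwartz_def Dn.simps)
next
 case (Suc n)
 have "Dn n (%x. fd (iterated_partial js f) x (axis j 1))" for j
  using Suc.IH[OF Suc.prems, of "j # js"] by simp
 moreover have "Dn 0 (iterated_partial js f)" using Suc.prems by (auto simp: schwartz_def Dn.simps)
 ultimately show ?case by (auto simp: Dn_Suc)
qed

lemma Dn_0: "Dn n f ==> Dn 0 f"
 by (cases n) (auto simp: Dn.simps)

lemma Dn_D: "Dn n f ==> (f has_derivative fd f x) (at x)"
 using Dn_0[of n f] by (simp add: Dn.simps frechet_derivative_works)

lemma Dn_Bn: "Dn n f ==> Bn n f"
proof (induction n arbitrary: f)
 case 0
 have "bounded (range f)" using 0[unfolded Dn.simps, THEN conjunct2, THEN spec[of _ 0]] by simp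
 then show ?case using 0 diff_measurable[of f] by (simp add: Dn.simps)
next
 case (Suc n)
 have "bounded (range f)" using Dn_0[OF Suc.prems, unfolded Dn.simps, THEN conjunct2, THEN spec[of _ 0]] by simp
 then show ?case
 proof (rule Bn_SucI[OF Dn_D[OF Suc.prems]])
  fix v
  show "Bn n (%x. fd f x v)"
   unfolding linear_axis[OF has_derivative_linear[OF Dn_D[OF Suc.prems]], of _ v]
   by (intro Bn_sum Bn_cmul Suc.IH) (use Suc.prems in \<open>auto simp: Dn_Suc\<close>)
 qed
qed

lemma Dn0_add: "Dn 0 f ==> Dn 0 g ==> Dn 0 (%x. f x + g x)"
 unfolding Dn.simps scaleR_add_right by (intro conjI allI differentiable_add bounded_range_add) auto

lemma Dn0_cmul: "Dn 0 f ==> Dn 0 (%x. c * f x)"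
proof -
 assume f: "Dn 0 f"
 have "bounded (range (%x. (1 + norm x) ^ m *R (c * f x)))" for m
  using bounded_range_cmul[of "%x. (1 + norm x) ^ m *R f x" c] f by (simp add: Dn.simps)
 then show ?thesis using f by (auto simp: Dn.simps)
qed

lemma Dn_add: "Dn n f ==> Dn n g ==> Dn n (%x. f x + g x)"
proof (induction n arbitrary: f g)
 case (Suc n)
 have "fd (%x. f x + g x) x = (%v. fd f x v + fd g x v)" for x
  by (rule frechet_derivative_at[OF has_derivative_add[OF Dn_D[OF Suc.prems(1)] Dn_D[OF Suc.prems(2)]], symmetric])
 then show ?case using Suc Dn0_add[OF Dn_0[OF Suc.prems(1)] Dn_0[OF Suc.prems(2)]] by (simp add: Dn_Suc)
qed (rule Dn0_add)

lemma Dn_cmul: "Dn n f ==> Dn n (%x. c * f x)"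
proof (induction n arbitrary: f)
 case (Suc n)
 have "fd (%x. c * f x) x = (%v. c * fd f x v)" for x
  by (rule frechet_derivative_at[OF has_derivative_mult_right[OF Dn_D[OF Suc.prems]], symmetric])
 then show ?case using Suc Dn0_cmul[OF Dn_0[OF Suc.prems]] by (simp add: Dn_Suc)
qed (rule Dn0_cmul)

lemma Dn_mono: "Dn (Suc n) f ==> Dn n f"
 by (induction n arbitrary: f) (auto simp: Dn_Suc)

lemma Dn0_times: "Dn 0 f ==> Dn 0 (%x. of_real (x \<cdot> v) * f x)"
proof -
 assume f: "Dn 0 f"
 have "bounded (range (%x. (1 + norm x) ^ m *R (of_real (x \<cdot> v) * f x)))" for m
 proof -
  obtain C where C: "!!x. norm ((1 + norm x) ^ Suc m *R f x) <= C"
   using f[unfolded Dn.simps, THEN conjunct2, THEN spec[of _ "Suc m"]] by (auto simp: bounded_iff)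
  have "norm ((1 + norm x) ^ m *R (of_real (x \<cdot> v) * f x)) <= norm v * C" for x
  proof -
   have "\<bar>x \<cdot> v\<bar> <= norm v * (1 + norm x)"
   proof -
    have "norm v * (1 + norm x) = norm v + norm x * norm v" by (simp add: algebra_simps)
    then show ?thesis using Cauchy_Schwarz_ineq2[of x v] norm_ge_zero[of v] by linarith
   qed
   then have "\<bar>x \<cdot> v\<bar> * ((1 + norm x) ^ m * norm (f x)) <= (norm v * (1 + norm x)) * ((1 + norm x) ^ m * norm (f x))"
    by (intro mult_right_mono) auto
   also have "... <= norm v * C" using mult_left_mono[OF C[of x], of "norm v"] by (simp add: norm_mult norm_power mult_ac)
   finally show ?thesis by (simp add: norm_mult norm_power mult_ac)
  qed
  then show ?thesis by (auto simp: bounded_iff)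
 qed
 moreover have "(%x. of_real (x \<cdot> v) * f x) differentiable (at x)" for x
  unfolding differentiable_def
  using has_derivative_mult[OF has_derivative_of_real[OF has_derivative_inner_left[OF has_derivative_ident]] Dn_D[OF f]] by blast
 ultimately show ?thesis by (simp add: Dn.simps(1))
qed

lemma Dn_times: "Dn n f ==> Dn n (%x. of_real (x \<cdot> v) * f x)"
proof (induction n arbitrary: f)
 case (Suc n)
 have "Dn n (%x. of_real (axis j 1 \<cdot> v) * f x + of_real (x \<cdot> v) * fd f x (axis j 1))" for j
  using Suc.prems by (intro Dn_add Dn_cmul Suc.IH Dn_mono[OF Suc.prems]) (simp add: Dn_Suc)
 then show ?case using Dn0_times[OF Dn_0[OF Suc.prems]] by (simp add: Dn_Suc D_times[OF Dn_D[OF Suc.prems]])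
qed (rule Dn0_times)

lemma schwartz_Sn:
 fixes f :: "real^'n => complex"
 assumes "f \<in> schwartz"
 shows "Sn n f"
proof -
 have "Dn n f" using Dn_iterated[OF assms, of n "[]"] by simp
 moreover have "Bn n (mon vs f)" if "Dn n f" for vs and f :: "real^'n => complex"
  using that by (induction vs arbitrary: f) (simp_all add: Dn_Bn Dn_times)
 ultimately show ?thesis by (simp add: Sn_def)
qed

definition Sm :: "(real^'n => complex) => bool" where "Sm f \<longleftrightarrow> (ALL n. Sn n f)"

lemma Sm_D: "Sm f ==> (f has_derivative fd f x) (at x)"
 unfolding Sm_def using Sn_D by blast

lemma Sm_closed:
 "Sm f ==> Sm g ==> Sm (%x. f x + g x)" "Sm f ==> Sm (%x. c * f x)"
 "Sm f ==> Sm (%x. fd f x v)" "Sm f ==> Sm (%x. of_real (x \<cdot> v) * f x)"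
 by (auto simp: Sm_def intro: Sn_add Sn_cmul Sn_deriv Sn_times)

lemma Sm_sum: "finite I ==> (!!i. i \<in> I ==> Sm (f i)) ==> Sm (%x. SUM i:I. f i x)"
 by (auto simp: Sm_def intro: Sn_sum)

context dunkl begin

definition quo :: "real^'n => (real^'n => complex) => real^'n => complex" where
 "quo al f x = (if al \<cdot> x = 0 then fd f x al else (f x - f (rf al x)) /R (al \<cdot> x))"

text \<open>The fundamental theorem along the segment from \<open>x\<close> to its reflection. The
  normalisation of the roots makes \<open>s = 1\<close> the reflected point.\<close>

lemma quo_pop:
 assumes a: "al \<in> R" and f: "Sm f"
 shows "quo al f = pop al 0 (%x. fd f x al)"
proof
 fix x
 let ?A = "%s. x - (s * (x \<cdot> al)) *R al" and ?g = "%x. fd f x al"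
 let ?F = "%s. - f (?A s)" and ?h = "%s. (x \<cdot> al) *R ?g (?A s)"
 have d: "(?F has_vector_derivative ?h s) (at s)" for s
 proof -
  have A: "(?A has_derivative (%h. - ((h * (x \<cdot> al)) *R al))) (at s)" by (auto intro!: derivative_eq_intros)
  show ?thesis unfolding has_vector_derivative_def
   by (rule has_derivative_eq_rhs[OF has_derivative_minus[OF has_derivative_compose[OF A Sm_D[OF f]]]])
    (simp add: fun_eq_iff linear_neg[OF has_derivative_linear[OF Sm_D[OF f]]] linear_cmul[OF has_derivative_linear[OF Sm_D[OF f]]])
 qed
 have gc: "continuous_on S ?g" for S
  by (rule continuous_at_imp_continuous_on) (metis has_derivative_continuous Sm_D[OF Sm_closed(3)[OF f]])
 have c: "continuous_on {0..1} ?h"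
  by (intro continuous_on_scaleR continuous_on_const continuous_on_compose2[OF gc[of UNIV]] continuous_intros) simp
 have "(LINT s|lborel. indicator {0..1} s *R ?h s) = ?F 1 - ?F 0"
  by (rule integral_FTC_Icc[OF _ has_vector_derivative_at_within[OF d] c]) simp
 also have "?F 1 - ?F 0 = f x - f (rf al x)" by (simp add: refl_eq[OF a])
 also have "(LINT s|lborel. indicator {0..1} s *R ?h s) = (x \<cdot> al) *R pop al 0 ?g x"
  unfolding pop_def integral_scaleR_right[symmetric] by (intro integral_cong refl) (simp add: mult.commute)
 finally have *: "(al \<cdot> x) *R pop al 0 ?g x = f x - f (rf al x)" by (simp add: inner_commute)
 show "quo al f x = pop al 0 ?g x"
 proof (cases "al \<cdot> x = 0")
  case True
  then have "pop al 0 ?g x = (LINT s|lborel. indicator {0..1::real} s *R ?g x)" by (simp add: pop_def inner_commute)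
  then show ?thesis using True by (simp add: quo_def)
 next
  case False
  then show ?thesis unfolding quo_def using *[symmetric] by simp
 qed
qed

lemma quo_times:
 assumes a: "al \<in> R" and f: "Sm f"
 shows "of_real (x \<cdot> v) * quo al f x = quo al (%x. of_real (x \<cdot> v) * f x) x + (- of_real (al \<cdot> v)) * f (rf al x)"
proof (cases "al \<cdot> x = 0")
 case True
 then show ?thesis by (simp add: quo_def D_times[OF Sm_D[OF f]] refl_fixed[OF a])
next
 case False
 have e: "z * (inverse y * (a - b)) = inverse y * (z * a - (z - y * w) * b) + - w * b" if "y ~= 0" for z a b y w :: complex
  using that by (simp add: field_simps)
 show ?thesis
  unfolding quo_def if_not_P[OF False] scaleR_conv_of_real of_real_inverse refl_inner_left[OF a] of_real_diff of_real_mult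
  by (rule e) (use False in simp)
qed

lemma Sm_refl:
 assumes a: "al \<in> R" and f: "Sm f"
 shows "Sm (%x. f (rf al x))"
proof -
 have h: "rf al x \<cdot> y = x \<cdot> rf al y" for x y
  unfolding refl_eq[OF a] inner_diff_left inner_diff_right inner_scaleR_left inner_scaleR_right by (simp add: inner_commute)
 show ?thesis unfolding Sm_def
  by (rule allI, rule Sn_linear[OF G_linear[OF refl_in_G[OF a]] h refl_refl[OF a]]) (rule f[unfolded Sm_def, THEN spec])
qed

text \<open>Induction over the list of linear forms: moving a form inside the quotient leaves a
  multiple of the reflected \<open>f\<close>, which belongs to the class again. With no form left,
  \<open>quo_pop\<close> applies.\<close>

lemma Sm_quo:
 assumes a: "al \<in> R" and f: "Sm f"
 shows "Sm (quo al f)"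
proof -
 have "Bn n (mon vs (quo al f))" for n vs
  using f
 proof (induction vs arbitrary: f)
  case Nil
  have "Bn n (%x. fd f x al)" by (rule Sn_Bn[OF Sm_closed(3)[OF Nil, unfolded Sm_def, THEN spec]])
  then show ?case by (simp add: quo_pop[OF a Nil] pop_Bn)
 next
  case (Cons v vs)
  have "Bn n (mon vs (%x. f (rf al x)))" using Sm_refl[OF a Cons.prems] by (simp add: Sm_def Sn_def)
  then show ?case using Cons.IH[OF Sm_closed(4)[OF Cons.prems, of v]]
   by (simp only: mon.simps quo_times[OF a Cons.prems] mon_add mon_cmul Bn_add Bn_cmul)
 qed
 then show ?thesis by (simp add: Sm_def Sn_def)
qed

lemma Sm_T:
 assumes f: "Sm f"
 shows "Sm (T v f)"
proof -
 have "T v f = (%x. fd f x v + (SUM al:R. of_real (k al / 2 * (al \<cdot> v)) * quo al f x))"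
  unfolding T_at[OF Sm_D[OF f], abs_def] quo_def scaleR_conv_of_real[symmetric] ..
 then show ?thesis by (simp only:) (intro Sm_closed(1) Sm_closed(2) Sm_closed(3) Sm_sum Sm_quo finite_R f)
qed

text \<open>One minus the Dunkl Laplacian, with multiplier \<open>1 + (norm xi)^2\<close>
  (\<open>Ft_lap\<close>).\<close>

definition lap :: "(real^'n => complex) => real^'n => complex" where
 "lap f x = f x + (SUM j:UNIV. - 1 * T (axis j 1) (T (axis j 1) f) x)"

lemma Sm_lap: "Sm f ==> Sm (lap f)"
 unfolding lap_def[abs_def] by (intro Sm_closed(1) Sm_closed(2) Sm_sum Sm_T) auto

lemma Sm_decay:
 assumes "Sm f"
 shows "EX C>=0. ALL x. norm (f x) <= C / (1 + norm x) ^ m"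
proof -
 obtain C where C: "C >= 0" "!!x. (1 + norm x) ^ m * norm (f x) <= C" using Sn_decay[of 0 f m] assms unfolding Sm_def by blast
 have "norm (f x) <= C / (1 + norm x) ^ m" for x
  using C(2)[of x] by (simp add: pos_le_divide_eq add_pos_nonneg mult.commute)
 then show ?thesis using C(1) by blast
qed

lemma Sm_deriv_decay:
 assumes f: "Sm f"
 shows "EX C>=0. ALL x u. norm (fd f x u) <= C * norm u / (1 + norm x) ^ m"
proof -
 have "ALL j. EX C>=0. ALL x. norm (fd f x (axis j 1)) <= C / (1 + norm x) ^ m"
  using Sm_decay[OF Sm_closed(3)[OF f]] by blast
 then obtain D where D: "!!j. D j >= 0" "!!j x. norm (fd f x (axis j 1)) <= D j / (1 + norm x) ^ m" by metis
 have "norm (fd f x u) <= (SUM j:UNIV. D j) * norm u / (1 + norm x) ^ m" for x u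
 proof -
  have "norm (fd f x u) <= (SUM j:UNIV. norm (of_real (u $ j) * fd f x (axis j 1)))"
   unfolding linear_axis[OF has_derivative_linear[OF Sm_D[OF f]], of x u] by (rule norm_sum)
  also have "... <= (SUM j:UNIV. norm u * (D j / (1 + norm x) ^ m))"
   unfolding norm_mult norm_of_real by (intro sum_mono mult_mono component_le_norm_cart D) auto
  finally show ?thesis by (simp add: sum_distrib_left sum_divide_distrib mult.commute)
 qed
 then show ?thesis using D(1) by (intro exI[of _ "SUM j:UNIV. D j"] conjI allI) (auto intro: sum_nonneg)
qed

section \<open>The unnormalised Dunkl transform of rapidly decaying functions\<close>

definition Ft :: "(real^'n => complex) => real^'n => complex" where
 "Ft f xi = (LINT x|dw. Ek (- \<i>) x xi * f x)"

lemma Sm_measurable: "Sm f ==> f \<in> BM"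
 unfolding Sm_def using Bn_measurable[OF Sn_Bn] by blast

lemma Sm_integrable: "Sm f ==> integrable dw f"
 using Sm_decay[of f Nd] integrable_decay[OF Sm_measurable] by blast

lemma Ft_integrable:
 assumes "Sm f"
 shows "integrable dw (%x. Ek (- \<i>) x xi * f x)"
proof (rule integrable_bound[OF Sm_integrable[OF assms]])
 show "(%x. Ek (- \<i>) x xi * f x) \<in> borel_measurable dw"
  unfolding meas_dw by (intro borel_measurable_times Ek_measurable Sm_measurable assms)
 show "AE x in dw. norm (Ek (- \<i>) x xi * f x) <= norm (f x)"
  using mult_right_mono[OF Ek_imag_le[of "- \<i>"] norm_ge_zero] by (intro AE_I2) (simp add: norm_mult)
qed

lemma Ft_T:
 assumes f: "Sm f"
 shows "Ft (T v f) xi = \<i> * of_real (v \<cdot> xi) * Ft f xi"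
proof -
 obtain C1 where C1: "C1 >= 0" "!!x. norm (f x) <= C1 / (1 + norm x) ^ Nd" using Sm_decay[OF f] by blast
 obtain C2 where C2: "C2 >= 0" "!!x u. norm (fd f x u) <= C2 * norm u / (1 + norm x) ^ Nd"
  using Sm_deriv_decay[OF f] by blast
 have "(LINT x|dw. T v (%x. Ek (- \<i>) x xi) x * f x) = - (LINT x|dw. Ek (- \<i>) x xi * T v f x)"
 proof (rule T_skew(3)[OF Ek_has_derivative Sm_D[OF f], where A = "1 + 3 * norm xi" and c = 0 and C = "C1 + C2"])
  fix x u :: "real^'n"
  show "norm (Ek (- \<i>) x xi) <= (1 + 3 * norm xi) * exp (0 * norm x)"
   using Ek_imag_le[of "- \<i>" x xi] by (simp add: add_increasing2)
  show "norm (dEk (- \<i>) x xi u) <= (1 + 3 * norm xi) * exp (0 * norm x) * norm u"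
   by (rule order_trans[OF dEk_imag_le]) (simp_all add: distrib_right distrib_left mult_ac)
  have "C1 / (1 + norm x) ^ Nd <= (C1 + C2) / (1 + norm x) ^ Nd" using C2(1) by (intro divide_right_mono) auto
  then show "norm (f x) <= (C1 + C2) * exp (- 0 * norm x) / (1 + norm x) ^ Nd" using C1(2)[of x] by simp
  have "C2 * norm u / (1 + norm x) ^ Nd <= (C1 + C2) * norm u / (1 + norm x) ^ Nd"
   using C1(1) by (intro divide_right_mono mult_right_mono) auto
  then show "norm (fd f x u) <= (C1 + C2) * exp (- 0 * norm x) * norm u / (1 + norm x) ^ Nd"
   using C2(2)[of x u] by simp
 qed simp
 moreover have "(LINT x|dw. T v (%x. Ek (- \<i>) x xi) x * f x) = (- \<i> * of_real (v \<cdot> xi)) * Ft f xi"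
  unfolding T_Ek Ft_def by (simp only: integral_mult_right_zero mult.assoc)
 ultimately have "- Ft (T v f) xi = - (\<i> * of_real (v \<cdot> xi) * Ft f xi)"
  unfolding Ft_def[of "T v f"] by (simp only: mult_minus_left)
 then show ?thesis by (simp only: neg_equal_iff_equal)
qed

lemma Ft_add: "Sm f ==> Sm g ==> Ft (%x. f x + g x) xi = Ft f xi + Ft g xi"
 unfolding Ft_def distrib_left by (rule integral_add[OF Ft_integrable Ft_integrable])

lemma Ft_cmul: "Ft (%x. c * f x) xi = c * Ft f xi"
 unfolding Ft_def mult.left_commute[of _ c] by (rule integral_mult_right_zero)

lemma Ft_lap:
 assumes f: "Sm f"
 shows "Ft (lap f) xi = of_real (1 + (norm xi)^2) * Ft f xi"
proof -
 let ?t = "%j x. - 1 * T (axis j 1) (T (axis j 1) f) x"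
 have S: "Sm (?t j)" for j by (rule Sm_closed(2)[OF Sm_T[OF Sm_T[OF f]]])
 have i2: "- 1 * (\<i> * a * (\<i> * a * b)) = a^2 * b" for a b
 proof -
  have "\<i> * a * (\<i> * a * b) = (\<i> * \<i>) * (a^2 * b)" by (simp only: power2_eq_square mult_ac)
  then show ?thesis by simp
 qed
 have "Ft (%x. SUM j:UNIV. ?t j x) xi = (SUM j:UNIV. Ft (?t j) xi)"
  unfolding Ft_def sum_distrib_left by (rule integral_sum[OF Ft_integrable[OF S]])
 also have "... = (SUM j:UNIV. of_real ((xi $ j)^2) * Ft f xi)"
  unfolding Ft_cmul Ft_T[OF Sm_T[OF f]] Ft_T[OF f]
  by (intro sum.cong refl) (simp only: inner_axis' inner_real_def mult_1_left i2 of_real_power)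
 also have "... = of_real ((norm xi)^2) * Ft f xi"
  unfolding power2_norm_eq_inner inner_vec_def by (simp add: sum_distrib_right power2_eq_square)
 finally show ?thesis
  unfolding lap_def[abs_def] Ft_add[OF f Sm_sum[OF finite_class.finite_UNIV S]] by (simp add: distrib_right)
qed

lemma lap_power: "Sm f ==> Sm ((lap ^^ L) f) & Ft ((lap ^^ L) f) xi = of_real ((1 + (norm xi)^2) ^ L) * Ft f xi"
 by (induction L) (auto simp: Sm_lap Ft_lap)

end

section \<open>Subordination to Gaussians and the kernel estimate\<close>

definition erl :: "nat => real => real => real" where
 "erl m a t = (if t < 0 then 0 else t ^ m * exp (- (1 + a) * t) / fact m)"

lemma erlang_integral:
 assumes "0 < l"
 shows "integrable lborel (erlang_density m l)" "(LINT t|lborel. erlang_density m l t) = 1"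
proof -
 have "(NL t. ennreal (erlang_density m l t)) = 1"
  using nn_integral_erlang_ith_moment[OF assms, of m 0] by simp
 moreover have "AE t in lborel. 0 <= erlang_density m l t" using assms by simp
 ultimately show "integrable lborel (erlang_density m l)" "(LINT t|lborel. erlang_density m l t) = 1"
  using nn_integral_eq_integrable[of "erlang_density m l" lborel 1] by (auto simp: measurable_lborel1)
qed

lemma erl_integral:
 assumes "0 <= a"
 shows "(LINT t|lborel. erl m a t) = 1 / (1 + a) ^ Suc m"
proof -
 have "erl m a = (%t. (1 / (1 + a) ^ Suc m) * erlang_density m (1 + a) t)"
  using assms by (auto simp: fun_eq_iff erl_def erlang_density_def)
 then show ?thesis using erlang_integral(2)[of "1 + a" m] assms by simp
qed

lemma exp_le_inverse_power: "0 < s ==> exp (- s) <= fact m / s ^ m" for s :: real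
 using pow_exp_le[of s m] by (simp add: exp_minus field_simps)

text \<open>A product bound for Fubini. The exponential is split into two equal factors: one yields
  the decay of order \<open>d\<close> in \<open>1 + a\<close>, at the price of \<open>t ^ d\<close>,
  and the other is at most \<open>exp (- (t / 2))\<close> and keeps the bound integrable in
  \<open>t\<close>.\<close>

lemma erl_le:
 assumes a: "0 <= a" and d: "0 < d"
 shows "erl (P + d) a t <= (2 ^ d * fact d * fact P * 2 ^ Suc P) * (1 / (1 + a) ^ d) * erlang_density P (1 / 2) t"
proof (cases "0 < t")
 case True
 have "exp (- (1 + a) * t) = exp (- ((1 + a) * t / 2)) * exp (- ((1 + a) * t / 2))"
  unfolding exp_add[symmetric] by (rule arg_cong[where f = exp]) (simp add: field_simps)
 also have "... <= (fact d / ((1 + a) * t / 2) ^ d) * exp (- (t / 2))"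
  using True a by (intro mult_mono exp_le_inverse_power) (auto simp: algebra_simps add_pos_nonneg)
 finally have e: "exp (- (1 + a) * t) <= (fact d / ((1 + a) * t / 2) ^ d) * exp (- (t / 2))" .
 have "erl (P + d) a t <= t ^ (P + d) * exp (- (1 + a) * t)"
 proof -
  have "t ^ (P + d) * exp (- (1 + a) * t) / fact (P + d) <= t ^ (P + d) * exp (- (1 + a) * t) / 1"
   using True by (intro divide_left_mono) (auto simp: fact_ge_1)
  then show ?thesis using True by (simp add: erl_def)
 qed
 also have "... <= t ^ (P + d) * ((fact d / ((1 + a) * t / 2) ^ d) * exp (- (t / 2)))"
  using True by (intro mult_left_mono e) auto
 also have "... = (2 ^ d * fact d * fact P * 2 ^ Suc P) * (1 / (1 + a) ^ d) * erlang_density P (1 / 2) t"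
 proof -
  have "t ^ (P + d) * ((F / (b * t / 2) ^ d) * E) = (2 ^ d * F) * (1 / b ^ d) * (t ^ P * E)" if "0 < b" for b F E :: real
   using True that by (simp add: power_add power_divide power_mult_distrib field_simps)
  from this[of "1 + a" "fact d" "exp (- (t / 2))"] show ?thesis
   using True a by (simp add: erlang_density_def power_divide)
 qed
 finally show ?thesis .
next
 case False
 then have "erl (P + d) a t = 0" using d by (cases "t = 0") (auto simp: erl_def)
 then show ?thesis using a by (simp add: erlang_density_nonneg)
qed

lemma norm_LINT_bound:
 fixes f :: "'a => complex"
 assumes "integrable M g" "!!x. norm (f x) <= g x"
 shows "norm (LINT x|M. f x) <= (LINT x|M. g x)"
proof (cases "integrable M f")
 case True
 show ?thesis by (rule order_trans[OF integral_norm_bound integral_mono[OF integrable_norm[OF True] assms]])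
next
 case False
 then show ?thesis using order_trans[OF norm_ge_zero assms(2)] by (simp add: not_integrable_integral_eq integral_nonneg_AE)
qed

context dunkl begin

lemma integrable_inverse_power: "integrable dw (%xi. 1 / (1 + (norm xi)^2) ^ Nd)"
proof (rule integrable_decay_real[where C = "2 ^ Nd"])
 have "continuous_on UNIV (%xi :: real^'n. 1 / (1 + (norm xi)^2) ^ Nd)"
  by (intro continuous_intros ballI power_not_zero less_imp_neq[OF one_plus_sq_pos, THEN not_sym])
 then show "(%xi :: real^'n. 1 / (1 + (norm xi)^2) ^ Nd) \<in> BM" by (rule cont_BM)
 fix xi :: "real^'n"
 have "1 + norm xi <= 2 * (1 + (norm xi)^2)"
 proof -
  have "2 * norm xi <= 1 + (norm xi)^2" using zero_le_power2[of "norm xi - 1"] by (simp add: power2_diff)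
  moreover have "0 <= (norm xi)^2" by simp
  ultimately show ?thesis by argo
 qed
 then have "(1 + norm xi) ^ Nd <= 2 ^ Nd * (1 + (norm xi)^2) ^ Nd"
  unfolding power_mult_distrib[symmetric] by (intro power_mono) auto
 then show "\<bar>1 / (1 + (norm xi)^2) ^ Nd\<bar> <= 2 ^ Nd / (1 + norm xi) ^ Nd"
  using one_plus_sq_pos[of xi] norm_ge_zero[of xi] by (simp add: divide_simps mult.commute add_pos_nonneg)
qed

lemma integrable_gauss_t:
 assumes t: "0 < t"
 shows "integrable dw (%xi. exp (- t * (norm xi)^2))"
proof (rule integrable_bound)
 show "integrable dw (%xi. (exp t * fact Nd / t ^ Nd) * (1 / (1 + (norm xi)^2) ^ Nd))"
  by (intro integrable_mult_right integrable_inverse_power)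
 show "(%xi. exp (- t * (norm xi)^2)) \<in> borel_measurable dw" unfolding meas_dw by measurable
 show "AE xi in dw. norm (exp (- t * (norm xi)^2)) <= norm ((exp t * fact Nd / t ^ Nd) * (1 / (1 + (norm xi)^2) ^ Nd))"
 proof (rule AE_I2)
  fix xi
  have "exp (- t * (norm xi)^2) = exp t * exp (- (t * (1 + (norm xi)^2)))" by (simp add: exp_add[symmetric] algebra_simps)
  also have "... <= exp t * (fact Nd / (t * (1 + (norm xi)^2)) ^ Nd)"
   using t by (intro mult_left_mono exp_le_inverse_power) auto
  also have "... = (exp t * fact Nd / t ^ Nd) * (1 / (1 + (norm xi)^2) ^ Nd)" by (simp add: power_mult_distrib)
  finally show "norm (exp (- t * (norm xi)^2)) <= norm ((exp t * fact Nd / t ^ Nd) * (1 / (1 + (norm xi)^2) ^ Nd))"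
   unfolding real_norm_def abs_exp_cancel by (rule order_trans[OF _ abs_ge_self])
 qed
qed

lemma Sm_cont: "Sm f ==> continuous_on UNIV f"
 by (intro continuous_at_imp_continuous_on ballI has_derivative_continuous[OF Sm_D])

lemma Ft_pair:
 assumes "Sm f"
 shows "case_prod (%xi x. Ek (- \<i>) x xi * f x) \<in> borel_measurable (dw \<Otimes>\<^sub>M dw)"
proof (rule dw_pair_measurable)
 show "continuous_on UNIV (%p :: (real^'n) \<times> (real^'n). Ek (- \<i>) (snd p) (fst p) * f (snd p))"
  by (intro continuous_intros Ek_continuous continuous_on_compose2[OF Sm_cont[OF assms]]) auto
qed

lemma Ft_measurable: "Sm f ==> Ft f \<in> borel_measurable dw"
 unfolding Ft_def[abs_def] using sigma_finite_measure.borel_measurable_lebesgue_integral[OF sigma_finite_dw Ft_pair[of f]] .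

lemma Ft_bound: "Sm f ==> norm (Ft f xi) <= (LINT x|dw. norm (f x))"
 unfolding Ft_def
proof (rule integral_norm_bound_integral[OF Ft_integrable integrable_norm[OF Sm_integrable]])
 show "norm (Ek (- \<i>) x xi * f x) <= norm (f x)" for x
  using mult_right_mono[OF Ek_imag_le[of "- \<i>" x xi] norm_ge_zero[of "f x"]] by (simp add: norm_mult)
qed

text \<open>Up to a dilation and constants the translated kernel, by
  \<open>translation_eq\<close>.\<close>

definition KK :: "(real^'n => complex) => real^'n => real^'n => complex" where
 "KK f x y = (LINT xi|dw. Ek \<i> xi x * Ek (- \<i>) xi y * Ft f xi)"

lemma Ek_Ek_le: "norm (Ek \<i> xi x * Ek (- \<i>) xi y) <= 1"
 unfolding norm_mult using mult_mono[OF Ek_imag_le[of \<i> xi x] Ek_imag_le[of "- \<i>" xi y]] by simp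

lemma Ft_gauss:
 assumes t: "0 < t" and f: "Sm f"
 shows "(LINT xi|dw. Ek \<i> xi x * Ek (- \<i>) xi y * of_real (exp (- t * (norm xi)^2)) * Ft f xi) = (LINT q|dw. f q * BB t x y q)"
proof -
 let ?e = "%xi. Ek \<i> xi x * Ek (- \<i>) xi y * of_real (exp (- t * (norm xi)^2))"
 have "(LINT xi|dw. ?e xi * Ft f xi) = (LINT xi|dw. LINT q|dw. ?e xi * (Ek (- \<i>) q xi * f q))"
  unfolding Ft_def integral_mult_right_zero ..
 also have "... = (LINT q|dw. LINT xi|dw. ?e xi * (Ek (- \<i>) q xi * f q))"
 proof (rule fubini_bound[OF sigma_finite_dw sigma_finite_dw dw_pair_measurable integrable_gauss_t[OF t] integrable_norm[OF Sm_integrable[OF f]]])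
  show "continuous_on UNIV (%p. ?e (fst p) * (Ek (- \<i>) (snd p) (fst p) * f (snd p)))"
   by (intro continuous_intros Ek_continuous continuous_on_compose2[OF Sm_cont[OF f]]) auto
  fix xi q
  have 1: "norm (?e xi) <= exp (- t * (norm xi)^2)"
   using mult_right_mono[OF Ek_Ek_le[of xi x y], of "exp (- t * (norm xi)^2)"] by (simp add: norm_mult)
  have 2: "norm (Ek (- \<i>) q xi * f q) <= norm (f q)"
   using mult_right_mono[OF Ek_imag_le[of "- \<i>" q xi] norm_ge_zero[of "f q"]] by (simp add: norm_mult)
  show "norm (?e xi * (Ek (- \<i>) q xi * f q)) <= exp (- t * (norm xi)^2) * norm (f q)"
   unfolding norm_mult[of "?e xi"] by (intro mult_mono 1 2) auto
 qed
 also have "... = (LINT q|dw. f q * BB t x y q)"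
  unfolding BB_def integral_mult_right_zero[symmetric]
  by (intro integral_cong refl) (simp only: Ek_sym mult_ac)
 finally show ?thesis .
qed

lemma erl_le0: "0 <= erl m a t"
 by (simp add: erl_def)

text \<open>The transform of \<open>f\<close> is that of \<open>g\<close> divided by a power of
  \<open>1 + (norm xi)^2\<close>, and this division is a Gamma integral over Gaussians. The
  condition \<open>Nd <= m\<close> leaves enough decay in \<open>xi\<close> to interchange the
  integrals.\<close>

lemma KK_erl:
 assumes f: "Sm f" and d: "Nd <= m" and g: "!!xi. Ft g xi = of_real ((1 + (norm xi)^2) ^ Suc m) * Ft f xi" and sg: "Sm g"
 shows "KK f x y = (LINT t|lborel. of_real (erl m 0 t) * (LINT q|dw. g q * BB t x y q))"
proof -
 let ?E = "%xi. Ek \<i> xi x * Ek (- \<i>) xi y" and ?a = "%xi :: real^'n. (norm xi)\<^sup>2"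
 obtain P where P: "m = P + Nd" using d by (metis add.commute le_Suc_ex)
 let ?K = "2 ^ Nd * fact Nd * fact P * 2 ^ Suc P :: real" and ?B = "LINT x|dw. norm (g x)"
 have Nd0: "0 < Nd" by (simp add: Nd_def)
 have B0: "0 <= ?B" by (intro integral_nonneg_AE) simp
 have "?E xi * Ft f xi = (LINT t|lborel. ?E xi * Ft g xi * of_real (erl m (?a xi) t))" for xi
 proof -
  have "(1 + ?a xi) ^ Suc m ~= 0" by (intro power_not_zero less_imp_neq[OF one_plus_sq_pos, THEN not_sym])
  moreover have "F = (of_real z * F) * of_real (1 / z)" if "z ~= 0" for z :: real and F :: complex using that by simp
  ultimately have "Ft f xi = Ft g xi * of_real (1 / (1 + ?a xi) ^ Suc m)" unfolding g by blast
  also have "... = Ft g xi * (LINT t|lborel. of_real (erl m (?a xi) t))"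
   unfolding integral_complex_of_real erl_integral[OF zero_le_power2] ..
  finally show ?thesis by (simp only: integral_mult_right_zero[symmetric] mult.assoc)
 qed
 then have "KK f x y = (LINT xi|dw. LINT t|lborel. ?E xi * Ft g xi * of_real (erl m (?a xi) t))"
  unfolding KK_def by (simp only:)
 also have "... = (LINT t|lborel. LINT xi|dw. ?E xi * Ft g xi * of_real (erl m (?a xi) t))"
 proof (rule fubini_bound[OF sigma_finite_dw lborel.sigma_finite_measure_axioms])
  have [measurable]: "Ft g \<in> borel_measurable dw" by (rule Ft_measurable[OF sg])
  have [measurable]: "(%xi. Ek th xi v) \<in> borel_measurable dw" for th v unfolding meas_dw by (rule Ek_measurable)
  have [measurable]: "norm \<in> borel_measurable dw" unfolding meas_dw by measurable
  show "case_prod (%xi t. ?E xi * Ft g xi * of_real (erl m (?a xi) t)) \<in> borel_measurable (dw \<Otimes>\<^sub>M lborel)"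
   unfolding erl_def by measurable
  show "integrable dw (%xi. (?B * ?K) * (1 / (1 + ?a xi) ^ Nd))"
   by (intro integrable_mult_right integrable_inverse_power)
  show "integrable lborel (erlang_density P (1 / 2))" by (rule erlang_integral) simp
  fix xi t
  have "norm (?E xi * Ft g xi) * erl m (?a xi) t <= ?B * (?K * (1 / (1 + ?a xi) ^ Nd) * erlang_density P (1 / 2) t)"
  proof (rule mult_mono)
   show "norm (?E xi * Ft g xi) <= ?B"
    using mult_mono[OF Ek_Ek_le[of xi x y] Ft_bound[OF sg, of xi]] unfolding norm_mult[of "?E xi"] by simp
   show "erl m (?a xi) t <= ?K * (1 / (1 + ?a xi) ^ Nd) * erlang_density P (1 / 2) t" unfolding P by (rule erl_le[OF _ Nd0]) simp
  qed (rule B0, rule erl_le0)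
  then show "norm (?E xi * Ft g xi * of_real (erl m (?a xi) t)) <= (?B * ?K) * (1 / (1 + ?a xi) ^ Nd) * erlang_density P (1 / 2) t"
   unfolding norm_mult[of "?E xi * Ft g xi"] norm_of_real abs_of_nonneg[OF erl_le0] by (simp only: mult.assoc)
 qed
 also have "... = (LINT t|lborel. of_real (erl m 0 t) * (LINT q|dw. g q * BB t x y q))"
 proof (intro integral_cong refl)
  fix t :: real
  show "(LINT xi|dw. ?E xi * Ft g xi * of_real (erl m (?a xi) t)) = of_real (erl m 0 t) * (LINT q|dw. g q * BB t x y q)"
  proof (cases "0 < t")
   case True
   have "erl m (?a xi) t = erl m 0 t * exp (- t * ?a xi)" for xi
    by (simp add: erl_def exp_add[symmetric] algebra_simps)
   then have "?E xi * Ft g xi * of_real (erl m (?a xi) t) = of_real (erl m 0 t) * (?E xi * of_real (exp (- t * ?a xi)) * Ft g xi)" for xi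
    by (simp only: of_real_mult mult_ac)
   then show ?thesis by (simp only: integral_mult_right_zero Ft_gauss[OF True sg])
  next
   case False
   then have "erl m a t = 0" for a using d Nd0 by (cases "t = 0") (auto simp: erl_def)
   then show ?thesis by simp
  qed
 qed
 finally show ?thesis .
qed

text \<open>The exponent \<open>P\<close> of \<open>BB_bound\<close> determines how often
  \<open>lap\<close> is applied: \<open>t ^ (P + Nd)\<close> compensates the singularity of order
  \<open>P\<close> at \<open>t = 0\<close>, the exponential compensates the growth for large
  \<open>t\<close>, and the decay of \<open>g\<close> compensates the growth in
  \<open>q\<close>.\<close>

lemma KK_bound:
 assumes f: "Sm f"
 shows "EX C>0. ALL x y. norm (KK f x y) <= C * kap x y ^ M / Vol x"
proof -
 obtain C P where C: "C > 0" and BB: "!!t x y q. 0 < t ==> norm (BB t x y q) <= C * ((1 + t)^2 / t) ^ P * kap x y ^ M * (1 + norm q) ^ P / Vol x"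
  using BB_bound[of M] by blast
 define m where "m = P + Nd"
 define g :: "real^'n => complex" where "g = (lap ^^ Suc m) f"
 note lp = lap_power[OF f, of "Suc m", folded g_def]
 have sg: "Sm g" and Fg: "!!xi. Ft g xi = of_real ((1 + (norm xi)^2) ^ Suc m) * Ft f xi" using lp by auto
 obtain D where D: "D >= 0" "!!q :: real^'n. norm (g q) <= D / (1 + norm q) ^ (P + Nd)" using Sm_decay[OF sg] by blast
 define I where "I = (LINT q|dw. D / (1 + norm q) ^ Nd)"
 have Ii: "integrable dw (%q :: real^'n. D / (1 + norm q) ^ Nd)"
 proof (rule integrable_decay_real[where C = D])
  have "continuous_on UNIV (%q :: real^'n. D / (1 + norm q) ^ Nd)"
   by (intro continuous_intros ballI power_not_zero) (metis add_pos_nonneg less_irrefl norm_ge_zero zero_less_one)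
  then show "(%q :: real^'n. D / (1 + norm q) ^ Nd) \<in> BM" by (rule cont_BM)
 qed (use D(1) in simp)
 have I0: "0 <= I" unfolding I_def using D(1) by (intro integral_nonneg_AE AE_I2) auto
 define n where "n = 2 * P + Nd"
 \<comment> \<open>The added 1 gives strict positivity even if \<open>I = 0\<close>.\<close>
 define H where "H = fact n * 2 ^ n * exp (1 / 2) * 2 * (I * C) + (1 :: real)"
 have H0: "0 < H" using I0 C unfolding H_def by (intro add_nonneg_pos mult_nonneg_nonneg) auto
 have "norm (KK f x y) <= H * kap x y ^ M / Vol x" for x y
 proof -
  let ?k = "kap x y ^ M / Vol x"
  have k0: "0 <= ?k" by (simp add: less_imp_le)
  have tb: "norm (of_real (erl m 0 t) * (LINT q|dw. g q * BB t x y q)) <= H * ?k * erlang_density 0 (1 / 2) t" for t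
  proof (cases "0 < t")
   case True
   let ?s = "((1 + t)^2 / t) ^ P"
   have s0: "0 <= ?s" using True by simp
   have "norm (LINT q|dw. g q * BB t x y q) <= (LINT q|dw. (C * ?s * ?k) * (D / (1 + norm q) ^ Nd))"
   proof (rule norm_LINT_bound)
    show "integrable dw (%q. (C * ?s * ?k) * (D / (1 + norm q) ^ Nd))" by (intro integrable_mult_right Ii)
    fix q :: "real^'n"
    have p: "0 < (1 + norm q) ^ P" by (simp add: add_pos_nonneg)
    have "norm (g q * BB t x y q) <= (D / (1 + norm q) ^ (P + Nd)) * (C * ?s * kap x y ^ M * (1 + norm q) ^ P / Vol x)"
     unfolding norm_mult using D(1) by (intro mult_mono D(2) BB[OF True]) auto
    also have "... = (C * ?s * ?k) * (D / (1 + norm q) ^ Nd)"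
    proof -
     have "D / (a * b) * (C * s * K * a / V) = (C * s * (K / V)) * (D / b)" if "0 < a" for a b s K V :: real
      using that by (simp add: mult_ac)
     from this[OF p] show ?thesis by (simp only: power_add)
    qed
    finally show "norm (g q * BB t x y q) <= (C * ?s * ?k) * (D / (1 + norm q) ^ Nd)" .
   qed
   then have 1: "norm (LINT q|dw. g q * BB t x y q) <= ?s * (I * C) * ?k" unfolding I_def integral_mult_right_zero by (simp only: mult_ac)
   have 2: "erl m 0 t * ?s <= fact n * 2 ^ n * exp (1 / 2) * exp (- (t / 2))"
   proof -
    have "(1 + t) ^ n = 2 ^ n * ((1 + t) / 2) ^ n" by (simp add: power_divide)
    also have "... <= 2 ^ n * (fact n * exp ((1 + t) / 2))" using True by (intro mult_left_mono pow_exp_le) auto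
    finally have e: "(1 + t) ^ n <= 2 ^ n * (fact n * exp ((1 + t) / 2))" .
    have "erl m 0 t * ?s <= t ^ m * exp (- t) * ?s"
    proof -
     have "t ^ m * exp (- t) / fact m <= t ^ m * exp (- t) / 1"
      using True by (intro divide_left_mono) (auto simp: fact_ge_1)
     then have "erl m 0 t <= t ^ m * exp (- t)" using True by (simp add: erl_def)
     then show ?thesis by (rule mult_right_mono[OF _ s0])
    qed
    also have "... = t ^ Nd * (1 + t) ^ (2 * P) * exp (- t)"
     using True by (simp add: m_def power_add power_divide power_mult)
    also have "... <= (1 + t) ^ Nd * (1 + t) ^ (2 * P) * exp (- t)"
     using True by (intro mult_right_mono power_mono) auto
    also have "... = (1 + t) ^ n * exp (- t)" by (simp add: n_def power_add)
    also have "... <= (2 ^ n * (fact n * exp ((1 + t) / 2))) * exp (- t)" by (intro mult_right_mono e) simp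
    also have "exp ((1 + t) / 2) = exp (1 / 2) * exp (t / 2)" by (simp add: exp_add[symmetric] add_divide_distrib)
    also have "2 ^ n * (fact n * (exp (1 / 2) * exp (t / 2))) * exp (- t) = fact n * 2 ^ n * exp (1 / 2) * (exp (t / 2) * exp (- t))"
     by (simp only: mult_ac)
    also have "exp (t / 2) * exp (- t) = exp (- (t / 2))" unfolding exp_add[symmetric] by (rule arg_cong[where f = exp]) simp
    finally show ?thesis .
   qed
   have "norm (of_real (erl m 0 t) * (LINT q|dw. g q * BB t x y q)) <= erl m 0 t * (?s * (I * C) * ?k)"
    unfolding norm_mult norm_of_real abs_of_nonneg[OF erl_le0] by (intro mult_left_mono 1 erl_le0)
   also have "... = (erl m 0 t * ?s) * (I * C * ?k)" by (simp only: mult_ac)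
   also have "... <= (fact n * 2 ^ n * exp (1 / 2) * exp (- (t / 2))) * (I * C * ?k)"
    using I0 C k0 by (intro mult_right_mono 2 mult_nonneg_nonneg) auto
   also have "... = (H - 1) * ?k * erlang_density 0 (1 / 2) t" using True by (simp add: H_def erlang_density_def)
   also have "... <= H * ?k * erlang_density 0 (1 / 2) t"
    using k0 by (intro mult_right_mono erlang_density_nonneg) auto
   finally show ?thesis .
  next
   case False
   then have "erl m 0 t = 0" by (cases "t = 0") (auto simp: erl_def m_def Nd_def)
   then show ?thesis using H0 k0 by (simp add: less_imp_le)
  qed
  have "norm (KK f x y) <= (LINT t|lborel. H * ?k * erlang_density 0 (1 / 2) t)"
   unfolding KK_erl[OF f _ Fg sg, of x y, unfolded m_def, OF le_add2, folded m_def]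
   by (rule norm_LINT_bound[OF integrable_mult_right[OF erlang_integral(1)] tb]) simp
  also have "... = H * ?k" using erlang_integral(2)[of "1 / 2" 0] by simp
  finally show ?thesis by simp
 qed
 then show ?thesis using H0 by blast
qed

section \<open>The maximal function\<close>

lemma Ek_neg: "Ek \<i> xi (- y) = Ek (- \<i>) xi y"
 using Ek_scale_right[of \<i> xi "- 1" y] by simp

lemma Ft_dilate:
 assumes t: "0 < t" and f: "Sm f"
 shows "dunkl_transform R k (dunkl_dilate R k t f) xi = Ft f (t *R xi) /R ck"
proof -
 note [measurable] = Sm_measurable[OF f] Ek_measurable
 have "(LINT x|dw. Ek (- \<i>) xi x * dunkl_dilate R k t f x) = (LINT x|dw. Ek (- \<i>) x xi * (t powr (- NN) *R f (x /R t)))"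
  by (simp only: Ek_sym[of _ xi] dunkl_dilate_def)
 also have "... = t powr NN *R (LINT x|dw. Ek (- \<i>) (t *R x) xi * (t powr (- NN) *R f ((t *R x) /R t)))"
  by (rule integral_dw_scale[OF t]) measurable
 also have "... = Ft f (t *R xi)"
  using t unfolding Ft_def by (simp add: Ek_scale Ek_scale_right powr_minus)
 finally show ?thesis unfolding dunkl_transform_def kernel_eq by simp
qed

text \<open>Substituting \<open>t *R xi\<close> for the frequency expresses all dilates through the
  single kernel \<open>KK f\<close>, so one estimate serves every \<open>t\<close>.\<close>

lemma translation_eq:
 assumes t: "0 < t" and f: "Sm f"
 shows "dunkl_translation R k x (dunkl_dilate R k t f) (- y) = (t powr (- NN) / ck^2) *R KK f (x /R t) (y /R t)"
proof -
 have [measurable]: "Ft f \<in> BM" using Ft_measurable[OF f] unfolding meas_dw .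
 note [measurable] = Ek_measurable
 have "(LINT xi|dw. Ek \<i> xi x * Ek (- \<i>) xi y * (Ft f (t *R xi) /R ck))
  = (1 / t) powr NN *R (LINT xi|dw. Ek \<i> ((1 / t) *R xi) x * Ek (- \<i>) ((1 / t) *R xi) y * (Ft f (t *R ((1 / t) *R xi)) /R ck))"
  by (rule integral_dw_scale) (use t in \<open>simp, measurable\<close>)
 also have "... = (1 / t) powr NN *R (KK f (x /R t) (y /R t) /R ck)"
  using t unfolding KK_def by (simp add: Ek_scale Ek_scale_right inverse_eq_divide)
 finally show ?thesis
  using t unfolding dunkl_translation_def kernel_eq Ek_neg Ft_dilate[OF t f]
  by (simp add: powr_minus powr_divide inverse_powr power2_eq_square divide_inverse mult_ac
   kernel_eq[of \<i> _ "- y", unfolded Ek_neg, folded cvec_def])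
qed

lemma emeasure_ball:
 fixes x :: "real^'n"
 assumes r: "0 < r"
 shows "emeasure dw (ball x r) = ennreal (r powr NN) * emeasure dw (ball (x /R r) 1)"
proof -
 have i: "indicator (ball x r) (r *R y) = (indicator (ball (x /R r) 1) y :: ennreal)" for y :: "real^'n"
 proof -
  have "x - r *R y = r *R (x /R r - y)" using r by (simp add: algebra_simps)
  then have "dist x (r *R y) = r * dist (x /R r) y" unfolding dist_norm using r by (simp only: norm_scaleR abs_of_pos)
  then have "dist x (r *R y) < r \<longleftrightarrow> dist (x /R r) y < 1" using r by (simp add: pos_less_divide_eq)
  then show ?thesis by (simp add: indicator_def)
 qed
 have s: "ball z s \<in> sets dw" for z :: "real^'n" and s unfolding sets_dw by simp
 have "emeasure dw (ball x r) = (NI y. indicator (ball x r) y)" by (simp add: s)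
 also have "... = ennreal (r powr NN) * (NI y. indicator (ball x r) (r *R y))"
  by (rule nn_integral_dw_scale[OF r borel_measurable_indicator]) simp
 finally show ?thesis unfolding i by (simp add: s)
qed

lemma ball_Vol_upper: "EX C>0. ALL x r s. 0 < r --> 1 <= s --> emeasure dw (ball x (s * r)) <= ennreal (C * (s * r) powr NN * Vol (x /R r))"
proof -
 obtain C where C: "C > 0" "!!x. emeasure dw (ball x 1) <= ennreal (C * Vol x)" using ball_upper by blast
 have "emeasure dw (ball x (s * r)) <= ennreal (C * (s * r) powr NN * Vol (x /R r))" if r: "0 < r" and s: "1 <= s" for x r s
 proof -
  have "emeasure dw (ball x (s * r)) <= ennreal ((s * r) powr NN) * ennreal (C * Vol (x /R r))"
   unfolding emeasure_ball[OF mult_pos_pos[OF less_le_trans[OF zero_less_one s] r]]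
  proof (rule mult_left_mono)
   have "emeasure dw (ball (x /R (s * r)) 1) <= ennreal (C * Vol (x /R (s * r)))" by (rule C(2))
   also have "... <= ennreal (C * Vol (x /R r))"
    using Vol_shrink(1)[OF s, of "x /R r"] C(1) by (intro ennreal_leI mult_left_mono) (simp_all add: mult.commute)
   finally show "emeasure dw (ball (x /R (s * r)) 1) <= ennreal (C * Vol (x /R r))" .
  qed simp
  also have "... = ennreal (C * (s * r) powr NN * Vol (x /R r))"
   using C(1) by (subst ennreal_mult[symmetric]) (auto simp: less_imp_le mult_ac)
  finally show ?thesis .
 qed
 then show ?thesis using C(1) by blast
qed

text \<open>For the least such \<open>j\<close>, either \<open>j = 0\<close> or \<rho> is at least
  half of \<open>2 ^ j\<close>; the factor 4 is the square of that half inverted.\<close>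

lemma dyadic:
 fixes \<rho> :: real
 assumes "0 <= \<rho>"
 shows "EX j. \<rho> < 2 ^ j & 1 / (1 + \<rho>\<^sup>2) <= 4 * (1 / 4) ^ j"
proof -
 define j where "j = (LEAST j. \<rho> < 2 ^ j)"
 have j: "\<rho> < 2 ^ j" unfolding j_def using real_arch_pow[of 2 \<rho>] by (auto intro: LeastI_ex)
 have "1 / (1 + \<rho>\<^sup>2) <= 4 * (1 / 4) ^ j"
 proof (cases j)
  case 0
  have "1 / (1 + \<rho>\<^sup>2) <= 1 / 1" by (intro divide_left_mono) (auto simp: add_pos_nonneg)
  then show ?thesis using 0 by simp
 next
  case (Suc i)
  then have "2 ^ i <= \<rho>" using not_less_Least[of i "%j. \<rho> < 2 ^ j"] unfolding j_def[symmetric] by simp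
  then have "(2 ^ i)^2 <= \<rho>\<^sup>2" by (intro power_mono) auto
  then have "4 ^ i <= 1 + \<rho>\<^sup>2" using power_mult[of "2 :: real" 2 i] by (simp add: power_mult[symmetric] mult.commute)
  then have "1 / (1 + \<rho>\<^sup>2) <= 1 / 4 ^ i" by (intro divide_left_mono) (auto simp: add_pos_nonneg)
  then show ?thesis by (simp add: Suc power_divide)
 qed
 with j show ?thesis by blast
qed

text \<open>Up to \<open>card G\<close>, \<open>kap\<close> is its largest term. For the group
  element of that term a single dyadic ball already supplies the bound, and the double sum contains
  it.\<close>

lemma kap_dyadic:
 assumes t: "0 < t"
 shows "ennreal (kap (x /R t) (y /R t) ^ M) <= (SUM g:G. \<Sum>j. ennreal ((4 * real (card G)) ^ M * ((1 / 4) ^ M) ^ j) * indicator (ball (g x) (2 ^ j * t)) y)"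
proof -
 define h where "h g i = ennreal ((4 * real (card G)) ^ M * ((1 / 4) ^ M) ^ i) * indicator (ball (g x) (2 ^ i * t)) y" for g i
 obtain g where g: "g \<in> G" "kap (x /R t) (y /R t) <= real (card G) * (1 / (1 + (norm (y /R t - g (x /R t)))^2))"
  using kap_max by blast
 have n: "norm (y /R t - g (x /R t)) = norm (y - g x) / t"
  using t by (simp add: linear_cmul[OF G_linear[OF g(1)]] scaleR_diff_right[symmetric] divide_inverse mult.commute)
 obtain j where j: "norm (y - g x) / t < 2 ^ j" "1 / (1 + (norm (y - g x) / t)^2) <= 4 * (1 / 4) ^ j"
  using dyadic[of "norm (y - g x) / t"] t by auto
 have "kap (x /R t) (y /R t) <= real (card G) * (4 * (1 / 4) ^ j)"
  using g(2) mult_left_mono[OF j(2), of "real (card G)"] unfolding n by simp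
 then have "kap (x /R t) (y /R t) ^ M <= (real (card G) * (4 * (1 / 4) ^ j)) ^ M"
  by (intro power_mono) (auto simp: less_imp_le)
 also have "... = (4 * real (card G)) ^ M * ((1 / 4) ^ M) ^ j"
  by (simp add: power_mult_distrib power_mult[symmetric] mult.commute)
 finally have "ennreal (kap (x /R t) (y /R t) ^ M) <= h g j"
  using j(1) t by (simp add: h_def dist_norm norm_minus_commute pos_divide_less_eq ennreal_leI)
 also have "... = (\<Sum>i\<in>{j}. h g i)" by simp
 also have "... <= (\<Sum>i. h g i)" by (rule sum_le_suminf) (auto intro: summableI)
 also have "... <= (SUM g:G. \<Sum>i. h g i)" by (rule member_le_sum[OF g(1)]) auto
 finally show ?thesis unfolding h_def .
qed

text \<open>The constant \<open>c\<close> stands for any common bound of the averages over balls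
  centred on the orbit. The exponent \<open>M\<close> exceeds \<open>NN\<close>, so the decay of
  \<open>kap ^ M\<close> over dyadic balls beats the growth of their measures and leaves
  \<open>(1 / 2) ^ j\<close>; the factor \<open>Vol\<close> and the powers of \<open>t\<close>
  cancel.\<close>

lemma maximal_pointwise:
 assumes \<Phi>: "Sm \<Phi>"
 obtains A where "A > 0" "ALL f x c. f \<in> BM -->
  (ALL g:G. ALL r>0. (NI y. ennreal (norm (f y)) * indicator (ball (g x) r) y) <= c * emeasure dw (ball (g x) r)) -->
  MX \<Phi> f x <= ennreal A * c"
proof -
 define M where "M = Suc (nat \<lceil>NN\<rceil>)"
 obtain C1 where C1: "C1 > 0" "!!x y. norm (KK \<Phi> x y) <= C1 * kap x y ^ M / Vol x" using KK_bound[OF \<Phi>] by blast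
 obtain C2 where C2: "C2 > 0" "!!x r s. 0 < r ==> 1 <= s ==> emeasure dw (ball x (s * r)) <= ennreal (C2 * (s * r) powr NN * Vol (x /R r))"
  using ball_Vol_upper by blast
 define n where "n = real (card G)"
 have n: "1 <= n" using card_G_pos unfolding n_def by linarith
 define A where "A = C1 / ck^2 * (n * ((4 * n) ^ M * C2 * 2))"
 have A: "0 < A" using C1 C2 n ck_pos by (simp add: A_def)
 have "MX \<Phi> f x <= ennreal A * c"
  if fm: "f \<in> BM"
   and c0: "ALL g:G. ALL r>0. (NI y. ennreal (norm (f y)) * indicator (ball (g x) r) y) <= c * emeasure dw (ball (g x) r)" for f x c
  unfolding dunkl_maximal_def
 proof (rule SUP_least)
  fix t :: real assume "t \<in> {0<..}"
  then have t: "0 < t" by simp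
  note [measurable] = fm
  note c = c0[rule_format]
  have [measurable]: "ball z r \<in> sets borel" for z :: "real^'n" and r by simp
  let ?V = "Vol (x /R t)" and ?c = "%j::nat. (4 * n) ^ M * ((1 / 4) ^ M) ^ j"
  let ?D = "t powr (- NN) / ck^2 * C1 / ?V"
  have D0: "0 <= ?D" using C1 by (simp add: less_imp_le)
  have "ennreal (norm (dunkl_convolution R k (dunkl_dilate R k t \<Phi>) f x))
   <= (NI y. ennreal (norm ((t powr (- NN) / ck^2) *R KK \<Phi> (x /R t) (y /R t) * f y)))"
   unfolding dunkl_convolution_def translation_eq[OF t \<Phi>] by (rule norm_LINT_le)
  also have "... <= (NI y. ennreal ?D * (ennreal (kap (x /R t) (y /R t) ^ M) * ennreal (norm (f y))))"
  proof (rule nn_integral_mono)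
   fix y
   have "norm (KK \<Phi> (x /R t) (y /R t)) * norm (f y) <= (C1 * kap (x /R t) (y /R t) ^ M / ?V) * norm (f y)"
    by (intro mult_right_mono C1) simp
   from mult_left_mono[OF this, of "t powr (- NN) / ck^2"]
   have "norm ((t powr (- NN) / ck^2) *R KK \<Phi> (x /R t) (y /R t) * f y) <= ?D * (kap (x /R t) (y /R t) ^ M * norm (f y))"
    by (simp add: norm_mult mult_ac)
   then show "ennreal (norm ((t powr (- NN) / ck^2) *R KK \<Phi> (x /R t) (y /R t) * f y))
    <= ennreal ?D * (ennreal (kap (x /R t) (y /R t) ^ M) * ennreal (norm (f y)))"
    using D0 by (simp add: ennreal_mult[symmetric] less_imp_le ennreal_leI)
  qed
  also have "... <= (NI y. ennreal ?D * (SUM g:G. \<Sum>j. ennreal (?c j) * (ennreal (norm (f y)) * indicator (ball (g x) (2 ^ j * t)) y)))"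
  proof (intro nn_integral_mono mult_left_mono)
   fix y
   have "ennreal (kap (x /R t) (y /R t) ^ M) * ennreal (norm (f y)) <= (SUM g:G. \<Sum>j. ennreal (?c j) * indicator (ball (g x) (2 ^ j * t)) y) * ennreal (norm (f y))"
    unfolding n_def by (intro mult_right_mono kap_dyadic t) simp
   also have "... = (SUM g:G. \<Sum>j. ennreal (?c j) * (ennreal (norm (f y)) * indicator (ball (g x) (2 ^ j * t)) y))"
    unfolding sum_distrib_right ennreal_suminf_multc[symmetric] by (simp only: mult.assoc mult.commute[of "indicator _ _" "ennreal (norm (f y))"])
   finally show "ennreal (kap (x /R t) (y /R t) ^ M) * ennreal (norm (f y)) <= ..." .
  qed simp
  also have "... = ennreal ?D * (SUM g:G. \<Sum>j. ennreal (?c j) * (NI y. ennreal (norm (f y)) * indicator (ball (g x) (2 ^ j * t)) y))"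
  proof -
   have m [measurable]: "(%y. ennreal (norm (f y)) * indicator (ball z r) y) \<in> borel_measurable dw" for z :: "real^'n" and r
    unfolding meas_dw by measurable
   let ?X = "%g j y. ennreal (?c j) * (ennreal (norm (f y)) * indicator (ball (g x) (2 ^ j * t)) y)"
   have "(NI y. ennreal ?D * (SUM g:G. \<Sum>j. ?X g j y)) = ennreal ?D * (NI y. (SUM g:G. \<Sum>j. ?X g j y))"
    by (rule nn_integral_cmult) measurable
   also have "(NI y. (SUM g:G. \<Sum>j. ?X g j y)) = (SUM g:G. \<integral>\<^sup>+y. (\<Sum>j. ?X g j y) \<partial>dw)"
    by (rule nn_integral_sum) measurable
   also have "... = (SUM g:G. \<Sum>j. \<integral>\<^sup>+y. ?X g j y \<partial>dw)"
    by (intro sum.cong refl nn_integral_suminf) measurable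
   also have "... = (SUM g:G. \<Sum>j. ennreal (?c j) * (NI y. ennreal (norm (f y)) * indicator (ball (g x) (2 ^ j * t)) y))"
    by (intro sum.cong refl suminf_cong nn_integral_cmult m)
   finally show ?thesis .
  qed
  also have "... <= ennreal ?D * (SUM g:G. \<Sum>j. ennreal ((4 * n) ^ M * C2 * t powr NN * ?V) * ennreal ((1 / 2) ^ j) * c)"
  proof (intro mult_left_mono sum_mono suminf_le summableI)
   fix g j assume g: "g \<in> G"
   have "ennreal (?c j) * (NI y. ennreal (norm (f y)) * indicator (ball (g x) (2 ^ j * t)) y)
    <= ennreal (?c j) * (c * ennreal (C2 * (2 ^ j * t) powr NN * Vol (g x /R t)))"
    using t by (intro mult_left_mono order_trans[OF c[OF g]] C2) auto
   also have "Vol (g x /R t) = ?V" using Vol_G[OF g, of "x /R t"] by (simp add: linear_cmul[OF G_linear[OF g]])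
   also have "ennreal (?c j) * (c * ennreal (C2 * (2 ^ j * t) powr NN * ?V)) = ennreal (?c j * (C2 * (2 ^ j * t) powr NN * ?V)) * c"
    using n C2(1) by (subst ennreal_mult) (auto simp: less_imp_le mult_ac)
   also have "... <= ennreal (((4 * n) ^ M * C2 * t powr NN * ?V) * (1 / 2) ^ j) * c"
   proof (intro mult_right_mono ennreal_leI)
    have "(2 ^ j) powr NN <= (2 ^ j) powr real M"
    proof (rule powr_mono)
     show "NN <= real M" unfolding M_def using real_nat_ceiling_ge[of NN] by simp
    qed simp
    also have "... = (2 ^ M) ^ j" by (simp add: powr_realpow power_mult[symmetric] mult.commute)
    finally have "((1 / 4) ^ M) ^ j * (2 ^ j) powr NN <= ((1 / 4) ^ M) ^ j * (2 ^ M) ^ j" by (intro mult_left_mono) auto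
    also have "... = ((1 / 2) ^ M) ^ j" by (simp add: power_mult_distrib[symmetric])
    also have "... <= (1 / 2) ^ j"
     by (intro power_mono) (auto simp: M_def intro: mult_le_one power_le_one)
    finally have e: "((1 / 4) ^ M) ^ j * (2 ^ j) powr NN <= (1 / 2) ^ j" .
    have "?c j * (C2 * (2 ^ j * t) powr NN * ?V) = ((4 * n) ^ M * C2 * t powr NN * ?V) * (((1 / 4) ^ M) ^ j * (2 ^ j) powr NN)"
     using t by (simp add: powr_mult mult_ac)
    also have "... <= ((4 * n) ^ M * C2 * t powr NN * ?V) * (1 / 2) ^ j"
     using n C2(1) by (intro mult_left_mono e) (auto simp: less_imp_le)
    finally show "?c j * (C2 * (2 ^ j * t) powr NN * ?V) <= ((4 * n) ^ M * C2 * t powr NN * ?V) * (1 / 2) ^ j" .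
   qed simp
   also have "... = ennreal ((4 * n) ^ M * C2 * t powr NN * ?V) * ennreal ((1 / 2) ^ j) * c"
    using n C2(1) by (subst ennreal_mult) (auto simp: less_imp_le)
   finally show "ennreal (?c j) * (NI y. ennreal (norm (f y)) * indicator (ball (g x) (2 ^ j * t)) y)
    <= ennreal ((4 * n) ^ M * C2 * t powr NN * ?V) * ennreal ((1 / 2) ^ j) * c" .
  qed simp
  also have "... = ennreal ?D * (ennreal n * (ennreal ((4 * n) ^ M * C2 * t powr NN * ?V) * 2 * c))"
  proof -
   have "(\<Sum>j. ennreal ((1 / 2) ^ j)) = ennreal (\<Sum>j. (1 / 2) ^ j)"
    by (rule suminf_ennreal2) (auto intro: summable_geometric)
   also have "(\<Sum>j. (1 / 2 :: real) ^ j) = 2" using suminf_geometric[of "1 / 2 :: real"] by simp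
   finally have "(\<Sum>j. ennreal ((1 / 2) ^ j)) = 2" by simp
   then have "(\<Sum>j. K * ennreal ((1 / 2) ^ j) * c) = K * 2 * c" for K
    by (simp only: ennreal_suminf_multc ennreal_suminf_cmult)
   then show ?thesis unfolding n_def by (simp only: sum_constant ennreal_of_nat_eq_real_of_nat)
  qed
  also have "... = ennreal (?D * (n * ((4 * n) ^ M * C2 * t powr NN * ?V * 2))) * c"
  proof -
   have "ennreal D * (ennreal a * (ennreal K * 2 * c)) = ennreal (D * (a * (K * 2))) * c" if "0 <= D" "0 <= a" "0 <= K" for D a K
    using that by (simp add: ennreal_mult mult_ac)
   from this[OF D0, of n "(4 * n) ^ M * C2 * t powr NN * ?V"] show ?thesis using n C2(1) by (simp add: less_imp_le)
  qed
  also have "?D * (n * ((4 * n) ^ M * C2 * t powr NN * ?V * 2)) = A * (t powr (- NN) * t powr NN)"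
   by (simp add: A_def)
  also have "t powr (- NN) * t powr NN = 1" using t by (simp add: powr_minus)
  finally show "ennreal (norm (dunkl_convolution R k (dunkl_dilate R k t \<Phi>) f x)) <= ennreal A * c" by simp
 qed
 then show ?thesis by (intro that[OF A] allI impI)
qed

section \<open>Doubling, Vitali covering and the basic weak estimate\<close>

lemma Vol_ge1: "1 <= Vol x"
 unfolding Vol_def using k_nonneg by (intro prod_ge_1 ge_one_powr_ge_zero) auto

lemma ball_lower_scaled: "EX c>0. ALL x r. 0 < r --> ennreal (c * r powr NN * Vol (x /R r)) <= emeasure dw (ball x r)"
proof -
 obtain c where c: "c > 0" "!!x. ennreal (c * Vol x) <= emeasure dw (ball x 1)" using ball_lower by blast
 have "ennreal (c * r powr NN * Vol (x /R r)) <= emeasure dw (ball x r)" if "0 < r" for x r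
 proof -
  have "ennreal (c * r powr NN * Vol (x /R r)) = ennreal (r powr NN) * ennreal (c * Vol (x /R r))"
   using c(1) by (subst ennreal_mult[symmetric]) (auto simp: less_imp_le mult_ac)
  also have "... <= emeasure dw (ball x r)" unfolding emeasure_ball[OF that] by (intro mult_left_mono c(2)) simp
  finally show ?thesis .
 qed
 then show ?thesis using c(1) by blast
qed

text \<open>The factor 5 is the enlargement in the Vitali covering lemma.\<close>

lemma doubling: "EX D>0. ALL x r. 0 < r --> emeasure dw (ball x (5 * r)) <= ennreal D * emeasure dw (ball x r)"
proof -
 obtain C where C: "C > 0" "!!x r s. 0 < r ==> 1 <= s ==> emeasure dw (ball x (s * r)) <= ennreal (C * (s * r) powr NN * Vol (x /R r))"
  using ball_Vol_upper by blast
 obtain c where c: "c > 0" "!!x r. 0 < r ==> ennreal (c * r powr NN * Vol (x /R r)) <= emeasure dw (ball x r)"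
  using ball_lower_scaled by blast
 define D where "D = C * 5 powr NN / c"
 have D: "0 < D" using C c by (simp add: D_def)
 have "emeasure dw (ball x (5 * r)) <= ennreal D * emeasure dw (ball x r)" if r: "0 < r" for x r
 proof -
  have "emeasure dw (ball x (5 * r)) <= ennreal (C * (5 * r) powr NN * Vol (x /R r))" using r by (intro C) auto
  also have "C * (5 * r) powr NN * Vol (x /R r) = D * (c * r powr NN * Vol (x /R r))"
   using c(1) r by (simp add: D_def powr_mult)
  also have "ennreal ... = ennreal D * ennreal (c * r powr NN * Vol (x /R r))"
   using D c(1) by (intro ennreal_mult) (auto simp: less_imp_le)
  also have "... <= ennreal D * emeasure dw (ball x r)" by (intro mult_left_mono c(2) r) simp
  finally show ?thesis .
 qed
 then show ?thesis using D by blast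
qed

text \<open>The set where some average exceeds \<open>l\<close> is enclosed in a Borel set to which
  a measure can be assigned. The covering lemma asks for bounded radii: as \<open>Vol\<close> is at
  least 1, a ball of radius \<open>r\<close> has measure at least \<open>c * r powr NN\<close>, so a
  large average of an integrable function bounds \<open>r\<close>.\<close>

lemma vitali_weak:
 obtains D where "D > 0" "ALL u l. u \<in> BM --> 0 < l -->
 (EX U:sets borel. {x. EX r>0. ennreal l * emeasure dw (ball x r) < (NI y. u y * indicator (ball x r) y)} \<subseteq> U
  & emeasure dw U <= ennreal (D / l) * (NI y. u y))"
proof -
 obtain D where D: "D > 0" "!!x r. 0 < r ==> emeasure dw (ball x (5 * r)) <= ennreal D * emeasure dw (ball x r)"
  using doubling by blast
 obtain c where c: "c > 0" "!!x r. 0 < r ==> ennreal (c * r powr NN * Vol (x /R r)) <= emeasure dw (ball x r)"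
  using ball_lower_scaled by blast
 have "EX U:sets borel. {x. EX r>0. ennreal l * emeasure dw (ball x r) < (NI y. u y * indicator (ball x r) y)} \<subseteq> U
  & emeasure dw U <= ennreal (D / l) * (NI y. u y)"
  if um [measurable]: "u \<in> BM" and l: "0 < l" for u :: "real^'n => ennreal" and l
 proof (cases "(NI y. u y) = \<infinity>")
  case True
  then show ?thesis using D(1) l by (intro bexI[of _ UNIV]) (auto simp: ennreal_mult_top)
 next
  case False
  let ?A = "{x. EX r>0. ennreal l * emeasure dw (ball x r) < (NI y. u y * indicator (ball x r) y)}"
  let ?N = "density dw u"
  have mb [measurable]: "ball x r \<in> sets borel" "ball x r \<in> sets dw" for x :: "real^'n" and r unfolding sets_dw by auto
  have um': "u \<in> borel_measurable dw" unfolding meas_dw by (rule um)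
  have N: "emeasure ?N B = (NI y. u y * indicator B y)" if "B \<in> sets dw" for B
   by (rule emeasure_density[OF um' that])
  define S where "S = enn2real (NI y. u y)"
  have S: "(NI y. u y) = ennreal S" "0 <= S" unfolding S_def using False by (auto simp: top.not_eq_extremum)
  obtain r where r: "!!x. x \<in> ?A ==> 0 < r x & ennreal l * emeasure dw (ball x (r x)) < emeasure ?N (ball x (r x))"
   unfolding N[OF mb(2)] by (atomize_elim, rule choice) blast
  have NN0: "0 < NN" by (simp add: NN_eq add_pos_nonneg)
  have rb: "r x <= (S / (l * c)) powr (1 / NN)" if x: "x \<in> ?A" for x
  proof -
   have rx: "0 < r x" using r[OF x] by simp
   have "ennreal (l * (c * r x powr NN)) <= ennreal l * emeasure dw (ball x (r x))"
   proof -
    have "ennreal (l * (c * r x powr NN)) = ennreal l * ennreal (c * r x powr NN)" using l c(1) by (intro ennreal_mult) auto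
    also have "ennreal (c * r x powr NN) <= ennreal (c * r x powr NN * Vol (x /R r x))"
     using mult_left_mono[OF Vol_ge1[of "x /R r x"], of "c * r x powr NN"] c(1) by (intro ennreal_leI) simp
    also note c(2)[OF rx]
    finally show ?thesis by (simp add: mult_left_mono)
   qed
   also have "... < emeasure ?N (ball x (r x))" using r[OF x] by simp
   also have "... <= (NI y. u y)" unfolding N[OF mb(2)] by (intro nn_integral_mono) (auto simp: indicator_def)
   finally have "l * (c * r x powr NN) < S" unfolding S(1) using S(2) l c(1) by (simp add: ennreal_less_iff)
   then have "r x powr NN <= S / (l * c)" using l c(1) by (simp add: field_simps)
   then have "(r x powr NN) powr (1 / NN) <= (S / (l * c)) powr (1 / NN)" using NN0 by (intro powr_mono2) auto
   then show ?thesis using rx NN0 by (simp add: powr_powr)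
  qed
  have cov: "?A \<subseteq> (\<Union>i\<in>?A. ball i (r i))" using r by fastforce
  have rr: "0 < r i & r i <= (S / (l * c)) powr (1 / NN)" if "i \<in> ?A" for i using r[OF that] rb[OF that] by simp
  obtain C where C: "countable C" "C \<subseteq> ?A" "pairwise (%i j. disjnt (ball i (r i)) (ball j (r j))) C"
   "?A \<subseteq> (\<Union>i\<in>C. ball i (5 * r i))"
   by (rule Vitali_covering_lemma_balls[OF cov rr])
  define V where "V n = (\<Union>i\<in>{i\<in>C. to_nat_on C i = n}. ball i (5 * r i))" for n
  define B where "B n = (\<Union>i\<in>{i\<in>C. to_nat_on C i = n}. ball i (r i))" for n
  have one: "(EX i:C. to_nat_on C i = n & V n = ball i (5 * r i) & B n = ball i (r i)) \<or> (V n = {} & B n = {})" for n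
  proof (cases "EX i:C. to_nat_on C i = n")
   case True
   then obtain i where i: "i \<in> C" "to_nat_on C i = n" by blast
   then have "{i\<in>C. to_nat_on C i = n} = {i}" using inj_on_to_nat_on[OF C(1)] by (auto dest: inj_onD)
   then show ?thesis using i by (auto simp: V_def B_def)
  qed (auto simp: V_def B_def)
  have sets: "V n \<in> sets dw" "B n \<in> sets dw" for n using one[of n] by (auto simp del: sets_dw simp: mb)
  have dj: "disjoint_family B"
   unfolding disjoint_family_on_def B_def using C(3) by (fastforce simp: pairwise_def disjnt_def)
  have step: "emeasure dw (V n) <= ennreal (D / l) * emeasure ?N (B n)" for n
   using one[of n]
  proof
   assume "EX i:C. to_nat_on C i = n & V n = ball i (5 * r i) & B n = ball i (r i)"
   then obtain i where i: "i \<in> C" "V n = ball i (5 * r i)" "B n = ball i (r i)" by blast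
   then have iA: "i \<in> ?A" using C(2) by blast
   have "emeasure dw (V n) <= ennreal (D / l * l) * emeasure dw (B n)" unfolding i using D(2) r[OF iA] l by simp
   also have "... = ennreal (D / l) * (ennreal l * emeasure dw (B n))"
    using D(1) l by (subst ennreal_mult) (auto simp: mult.assoc)
   also have "... <= ennreal (D / l) * emeasure ?N (B n)" unfolding i using r[OF iA] by (intro mult_left_mono) auto
   finally show ?thesis .
  qed simp
  have "emeasure dw (\<Union>n. V n) <= (\<Sum>n. emeasure dw (V n))"
   by (rule emeasure_subadditive_countably) (use sets in auto)
  also have "... <= (\<Sum>n. ennreal (D / l) * emeasure ?N (B n))" by (intro suminf_le step summableI)
  also have "... = ennreal (D / l) * (\<Sum>n. emeasure ?N (B n))" by (rule ennreal_suminf_cmult)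
  also have "(\<Sum>n. emeasure ?N (B n)) = emeasure ?N (\<Union>n. B n)"
   by (rule suminf_emeasure[OF _ dj]) (use sets in auto)
  also have "... <= (NI y. u y)"
   by (subst N) (use sets in \<open>auto intro!: nn_integral_mono simp: indicator_def\<close>)
  finally have "emeasure dw (\<Union>n. V n) <= ennreal (D / l) * (NI y. u y)" by (simp add: mult_left_mono)
  moreover have "?A \<subseteq> (\<Union>n. V n)" using C(4) by (fastforce simp: V_def)
  moreover have "(\<Union>n. V n) \<in> sets borel" using sets(1) unfolding sets_dw by (intro sets.countable_UN) auto
  ultimately show ?thesis by blast
 qed
 then show ?thesis by (intro that[OF D(1)] allI impI)
qed

text \<open>The form |f| <= u + l covers two cases: \<open>u\<close> = |f| gives the weak type
  estimate, and \<open>u\<close> equal to |f| cut off below a height gives the interpolation step.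
  The constant part adds at most \<open>l\<close> to each average, which doubles the constant of
  \<open>maximal_pointwise\<close>. Since that lemma averages around all \<open>g x\<close>, the
  exceptional set is pulled back by every \<open>g\<close>, which preserves the measure.\<close>

lemma maximal_weak:
 assumes \<Phi>: "Sm \<Phi>"
 obtains A K where "A > 0" "K > 0" "ALL f u l. f \<in> BM --> u \<in> BM --> 0 < l -->
  (ALL y. ennreal (norm (f y)) <= u y + ennreal l) -->
  (EX U:sets borel. {x. ennreal (A * l) < MX \<Phi> f x} \<subseteq> U & emeasure dw U <= ennreal (K / l) * (NI y. u y))"
proof -
 obtain A where A: "A > 0" and pw0: "ALL f x c. f \<in> BM -->
  (ALL g:G. ALL r>0. (NI y. ennreal (norm (f y)) * indicator (ball (g x) r) y) <= c * emeasure dw (ball (g x) r)) -->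
  MX \<Phi> f x <= ennreal A * c" by (rule maximal_pointwise[OF \<Phi>])
 note pw = pw0[rule_format]
 obtain D where D: "D > 0" and vw0: "ALL u l. u \<in> BM --> 0 < l -->
  (EX U:sets borel. {x. EX r>0. ennreal l * emeasure dw (ball x r) < (NI y. u y * indicator (ball x r) y)} \<subseteq> U
   & emeasure dw U <= ennreal (D / l) * (NI y. u y))" by (rule vitali_weak)
 note vw = vw0[rule_format]
 define K where "K = real (card G) * D"
 have K: "0 < K" using D card_G_pos by (simp add: K_def)
 have "EX V:sets borel. {x. ennreal (A * 2 * l) < MX \<Phi> f x} \<subseteq> V & emeasure dw V <= ennreal (K / l) * (NI y. u y)"
  if m [measurable]: "f \<in> BM" "u \<in> BM" and l: "0 < l" and le: "ALL y. ennreal (norm (f y)) <= u y + ennreal l" for f u l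
 proof -
  obtain U where U: "U \<in> sets borel" "{x. EX r>0. ennreal l * emeasure dw (ball x r) < (NI y. u y * indicator (ball x r) y)} \<subseteq> U"
   "emeasure dw U <= ennreal (D / l) * (NI y. u y)" using vw[OF m(2) l] by blast
  define V where "V = (\<Union>g\<in>G. g -` U)"
  have gU: "g -` U \<in> sets borel" if "g \<in> G" for g
   using measurable_sets[OF G_measurable[OF that] U(1)] by simp
  have eg: "emeasure dw (g -` U) = emeasure dw U" if g: "g \<in> G" for g
  proof -
   have "emeasure dw (g -` U) = (NI x. indicator U (g x))"
    using gU[OF g] by (simp add: sets_dw indicator_vimage[symmetric])
   also have "... = (NI x. indicator U x)" by (rule nn_integral_dw_G[OF g borel_measurable_indicator[OF U(1)]])
   finally show ?thesis using U(1) by (simp add: sets_dw)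
  qed
  have "emeasure dw V <= (SUM g:G. emeasure dw (g -` U))"
   unfolding V_def by (rule emeasure_subadditive_finite) (use gU in \<open>auto simp: sets_dw\<close>)
  also have "... = (SUM g:G. emeasure dw U)" by (intro sum.cong refl eg)
  also have "... <= ennreal (real (card G)) * (ennreal (D / l) * (NI y. u y))"
   unfolding sum_constant ennreal_of_nat_eq_real_of_nat by (intro mult_left_mono U(3)) simp
  also have "... = ennreal (K / l) * (NI y. u y)"
   using D l by (simp add: K_def ennreal_mult[symmetric] mult.assoc[symmetric])
  finally have e: "emeasure dw V <= ennreal (K / l) * (NI y. u y)" .
  have "x \<in> V" if x: "ennreal (A * 2 * l) < MX \<Phi> f x" for x
  proof (rule ccontr)
   assume nV: "x \<notin> V"
   have "(NI y. ennreal (norm (f y)) * indicator (ball (g x) r) y) <= ennreal (2 * l) * emeasure dw (ball (g x) r)"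
    if g: "g \<in> G" and r: "0 < r" for g r
   proof -
    have [measurable]: "ball (g x) r \<in> sets borel" by simp
    have "g x \<notin> U" using nV g by (auto simp: V_def)
    then have 1: "(NI y. u y * indicator (ball (g x) r) y) <= ennreal l * emeasure dw (ball (g x) r)"
     using U(2) r not_less by blast
    have "(NI y. ennreal (norm (f y)) * indicator (ball (g x) r) y) <= (NI y. u y * indicator (ball (g x) r) y + ennreal l * indicator (ball (g x) r) y)"
     using le by (intro nn_integral_mono) (auto simp: indicator_def)
    also have "... = (NI y. u y * indicator (ball (g x) r) y) + (NI y. ennreal l * indicator (ball (g x) r) y)"
     by (rule nn_integral_add) (unfold meas_dw, measurable)
    also have "(NI y. ennreal l * indicator (ball (g x) r) y) = ennreal l * emeasure dw (ball (g x) r)"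
     by (rule nn_integral_cmult_indicator) (simp add: sets_dw)
    also have "(NI y. u y * indicator (ball (g x) r) y) + ... <= ennreal l * emeasure dw (ball (g x) r) + ennreal l * emeasure dw (ball (g x) r)"
     by (intro add_right_mono 1)
    also have "... = ennreal (2 * l) * emeasure dw (ball (g x) r)"
     using l by (simp add: distrib_right[symmetric] ennreal_plus[symmetric] del: ennreal_plus)
    finally show ?thesis .
   qed
   from pw[OF m(1) this] have "MX \<Phi> f x <= ennreal A * ennreal (2 * l)" .
   also have "... = ennreal (A * 2 * l)" using A l by (subst ennreal_mult[symmetric]) (auto simp: mult.assoc)
   finally show False using x by simp
  qed
  then have "{x. ennreal (A * 2 * l) < MX \<Phi> f x} \<subseteq> V" by blast
  moreover have "V \<in> sets borel" unfolding V_def using gU by (intro sets.finite_UN) auto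
  ultimately show ?thesis using e by blast
 qed
 then show ?thesis by (intro that[OF mult_pos_pos[OF A zero_less_numeral] K] allI impI)
qed

end

section \<open>Measurability and layer-cake formulas\<close>

lemma cont_LINT:
 fixes F :: "'a :: metric_space => 'b => complex"
 assumes c: "!!y. continuous_on UNIV (%x. F x y)" and m: "!!x. F x \<in> borel_measurable M"
  and dom: "!!B. bounded B ==> EX w. integrable M w & (ALL x:B. ALL y. norm (F x y) <= w y)"
 shows "continuous_on UNIV (%x. LINT y|M. F x y)"
 unfolding continuous_on_sequentially
proof (intro allI ballI impI)
 fix X :: "nat => 'a" and a assume "(ALL n. X n \<in> UNIV) & X \<longlonglongrightarrow> a"
 then have X: "X \<longlonglongrightarrow> a" by simp
 obtain w where w: "integrable M w" "ALL x:range X. ALL y. norm (F x y) <= w y"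
  using dom[OF convergent_imp_bounded[OF X]] by blast
 have "(%n. LINT y|M. F (X n) y) \<longlonglongrightarrow> (LINT y|M. F a y)"
 proof (rule integral_dominated_convergence[OF m m w(1)])
  show "AE y in M. (%n. F (X n) y) \<longlonglongrightarrow> F a y"
   using c X unfolding continuous_on_sequentially comp_def by (intro AE_I2) simp
  show "AE y in M. norm (F (X n) y) <= w y" for n using w(2) by (intro AE_I2) simp
 qed
 then show "((%x. LINT y|M. F x y) o X) \<longlonglongrightarrow> (LINT y|M. F a y)" by (simp add: comp_def)
qed

text \<open>The supremum is uncountable, but lower semicontinuous.\<close>

lemma lsc_measurable:
 fixes F :: "'i => 'a :: topological_space => complex"
 assumes "!!i. i \<in> I ==> continuous_on UNIV (F i)"
 shows "(%x. SUP i\<in>I. ennreal (norm (F i x))) \<in> BM"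
proof (rule borel_measurableI_greater)
 fix y
 have "open {x. y < ennreal (norm (F i x))}" if "i \<in> I" for i
  by (intro open_Collect_less continuous_on_const continuous_on_ennreal continuous_on_norm assms[OF that])
 then have "open (\<Union>i\<in>I. {x. y < ennreal (norm (F i x))})" by blast
 moreover have "{x \<in> space borel. y < (SUP i\<in>I. ennreal (norm (F i x)))} = (\<Union>i\<in>I. {x. y < ennreal (norm (F i x))})"
  by (auto simp: less_SUP_iff)
 ultimately show "{x \<in> space borel. y < (SUP i\<in>I. ennreal (norm (F i x)))} \<in> sets borel" by simp
qed

lemma powr_layer:
 assumes "0 < q" "0 <= s"
 shows "(NL l. (if 0 <= l & l <= s then ennreal (l powr (q - 1)) else 0)) = ennreal (s powr q / q)"
proof -
 have "(NL l. ennreal (l powr (q - 1)) * indicator {0..s} l) = ennreal (s powr q / q)"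
  using nn_integral_has_integral_lebesgue'[OF _ has_integral_powr_from_0[of "q - 1" s]] assms by simp
 moreover have "(%l. if 0 <= l & l <= s then ennreal (l powr (q - 1)) else 0) = (%l. ennreal (l powr (q - 1)) * indicator {0..s} l)"
  by (auto simp: fun_eq_iff)
 ultimately show ?thesis by (simp only:)
qed

text \<open>Every finite \<open>s\<close> below \<open>F\<close> gives the lower bound
  \<open>s powr q\<close> for the integral; if \<open>F\<close> is infinite, these bounds are
  arbitrarily large.\<close>

lemma ennreal_powr_layer:
 assumes q: "0 < q"
 shows "ennreal_powr F q <= ennreal q * (NL l. (if 0 <= l & ennreal l <= F then ennreal (l powr (q - 1)) else 0))"
  (is "_ <= ?R")
proof -
 have s: "ennreal (s powr q) <= ?R" if "0 <= s" "ennreal s <= F" for s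
 proof -
  have "ennreal (s powr q) = ennreal q * ennreal (s powr q / q)" using q by (subst ennreal_mult[symmetric]) auto
  also have "... <= ?R" unfolding powr_layer[OF q that(1), symmetric]
   by (intro mult_left_mono nn_integral_mono) (auto intro: order_trans[OF ennreal_leI that(2)])
  finally show ?thesis .
 qed
 show ?thesis
 proof (cases F)
  case (real r)
  then show ?thesis using s[of r] by (simp add: ennreal_powr_def)
 next
  case top
  have "?R = top"
  proof (cases ?R)
   case (real r)
   \<comment> \<open>The witness has \<open>q\<close>-th power \<open>r + 1\<close>, which
     contradicts a finite value \<open>r\<close>.\<close>
   have "ennreal (((r + 1) powr (1 / q)) powr q) <= ennreal r" using s[of "(r + 1) powr (1 / q)"] top real by simp
   then show ?thesis using real(1) q by (simp add: powr_powr)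
  qed simp
  then show ?thesis by simp
 qed
qed

lemma ennreal_powr_mono: "a <= b ==> 0 <= r ==> ennreal_powr a r <= ennreal_powr b r"
 by (auto simp: ennreal_powr_def top_unique intro!: ennreal_leI powr_mono2 enn2real_mono simp: top.not_eq_extremum)

lemma ennreal_powr_one [simp]: "ennreal_powr a 1 = a"
 by (cases a) (auto simp: ennreal_powr_def)

lemma ennreal_powr_ennreal: "0 <= a ==> ennreal_powr (ennreal a) r = ennreal (a powr r)"
 by (simp add: ennreal_powr_def)

context dunkl begin

text \<open>Applying \<open>lap\<close> \<open>Nd\<close> times multiplies the transform by
  \<open>(1 + (norm xi)^2) ^ Nd\<close> and keeps it bounded.\<close>

lemma Ft_integrable_transform:
 assumes f: "Sm f"
 shows "integrable dw (Ft f)"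
proof -
 let ?g = "(lap ^^ Nd) f"
 note lp = lap_power[OF f, of Nd]
 let ?B = "LINT x|dw. norm (?g x)"
 show ?thesis
 proof (rule integrable_bound[OF integrable_mult_right[OF integrable_inverse_power, of ?B] Ft_measurable[OF f]], rule AE_I2)
  fix xi :: "real^'n"
  have p: "0 < (1 + (norm xi)^2) ^ Nd" by simp
  have "(1 + (norm xi)^2) ^ Nd * norm (Ft f xi) <= ?B"
  proof -
   have "(1 + (norm xi)^2) ^ Nd * norm (Ft f xi) = norm (Ft ?g xi)"
    using lp[of xi] p by (simp only: norm_mult norm_of_real abs_of_pos)
   then show ?thesis using Ft_bound[of ?g xi] lp[of xi] by simp
  qed
  moreover have "a <= b * (1 / c)" if "c * a <= b" "0 < c" for a b c :: real using that by (simp add: field_simps)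
  ultimately have "norm (Ft f xi) <= ?B * (1 / (1 + (norm xi)^2) ^ Nd)" using p by blast
  then show "norm (Ft f xi) <= norm (?B * (1 / (1 + (norm xi)^2) ^ Nd))"
   unfolding real_norm_def by (rule order_trans[OF _ abs_ge_self])
 qed
qed

lemma KK_cont:
 assumes f: "Sm f"
 shows "continuous_on UNIV (%p. KK f (fst p) (snd p))"
 unfolding KK_def
proof (rule cont_LINT)
 show "continuous_on UNIV (%p. Ek \<i> xi (fst p) * Ek (- \<i>) xi (snd p) * Ft f xi)" for xi
  by (intro continuous_intros Ek_continuous)
 show "(%xi. Ek \<i> xi (fst p) * Ek (- \<i>) xi (snd p) * Ft f xi) \<in> borel_measurable dw" for p
  using Ft_measurable[OF f] unfolding meas_dw by (intro borel_measurable_times Ek_measurable)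
 have "norm (Ek \<i> xi x * Ek (- \<i>) xi y * Ft f xi) <= norm (Ft f xi)" for x y xi
  using mult_right_mono[OF Ek_Ek_le[of xi x y] norm_ge_zero[of "Ft f xi"]] by (simp add: norm_mult)
 then show "EX w. integrable dw w & (ALL p:B. ALL xi. norm (Ek \<i> xi (fst p) * Ek (- \<i>) xi (snd p) * Ft f xi) <= w xi)" for B
  using integrable_norm[OF Ft_integrable_transform[OF f]] by (intro exI[of _ "%xi. norm (Ft f xi)"]) simp
qed

lemma kap_decay: "kap x y <= 2 * real (card G) * (1 + norm x)^2 / (1 + norm y)^2"
proof -
 have "1 / (1 + (norm (y - g x))^2) <= 2 * (1 + norm x)^2 / (1 + norm y)^2" if g: "g \<in> G" for g
 proof -
  let ?d = "norm (y - g x)"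
  have "norm y <= ?d + norm x" using norm_triangle_ineq[of "y - g x" "g x"] g by simp
  moreover have "(1 + ?d) * (1 + norm x) = 1 + ?d + norm x + ?d * norm x" by (simp add: algebra_simps)
  moreover have "0 <= ?d * norm x" by simp
  ultimately have "1 + norm y <= (1 + ?d) * (1 + norm x)" by linarith
  then have "(1 + norm y)^2 <= ((1 + ?d) * (1 + norm x))^2" by (intro power_mono) auto
  also have "... <= (2 * (1 + ?d^2)) * (1 + norm x)^2"
  proof -
   have "(1 + ?d)^2 <= 2 * (1 + ?d^2)" using zero_le_power2[of "?d - 1"] by (simp add: power2_eq_square algebra_simps)
   then show ?thesis unfolding power_mult_distrib by (intro mult_right_mono) auto
  qed
  finally have "(1 + norm y)^2 * 1 <= (2 * (1 + norm x)^2) * (1 + ?d^2)" by (simp only: mult_ac mult_1_right)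
  moreover have "1 + norm y ~= 0" by (metis add_pos_nonneg less_irrefl norm_ge_zero zero_less_one)
  ultimately show ?thesis using one_plus_sq_pos[of "y - g x"] by (simp add: divide_simps mult_ac)
 qed
 then have "kap x y <= (SUM g:G. 2 * (1 + norm x)^2 / (1 + norm y)^2)" unfolding kap_def by (intro sum_mono)
 then show ?thesis by (simp add: mult_ac)
qed

text \<open>For \<open>x\<close> in a bounded set, \<open>KK_bound\<close> and
  \<open>kap_decay\<close> dominate the kernel by a multiple of
  \<open>1 / (1 + norm y) ^ Nd\<close>, so dominated convergence applies. \<open>Lp_weight\<close>
  provides the integrability assumption for each exponent.\<close>

lemma convolution_cont:
 assumes \<Phi>: "Sm \<Phi>" and t: "0 < t" and fm: "f \<in> BM" and fi: "integrable dw (%y. norm (f y) / (1 + norm y) ^ Nd)"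
 shows "continuous_on UNIV (dunkl_convolution R k (dunkl_dilate R k t \<Phi>) f)"
 unfolding dunkl_convolution_def[abs_def] translation_eq[OF t \<Phi>]
proof (rule cont_LINT)
 let ?c = "t powr (- NN) / ck^2"
 have K: "continuous_on UNIV (%x. KK \<Phi> (a x) (b x))" if "continuous_on UNIV a" "continuous_on UNIV b" for a b :: "real^'n => real^'n"
  using continuous_on_compose2[OF KK_cont[OF \<Phi>] continuous_on_Pair[OF that]] by simp
 show "continuous_on UNIV (%x. ?c *R KK \<Phi> (x /R t) (y /R t) * f y)" for y
  by (intro continuous_intros K)
 have "(%y. KK \<Phi> (x /R t) (y /R t)) \<in> BM" for x
  by (intro cont_BM K continuous_intros)
 then show "(%y. ?c *R KK \<Phi> (x /R t) (y /R t) * f y) \<in> borel_measurable dw" for x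
  unfolding meas_dw by (intro borel_measurable_times borel_measurable_scaleR borel_measurable_const fm)
 fix B :: "(real^'n) set" assume "bounded B"
 then obtain \<rho> where \<rho>: "0 < \<rho>" "!!x. x \<in> B ==> norm x <= \<rho>" unfolding bounded_pos by blast
 obtain C where C: "C > 0" "!!x y. norm (KK \<Phi> x y) <= C * kap x y ^ Nd / Vol x" using KK_bound[OF \<Phi>] by blast
 define E where "E = (2 * real (card G) * (1 + \<rho> / t)^2 * (1 + t)^2) ^ Nd"
 have E0: "0 <= E" by (simp add: E_def)
 have "norm (?c *R KK \<Phi> (x /R t) (y /R t) * f y) <= (?c * (C * E)) * (norm (f y) / (1 + norm y) ^ Nd)" if x: "x \<in> B" for x y
 proof -
  have p: "0 < 1 + norm y" by (simp add: add_pos_nonneg)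
  have y: "1 + norm y <= (1 + norm (y /R t)) * (1 + t)"
  proof -
   have "(1 + norm (y /R t)) * (1 + t) = 1 + t + norm (y /R t) + norm y" using t by (simp add: algebra_simps)
   then show ?thesis using t norm_ge_zero[of "y /R t"] by linarith
  qed
  have "kap (x /R t) (y /R t) <= 2 * real (card G) * (1 + norm (x /R t))^2 / (1 + norm (y /R t))^2" by (rule kap_decay)
  also have "... <= 2 * real (card G) * (1 + \<rho> / t)^2 / ((1 + norm y) / (1 + t))^2"
  proof (intro frac_le mult_left_mono power_mono)
   show "1 + norm (x /R t) <= 1 + \<rho> / t" using \<rho>(2)[OF x] t by (simp add: divide_inverse mult.commute)
   show "(1 + norm y) / (1 + t) <= 1 + norm (y /R t)" using y t by (simp add: pos_divide_le_eq)
  qed (use t p \<rho>(1) in \<open>auto simp: add_pos_pos\<close>)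
  also have "... = (2 * real (card G) * (1 + \<rho> / t)^2 * (1 + t)^2) * (1 / (1 + norm y)^2)" by (simp add: power_divide)
  finally have "kap (x /R t) (y /R t) ^ Nd <= ((2 * real (card G) * (1 + \<rho> / t)^2 * (1 + t)^2) * (1 / (1 + norm y)^2)) ^ Nd"
   by (intro power_mono) (auto simp: less_imp_le)
  also have "... = E * (1 / (1 + norm y) ^ (2 * Nd))" unfolding E_def power_mult_distrib power_one_over[symmetric] by (simp add: power_mult[symmetric] power_divide)
  also have "... <= E * (1 / (1 + norm y) ^ Nd)"
   using E0 p by (intro mult_left_mono divide_left_mono power_increasing mult_pos_pos) auto
  finally have k: "kap (x /R t) (y /R t) ^ Nd <= E * (1 / (1 + norm y) ^ Nd)" .
  have "norm (KK \<Phi> (x /R t) (y /R t)) <= C * kap (x /R t) (y /R t) ^ Nd / 1"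
   using C(1) Vol_ge1 by (intro order_trans[OF C(2)] divide_left_mono) (auto simp: less_imp_le)
  also have "... <= C * (E * (1 / (1 + norm y) ^ Nd))" using mult_left_mono[OF k, of C] C(1) by simp
  finally have "norm (KK \<Phi> (x /R t) (y /R t)) * norm (f y) <= (C * (E * (1 / (1 + norm y) ^ Nd))) * norm (f y)"
   by (rule mult_right_mono) simp
  from mult_left_mono[OF this, of ?c] show ?thesis by (simp add: norm_mult mult_ac)
 qed
 then show "EX w. integrable dw w & (ALL x:B. ALL y. norm (?c *R KK \<Phi> (x /R t) (y /R t) * f y) <= w y)"
  by (intro exI[of _ "%y. (?c * (C * E)) * (norm (f y) / (1 + norm y) ^ Nd)"] conjI ballI allI
    integrable_mult_right fi)
qed

lemma maximal_measurable:
 assumes "Sm \<Phi>" "f \<in> BM" "integrable dw (%y. norm (f y) / (1 + norm y) ^ Nd)"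
 shows "MX \<Phi> f \<in> borel_measurable dw"
 unfolding dunkl_maximal_def[abs_def] meas_dw
 by (rule lsc_measurable) (simp add: convolution_cont[OF assms(1) _ assms(2,3)])

lemma integrable_weight: "integrable dw (%y. 1 / (1 + norm y) ^ Nd)"
proof (rule integrable_decay_real[where C = 1])
 have "continuous_on UNIV (%q :: real^'n. 1 / (1 + norm q) ^ Nd)"
  by (intro continuous_intros ballI power_not_zero) (metis add_pos_nonneg less_irrefl norm_ge_zero zero_less_one)
 then show "(%q :: real^'n. 1 / (1 + norm q) ^ Nd) \<in> BM" by (rule cont_BM)
qed simp

text \<open>For finite \<open>p\<close>, the weight dominates where \<open>norm (f y)\<close> is at
  most 1, and the power \<open>q >= 1\<close> of \<open>norm (f y)\<close> dominates
  elsewhere.\<close>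

lemma Lp_weight:
 assumes f: "f \<in> Lp_space dw p" and p: "1 <= p"
 shows "integrable dw (%y. norm (f y) / (1 + norm y) ^ Nd)"
proof -
 have fm [measurable]: "f \<in> borel_measurable dw" and fin: "Lp_norm dw p (%x. ennreal (norm (f x))) < \<infinity>"
  using f by (auto simp: Lp_space_def)
 have wm: "(%y. 1 / (1 + norm y) ^ Nd) \<in> borel_measurable dw" using integrable_weight by (rule borel_measurable_integrable)
 have m: "(%y. norm (f y) / (1 + norm y) ^ Nd) \<in> borel_measurable dw"
  using borel_measurable_times[OF measurable_compose[OF fm borel_measurable_norm] wm] by simp
 show ?thesis
 proof (cases "p = \<infinity>")
  case True
  let ?S = "esssup dw (%x. ennreal (norm (f x)))"
  have S: "?S < \<infinity>" using fin True by (simp add: Lp_norm_def)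
  have "AE y in dw. norm (f y) / (1 + norm y) ^ Nd <= enn2real ?S * (1 / (1 + norm y) ^ Nd)"
   using esssup_AE[of "%x. ennreal (norm (f x))" dw]
  proof eventually_elim
   fix y assume "ennreal (norm (f y)) <= ?S"
   then have "norm (f y) <= enn2real ?S" using S by (simp add: enn2real_leI flip: le_ennreal_iff enn2real_ennreal) (metis enn2real_ennreal enn2real_mono norm_ge_zero)
   from divide_right_mono[OF this, of "(1 + norm y) ^ Nd"] show "norm (f y) / (1 + norm y) ^ Nd <= enn2real ?S * (1 / (1 + norm y) ^ Nd)" by simp
  qed
  then show ?thesis
   by (intro integrable_bound[OF integrable_mult_right[OF integrable_weight, of "enn2real ?S"] m])
    (auto elim!: eventually_mono intro: order_trans[OF _ abs_ge_self])
 next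
  case False
  define q where "q = enn2real p"
  have q: "1 <= q" using p False unfolding q_def by (cases p) auto
  have "(NI x. ennreal (norm (f x) powr q)) < \<infinity>"
   using fin False by (auto simp: Lp_norm_def ennreal_powr_def q_def[symmetric] top.not_eq_extremum split: if_splits)
  then have i: "integrable dw (%x. norm (f x) powr q)" by (intro integrableI_nonneg) auto
  have le: "norm (f y) / (1 + norm y) ^ Nd <= 1 / (1 + norm y) ^ Nd + norm (f y) powr q" for y
  proof -
   have n: "1 <= (1 + norm y) ^ Nd" by (rule one_le_power) simp
   show ?thesis
   proof (cases "norm (f y) <= 1")
    case True
    then have "norm (f y) / (1 + norm y) ^ Nd <= 1 / (1 + norm y) ^ Nd" by (intro divide_right_mono) auto
    then show ?thesis by (simp add: add_increasing2)
   next
    case False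
    have "norm (f y) / (1 + norm y) ^ Nd <= norm (f y) / 1" using n by (intro divide_left_mono) (auto simp: add_pos_nonneg)
    also have "norm (f y) / 1 <= norm (f y) powr q" using powr_mono[OF q, of "norm (f y)"] False by simp
    finally show ?thesis by (simp add: add_increasing)
   qed
  qed
  show ?thesis
   by (rule integrable_bound[OF integrable_add[OF integrable_weight i] m])
    (use le in \<open>auto intro!: AE_I2 order_trans[OF _ abs_ge_self]\<close>)
 qed
qed

text \<open>Marcinkiewicz's argument: at height \<open>l\<close> only the part of \<open>f\<close>
  above a fixed multiple of \<open>l\<close> counts. After Fubini the integral of
  \<open>l powr (q - 2)\<close> up to \<open>B * norm (f y)\<close> remains, which converges at 0
  because \<open>q > 1\<close>.\<close>

lemma maximal_strong:
 assumes \<Phi>: "Sm \<Phi>" and q: "1 < q"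
 obtains C where "0 <= C" "ALL f. f \<in> BM --> MX \<Phi> f \<in> borel_measurable dw -->
  (NI x. ennreal_powr (MX \<Phi> f x) q) <= ennreal C * (NI x. ennreal (norm (f x) powr q))"
proof -
 obtain A K where AK: "A > 0" "K > 0" and mw0: "ALL f u l. f \<in> BM --> u \<in> BM --> 0 < l -->
  (ALL y. ennreal (norm (f y)) <= u y + ennreal l) -->
  (EX U:sets borel. {x. ennreal (A * l) < MX \<Phi> f x} \<subseteq> U & emeasure dw U <= ennreal (K / l) * (NI y. u y))"
  by (rule maximal_weak[OF \<Phi>])
 note mw = mw0[rule_format]
 \<comment> \<open>The factor 2 makes \<open>A * e\<close> strictly smaller than \<open>l\<close>:
   the layers use \<open>ennreal l <= ?T x\<close>, whereas \<open>maximal_weak\<close> covers a set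
   given by a strict inequality.\<close>
 define B where "B = 2 * A"
 have B: "0 < B" using AK by (simp add: B_def)
 define C where "C = q * (B * K * (B powr (q - 1) / (q - 1)))"
 have C0: "0 <= C" using q AK B by (simp add: C_def)
 have "(NI x. ennreal_powr (MX \<Phi> f x) q) <= ennreal C * (NI x. ennreal (norm (f x) powr q))"
  if fb: "f \<in> BM" and Tm: "MX \<Phi> f \<in> borel_measurable dw" for f
 proof -
  let ?T = "MX \<Phi> f"
  have fm: "f \<in> borel_measurable dw" unfolding meas_dw by (rule fb)
  note [measurable] = Tm fm
  interpret P: pair_sigma_finite dw "lborel :: real measure"
   by (simp add: pair_sigma_finite_def sigma_finite_dw lborel.sigma_finite_measure_axioms)
  let ?X = "%x l. if 0 <= l & ennreal l <= ?T x then ennreal (l powr (q - 1)) else 0"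
  let ?Y = "%y l. if 0 <= l & l <= B * norm (f y) then ennreal (l powr (q - 1 - 1)) else 0"
  have inner: "(NI x. ?X x l) <= ennreal (B * K) * (NI y. ennreal (norm (f y)) * ?Y y l)" for l
  proof (cases "0 < l")
   case True
   define e where "e = l / B"
   have e: "0 < e" "A * e < l" "B * e = l" using True AK B by (auto simp: e_def B_def field_simps)
   let ?u = "%y. if e <= norm (f y) then ennreal (norm (f y)) else 0"
   have um: "?u \<in> BM" using fb by measurable
   have ule: "ennreal (norm (f y)) <= ?u y + ennreal e" for y by (auto intro: ennreal_leI)
   obtain U where U: "U \<in> sets borel" "{x. ennreal (A * e) < ?T x} \<subseteq> U" "emeasure dw U <= ennreal (K / e) * (NI y. ?u y)"
    using mw[OF fb um e(1) ule] by blast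
   have "(NI x. ?X x l) <= (NI x. ennreal (l powr (q - 1)) * indicator U x)"
   proof (rule nn_integral_mono)
    fix x
    have "x \<in> U" if "ennreal l <= ?T x"
    proof -
     have "ennreal (A * e) < ennreal l" using e True by (simp add: ennreal_less_iff AK(1) less_imp_le)
     then show ?thesis using U(2) that by (auto intro: less_le_trans)
    qed
    then show "?X x l <= ennreal (l powr (q - 1)) * indicator U x" by auto
   qed
   also have "... = ennreal (l powr (q - 1)) * emeasure dw U" by (rule nn_integral_cmult_indicator) (simp add: sets_dw U(1))
   also have "... <= ennreal (l powr (q - 1)) * (ennreal (K / e) * (NI y. ?u y))" by (intro mult_left_mono U(3)) simp
   also have "... = ennreal (B * K) * (ennreal (l powr (q - 1 - 1)) * (NI y. ?u y))"
   proof -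
    have "l powr (q - 1) * (K / e) = B * K * l powr (q - 1 - 1)"
    proof -
     have "l * l powr (q - 1 - 1) = l powr (1 + (q - 1 - 1))" using True by (intro powr_mult_base) simp
     also have "1 + (q - 1 - 1) = q - 1" by simp
     finally have "l powr (q - 1) = l * l powr (q - 1 - 1)" by simp
     then show ?thesis using True B by (simp only: e_def) (simp add: field_simps)
    qed
    then show ?thesis using AK B e(1) by (simp add: mult.assoc[symmetric] ennreal_mult[symmetric])
   qed
   also have "ennreal (l powr (q - 1 - 1)) * (NI y. ?u y) = (NI y. ennreal (l powr (q - 1 - 1)) * ?u y)"
    by (rule nn_integral_cmult[symmetric]) (use um in \<open>simp only: meas_dw\<close>)
   also have "... = (NI y. ennreal (norm (f y)) * ?Y y l)"
   proof (rule nn_integral_cong)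
    fix y
    have "l <= B * norm (f y) \<longleftrightarrow> e <= norm (f y)" using B e(3) by auto
    then show "ennreal (l powr (q - 1 - 1)) * ?u y = ennreal (norm (f y)) * ?Y y l" using True by (simp add: mult.commute)
   qed
   finally show ?thesis .
  next
   case False
   then have "?X x l = 0" for x by auto
   then show ?thesis by simp
  qed
  have "(NI x. ennreal_powr (?T x) q) <= (NI x. ennreal q * (NL l. ?X x l))"
   using q by (intro nn_integral_mono ennreal_powr_layer) simp
  also have "... = ennreal q * (NI x. \<integral>\<^sup>+l. ?X x l \<partial>lborel)"
   by (rule nn_integral_cmult) measurable
  also have "(NI x. \<integral>\<^sup>+l. ?X x l \<partial>lborel) = (NL l. \<integral>\<^sup>+x. ?X x l \<partial>dw)"
   by (rule P.Fubini'[symmetric]) measurable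
  also have "... <= (NL l. ennreal (B * K) * (NI y. ennreal (norm (f y)) * ?Y y l))"
   by (intro nn_integral_mono inner)
  also have "... = ennreal (B * K) * (NL l. \<integral>\<^sup>+y. ennreal (norm (f y)) * ?Y y l \<partial>dw)"
   by (rule nn_integral_cmult) measurable
  also have "(NL l. \<integral>\<^sup>+y. ennreal (norm (f y)) * ?Y y l \<partial>dw) = (NI y. \<integral>\<^sup>+l. ennreal (norm (f y)) * ?Y y l \<partial>lborel)"
   by (rule P.Fubini') measurable
  also have "... = (NI y. ennreal (B powr (q - 1) / (q - 1)) * ennreal (norm (f y) powr q))"
  proof (rule nn_integral_cong)
   fix y
   have "(NL l. ennreal (norm (f y)) * ?Y y l) = ennreal (norm (f y)) * (NL l. ?Y y l)"
    by (rule nn_integral_cmult) measurable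
   also have "(NL l. ?Y y l) = ennreal ((B * norm (f y)) powr (q - 1) / (q - 1))"
    using q B by (intro powr_layer) auto
   also have "ennreal (norm (f y)) * ... = ennreal (norm (f y) * ((B * norm (f y)) powr (q - 1) / (q - 1)))"
    using q by (intro ennreal_mult[symmetric]) auto
   also have "norm (f y) * ((B * norm (f y)) powr (q - 1) / (q - 1)) = B powr (q - 1) / (q - 1) * norm (f y) powr q"
    using B by (cases "f y = 0") (simp_all add: powr_mult powr_diff)
   also have "ennreal ... = ennreal (B powr (q - 1) / (q - 1)) * ennreal (norm (f y) powr q)"
    using q by (intro ennreal_mult) auto
   finally show "(NL l. ennreal (norm (f y)) * ?Y y l) = ..." .
  qed
  also have "... = ennreal (B powr (q - 1) / (q - 1)) * (NI y. ennreal (norm (f y) powr q))"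
   by (rule nn_integral_cmult) measurable
  finally have "(NI x. ennreal_powr (?T x) q) <= ennreal q * (ennreal (B * K) * (ennreal (B powr (q - 1) / (q - 1)) * (NI y. ennreal (norm (f y) powr q))))"
   by (simp add: mult_left_mono)
  also have "... = ennreal C * (NI y. ennreal (norm (f y) powr q))"
   using q AK B by (simp add: C_def mult.assoc[symmetric] ennreal_mult[symmetric])
  finally show ?thesis .
 qed
 then show ?thesis by (intro that[OF C0] allI impI)
qed

lemma maximal_weak_type:
 assumes \<Phi>: "Sm \<Phi>"
 shows "weak_type_1_1 dw (MX \<Phi>)"
proof -
 obtain A K where AK: "A > 0" "K > 0" and mw0: "ALL f u l. f \<in> BM --> u \<in> BM --> 0 < l -->
  (ALL y. ennreal (norm (f y)) <= u y + ennreal l) -->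
  (EX U:sets borel. {x. ennreal (A * l) < MX \<Phi> f x} \<subseteq> U & emeasure dw U <= ennreal (K / l) * (NI y. u y))"
  by (rule maximal_weak[OF \<Phi>])
 note mw = mw0[rule_format]
 show ?thesis unfolding weak_type_1_1_def
 proof (intro exI[of _ "K * A"] ballI conjI allI impI)
  fix f assume f: "f \<in> Lp_space dw 1"
  then have fm: "f \<in> BM" by (simp add: Lp_space_def meas_dw)
  show Tm: "MX \<Phi> f \<in> borel_measurable dw" by (rule maximal_measurable[OF \<Phi> fm Lp_weight[OF f order_refl]])
  fix l :: real assume l: "0 < l"
  have um: "(%y. ennreal (norm (f y))) \<in> BM" using fm by measurable
  obtain U where U: "U \<in> sets borel" "{x. ennreal (A * (l / A)) < MX \<Phi> f x} \<subseteq> U"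
   "emeasure dw U <= ennreal (K / (l / A)) * (NI y. ennreal (norm (f y)))"
   using mw[OF fm um, of "l / A"] l AK by auto
  have "emeasure dw {x \<in> space dw. ennreal l < MX \<Phi> f x} <= emeasure dw U"
   using U(1,2) AK by (intro emeasure_mono) (auto simp: sets_dw)
  also note U(3)
  finally show "emeasure dw {x \<in> space dw. ennreal l < MX \<Phi> f x} <= ennreal (K * A / l) * Lp_norm dw 1 (%x. ennreal (norm (f x)))"
   by (simp add: Lp_norm_def)
 qed
qed

text \<open>The essential supremum bounds every average, so \<open>maximal_pointwise\<close> applies
  with it as \<open>c\<close> at every point.\<close>

lemma maximal_sup:
 assumes \<Phi>: "Sm \<Phi>"
 shows "bounded_on_Lp dw \<infinity> (MX \<Phi>)"
proof -
 obtain A where A: "A > 0" and pw0: "ALL f x c. f \<in> BM -->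
  (ALL g:G. ALL r>0. (NI y. ennreal (norm (f y)) * indicator (ball (g x) r) y) <= c * emeasure dw (ball (g x) r)) -->
  MX \<Phi> f x <= ennreal A * c" by (rule maximal_pointwise[OF \<Phi>])
 note pw = pw0[rule_format]
 show ?thesis unfolding bounded_on_Lp_def
 proof (intro exI[of _ A] ballI conjI)
  fix f assume f: "f \<in> Lp_space dw \<infinity>"
  then have fm: "f \<in> BM" by (simp add: Lp_space_def meas_dw)
  show Tm: "MX \<Phi> f \<in> borel_measurable dw"
   by (rule maximal_measurable[OF \<Phi> fm Lp_weight[OF f]]) simp
  let ?S = "esssup dw (%x. ennreal (norm (f x)))"
  have "MX \<Phi> f x <= ennreal A * ?S" for x
  proof (rule pw[OF fm])
   fix g r assume "g \<in> G" "0 < (r :: real)"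
   have "(NI y. ennreal (norm (f y)) * indicator (ball (g x) r) y) <= (NI y. ?S * indicator (ball (g x) r) y)"
    using esssup_AE[of "%x. ennreal (norm (f x))" dw] by (intro nn_integral_mono_AE) (auto elim!: eventually_mono intro: mult_right_mono)
   also have "... = ?S * emeasure dw (ball (g x) r)" by (rule nn_integral_cmult_indicator) (simp add: sets_dw)
   finally show "(NI y. ennreal (norm (f y)) * indicator (ball (g x) r) y) <= ?S * emeasure dw (ball (g x) r)" .
  qed
  then show "Lp_norm dw \<infinity> (MX \<Phi> f) <= ennreal A * Lp_norm dw \<infinity> (%x. ennreal (norm (f x)))"
   using Tm by (simp add: Lp_norm_def esssup_I)
 qed
qed

lemma maximal_Lp:
 assumes \<Phi>: "Sm \<Phi>" and p: "1 < p"
 shows "bounded_on_Lp dw p (MX \<Phi>)"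
proof (cases "p = \<infinity>")
 case True
 then show ?thesis using maximal_sup[OF \<Phi>] by simp
next
 case False
 define q where "q = enn2real p"
 have q: "1 < q" using p False unfolding q_def by (cases p) auto
 obtain C where C: "0 <= C" and st0: "ALL f. f \<in> BM --> MX \<Phi> f \<in> borel_measurable dw -->
  (NI x. ennreal_powr (MX \<Phi> f x) q) <= ennreal C * (NI x. ennreal (norm (f x) powr q))"
  by (rule maximal_strong[OF \<Phi> q])
 show ?thesis unfolding bounded_on_Lp_def
 proof (intro exI[of _ "C powr (1 / q)"] ballI conjI)
  fix f assume f: "f \<in> Lp_space dw p"
  then have fm: "f \<in> BM" and fin: "Lp_norm dw p (%x. ennreal (norm (f x))) < \<infinity>"
   by (simp_all add: Lp_space_def meas_dw)
  show Tm: "MX \<Phi> f \<in> borel_measurable dw"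
   by (rule maximal_measurable[OF \<Phi> fm Lp_weight[OF f less_imp_le[OF p]]])
  let ?I = "NI x. ennreal (norm (f x) powr q)"
  have N: "Lp_norm dw p (%x. ennreal (norm (f x))) = ennreal_powr ?I (1 / q)"
   using False by (simp add: Lp_norm_def q_def[symmetric] ennreal_powr_def[of "ennreal _"])
  have "?I < \<infinity>" using fin unfolding N by (auto simp: ennreal_powr_def top.not_eq_extremum split: if_splits)
  then obtain J where J: "?I = ennreal J" "0 <= J" by (cases ?I) auto
  have "Lp_norm dw p (MX \<Phi> f) = ennreal_powr (NI x. ennreal_powr (MX \<Phi> f x) q) (1 / q)"
   using False by (simp add: Lp_norm_def q_def)
  also have "... <= ennreal_powr (ennreal (C * J)) (1 / q)"
   using st0[rule_format, OF fm Tm] q C J(2) unfolding J(1) by (intro ennreal_powr_mono) (auto simp: ennreal_mult)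
  also have "... = ennreal (C powr (1 / q)) * ennreal_powr ?I (1 / q)"
   unfolding J(1) using C J(2) by (simp add: ennreal_powr_ennreal powr_mult ennreal_mult[symmetric])
  finally show "Lp_norm dw p (MX \<Phi> f) <= ennreal (C powr (1 / q)) * Lp_norm dw p (%x. ennreal (norm (f x)))"
   unfolding N .
 qed
qed

end

theorem theorem4p19:
  fixes R :: "(real^'n) set" and k :: "real^'n \<Rightarrow> real" and \<Phi> :: "real^'n \<Rightarrow> complex"
  assumes "normalized_root_system R"
    and "multiplicity_function R k"
    and "\<Phi> \<in> schwartz"
  shows "weak_type_1_1 (dunkl_measure R k) (dunkl_maximal R k \<Phi>) \<and>
    (\<forall>p::ennreal. 1 < p \<longrightarrow> bounded_on_Lp (dunkl_measure R k) p (dunkl_maximal R k \<Phi>))"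
proof -
  interpret dunkl R k by (rule dunkl.intro) (rule assms)+
  have "Sm \<Phi>" unfolding Sm_def using schwartz_Sn[OF assms(3)] by simp
  then show ?thesis using maximal_weak_type maximal_Lp by simp
qed

end
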